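(* Let $X$ be a smooth projective variety over an algebraically closed field $\mathfrak k$, let $L$ be a line bundle on $X$ with $L^{-1}$ ample, and let $E_1,\dots,E_n$ be a full, strong, exceptional collection of line bundles on $X$ which generates a simple spiral with respect to $L$. Let $\pi:V\to X$ be the total space of $L$, let $V_0=\operatorname{Spec}\Gamma(\mathcal O_V)$, let $\mathbf Q$ be the Bondal quiver of the collection $\pi^*E_1,\dots,\pi^*E_n$ on $V$, let $M_0$ be the affine quotient of its representation space with dimension vector $(1,\dots,1)$, and let $\varphi_0:V_0\to M_0$ be the canonical map. Then $\varphi_0$ identifies $V_0$ with the canonical reduced subvariety of an irreducible component of $M_0$. In particular, if $M_0$ is reduced, then $\varphi_0$ is an isomorphism onto an irreducible component of $M_0$.
   Context: **Exceptional collections.** An object $E$ of a $\mathfrak k$-linear abelian category $\mathcal C$ is exceptional if $\operatorname{End}(E)\cong\mathfrak k$ and $\operatorname{Ext}^k(E,E)=0$ for $k\ne0$. A collection $E_1,\dots,E_n$ is exceptional if each $E_i$ is exceptional and $\operatorname{Ext}^\bullet(E_i,E_j)=0$ for $i>j$; it is full if it spans $\mathcal D(\mathcal C)$ (for every nonzero object $\mathcal F$ of $\mathcal{D}(\mathcal{C})$ there is an object $E$ in the set of objects considered with $\operatorname{Hom}_{\mathcal D(\mathcal C)}(E,\mathcal F)\neq0$, shifts of the $E_i$ being allowed), and strong if $\operatorname{Ext}^k(E_i,E_j)=0$ for all $k\neq0$ and all $i,j$. Here $\mathcal C=\operatorname{Coh}(X)$. **Simple spiral.** Extend the collection to all indices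 $i\in\mathbb Z$ by $E_{i-n}=E_i\otimes L$. This infinite collection is the spiral with respect to $L$; it is simple if $\operatorname{Ext}^k_X(E_i,E_j)=0$ for all $k\ne0$ and all $i\le j$ in $\mathbb Z$. **Bondal quiver, $M_0$ and $\varphi_0$.** Let $A=\operatorname{End}_V(\oplus_i\pi^*E_i)^{\mathrm{op}}$. The Bondal quiver $\mathbf Q$ is a quiver with relations with nodes $1,\dots,n$ whose path algebra is isomorphic to $A$; representations of $\mathbf Q$ are left $A$-modules. $R_\alpha(\mathbf Q)$, with $\alpha=(1,\dots,1)$, is the affine scheme whose points are collections of elements $a_{ij}\in\operatorname{Hom}_V(\pi^*E_i,\pi^*E_j)^\vee$ with $a_{ii}(\mathrm{id})=1$ and $a_{ik}(g\circ f)=a_{ij}(f)a_{jk}(g)$ for all $f\in\operatorname{Hom}_V(\pi^*E_i,\pi^*E_j)$, $g\in\operatorname{Hom}_V(\pi^*E_j,\pi^*E_k)$. The torus $G=\mathbb G_m^n/\mathbb G_m^{diag}$ acts by $a_{ij}\mapsto g_ia_{ij}g_j^{-1}$. Put $M_0=\operatorname{Spec}B^G$ where $B$ is the coordinate ring of $R_\alpha(\mathbf Q)$. The tautological map $T:V\to[R_\alpha(\mathbf Q)/G]$ sends $p$ to the fiber at $p$ of $\oplus_i\pi^*E_i^\vee$, on which $f\in\operatorname{Hom}_V(\pi^*E_i,\pi^*E_j)$ acts by its transpose. Pullback of global functions along $T$ gives $B^G\to\Gamma(\mathcal O_V)$, and $\varphi_0:V_0\to M_0$ is the induced map. *)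

theory Defs
  imports
    "HOL-Analysis.Abstract_Topology"
    "HOL-Algebra.QuotRing"
    "HOL-Algebra.Module"
    "HOL-Library.Poly_Mapping"
    "HOL-Combinatorics.Permutations"
    "HOL-Computational_Algebra.Polynomial"
begin

section \<open>Sheaves and locally ringed spaces\<close>

text \<open>\<open>ores X U W\<close> is the restriction map from \<open>U\<close> to \<open>W\<close>. The values of \<open>osec\<close> and \<open>ores\<close>
  matter only on open sets \<open>W \<subseteq> U\<close>.\<close>

record ('p, 'a) rspace =
  tp :: "'p topology"
  osec :: "'p set \<Rightarrow> 'a ring"
  ores :: "'p set \<Rightarrow> 'p set \<Rightarrow> 'a \<Rightarrow> 'a"

abbreviation pts :: "('p, 'a) rspace \<Rightarrow> 'p set"
  where "pts X \<equiv> topspace (tp X)"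

abbreviation opn :: "('p, 'a) rspace \<Rightarrow> 'p set \<Rightarrow> bool"
  where "opn X U \<equiv> openin (tp X) U"

definition is_presheaf ::
  "'p topology \<Rightarrow> ('p set \<Rightarrow> 's set) \<Rightarrow> ('p set \<Rightarrow> 'p set \<Rightarrow> 's \<Rightarrow> 's) \<Rightarrow> bool"
  where "is_presheaf T S res \<longleftrightarrow>
    (\<forall>U W. openin T U \<and> openin T W \<and> W \<subseteq> U \<longrightarrow> res U W \<in> S U \<rightarrow> S W) \<and>
    (\<forall>U. openin T U \<longrightarrow> (\<forall>s\<in>S U. res U U s = s)) \<and>
    (\<forall>U W Z. openin T U \<and> openin T W \<and> openin T Z \<and> Z \<subseteq> W \<and> W \<subseteq> U \<longrightarrow>
      (\<forall>s\<in>S U. res W Z (res U W s) = res U Z s))"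

definition is_sheaf ::
  "'p topology \<Rightarrow> ('p set \<Rightarrow> 's set) \<Rightarrow> ('p set \<Rightarrow> 'p set \<Rightarrow> 's \<Rightarrow> 's) \<Rightarrow> bool"
  where "is_sheaf T S res \<longleftrightarrow> is_presheaf T S res \<and>
    (\<forall>\<C> s. (\<forall>U\<in>\<C>. openin T U \<and> s U \<in> S U) \<and>
       (\<forall>U\<in>\<C>. \<forall>W\<in>\<C>. res U (U \<inter> W) (s U) = res W (U \<inter> W) (s W)) \<longrightarrow>
       (\<exists>!t. t \<in> S (\<Union>\<C>) \<and> (\<forall>U\<in>\<C>. res (\<Union>\<C>) U t = s U)))"

definition ring_sheaf :: "('p, 'a) rspace \<Rightarrow> bool"
  where "ring_sheaf X \<longleftrightarrow>
    (\<forall>U. opn X U \<longrightarrow> cring (osec X U)) \<and>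
    (\<forall>U W. opn X U \<and> opn X W \<and> W \<subseteq> U \<longrightarrow> ores X U W \<in> ring_hom (osec X U) (osec X W)) \<and>
    is_sheaf (tp X) (\<lambda>U. carrier (osec X U)) (ores X)"

text \<open>The germ at \<open>p\<close> of the section \<open>s\<close> over \<open>U\<close>, as an equivalence class of pairs
  (neighbourhood, section). Operations on classes are unions over representatives.\<close>

definition germ ::
  "'p topology \<Rightarrow> ('p set \<Rightarrow> 's set) \<Rightarrow> ('p set \<Rightarrow> 'p set \<Rightarrow> 's \<Rightarrow> 's) \<Rightarrow> 'p \<Rightarrow> 'p set \<Rightarrow> 's \<Rightarrow> ('p set \<times> 's) set"
  where "germ T S res p U s =
    {(U', s'). openin T U' \<and> p \<in> U' \<and> s' \<in> S U' \<and>
       (\<exists>W. openin T W \<and> p \<in> W \<and> W \<subseteq> U \<inter> U' \<and> res U W s = res U' W s')}"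

definition ogerm :: "('p, 'a) rspace \<Rightarrow> 'p \<Rightarrow> 'p set \<Rightarrow> 'a \<Rightarrow> ('p set \<times> 'a) set"
  where "ogerm X = germ (tp X) (\<lambda>U. carrier (osec X U)) (ores X)"

definition ostalk :: "('p, 'a) rspace \<Rightarrow> 'p \<Rightarrow> ('p set \<times> 'a) set ring"
  where "ostalk X p =
    \<lparr>carrier = {ogerm X p U s |U s. opn X U \<and> p \<in> U \<and> s \<in> carrier (osec X U)},
     monoid.mult = (\<lambda>A B. \<Union>(U, s)\<in>A. \<Union>(W, t)\<in>B. ogerm X p (U \<inter> W)
        (ores X U (U \<inter> W) s \<otimes>\<^bsub>osec X (U \<inter> W)\<^esub> ores X W (U \<inter> W) t)),
     one = ogerm X p (pts X) \<one>\<^bsub>osec X (pts X)\<^esub>,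
     zero = ogerm X p (pts X) \<zero>\<^bsub>osec X (pts X)\<^esub>,
     add = (\<lambda>A B. \<Union>(U, s)\<in>A. \<Union>(W, t)\<in>B. ogerm X p (U \<inter> W)
        (ores X U (U \<inter> W) s \<oplus>\<^bsub>osec X (U \<inter> W)\<^esub> ores X W (U \<inter> W) t))\<rparr>"

definition local_ring :: "'a ring \<Rightarrow> bool"
  where "local_ring R \<longleftrightarrow> cring R \<and> (\<exists>!m. maximalideal m R)"

definition lrs :: "('p, 'a) rspace \<Rightarrow> bool"
  where "lrs X \<longleftrightarrow> ring_sheaf X \<and> (\<forall>p\<in>pts X. local_ring (ostalk X p))"

definition open_sub :: "('p, 'a) rspace \<Rightarrow> 'p set \<Rightarrow> ('p, 'a) rspace"
  where "open_sub X U = \<lparr>tp = subtopology (tp X) U, osec = osec X, ores = ores X\<rparr>"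

text \<open>A morphism \<open>X \<rightarrow> Y\<close>: a map on points and the comorphism \<open>\<O>\<^sub>Y(U) \<rightarrow> \<O>\<^sub>X(f\<^sup>-\<^sup>1 U)\<close>.\<close>

record ('p, 'a, 'q, 'b) rmor =
  mpt :: "'p \<Rightarrow> 'q"
  mco :: "'q set \<Rightarrow> 'b \<Rightarrow> 'a"

definition preim :: "('p, 'a) rspace \<Rightarrow> ('p, 'a, 'q, 'b) rmor \<Rightarrow> 'q set \<Rightarrow> 'p set"
  where "preim X f U = {p \<in> pts X. mpt f p \<in> U}"

definition stalk_map ::
  "('p, 'a) rspace \<Rightarrow> ('p, 'a, 'q, 'b) rmor \<Rightarrow> 'p \<Rightarrow> ('q set \<times> 'b) set \<Rightarrow> ('p set \<times> 'a) set"
  where "stalk_map X f p A = (\<Union>(U, s)\<in>A. ogerm X p (preim X f U) (mco f U s))"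

definition lrs_hom :: "('p, 'a) rspace \<Rightarrow> ('q, 'b) rspace \<Rightarrow> ('p, 'a, 'q, 'b) rmor \<Rightarrow> bool"
  where "lrs_hom X Y f \<longleftrightarrow>
    continuous_map (tp X) (tp Y) (mpt f) \<and>
    (\<forall>U. opn Y U \<longrightarrow> mco f U \<in> ring_hom (osec Y U) (osec X (preim X f U))) \<and>
    (\<forall>U W. opn Y U \<and> opn Y W \<and> W \<subseteq> U \<longrightarrow> (\<forall>s\<in>carrier (osec Y U).
       mco f W (ores Y U W s) = ores X (preim X f U) (preim X f W) (mco f U s))) \<and>
    (\<forall>p\<in>pts X. \<forall>A\<in>carrier (ostalk Y (mpt f p)).
       stalk_map X f p A \<in> Units (ostalk X p) \<longrightarrow> A \<in> Units (ostalk Y (mpt f p)))"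

definition mor_eq ::
  "('p, 'a) rspace \<Rightarrow> ('q, 'b) rspace \<Rightarrow> ('p, 'a, 'q, 'b) rmor \<Rightarrow> ('p, 'a, 'q, 'b) rmor \<Rightarrow> bool"
  where "mor_eq X Y f g \<longleftrightarrow> (\<forall>p\<in>pts X. mpt f p = mpt g p) \<and>
    (\<forall>U. opn Y U \<longrightarrow> (\<forall>s\<in>carrier (osec Y U). mco f U s = mco g U s))"

definition mor_id :: "('p, 'a, 'p, 'a) rmor"
  where "mor_id = \<lparr>mpt = (\<lambda>p. p), mco = (\<lambda>U s. s)\<rparr>"

text \<open>\<open>mor_comp Y g f\<close> is \<open>g \<circ> f\<close> for \<open>f : X \<rightarrow> Y\<close> and \<open>g : Y \<rightarrow> Z\<close>.\<close>

definition mor_comp ::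
  "('q, 'b) rspace \<Rightarrow> ('q, 'b, 'r, 'c) rmor \<Rightarrow> ('p, 'a, 'q, 'b) rmor \<Rightarrow> ('p, 'a, 'r, 'c) rmor"
  where "mor_comp Y g f =
    \<lparr>mpt = (\<lambda>p. mpt g (mpt f p)), mco = (\<lambda>U s. mco f (preim Y g U) (mco g U s))\<rparr>"

definition lrs_iso :: "('p, 'a) rspace \<Rightarrow> ('q, 'b) rspace \<Rightarrow> ('p, 'a, 'q, 'b) rmor \<Rightarrow> bool"
  where "lrs_iso X Y f \<longleftrightarrow> lrs_hom X Y f \<and>
    (\<exists>g. lrs_hom Y X g \<and> mor_eq X X (mor_comp Y g f) mor_id \<and> mor_eq Y Y (mor_comp X f g) mor_id)"

definition closed_immersion :: "('p, 'a) rspace \<Rightarrow> ('q, 'b) rspace \<Rightarrow> ('p, 'a, 'q, 'b) rmor \<Rightarrow> bool"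
  where "closed_immersion X Y f \<longleftrightarrow> lrs_hom X Y f \<and>
    closedin (tp Y) (mpt f ` pts X) \<and>
    homeomorphic_map (tp X) (subtopology (tp Y) (mpt f ` pts X)) (mpt f) \<and>
    (\<forall>p\<in>pts X. stalk_map X f p ` carrier (ostalk Y (mpt f p)) = carrier (ostalk X p))"


section \<open>Affine schemes, projective space, varieties\<close>

text \<open>Fractions \<open>a/t\<close> with \<open>(a, t) \<in> D\<close>, where \<open>(a, t)\<close> and \<open>(b, s)\<close> are identified if
  \<open>u(as - bt) = 0\<close> for some \<open>u \<in> M\<close>.\<close>

definition fraction :: "'a ring \<Rightarrow> ('a \<times> 'a) set \<Rightarrow> 'a set \<Rightarrow> 'a \<times> 'a \<Rightarrow> ('a \<times> 'a) set"
  where "fraction R D M x =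
    {(b, s) \<in> D. \<exists>u\<in>M. u \<otimes>\<^bsub>R\<^esub> (fst x \<otimes>\<^bsub>R\<^esub> s \<ominus>\<^bsub>R\<^esub> b \<otimes>\<^bsub>R\<^esub> snd x) = \<zero>\<^bsub>R\<^esub>}"

definition frac_ring :: "'a ring \<Rightarrow> ('a \<times> 'a) set \<Rightarrow> 'a set \<Rightarrow> ('a \<times> 'a) set ring"
  where "frac_ring R D M =
    \<lparr>carrier = fraction R D M ` D,
     monoid.mult = (\<lambda>A B. \<Union>(a, s)\<in>A. \<Union>(b, t)\<in>B. fraction R D M (a \<otimes>\<^bsub>R\<^esub> b, s \<otimes>\<^bsub>R\<^esub> t)),
     one = fraction R D M (\<one>\<^bsub>R\<^esub>, \<one>\<^bsub>R\<^esub>),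
     zero = fraction R D M (\<zero>\<^bsub>R\<^esub>, \<one>\<^bsub>R\<^esub>),
     add = (\<lambda>A B. \<Union>(a, s)\<in>A. \<Union>(b, t)\<in>B.
        fraction R D M (a \<otimes>\<^bsub>R\<^esub> t \<oplus>\<^bsub>R\<^esub> b \<otimes>\<^bsub>R\<^esub> s, s \<otimes>\<^bsub>R\<^esub> t))\<rparr>"

text \<open>The ringed space on a set \<open>P\<close> of prime ideals with the Zariski topology, whose sections over
  \<open>U\<close> are the functions \<open>p \<mapsto> s p\<close>, with \<open>s p\<close> in the localization at \<open>p\<close>, that are locally a
  fraction. It specializes to \<open>Spec\<close> and to \<open>Proj\<close>.\<close>

definition zariski :: "'a ring \<Rightarrow> 'a set set \<Rightarrow> 'a set topology"
  where "zariski R P = topology (\<lambda>U. \<exists>S\<subseteq>carrier R. U = {p \<in> P. \<not> S \<subseteq> p})"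

definition frac_space ::
  "'a ring \<Rightarrow> 'a set set \<Rightarrow> ('a set \<Rightarrow> ('a \<times> 'a) set) \<Rightarrow> ('a set \<Rightarrow> 'a set)
    \<Rightarrow> ('a set, 'a set \<Rightarrow> ('a \<times> 'a) set) rspace"
  where "frac_space R P D M =
    \<lparr>tp = zariski R P,
     osec = (\<lambda>U. \<lparr>
       carrier = {s \<in> extensional U. \<forall>p\<in>U. \<exists>W x. openin (zariski R P) W \<and> p \<in> W \<and> W \<subseteq> U \<and>
         (\<forall>q\<in>W. x \<in> D q \<and> s q = fraction R (D q) (M q) x)},
       monoid.mult = (\<lambda>s t. \<lambda>p\<in>U. s p \<otimes>\<^bsub>frac_ring R (D p) (M p)\<^esub> t p),
       one = (\<lambda>p\<in>U. \<one>\<^bsub>frac_ring R (D p) (M p)\<^esub>),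
       zero = (\<lambda>p\<in>U. \<zero>\<^bsub>frac_ring R (D p) (M p)\<^esub>),
       add = (\<lambda>s t. \<lambda>p\<in>U. s p \<oplus>\<^bsub>frac_ring R (D p) (M p)\<^esub> t p)\<rparr>),
     ores = (\<lambda>U W s. restrict s W)\<rparr>"

definition loc_den :: "'a ring \<Rightarrow> 'a set \<Rightarrow> 'a set"
  where "loc_den R p = carrier R - p"

definition loc_pairs :: "'a ring \<Rightarrow> 'a set \<Rightarrow> ('a \<times> 'a) set"
  where "loc_pairs R p = carrier R \<times> (carrier R - p)"

definition Spec :: "'a ring \<Rightarrow> ('a set, 'a set \<Rightarrow> ('a \<times> 'a) set) rspace"
  where "Spec R = frac_space R {p. primeideal p R} (loc_pairs R) (loc_den R)"

text \<open>The morphism \<open>Spec S \<rightarrow> Spec R\<close> induced by a ring homomorphism \<open>h : R \<rightarrow> S\<close>.\<close>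

definition Spec_map ::
  "'a ring \<Rightarrow> 'b ring \<Rightarrow> ('a \<Rightarrow> 'b)
    \<Rightarrow> ('b set, 'b set \<Rightarrow> ('b \<times> 'b) set, 'a set, 'a set \<Rightarrow> ('a \<times> 'a) set) rmor"
  where "Spec_map R S h =
    \<lparr>mpt = (\<lambda>q. {a \<in> carrier R. h a \<in> q}),
     mco = (\<lambda>U s. \<lambda>q\<in>{q. primeideal q S \<and> {a \<in> carrier R. h a \<in> q} \<in> U}.
        \<Union>(a, t)\<in>s {a \<in> carrier R. h a \<in> q}. fraction S (loc_pairs S q) (loc_den S q) (h a, h t))\<rparr>"

definition affine_open :: "('p, 'a) rspace \<Rightarrow> 'p set \<Rightarrow> bool"
  where "affine_open X U \<longleftrightarrow> opn X U \<and> (\<exists>f. lrs_iso (open_sub X U) (Spec (osec X U)) f)"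

definition scheme :: "('p, 'a) rspace \<Rightarrow> bool"
  where "scheme X \<longleftrightarrow> lrs X \<and> (\<forall>p\<in>pts X. \<exists>U. affine_open X U \<and> p \<in> U)"

definition reduced_scheme :: "('p, 'a) rspace \<Rightarrow> bool"
  where "reduced_scheme X \<longleftrightarrow> scheme X \<and> (\<forall>U. opn X U \<longrightarrow>
    (\<forall>a\<in>carrier (osec X U). \<forall>m::nat. a [^]\<^bsub>osec X U\<^esub> m = \<zero>\<^bsub>osec X U\<^esub> \<longrightarrow> a = \<zero>\<^bsub>osec X U\<^esub>))"

definition integral_scheme :: "('p, 'a) rspace \<Rightarrow> bool"
  where "integral_scheme X \<longleftrightarrow> scheme X \<and> pts X \<noteq> {} \<and>
    (\<forall>U. opn X U \<and> U \<noteq> {} \<longrightarrow> domain (osec X U))"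

text \<open>Polynomials over the field \<open>'k\<close> in variables from \<open>'v\<close> are elements of the monoid algebra
  \<open>('v \<Rightarrow>\<^sub>0 nat) \<Rightarrow>\<^sub>0 'k\<close>; \<open>mpoly_ring S\<close> is the polynomial ring in the variables in \<open>S\<close>.\<close>

type_synonym ('v, 'k) mpol = "('v \<Rightarrow>\<^sub>0 nat) \<Rightarrow>\<^sub>0 'k"

definition mpoly_ring :: "'v set \<Rightarrow> ('v, 'k::field) mpol ring"
  where "mpoly_ring S = \<lparr>carrier = {q. \<forall>m\<in>Poly_Mapping.keys q. Poly_Mapping.keys m \<subseteq> S},
    monoid.mult = (*), one = 1, zero = 0, add = (+)\<rparr>"

definition mConst :: "'k \<Rightarrow> ('v, 'k::field) mpol"
  where "mConst c = Poly_Mapping.single 0 c"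

definition mVar :: "'v \<Rightarrow> ('v, 'k::field) mpol"
  where "mVar v = Poly_Mapping.single (Poly_Mapping.single v 1) 1"

definition mp_eval ::
  "('k \<Rightarrow> 'a) \<Rightarrow> 'a ring \<Rightarrow> ('v \<Rightarrow> 'a) \<Rightarrow> ('v, 'k::field) mpol \<Rightarrow> 'a"
  where "mp_eval c R x q = finsum R
    (\<lambda>m. c (Poly_Mapping.lookup q m) \<otimes>\<^bsub>R\<^esub>
      finprod R (\<lambda>v. x v [^]\<^bsub>R\<^esub> Poly_Mapping.lookup m v) (Poly_Mapping.keys m)) (Poly_Mapping.keys q)"

definition mp_deriv :: "'v \<Rightarrow> ('v, 'k::field) mpol \<Rightarrow> ('v, 'k) mpol"
  where "mp_deriv v q = (\<Sum>m\<in>Poly_Mapping.keys q. Poly_Mapping.single (m - Poly_Mapping.single v 1)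
    (of_nat (Poly_Mapping.lookup m v) * Poly_Mapping.lookup q m))"

definition mono_deg :: "('v \<Rightarrow>\<^sub>0 nat) \<Rightarrow> nat"
  where "mono_deg m = (\<Sum>v\<in>Poly_Mapping.keys m. Poly_Mapping.lookup m v)"

definition homog :: "nat \<Rightarrow> ('v, 'k::field) mpol \<Rightarrow> bool"
  where "homog d q \<longleftrightarrow> (\<forall>m\<in>Poly_Mapping.keys q. mono_deg m = d)"

definition homog_part :: "nat \<Rightarrow> ('v, 'k::field) mpol \<Rightarrow> ('v, 'k) mpol"
  where "homog_part d q =
    (\<Sum>m\<in>{m \<in> Poly_Mapping.keys q. mono_deg m = d}. Poly_Mapping.single m (Poly_Mapping.lookup q m))"

definition proj_points :: "nat \<Rightarrow> (nat, 'k::field) mpol set set"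
  where "proj_points N = {p. primeideal p (mpoly_ring {..N}) \<and>
    (\<forall>q\<in>p. \<forall>d. homog_part d q \<in> p) \<and>
    \<not> {q \<in> carrier (mpoly_ring {..N}). Poly_Mapping.lookup q 0 = 0} \<subseteq> p}"

definition proj_den :: "nat \<Rightarrow> (nat, 'k::field) mpol set \<Rightarrow> (nat, 'k) mpol set"
  where "proj_den N p = {t \<in> carrier (mpoly_ring {..N}) - p. \<exists>d. homog d t}"

definition proj_pairs ::
  "nat \<Rightarrow> (nat, 'k::field) mpol set \<Rightarrow> ((nat, 'k) mpol \<times> (nat, 'k) mpol) set"
  where "proj_pairs N p = {(a, t). a \<in> carrier (mpoly_ring {..N}) \<and>
    t \<in> carrier (mpoly_ring {..N}) - p \<and> (\<exists>d. homog d a \<and> homog d t)}"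

text \<open>Projective space of dimension \<open>N\<close> as \<open>Proj\<close> of the polynomial ring in the variables
  \<open>0, \<dots>, N\<close>.\<close>

definition proj_space ::
  "nat \<Rightarrow> ((nat, 'k::field) mpol set, (nat, 'k) mpol set \<Rightarrow> ((nat, 'k) mpol \<times> (nat, 'k) mpol) set) rspace"
  where "proj_space N = frac_space (mpoly_ring {..N}) (proj_points N) (proj_pairs N) (proj_den N)"

definition proj_const ::
  "nat \<Rightarrow> 'k \<Rightarrow> (nat, 'k::field) mpol set \<Rightarrow> ((nat, 'k) mpol \<times> (nat, 'k) mpol) set"
  where "proj_const N c = (\<lambda>p\<in>proj_points N.
    fraction (mpoly_ring {..N}) (proj_pairs N p) (proj_den N p) (mConst c, 1))"

text \<open>The structure of a scheme over \<open>k\<close> is given by a ring homomorphism from \<open>k\<close>, the universe of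
  the type \<open>'k\<close>, to the global functions.\<close>

definition k_ring :: "'k::field ring"
  where "k_ring = \<lparr>carrier = UNIV, monoid.mult = (*), one = 1, zero = 0, add = (+)\<rparr>"

definition k_scheme :: "('k::field \<Rightarrow> 'a) \<Rightarrow> ('p, 'a) rspace \<Rightarrow> bool"
  where "k_scheme \<kappa> X \<longleftrightarrow> scheme X \<and> \<kappa> \<in> ring_hom k_ring (osec X (pts X))"

definition k_const :: "('k \<Rightarrow> 'a) \<Rightarrow> ('p, 'a) rspace \<Rightarrow> 'p set \<Rightarrow> 'k \<Rightarrow> 'a"
  where "k_const \<kappa> X U c = ores X (pts X) U (\<kappa> c)"

definition projective_over_k :: "('k::field \<Rightarrow> 'a) \<Rightarrow> ('p, 'a) rspace \<Rightarrow> bool"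
  where "projective_over_k \<kappa> X \<longleftrightarrow> (\<exists>N f.
    closed_immersion X (proj_space N) f \<and>
    (\<forall>c::'k. mco f (pts (proj_space N :: ((nat, 'k) mpol set, _) rspace)) (proj_const N c) = \<kappa> c))"

text \<open>Smoothness over \<open>k\<close>: locally \<open>X\<close> is the spectrum of a standard smooth algebra
  \<open>k[x\<^sub>1, \<dots>, x\<^sub>n]/(f\<^sub>1, \<dots>, f\<^sub>c)\<close>, that is, the Jacobian minor \<open>det (\<partial>f\<^sub>i/\<partial>x\<^sub>j)\<close>, \<open>i, j \<le> c\<close>,
  is invertible in it.\<close>

definition smooth_over_k :: "('k::field \<Rightarrow> 'a) \<Rightarrow> ('p, 'a) rspace \<Rightarrow> bool"
  where "smooth_over_k \<kappa> X \<longleftrightarrow> (\<forall>p\<in>pts X. \<exists>U. affine_open X U \<and> p \<in> U \<and>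
    (\<exists>(n::nat) c x f. c \<le> n \<and> x \<in> {..<n} \<rightarrow> carrier (osec X U) \<and>
       f \<in> {..<c} \<rightarrow> carrier (mpoly_ring {..<n}) \<and>
       mp_eval (k_const \<kappa> X U) (osec X U) x ` carrier (mpoly_ring {..<n}) = carrier (osec X U) \<and>
       {q \<in> carrier (mpoly_ring {..<n}). mp_eval (k_const \<kappa> X U) (osec X U) x q = \<zero>\<^bsub>osec X U\<^esub>}
         = genideal (mpoly_ring {..<n}) (f ` {..<c}) \<and>
       mp_eval (k_const \<kappa> X U) (osec X U) x
         (\<Sum>\<tau> | \<tau> permutes {..<c}. of_int (sign \<tau>) * (\<Prod>i<c. mp_deriv (\<tau> i) (f i)))
         \<in> Units (osec X U)))"

text \<open>A variety is an integral separated scheme of finite type over \<open>k\<close>. Separatedness and finite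
  type need not be listed: they follow from the closed immersion into projective space.\<close>

definition smooth_projective_variety :: "('k::field \<Rightarrow> 'a) \<Rightarrow> ('p, 'a) rspace \<Rightarrow> bool"
  where "smooth_projective_variety \<kappa> X \<longleftrightarrow>
    k_scheme \<kappa> X \<and> integral_scheme X \<and> projective_over_k \<kappa> X \<and> smooth_over_k \<kappa> X"


section \<open>Sheaves of modules\<close>

record ('p, 'a, 'm) msheaf =
  msec :: "'p set \<Rightarrow> ('a, 'm) module"
  mres :: "'p set \<Rightarrow> 'p set \<Rightarrow> 'm \<Rightarrow> 'm"

definition mod_sheaf :: "('p, 'a) rspace \<Rightarrow> ('p, 'a, 'm) msheaf \<Rightarrow> bool"
  where "mod_sheaf X F \<longleftrightarrow>
    (\<forall>U. opn X U \<longrightarrow> module (osec X U) (msec F U)) \<and>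
    (\<forall>U W. opn X U \<and> opn X W \<and> W \<subseteq> U \<longrightarrow>
      (\<forall>s\<in>carrier (msec F U). \<forall>t\<in>carrier (msec F U).
         mres F U W (s \<oplus>\<^bsub>msec F U\<^esub> t) = mres F U W s \<oplus>\<^bsub>msec F W\<^esub> mres F U W t) \<and>
      (\<forall>a\<in>carrier (osec X U). \<forall>s\<in>carrier (msec F U).
         mres F U W (a \<odot>\<^bsub>msec F U\<^esub> s) = ores X U W a \<odot>\<^bsub>msec F W\<^esub> mres F U W s)) \<and>
    is_sheaf (tp X) (\<lambda>U. carrier (msec F U)) (mres F)"

text \<open>Homomorphisms of sheaves of modules. They are extensional, so that \<open>mod_hom X F G\<close> is the
  group \<open>Hom(F, G)\<close> without repetitions.\<close>

definition mod_hom ::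
  "('p, 'a) rspace \<Rightarrow> ('p, 'a, 'm) msheaf \<Rightarrow> ('p, 'a, 'n) msheaf \<Rightarrow> ('p set \<Rightarrow> 'm \<Rightarrow> 'n) set"
  where "mod_hom X F G = {f \<in> extensional {U. opn X U}.
    (\<forall>U. opn X U \<longrightarrow>
       f U \<in> carrier (msec F U) \<rightarrow>\<^sub>E carrier (msec G U) \<and>
       (\<forall>s\<in>carrier (msec F U). \<forall>t\<in>carrier (msec F U).
          f U (s \<oplus>\<^bsub>msec F U\<^esub> t) = f U s \<oplus>\<^bsub>msec G U\<^esub> f U t) \<and>
       (\<forall>a\<in>carrier (osec X U). \<forall>s\<in>carrier (msec F U).
          f U (a \<odot>\<^bsub>msec F U\<^esub> s) = a \<odot>\<^bsub>msec G U\<^esub> f U s)) \<and>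
    (\<forall>U W. opn X U \<and> opn X W \<and> W \<subseteq> U \<longrightarrow>
       (\<forall>s\<in>carrier (msec F U). f W (mres F U W s) = mres G U W (f U s)))}"

definition hom_id :: "('p, 'a) rspace \<Rightarrow> ('p, 'a, 'm) msheaf \<Rightarrow> 'p set \<Rightarrow> 'm \<Rightarrow> 'm"
  where "hom_id X F = (\<lambda>U\<in>{U. opn X U}. \<lambda>s\<in>carrier (msec F U). s)"

definition hom_comp ::
  "('p, 'a) rspace \<Rightarrow> ('p, 'a, 'm) msheaf \<Rightarrow> ('p set \<Rightarrow> 'n \<Rightarrow> 'r) \<Rightarrow> ('p set \<Rightarrow> 'm \<Rightarrow> 'n) \<Rightarrow> 'p set \<Rightarrow> 'm \<Rightarrow> 'r"
  where "hom_comp X F g f = (\<lambda>U\<in>{U. opn X U}. \<lambda>s\<in>carrier (msec F U). g U (f U s))"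

definition hom_zero ::
  "('p, 'a) rspace \<Rightarrow> ('p, 'a, 'm) msheaf \<Rightarrow> ('p, 'a, 'n) msheaf \<Rightarrow> 'p set \<Rightarrow> 'm \<Rightarrow> 'n"
  where "hom_zero X F G = (\<lambda>U\<in>{U. opn X U}. \<lambda>s\<in>carrier (msec F U). \<zero>\<^bsub>msec G U\<^esub>)"

definition hom_add ::
  "('p, 'a) rspace \<Rightarrow> ('p, 'a, 'm) msheaf \<Rightarrow> ('p, 'a, 'n) msheaf
    \<Rightarrow> ('p set \<Rightarrow> 'm \<Rightarrow> 'n) \<Rightarrow> ('p set \<Rightarrow> 'm \<Rightarrow> 'n) \<Rightarrow> 'p set \<Rightarrow> 'm \<Rightarrow> 'n"
  where "hom_add X F G f g = (\<lambda>U\<in>{U. opn X U}. \<lambda>s\<in>carrier (msec F U). f U s \<oplus>\<^bsub>msec G U\<^esub> g U s)"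

definition hom_smult ::
  "('p, 'a) rspace \<Rightarrow> ('p, 'a, 'm) msheaf \<Rightarrow> ('p, 'a, 'n) msheaf
    \<Rightarrow> 'a \<Rightarrow> ('p set \<Rightarrow> 'm \<Rightarrow> 'n) \<Rightarrow> 'p set \<Rightarrow> 'm \<Rightarrow> 'n"
  where "hom_smult X F G a f =
    (\<lambda>U\<in>{U. opn X U}. \<lambda>s\<in>carrier (msec F U). ores X (pts X) U a \<odot>\<^bsub>msec G U\<^esub> f U s)"

definition mod_iso :: "('p, 'a) rspace \<Rightarrow> ('p, 'a, 'm) msheaf \<Rightarrow> ('p, 'a, 'n) msheaf \<Rightarrow> bool"
  where "mod_iso X F G \<longleftrightarrow> (\<exists>f\<in>mod_hom X F G. \<forall>U. opn X U \<longrightarrow>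
    bij_betw (f U) (carrier (msec F U)) (carrier (msec G U)))"

text \<open>Module records inherit from \<open>ring\<close> the fields \<open>mult\<close> and \<open>one\<close>, which have no meaning for
  modules and are filled with \<open>undefined\<close> below.\<close>

definition reg_module :: "'a ring \<Rightarrow> ('a, 'a) module"
  where "reg_module R = \<lparr>carrier = carrier R, monoid.mult = undefined, one = undefined,
    zero = zero R, add = add R, module.smult = monoid.mult R\<rparr>"

definition osheaf :: "('p, 'a) rspace \<Rightarrow> ('p, 'a, 'a) msheaf"
  where "osheaf X = \<lparr>msec = (\<lambda>U. reg_module (osec X U)), mres = ores X\<rparr>"

definition pushforward_osheaf ::
  "('q, 'b) rspace \<Rightarrow> ('q, 'b, 'p, 'a) rmor \<Rightarrow> ('p, 'a, 'b) msheaf"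
  where "pushforward_osheaf V f =
    \<lparr>msec = (\<lambda>U. \<lparr>carrier = carrier (osec V (preim V f U)), monoid.mult = undefined, one = undefined,
        zero = \<zero>\<^bsub>osec V (preim V f U)\<^esub>, add = add (osec V (preim V f U)),
        module.smult = (\<lambda>a s. mco f U a \<otimes>\<^bsub>osec V (preim V f U)\<^esub> s)\<rparr>),
     mres = (\<lambda>U W. ores V (preim V f U) (preim V f W))\<rparr>"

text \<open>The dual \<open>\<H>om(L, \<O>)\<close>; for a line bundle \<open>L\<close> this is \<open>L\<^sup>-\<^sup>1\<close>.\<close>

definition dual ::
  "('p, 'a) rspace \<Rightarrow> ('p, 'a, 'm) msheaf \<Rightarrow> ('p, 'a, 'p set \<Rightarrow> 'm \<Rightarrow> 'a) msheaf"
  where "dual X L =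
    \<lparr>msec = (\<lambda>U. \<lparr>carrier = mod_hom (open_sub X U) L (osheaf X),
        monoid.mult = undefined, one = undefined,
        zero = hom_zero (open_sub X U) L (osheaf X),
        add = hom_add (open_sub X U) L (osheaf X),
        module.smult = hom_smult (open_sub X U) L (osheaf X)\<rparr>),
     mres = (\<lambda>U W f. restrict f {Z. opn X Z \<and> Z \<subseteq> W})\<rparr>"

definition free_gen :: "('p, 'a) rspace \<Rightarrow> ('p, 'a, 'm) msheaf \<Rightarrow> 'p set \<Rightarrow> 'm \<Rightarrow> bool"
  where "free_gen X F U e \<longleftrightarrow> opn X U \<and> e \<in> carrier (msec F U) \<and>
    (\<forall>W. opn X W \<and> W \<subseteq> U \<longrightarrow> (\<forall>s\<in>carrier (msec F W).
       \<exists>!a. a \<in> carrier (osec X W) \<and> s = a \<odot>\<^bsub>msec F W\<^esub> mres F U W e))"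

definition line_bundle :: "('p, 'a) rspace \<Rightarrow> ('p, 'a, 'm) msheaf \<Rightarrow> bool"
  where "line_bundle X F \<longleftrightarrow> mod_sheaf X F \<and> (\<forall>p\<in>pts X. \<exists>U e. p \<in> U \<and> free_gen X F U e)"

definition lin_comb ::
  "('p, 'a, 'm) msheaf \<Rightarrow> 'p set \<Rightarrow> 'p set \<Rightarrow> nat \<Rightarrow> (nat \<Rightarrow> 'a) \<Rightarrow> (nat \<Rightarrow> 'm) \<Rightarrow> 'm"
  where "lin_comb F U W n a s =
    finsum (msec F W) (\<lambda>i. a i \<odot>\<^bsub>msec F W\<^esub> mres F U W (s i)) {..<n}"

definition finite_type :: "('p, 'a) rspace \<Rightarrow> ('p, 'a, 'm) msheaf \<Rightarrow> bool"
  where "finite_type X F \<longleftrightarrow> (\<forall>p\<in>pts X. \<exists>U n s. opn X U \<and> p \<in> U \<and>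
    s \<in> {..<n} \<rightarrow> carrier (msec F U) \<and>
    (\<forall>W. opn X W \<and> W \<subseteq> U \<longrightarrow> (\<forall>t\<in>carrier (msec F W). \<forall>q\<in>W. \<exists>Z a.
       opn X Z \<and> q \<in> Z \<and> Z \<subseteq> W \<and> a \<in> {..<n} \<rightarrow> carrier (osec X Z) \<and>
       mres F W Z t = lin_comb F U Z n a s)))"

text \<open>Coherence: finite type, and for every open \<open>U\<close> and every \<open>\<O>\<^sub>U\<^sup>n \<rightarrow> F|\<^sub>U\<close>, given by sections
  \<open>s\<^sub>0, \<dots>, s\<^bsub>n-1\<^esub>\<close>, the kernel is of finite type, i.e. locally generated by finitely many
  relations \<open>r\<^sub>0, \<dots>, r\<^bsub>m-1\<^esub>\<close>.\<close>

definition coherent :: "('p, 'a) rspace \<Rightarrow> ('p, 'a, 'm) msheaf \<Rightarrow> bool"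
  where "coherent X F \<longleftrightarrow> mod_sheaf X F \<and> finite_type X F \<and>
    (\<forall>U n s. opn X U \<and> s \<in> {..<n} \<rightarrow> carrier (msec F U) \<longrightarrow>
      (\<forall>p\<in>U. \<exists>W (m::nat) r. opn X W \<and> p \<in> W \<and> W \<subseteq> U \<and>
        (\<forall>j<m. r j \<in> {..<n} \<rightarrow> carrier (osec X W) \<and>
           lin_comb F U W n (r j) s = \<zero>\<^bsub>msec F W\<^esub>) \<and>
        (\<forall>Z b. opn X Z \<and> Z \<subseteq> W \<and> b \<in> {..<n} \<rightarrow> carrier (osec X Z) \<and>
           lin_comb F U Z n b s = \<zero>\<^bsub>msec F Z\<^esub> \<longrightarrow>
           (\<forall>q\<in>Z. \<exists>Y c. opn X Y \<and> q \<in> Y \<and> Y \<subseteq> Z \<and> c \<in> {..<m} \<rightarrow> carrier (osec X Y) \<and>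
              (\<forall>i<n. ores X Z Y (b i) =
                 finsum (osec X Y) (\<lambda>j. c j \<otimes>\<^bsub>osec X Y\<^esub> ores X W Y (r j i)) {..<m})))))"

definition globally_generated :: "('p, 'a) rspace \<Rightarrow> ('p, 'a, 'm) msheaf \<Rightarrow> bool"
  where "globally_generated X F \<longleftrightarrow>
    (\<forall>U. opn X U \<longrightarrow> (\<forall>s\<in>carrier (msec F U). \<forall>p\<in>U. \<exists>W n t a.
       opn X W \<and> p \<in> W \<and> W \<subseteq> U \<and> t \<in> {..<n} \<rightarrow> carrier (msec F (pts X)) \<and>
       a \<in> {..<n} \<rightarrow> carrier (osec X W) \<and> mres F U W s = lin_comb F (pts X) W n a t))"


section \<open>Tensor products and pullbacks\<close>

definition mgerm :: "('p, 'a) rspace \<Rightarrow> ('p, 'a, 'm) msheaf \<Rightarrow> 'p \<Rightarrow> 'p set \<Rightarrow> 'm \<Rightarrow> ('p set \<times> 'm) set"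
  where "mgerm X F = germ (tp X) (\<lambda>U. carrier (msec F U)) (mres F)"

definition mstalk ::
  "('p, 'a) rspace \<Rightarrow> ('p, 'a, 'm) msheaf \<Rightarrow> 'p \<Rightarrow> (('p set \<times> 'a) set, ('p set \<times> 'm) set) module"
  where "mstalk X F p =
    \<lparr>carrier = {mgerm X F p U s |U s. opn X U \<and> p \<in> U \<and> s \<in> carrier (msec F U)},
     monoid.mult = undefined, one = undefined,
     zero = mgerm X F p (pts X) \<zero>\<^bsub>msec F (pts X)\<^esub>,
     add = (\<lambda>A B. \<Union>(U, s)\<in>A. \<Union>(W, t)\<in>B. mgerm X F p (U \<inter> W)
        (mres F U (U \<inter> W) s \<oplus>\<^bsub>msec F (U \<inter> W)\<^esub> mres F W (U \<inter> W) t)),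
     module.smult = (\<lambda>A B. \<Union>(U, a)\<in>A. \<Union>(W, t)\<in>B. mgerm X F p (U \<inter> W)
        (ores X U (U \<inter> W) a \<odot>\<^bsub>msec F (U \<inter> W)\<^esub> mres F W (U \<inter> W) t))\<rparr>"

text \<open>For a ring homomorphism \<open>h : R \<rightarrow> S\<close>, an \<open>R\<close>-module \<open>M\<close> and an \<open>S\<close>-module \<open>N\<close>, the
  \<open>S\<close>-module \<open>M \<otimes>\<^sub>R N\<close> is the free abelian group on \<open>M \<times> N\<close> modulo \<open>tens_null\<close>. The case
  \<open>h = id\<close> is the usual tensor product and the case \<open>N = S\<close> is extension of scalars.\<close>

inductive_set tens_null ::
  "('r, 'x) ring_scheme \<Rightarrow> ('r \<Rightarrow> 's) \<Rightarrow> ('r, 'm) module \<Rightarrow> ('s, 'n) module \<Rightarrow> ('m \<times> 'n \<Rightarrow>\<^sub>0 int) set"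
  for R h M N where
  zero: "0 \<in> tens_null R h M N"
| diff: "z \<in> tens_null R h M N \<Longrightarrow> w \<in> tens_null R h M N \<Longrightarrow> z - w \<in> tens_null R h M N"
| add_left: "m \<in> carrier M \<Longrightarrow> m' \<in> carrier M \<Longrightarrow> n \<in> carrier N \<Longrightarrow>
    frag_of (m \<oplus>\<^bsub>M\<^esub> m', n) - frag_of (m, n) - frag_of (m', n) \<in> tens_null R h M N"
| add_right: "m \<in> carrier M \<Longrightarrow> n \<in> carrier N \<Longrightarrow> n' \<in> carrier N \<Longrightarrow>
    frag_of (m, n \<oplus>\<^bsub>N\<^esub> n') - frag_of (m, n) - frag_of (m, n') \<in> tens_null R h M N"
| balanced: "r \<in> carrier R \<Longrightarrow> m \<in> carrier M \<Longrightarrow> n \<in> carrier N \<Longrightarrow>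
    frag_of (r \<odot>\<^bsub>M\<^esub> m, n) - frag_of (m, h r \<odot>\<^bsub>N\<^esub> n) \<in> tens_null R h M N"

definition tens_class ::
  "('r, 'x) ring_scheme \<Rightarrow> ('r \<Rightarrow> 's) \<Rightarrow> ('r, 'm) module \<Rightarrow> ('s, 'n) module
    \<Rightarrow> ('m \<times> 'n \<Rightarrow>\<^sub>0 int) \<Rightarrow> ('m \<times> 'n \<Rightarrow>\<^sub>0 int) set"
  where "tens_class R h M N z =
    {w. Poly_Mapping.keys w \<subseteq> carrier M \<times> carrier N \<and> w - z \<in> tens_null R h M N}"

definition tens_module ::
  "('r, 'x) ring_scheme \<Rightarrow> ('r \<Rightarrow> 's) \<Rightarrow> ('r, 'm) module \<Rightarrow> ('s, 'n) module
    \<Rightarrow> ('s, ('m \<times> 'n \<Rightarrow>\<^sub>0 int) set) module"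
  where "tens_module R h M N =
    \<lparr>carrier = tens_class R h M N ` {z. Poly_Mapping.keys z \<subseteq> carrier M \<times> carrier N},
     monoid.mult = undefined, one = undefined,
     zero = tens_class R h M N 0,
     add = (\<lambda>A B. \<Union>z\<in>A. \<Union>w\<in>B. tens_class R h M N (z + w)),
     module.smult = (\<lambda>a A. \<Union>z\<in>A. tens_class R h M N
        (frag_extend (\<lambda>(m, n). frag_of (m, a \<odot>\<^bsub>N\<^esub> n)) z))\<rparr>"

text \<open>The sheaf with stalks \<open>S p\<close> whose sections agree locally with functions in \<open>loc\<close>.\<close>

definition etale_sheaf ::
  "('p, 'a) rspace \<Rightarrow> ('p \<Rightarrow> (('p set \<times> 'a) set, 't) module) \<Rightarrow> ('p set \<Rightarrow> ('p \<Rightarrow> 't) set)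
    \<Rightarrow> ('p, 'a, 'p \<Rightarrow> 't) msheaf"
  where "etale_sheaf X S loc =
    \<lparr>msec = (\<lambda>U. \<lparr>
       carrier = {s \<in> extensional U. \<forall>p\<in>U. \<exists>W t. opn X W \<and> p \<in> W \<and> W \<subseteq> U \<and> t \<in> loc W \<and>
         (\<forall>q\<in>W. s q = t q)},
       monoid.mult = undefined, one = undefined,
       zero = (\<lambda>p\<in>U. \<zero>\<^bsub>S p\<^esub>),
       add = (\<lambda>s t. \<lambda>p\<in>U. s p \<oplus>\<^bsub>S p\<^esub> t p),
       module.smult = (\<lambda>a s. \<lambda>p\<in>U. ogerm X p U a \<odot>\<^bsub>S p\<^esub> s p)\<rparr>),
     mres = (\<lambda>U W s. restrict s W)\<rparr>"

definition tensor_stalk ::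
  "('p, 'a) rspace \<Rightarrow> ('p, 'a, 'm) msheaf \<Rightarrow> ('p, 'a, 'n) msheaf \<Rightarrow> 'p
    \<Rightarrow> (('p set \<times> 'a) set, (('p set \<times> 'm) set \<times> ('p set \<times> 'n) set \<Rightarrow>\<^sub>0 int) set) module"
  where "tensor_stalk X F G p = tens_module (ostalk X p) (\<lambda>a. a) (mstalk X F p) (mstalk X G p)"

definition tensor ::
  "('p, 'a) rspace \<Rightarrow> ('p, 'a, 'm) msheaf \<Rightarrow> ('p, 'a, 'n) msheaf
    \<Rightarrow> ('p, 'a, 'p \<Rightarrow> (('p set \<times> 'm) set \<times> ('p set \<times> 'n) set \<Rightarrow>\<^sub>0 int) set) msheaf"
  where "tensor X F G = etale_sheaf X (tensor_stalk X F G)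
    (\<lambda>W. {(\<lambda>q. finsum (tensor_stalk X F G q)
            (\<lambda>i. tens_class (ostalk X q) (\<lambda>a. a) (mstalk X F q) (mstalk X G q)
                   (frag_of (mgerm X F q W (u i), mgerm X G q W (v i)))) {..<l})
          | l u v. u \<in> {..<l::nat} \<rightarrow> carrier (msec F W) \<and> v \<in> {..<l} \<rightarrow> carrier (msec G W)})"

text \<open>The pullback \<open>f\<^sup>*F\<close> along \<open>f : V \<rightarrow> X\<close>, with stalks \<open>F\<^bsub>f(p)\<^esub> \<otimes> \<O>\<^bsub>V,p\<^esub>\<close> over \<open>\<O>\<^bsub>X,f(p)\<^esub>\<close>.\<close>

definition pullback_stalk ::
  "('q, 'b) rspace \<Rightarrow> ('p, 'a) rspace \<Rightarrow> ('q, 'b, 'p, 'a) rmor \<Rightarrow> ('p, 'a, 'm) msheaf \<Rightarrow> 'q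
    \<Rightarrow> (('q set \<times> 'b) set, (('p set \<times> 'm) set \<times> ('q set \<times> 'b) set \<Rightarrow>\<^sub>0 int) set) module"
  where "pullback_stalk V X f F q =
    tens_module (ostalk X (mpt f q)) (stalk_map V f q) (mstalk X F (mpt f q)) (reg_module (ostalk V q))"

definition pullback ::
  "('q, 'b) rspace \<Rightarrow> ('p, 'a) rspace \<Rightarrow> ('q, 'b, 'p, 'a) rmor \<Rightarrow> ('p, 'a, 'm) msheaf
    \<Rightarrow> ('q, 'b, 'q \<Rightarrow> (('p set \<times> 'm) set \<times> ('q set \<times> 'b) set \<Rightarrow>\<^sub>0 int) set) msheaf"
  where "pullback V X f F = etale_sheaf V (pullback_stalk V X f F)
    (\<lambda>W. {(\<lambda>q. finsum (pullback_stalk V X f F q)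
            (\<lambda>i. tens_class (ostalk X (mpt f q)) (stalk_map V f q)
                   (mstalk X F (mpt f q)) (reg_module (ostalk V q))
                   (frag_of (mgerm X F (mpt f q) U (u i), ogerm V q W (v i)))) {..<l})
          | l U u v. opn X U \<and> mpt f ` W \<subseteq> U \<and>
              u \<in> {..<l::nat} \<rightarrow> carrier (msec F U) \<and> v \<in> {..<l} \<rightarrow> carrier (osec V W)})"

text \<open>Ampleness of the line bundle \<open>A\<close>: for every coherent sheaf \<open>F\<close>, the sheaves
  \<open>F \<otimes> A\<^sup>m\<close> are globally generated for large \<open>m\<close>. The sheaf \<open>P m\<close> is \<open>F \<otimes> A\<^sup>m\<close> up to isomorphism.

  As in the derived category below, coherent sheaves are taken with sections in a fixed type \<open>'m\<close>.
  This is no restriction on a variety over an infinite field \<open>k\<close>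
  if \<open>'m\<close> has at least the cardinality of \<open>k\<close>: the sections of a coherent sheaf over an open set
  are at most as many as the elements of \<open>k\<close>, so every coherent sheaf has an isomorphic copy with
  sections in \<open>'m\<close>. The cardinality condition holds as soon as there is a line bundle with
  sections in \<open>'m\<close>.\<close>

definition ample :: "'m itself \<Rightarrow> ('p, 'a) rspace \<Rightarrow> ('p, 'a, 'l) msheaf \<Rightarrow> bool"
  where "ample (ty :: 'm itself) X A \<longleftrightarrow> line_bundle X A \<and>
    (\<forall>F :: ('p, 'a, 'm) msheaf. coherent X F \<longrightarrow>
      (\<exists>P :: nat \<Rightarrow> ('p, 'a, 'm) msheaf. P 0 = F \<and>
        (\<forall>m. mod_sheaf X (P m) \<and> mod_iso X (P (Suc m)) (tensor X (P m) A)) \<and>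
        (\<exists>m\<^sub>0. \<forall>m\<ge>m\<^sub>0. globally_generated X (P m))))"


section \<open>The bounded derived category of coherent sheaves\<close>

record ('p, 'a, 'm) cplx =
  cob :: "int \<Rightarrow> ('p, 'a, 'm) msheaf"
  cdf :: "int \<Rightarrow> 'p set \<Rightarrow> 'm \<Rightarrow> 'm"

definition bounded_complex :: "('p, 'a) rspace \<Rightarrow> ('p, 'a, 'm) cplx \<Rightarrow> bool"
  where "bounded_complex X C \<longleftrightarrow>
    (\<forall>i. coherent X (cob C i) \<and> cdf C i \<in> mod_hom X (cob C i) (cob C (i + 1)) \<and>
       hom_comp X (cob C i) (cdf C (i + 1)) (cdf C i) = hom_zero X (cob C i) (cob C (i + 1 + 1))) \<and>
    (\<exists>N. \<forall>i. \<bar>i\<bar> > N \<longrightarrow> (\<forall>U. opn X U \<longrightarrow> carrier (msec (cob C i) U) = {\<zero>\<^bsub>msec (cob C i) U\<^esub>}))"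

definition chain_map ::
  "('p, 'a) rspace \<Rightarrow> ('p, 'a, 'm) cplx \<Rightarrow> ('p, 'a, 'm) cplx \<Rightarrow> (int \<Rightarrow> 'p set \<Rightarrow> 'm \<Rightarrow> 'm) \<Rightarrow> bool"
  where "chain_map X C D f \<longleftrightarrow> (\<forall>i. f i \<in> mod_hom X (cob C i) (cob D i) \<and>
    hom_comp X (cob C i) (f (i + 1)) (cdf C i) = hom_comp X (cob C i) (cdf D i) (f i))"

definition chain_comp ::
  "('p, 'a) rspace \<Rightarrow> ('p, 'a, 'm) cplx \<Rightarrow> (int \<Rightarrow> 'p set \<Rightarrow> 'm \<Rightarrow> 'm) \<Rightarrow> (int \<Rightarrow> 'p set \<Rightarrow> 'm \<Rightarrow> 'm)
    \<Rightarrow> int \<Rightarrow> 'p set \<Rightarrow> 'm \<Rightarrow> 'm"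
  where "chain_comp X C g f = (\<lambda>i. hom_comp X (cob C i) (g i) (f i))"

definition chain_homotopic ::
  "('p, 'a) rspace \<Rightarrow> ('p, 'a, 'm) cplx \<Rightarrow> ('p, 'a, 'm) cplx
    \<Rightarrow> (int \<Rightarrow> 'p set \<Rightarrow> 'm \<Rightarrow> 'm) \<Rightarrow> (int \<Rightarrow> 'p set \<Rightarrow> 'm \<Rightarrow> 'm) \<Rightarrow> bool"
  where "chain_homotopic X C D f g \<longleftrightarrow>
    (\<exists>h. (\<forall>i. h i \<in> mod_hom X (cob C i) (cob D (i - 1))) \<and>
      (\<forall>i U. opn X U \<longrightarrow> (\<forall>s\<in>carrier (msec (cob C i) U).
         f i U s = g i U s \<oplus>\<^bsub>msec (cob D i) U\<^esub>
           (cdf D (i - 1) U (h i U s) \<oplus>\<^bsub>msec (cob D i) U\<^esub> h (i + 1) U (cdf C i U s)))))"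

definition cocycle :: "('p, 'a, 'm) cplx \<Rightarrow> int \<Rightarrow> 'p set \<Rightarrow> 'm \<Rightarrow> bool"
  where "cocycle C i U s \<longleftrightarrow> s \<in> carrier (msec (cob C i) U) \<and> cdf C i U s = \<zero>\<^bsub>msec (cob C (i + 1)) U\<^esub>"

text \<open>\<open>s\<close> is a section of the image sheaf of the differential into degree \<open>i\<close>.\<close>

definition coboundary :: "('p, 'a) rspace \<Rightarrow> ('p, 'a, 'm) cplx \<Rightarrow> int \<Rightarrow> 'p set \<Rightarrow> 'm \<Rightarrow> bool"
  where "coboundary X C i U s \<longleftrightarrow> s \<in> carrier (msec (cob C i) U) \<and>
    (\<forall>p\<in>U. \<exists>W. opn X W \<and> p \<in> W \<and> W \<subseteq> U \<and>
       (\<exists>t\<in>carrier (msec (cob C (i - 1)) W). mres (cob C i) U W s = cdf C (i - 1) W t))"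

definition acyclic_complex :: "('p, 'a) rspace \<Rightarrow> ('p, 'a, 'm) cplx \<Rightarrow> bool"
  where "acyclic_complex X C \<longleftrightarrow>
    (\<forall>i U s. opn X U \<and> cocycle C i U s \<longrightarrow> coboundary X C i U s)"

text \<open>The two conditions say that the map induced by \<open>f\<close> on the \<open>i\<close>-th cohomology sheaves is
  injective and surjective.\<close>

definition quasi_iso ::
  "('p, 'a) rspace \<Rightarrow> ('p, 'a, 'm) cplx \<Rightarrow> ('p, 'a, 'm) cplx \<Rightarrow> (int \<Rightarrow> 'p set \<Rightarrow> 'm \<Rightarrow> 'm) \<Rightarrow> bool"
  where "quasi_iso X C D f \<longleftrightarrow> chain_map X C D f \<and>
    (\<forall>i U. opn X U \<longrightarrow>
      (\<forall>s. cocycle C i U s \<and> coboundary X D i U (f i U s) \<longrightarrow> coboundary X C i U s) \<and>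
      (\<forall>t. cocycle D i U t \<longrightarrow> (\<forall>p\<in>U. \<exists>W s. opn X W \<and> p \<in> W \<and> W \<subseteq> U \<and> cocycle C i W s \<and>
         coboundary X D i W (mres (cob D i) U W t \<ominus>\<^bsub>msec (cob D i) W\<^esub> f i W s))))"

text \<open>Morphisms \<open>A \<rightarrow> B\<close> in the derived category are equivalence classes of roofs
  \<open>A \<leftarrow> C \<rightarrow> B\<close> whose left leg is a quasi-isomorphism; two roofs are equivalent if
  they are dominated by a third one up to homotopy.\<close>

definition roofs ::
  "('p, 'a) rspace \<Rightarrow> ('p, 'a, 'm) cplx \<Rightarrow> ('p, 'a, 'm) cplx
    \<Rightarrow> (('p, 'a, 'm) cplx \<times> (int \<Rightarrow> 'p set \<Rightarrow> 'm \<Rightarrow> 'm) \<times> (int \<Rightarrow> 'p set \<Rightarrow> 'm \<Rightarrow> 'm)) set"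
  where "roofs X A B = {(C, s, f). bounded_complex X C \<and> quasi_iso X C A s \<and> chain_map X C B f}"

definition roof_rel ::
  "('p, 'a) rspace \<Rightarrow> ('p, 'a, 'm) cplx \<Rightarrow> ('p, 'a, 'm) cplx
    \<Rightarrow> (('p, 'a, 'm) cplx \<times> (int \<Rightarrow> 'p set \<Rightarrow> 'm \<Rightarrow> 'm) \<times> (int \<Rightarrow> 'p set \<Rightarrow> 'm \<Rightarrow> 'm)) rel"
  where "roof_rel X A B = {((C, s, f), (C', s', f')).
    (C, s, f) \<in> roofs X A B \<and> (C', s', f') \<in> roofs X A B \<and>
    (\<exists>K u u'. bounded_complex X K \<and> chain_map X K C u \<and> chain_map X K C' u' \<and>
       quasi_iso X K A (chain_comp X K s u) \<and>
       chain_homotopic X K A (chain_comp X K s u) (chain_comp X K s' u') \<and>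
       chain_homotopic X K B (chain_comp X K f u) (chain_comp X K f' u'))}"

definition derived_hom ::
  "('p, 'a) rspace \<Rightarrow> ('p, 'a, 'm) cplx \<Rightarrow> ('p, 'a, 'm) cplx
    \<Rightarrow> (('p, 'a, 'm) cplx \<times> (int \<Rightarrow> 'p set \<Rightarrow> 'm \<Rightarrow> 'm) \<times> (int \<Rightarrow> 'p set \<Rightarrow> 'm \<Rightarrow> 'm)) set set"
  where "derived_hom X A B = roofs X A B // roof_rel X A B"

definition derived_zero ::
  "('p, 'a) rspace \<Rightarrow> ('p, 'a, 'm) cplx \<Rightarrow> ('p, 'a, 'm) cplx
    \<Rightarrow> (('p, 'a, 'm) cplx \<times> (int \<Rightarrow> 'p set \<Rightarrow> 'm \<Rightarrow> 'm) \<times> (int \<Rightarrow> 'p set \<Rightarrow> 'm \<Rightarrow> 'm)) set"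
  where "derived_zero X A B =
    roof_rel X A B `` {(A, (\<lambda>i. hom_id X (cob A i)), (\<lambda>i. hom_zero X (cob A i) (cob B i)))}"

text \<open>\<open>shifted X E k\<close> is the object \<open>E[k]\<close>: the sheaf \<open>E\<close> placed in degree \<open>-k\<close>.\<close>

definition zero_sub :: "('p, 'a, 'm) msheaf \<Rightarrow> ('p, 'a, 'm) msheaf"
  where "zero_sub F = F\<lparr>msec := (\<lambda>U. (msec F U)\<lparr>carrier := {\<zero>\<^bsub>msec F U\<^esub>}\<rparr>)\<rparr>"

definition shifted :: "('p, 'a) rspace \<Rightarrow> ('p, 'a, 'm) msheaf \<Rightarrow> int \<Rightarrow> ('p, 'a, 'm) cplx"
  where "shifted X E k =
    (let C = (\<lambda>i. if i = - k then E else zero_sub E)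
     in \<lparr>cob = C, cdf = (\<lambda>i. hom_zero X (C i) (C (i + 1)))\<rparr>)"

definition Ext ::
  "('p, 'a) rspace \<Rightarrow> int \<Rightarrow> ('p, 'a, 'm) msheaf \<Rightarrow> ('p, 'a, 'm) msheaf
    \<Rightarrow> (('p, 'a, 'm) cplx \<times> (int \<Rightarrow> 'p set \<Rightarrow> 'm \<Rightarrow> 'm) \<times> (int \<Rightarrow> 'p set \<Rightarrow> 'm \<Rightarrow> 'm)) set set"
  where "Ext X k E F = derived_hom X (shifted X E 0) (shifted X F k)"

definition Ext_vanishes ::
  "('p, 'a) rspace \<Rightarrow> int \<Rightarrow> ('p, 'a, 'm) msheaf \<Rightarrow> ('p, 'a, 'm) msheaf \<Rightarrow> bool"
  where "Ext_vanishes X k E F \<longleftrightarrow> Ext X k E F = {derived_zero X (shifted X E 0) (shifted X F k)}"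


section \<open>Exceptional collections and spirals\<close>

text \<open>\<open>End(E) \<cong> k\<close> as \<open>k\<close>-algebras means that the structure map \<open>c \<mapsto> c \<cdot> id\<close> is bijective.\<close>

definition exceptional_object ::
  "('k::field \<Rightarrow> 'a) \<Rightarrow> ('p, 'a) rspace \<Rightarrow> ('p, 'a, 'm) msheaf \<Rightarrow> bool"
  where "exceptional_object \<kappa> X E \<longleftrightarrow> coherent X E \<and>
    bij_betw (\<lambda>c. hom_smult X E E (\<kappa> c) (hom_id X E)) UNIV (mod_hom X E E) \<and>
    (\<forall>k. k \<noteq> 0 \<longrightarrow> Ext_vanishes X k E E)"

definition exceptional_collection ::
  "('k::field \<Rightarrow> 'a) \<Rightarrow> ('p, 'a) rspace \<Rightarrow> nat \<Rightarrow> (int \<Rightarrow> ('p, 'a, 'm) msheaf) \<Rightarrow> bool"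
  where "exceptional_collection \<kappa> X n E \<longleftrightarrow>
    (\<forall>i\<in>{1..int n}. exceptional_object \<kappa> X (E i)) \<and>
    (\<forall>i\<in>{1..int n}. \<forall>j\<in>{1..int n}. i > j \<longrightarrow> (\<forall>k. Ext_vanishes X k (E i) (E j)))"

definition full_collection ::
  "('p, 'a) rspace \<Rightarrow> nat \<Rightarrow> (int \<Rightarrow> ('p, 'a, 'm) msheaf) \<Rightarrow> bool"
  where "full_collection X n E \<longleftrightarrow>
    (\<forall>F. bounded_complex X F \<and> \<not> acyclic_complex X F \<longrightarrow>
      (\<exists>i\<in>{1..int n}. \<exists>k. derived_hom X (shifted X (E i) k) F \<noteq> {derived_zero X (shifted X (E i) k) F}))"

definition strong_collection ::
  "('p, 'a) rspace \<Rightarrow> nat \<Rightarrow> (int \<Rightarrow> ('p, 'a, 'm) msheaf) \<Rightarrow> bool"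
  where "strong_collection X n E \<longleftrightarrow>
    (\<forall>i\<in>{1..int n}. \<forall>j\<in>{1..int n}. \<forall>k. k \<noteq> 0 \<longrightarrow> Ext_vanishes X k (E i) (E j))"

text \<open>The members of the spiral outside \<open>1, \<dots>, n\<close> are determined up to isomorphism.\<close>

definition spiral ::
  "('p, 'a) rspace \<Rightarrow> ('p, 'a, 'l) msheaf \<Rightarrow> nat \<Rightarrow> (int \<Rightarrow> ('p, 'a, 'm) msheaf) \<Rightarrow> bool"
  where "spiral X L n E \<longleftrightarrow>
    (\<forall>i. mod_sheaf X (E i) \<and> mod_iso X (E (i - int n)) (tensor X (E i) L))"

definition simple_spiral ::
  "('p, 'a) rspace \<Rightarrow> ('p, 'a, 'l) msheaf \<Rightarrow> nat \<Rightarrow> (int \<Rightarrow> ('p, 'a, 'm) msheaf) \<Rightarrow> bool"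
  where "simple_spiral X L n E \<longleftrightarrow> spiral X L n E \<and>
    (\<forall>i j k. i \<le> j \<and> k \<noteq> 0 \<longrightarrow> Ext_vanishes X k (E i) (E j))"


section \<open>The total space of a line bundle\<close>

text \<open>\<open>\<pi> : V \<rightarrow> X\<close> is the relative spectrum of \<open>Sym(L\<^sup>\<or>)\<close>: it is affine, and the linear map
  \<open>\<sigma> : L\<^sup>\<or> \<rightarrow> \<pi>\<^sub>*\<O>\<^sub>V\<close> identifies \<open>\<pi>\<^sub>*\<O>\<^sub>V\<close> with the symmetric algebra, i.e. over an affine open set
  \<open>U\<close> on which \<open>t\<close> generates \<open>L\<^sup>\<or>\<close> freely, \<open>\<O>\<^sub>V(\<pi>\<^sup>-\<^sup>1 U)\<close> is the polynomial ring over \<open>\<O>\<^sub>X(U)\<close> in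
  \<open>\<sigma>(t)\<close>.\<close>

definition total_space ::
  "('p, 'a) rspace \<Rightarrow> ('p, 'a, 'l) msheaf \<Rightarrow> ('v, 'b) rspace \<Rightarrow> ('v, 'b, 'p, 'a) rmor
    \<Rightarrow> ('p set \<Rightarrow> ('p set \<Rightarrow> 'l \<Rightarrow> 'a) \<Rightarrow> 'b) \<Rightarrow> bool"
  where "total_space X L V \<pi> \<sigma> \<longleftrightarrow> scheme V \<and> lrs_hom V X \<pi> \<and>
    (\<forall>U. affine_open X U \<longrightarrow> affine_open V (preim V \<pi> U)) \<and>
    \<sigma> \<in> mod_hom X (dual X L) (pushforward_osheaf V \<pi>) \<and>
    (\<forall>U t. affine_open X U \<and> free_gen X (dual X L) U t \<longrightarrow>
      (\<forall>s\<in>carrier (osec V (preim V \<pi> U)).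
        \<exists>!c :: nat \<Rightarrow> 'a. c \<in> UNIV \<rightarrow> carrier (osec X U) \<and> finite {m. c m \<noteq> \<zero>\<^bsub>osec X U\<^esub>} \<and>
          s = finsum (osec V (preim V \<pi> U))
            (\<lambda>m. mco \<pi> U (c m) \<otimes>\<^bsub>osec V (preim V \<pi> U)\<^esub> \<sigma> U t [^]\<^bsub>osec V (preim V \<pi> U)\<^esub> m)
            {m. c m \<noteq> \<zero>\<^bsub>osec X U\<^esub>}))"


section \<open>The representation space of the Bondal quiver and its affine quotient\<close>

text \<open>Here \<open>F 1, \<dots>, F n\<close> are line bundles on the \<open>k\<close>-scheme \<open>V\<close>. The variable
  \<open>(i, j, f)\<close> is the coordinate function \<open>a \<mapsto> a\<^sub>i\<^sub>j(f)\<close> on the representation space with dimension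
  vector \<open>(1, \<dots>, 1)\<close>, for \<open>f \<in> Hom\<^sub>V(F i, F j)\<close>.\<close>

type_synonym ('v, 'n) bvar = "int \<times> int \<times> ('v set \<Rightarrow> 'n \<Rightarrow> 'n)"

definition bondal_vars ::
  "('v, 'b) rspace \<Rightarrow> nat \<Rightarrow> (int \<Rightarrow> ('v, 'b, 'n) msheaf) \<Rightarrow> ('v, 'n) bvar set"
  where "bondal_vars V n F =
    {(i, j, f). i \<in> {1..int n} \<and> j \<in> {1..int n} \<and> f \<in> mod_hom V (F i) (F j)}"

inductive_set bondal_relations ::
  "('k::field \<Rightarrow> 'b) \<Rightarrow> ('v, 'b) rspace \<Rightarrow> nat \<Rightarrow> (int \<Rightarrow> ('v, 'b, 'n) msheaf)
    \<Rightarrow> (('v, 'n) bvar, 'k) mpol set"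
  for \<kappa> V n F where
  add: "(i, j, f) \<in> bondal_vars V n F \<Longrightarrow> (i, j, g) \<in> bondal_vars V n F \<Longrightarrow>
    mVar (i, j, hom_add V (F i) (F j) f g) - mVar (i, j, f) - mVar (i, j, g)
      \<in> bondal_relations \<kappa> V n F"
| smult: "(i, j, f) \<in> bondal_vars V n F \<Longrightarrow>
    mVar (i, j, hom_smult V (F i) (F j) (\<kappa> c) f) - mConst c * mVar (i, j, f)
      \<in> bondal_relations \<kappa> V n F"
| ident: "i \<in> {1..int n} \<Longrightarrow> mVar (i, i, hom_id V (F i)) - 1 \<in> bondal_relations \<kappa> V n F"
| comp: "(i, j, f) \<in> bondal_vars V n F \<Longrightarrow> (j, l, g) \<in> bondal_vars V n F \<Longrightarrow>
    mVar (i, l, hom_comp V (F i) g f) - mVar (i, j, f) * mVar (j, l, g)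
      \<in> bondal_relations \<kappa> V n F"

definition rep_ring ::
  "('k::field \<Rightarrow> 'b) \<Rightarrow> ('v, 'b) rspace \<Rightarrow> nat \<Rightarrow> (int \<Rightarrow> ('v, 'b, 'n) msheaf)
    \<Rightarrow> (('v, 'n) bvar, 'k) mpol set ring"
  where "rep_ring \<kappa> V n F = mpoly_ring (bondal_vars V n F) Quot
    genideal (mpoly_ring (bondal_vars V n F)) (bondal_relations \<kappa> V n F)"

text \<open>The torus acts by \<open>a\<^sub>i\<^sub>j \<mapsto> g\<^sub>i a\<^sub>i\<^sub>j g\<^sub>j\<^sup>-\<^sup>1\<close>; on the quotient ring it acts on representatives.
  As \<open>k\<close> is algebraically closed, the invariants of the torus are those of its \<open>k\<close>-points.\<close>

definition torus_act ::
  "('v, 'b) rspace \<Rightarrow> nat \<Rightarrow> (int \<Rightarrow> ('v, 'b, 'n) msheaf) \<Rightarrow> (int \<Rightarrow> 'k::field)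
    \<Rightarrow> (('v, 'n) bvar, 'k) mpol \<Rightarrow> (('v, 'n) bvar, 'k) mpol"
  where "torus_act V n F g = mp_eval mConst (mpoly_ring (bondal_vars V n F))
    (\<lambda>(i, j, f). mConst (g i * inverse (g j)) * mVar (i, j, f))"

definition inv_ring ::
  "('k::field \<Rightarrow> 'b) \<Rightarrow> ('v, 'b) rspace \<Rightarrow> nat \<Rightarrow> (int \<Rightarrow> ('v, 'b, 'n) msheaf)
    \<Rightarrow> (('v, 'n) bvar, 'k) mpol set ring"
  where "inv_ring \<kappa> V n F = (rep_ring \<kappa> V n F)
    \<lparr>carrier := {b \<in> carrier (rep_ring \<kappa> V n F).
       \<forall>g. (\<forall>i\<in>{1..int n}. g i \<noteq> 0) \<longrightarrow> torus_act V n F g ` b = b}\<rparr>"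

text \<open>Pullback of invariant functions along the tautological map. If \<open>e\<^sub>i\<close> generates \<open>F i\<close> over \<open>U\<close>
  for all \<open>i\<close>, then with respect to the dual bases the transpose of \<open>f : F i \<rightarrow> F j\<close> is
  multiplication by the function \<open>c\<close> with \<open>f(e\<^sub>i) = c e\<^sub>j\<close>. This gives a map from \<open>U\<close> to the
  representation space, along which an invariant function pulls back to a function that does not
  depend on the choice of the \<open>e\<^sub>i\<close>.\<close>

definition taut_coord ::
  "('v, 'b) rspace \<Rightarrow> (int \<Rightarrow> ('v, 'b, 'n) msheaf) \<Rightarrow> 'v set \<Rightarrow> (int \<Rightarrow> 'n) \<Rightarrow> ('v, 'n) bvar \<Rightarrow> 'b"
  where "taut_coord V F U e = (\<lambda>(i, j, f).
    THE c. c \<in> carrier (osec V U) \<and> f U (e i) = c \<odot>\<^bsub>msec (F j) U\<^esub> e j)"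

definition taut_pullback ::
  "('k::field \<Rightarrow> 'b) \<Rightarrow> ('v, 'b) rspace \<Rightarrow> nat \<Rightarrow> (int \<Rightarrow> ('v, 'b, 'n) msheaf)
    \<Rightarrow> (('v, 'n) bvar, 'k) mpol set \<Rightarrow> 'b"
  where "taut_pullback \<kappa> V n F b = (THE h. h \<in> carrier (osec V (pts V)) \<and>
    (\<forall>U e. opn V U \<and> (\<forall>i\<in>{1..int n}. free_gen V (F i) U (e i)) \<longrightarrow>
      (\<forall>q\<in>b. ores V (pts V) U h = mp_eval (k_const \<kappa> V U) (osec V U) (taut_coord V F U e) q)))"

definition M\<^sub>0 ::
  "('k::field \<Rightarrow> 'b) \<Rightarrow> ('v, 'b) rspace \<Rightarrow> nat \<Rightarrow> (int \<Rightarrow> ('v, 'b, 'n) msheaf)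
    \<Rightarrow> ((('v, 'n) bvar, 'k) mpol set set,
        (('v, 'n) bvar, 'k) mpol set set \<Rightarrow> ((('v, 'n) bvar, 'k) mpol set \<times> (('v, 'n) bvar, 'k) mpol set) set) rspace"
  where "M\<^sub>0 \<kappa> V n F = Spec (inv_ring \<kappa> V n F)"

definition V\<^sub>0 :: "('v, 'b) rspace \<Rightarrow> ('b set, 'b set \<Rightarrow> ('b \<times> 'b) set) rspace"
  where "V\<^sub>0 V = Spec (osec V (pts V))"

definition \<phi>\<^sub>0 ::
  "('k::field \<Rightarrow> 'b) \<Rightarrow> ('v, 'b) rspace \<Rightarrow> nat \<Rightarrow> (int \<Rightarrow> ('v, 'b, 'n) msheaf)
    \<Rightarrow> ('b set, 'b set \<Rightarrow> ('b \<times> 'b) set, (('v, 'n) bvar, 'k) mpol set set,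
        (('v, 'n) bvar, 'k) mpol set set \<Rightarrow> ((('v, 'n) bvar, 'k) mpol set \<times> (('v, 'n) bvar, 'k) mpol set) set) rmor"
  where "\<phi>\<^sub>0 \<kappa> V n F =
    Spec_map (inv_ring \<kappa> V n F) (osec V (pts V)) (taut_pullback \<kappa> V n F)"


section \<open>Irreducible components and closed subschemes of affine schemes\<close>

definition irreducible_set :: "'p topology \<Rightarrow> 'p set \<Rightarrow> bool"
  where "irreducible_set T Z \<longleftrightarrow> Z \<subseteq> topspace T \<and> Z \<noteq> {} \<and>
    (\<forall>C D. closedin T C \<and> closedin T D \<and> Z \<subseteq> C \<union> D \<longrightarrow> Z \<subseteq> C \<or> Z \<subseteq> D)"

definition irreducible_component :: "'p topology \<Rightarrow> 'p set \<Rightarrow> bool"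
  where "irreducible_component T Z \<longleftrightarrow> irreducible_set T Z \<and>
    (\<forall>Z'. irreducible_set T Z' \<and> Z \<subseteq> Z' \<longrightarrow> Z' = Z)"

text \<open>\<open>f : Y \<rightarrow> Spec R\<close> is an isomorphism onto the closed subscheme \<open>Spec (R/I)\<close>.\<close>

definition iso_onto_closed ::
  "('q, 'b) rspace \<Rightarrow> 'a ring \<Rightarrow> ('q, 'b, 'a set, 'a set \<Rightarrow> ('a \<times> 'a) set) rmor \<Rightarrow> 'a set \<Rightarrow> bool"
  where "iso_onto_closed Y R f I \<longleftrightarrow> ideal I R \<and>
    (\<exists>g. lrs_iso Y (Spec (R Quot I)) g \<and>
      mor_eq Y (Spec R) f
        (mor_comp (Spec (R Quot I)) (Spec_map R (R Quot I) (\<lambda>a. I +>\<^bsub>R\<^esub> a)) g))"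

text \<open>The reduced induced structure on a closed set \<open>Z\<close> of primes is defined by the ideal \<open>\<Inter>Z\<close>.\<close>

definition reduced_ideal :: "'a set set \<Rightarrow> 'a set"
  where "reduced_ideal Z = \<Inter>Z"

text \<open>The scheme structure that an irreducible component \<open>Z\<close> of \<open>Spec R\<close> inherits from \<open>Spec R\<close>:
  its ideal is the kernel of the localization of \<open>R\<close> at the generic point \<open>\<Inter>Z\<close> of \<open>Z\<close>. It may be
  non-reduced, and agrees with the reduced structure if \<open>Spec R\<close> is reduced.\<close>

definition component_ideal :: "'a ring \<Rightarrow> 'a set set \<Rightarrow> 'a set"
  where "component_ideal R Z = {a \<in> carrier R. \<exists>u\<in>carrier R - \<Inter>Z. u \<otimes>\<^bsub>R\<^esub> a = \<zero>\<^bsub>R\<^esub>}"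

end

theory Submission
  imports Defs "HOL-Algebra.UnivPoly" "HOL-Algebra.Free_Abelian_Groups" "HOL-Algebra.Subrings"
begin

text \<open>Let \<open>A = \<Gamma>(\<O>\<^sub>V)\<close>, let \<open>F\<^sub>i = \<pi>\<^sup>*E\<^sub>i\<close>, and let \<open>\<chi>\<^sub>i(a)\<close> be the coordinate function on the representation space
  given by \<open>a \<cdot> id \<in> End(F\<^sub>i)\<close>. It is invariant, and \<open>a \<mapsto> \<chi>\<^sub>1(a)\<close> is a section of the pullback map \<open>B\<^sup>G \<rightarrow> A\<close>,
  which is therefore surjective. As \<open>L\<^sup>-\<^sup>1\<close> is ample, there are nonzero homomorphisms \<open>F\<^sub>1 \<rightarrow> F\<^sub>i \<rightarrow> F\<^sub>1\<close>; their
  composition is multiplication by some \<open>h\<^sub>i \<noteq> 0\<close> in the domain \<open>A\<close>. Moving scalars through these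
  homomorphisms gives \<open>\<chi>\<^sub>1(h\<^sub>i) \<chi>\<^sub>i(a) = \<chi>\<^sub>1(h\<^sub>i) \<chi>\<^sub>1(a)\<close>. An invariant function is a polynomial in closed walks, that is,
  in the \<open>\<chi>\<^sub>i(a)\<close>. Hence \<open>u = \<chi>\<^sub>1(\<Prod>\<^sub>i h\<^sub>i)\<close> annihilates the kernel of \<open>B\<^sup>G \<rightarrow> A\<close>, and it does not lie in this prime
  ideal. So the kernel is a minimal prime, and it is also the kernel of the localization at itself.\<close>

abbreviation (input) ring_mult ("(_ *[_] _)" [70, 0, 71] 70) where "x *[R] y \<equiv> monoid.mult R x y"
abbreviation (input) ring_add ("(_ +[_] _)" [65, 0, 66] 65) where "x +[R] y \<equiv> ring.add R x y"
abbreviation (input) mod_smult ("(_ *.[_] _)" [70, 0, 71] 70) where "a *.[M] x \<equiv> module.smult M a x"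
abbreviation (input) ring_zero ("0[_]") where "0[R] \<equiv> ring.zero R"
abbreviation (input) ring_one ("1[_]") where "1[R] \<equiv> monoid.one R"
abbreviation (input) ring_pow ("(_ ^[_] _)" [76, 0, 75] 75) where "x ^[R] n \<equiv> x [^]\<^bsub>R\<^esub> n"
abbreviation (input) keys where "keys \<equiv> Poly_Mapping.keys"
abbreviation (input) lookup where "lookup \<equiv> Poly_Mapping.lookup"
abbreviation (input) single where "single \<equiv> Poly_Mapping.single"
abbreviation (input) Os where "Os X U \<equiv> carrier (osec X U)"
abbreviation (input) Ms where "Ms F U \<equiv> carrier (msec F U)"

section \<open>Germs and stalks\<close>

lemma UN_const:
 assumes "x \<in> A" "\<And>z. z \<in> A \<Longrightarrow> g z = C" shows "(\<Union>z\<in>A. g z) = C"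
 using assms by blast

lemma UN_const2:
 assumes "x \<in> A" "y \<in> B" "\<And>z w. z \<in> A \<Longrightarrow> w \<in> B \<Longrightarrow> g z w = C"
 shows "(\<Union>z\<in>A. \<Union>w\<in>B. g z w) = C"
 using assms by blast

lemma UN_pairs_const2:
 assumes "x \<in> A" "y \<in> B" "\<And>a s b t. \<lbrakk>(a, s) \<in> A; (b, t) \<in> B\<rbrakk> \<Longrightarrow> g a s b t = C"
 shows "(\<Union>(a, s)\<in>A. \<Union>(b, t)\<in>B. g a s b t) = C"
 unfolding case_prod_beta by (rule UN_const2[OF assms(1,2)]) (rule assms(3), simp_all)

lemma is_presheafD:
 assumes "is_presheaf T S res"
 shows "\<lbrakk>openin T U; openin T W; W \<subseteq> U; s \<in> S U\<rbrakk> \<Longrightarrow> res U W s \<in> S W"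
  and "\<lbrakk>openin T U; s \<in> S U\<rbrakk> \<Longrightarrow> res U U s = s"
  and "\<lbrakk>openin T U; openin T W; openin T Z; Z \<subseteq> W; W \<subseteq> U; s \<in> S U\<rbrakk> \<Longrightarrow> res W Z (res U W s) = res U Z s"
 using assms unfolding is_presheaf_def by (simp add: Pi_iff, blast, metis)

lemma is_sheaf_presheaf: "is_sheaf T S res \<Longrightarrow> is_presheaf T S res"
 by (simp add: is_sheaf_def)

lemma germ_eqI:
 assumes pre: "is_presheaf T S res"
  and U: "openin T U" "s \<in> S U" and W: "openin T W" "t \<in> S W"
  and Z: "openin T Z" "p \<in> Z" "Z \<subseteq> U" "Z \<subseteq> W" and eq: "res U Z s = res W Z t"
 shows "germ T S res p U s = germ T S res p W t"
proof -
 have germ_subset: "germ T S res p U s \<subseteq> germ T S res p W t"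
  if U: "openin T U" "s \<in> S U" "Z \<subseteq> U" and W: "openin T W" "t \<in> S W"
    "Z \<subseteq> W" and eq: "res U Z s = res W Z t"
  for U W s t
 proof (clarsimp simp: germ_def)
  fix U' s' Y assume Y: "openin T U'" "s' \<in> S U'" "openin T Y" "p \<in> Y" "Y \<subseteq> U" "Y \<subseteq> U'"
    "res U Y s = res U' Y s'"
  have YZ: "openin T (Y \<inter> Z)" using Y(3) Z(1) by blast
  have "res W (Y \<inter> Z) t = res Z (Y \<inter> Z) (res W Z t)"
   using is_presheafD(3)[OF pre W(1) Z(1) YZ _ W(3,2)] by simp
  also have "... = res U (Y \<inter> Z) s"
   using is_presheafD(3)[OF pre U(1) Z(1) YZ _ U(3,2)] eq by simp
  also have "... = res Y (Y \<inter> Z) (res U Y s)"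
   using is_presheafD(3)[OF pre U(1) Y(3) YZ _ Y(5) U(2)] by simp
  also have "... = res U' (Y \<inter> Z) s'"
   using is_presheafD(3)[OF pre Y(1,3) YZ _ Y(6,2)] Y(7) by simp
  finally show "\<exists>Y. openin T Y \<and> p \<in> Y \<and> Y \<subseteq> W \<and> Y \<subseteq> U' \<and> res W Y t = res U' Y s'"
   using YZ Y(4,6) Z(2) W(3) by (intro exI[of _ "Y \<inter> Z"]) auto
 qed
 show ?thesis
  using germ_subset[OF U Z(3) W Z(4) eq] germ_subset[OF W Z(4) U Z(3) eq[symmetric]] by blast
qed

lemma germ_self:
 assumes "is_presheaf T S res" "openin T U" "p \<in> U" "s \<in> S U"
 shows "(U, s) \<in> germ T S res p U s"
 unfolding germ_def using assms(2-4) by auto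

lemma germ_memE:
 assumes "(W, t) \<in> germ T S res p U s"
 obtains Z where "openin T W" "p \<in> W" "t \<in> S W" "openin T Z" "p \<in> Z" "Z \<subseteq> U" "Z \<subseteq> W"
   "res U Z s = res W Z t"
 using assms unfolding germ_def by auto

lemma germ_eqE:
 assumes "is_presheaf T S res" "germ T S res p U s = germ T S res p W t"
  "openin T W" "p \<in> W" "t \<in> S W"
 obtains Z where "openin T Z" "p \<in> Z" "Z \<subseteq> U" "Z \<subseteq> W" "res U Z s = res W Z t"
 using germ_self[OF assms(1,3-5)] unfolding assms(2)[symmetric] by (rule germ_memE)

lemma germ_res:
 assumes "is_presheaf T S res" "openin T U" "openin T W" "W \<subseteq> U" "p \<in> W" "s \<in> S U"
 shows "germ T S res p W (res U W s) = germ T S res p U s"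
 by (rule germ_eqI[OF assms(1,3) _ assms(2,6,3,5)])
  (use assms is_presheafD(1,2)[OF assms(1)] in simp_all)

lemma germ_binop:
 assumes pre1: "is_presheaf T S1 res1" and pre2: "is_presheaf T S2 res2" and pre: "is_presheaf T S res"
  and closed: "\<And>W s t. \<lbrakk>openin T W; s \<in> S1 W; t \<in> S2 W\<rbrakk> \<Longrightarrow> f W s t \<in> S W"
  and res: "\<And>W Z s t. \<lbrakk>openin T W; openin T Z; Z \<subseteq> W; s \<in> S1 W; t \<in> S2 W\<rbrakk> \<Longrightarrow>
   res W Z (f W s t) = f Z (res1 W Z s) (res2 W Z t)"
  and U: "openin T U" "p \<in> U" and s: "s \<in> S1 U" and t: "t \<in> S2 U"
 shows "(\<Union>(U', s')\<in>germ T S1 res1 p U s. \<Union>(W', t')\<in>germ T S2 res2 p U t.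
   germ T S res p (U' \<inter> W') (f (U' \<inter> W') (res1 U' (U' \<inter> W') s') (res2 W' (U' \<inter> W') t')))
  = germ T S res p U (f U s t)"
proof (rule UN_pairs_const2[OF germ_self[OF pre1 U s] germ_self[OF pre2 U t]])
 fix U' s' W' t' assume "(U', s') \<in> germ T S1 res1 p U s" "(W', t') \<in> germ T S2 res2 p U t"
 then obtain Y Z where U': "openin T U'" "s' \<in> S1 U'" and Y: "openin T Y" "p \<in> Y" "Y \<subseteq> U" "Y \<subseteq> U'"
   "res1 U Y s = res1 U' Y s'"
  and W': "openin T W'" "t' \<in> S2 W'" and Z: "openin T Z" "p \<in> Z" "Z \<subseteq> U" "Z \<subseteq> W'"
    "res2 U Z t = res2 W' Z t'"
  by (elim germ_memE)
 let ?I = "U' \<inter> W'" and ?Z = "Y \<inter> Z"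
 have o: "openin T ?I" "openin T ?Z" and sub: "?Z \<subseteq> ?I" "?Z \<subseteq> U" "p \<in> ?Z" using U' W' Y Z by auto
 note res_res = is_presheafD(3)[OF pre1] is_presheafD(3)[OF pre2]
 have "res1 U ?Z s = res1 U' ?Z s'" "res2 U ?Z t = res2 W' ?Z t'"
  using res_res(1)[OF U(1) Y(1) o(2) _ Y(3) s] res_res(1)[OF U'(1) Y(1) o(2) _ Y(4) U'(2)] Y(5)
   res_res(2)[OF U(1) Z(1) o(2) _ Z(3) t] res_res(2)[OF W'(1) Z(1) o(2) _ Z(4) W'(2)] Z(5) by simp_all
 moreover have c: "res1 U' ?I s' \<in> S1 ?I" "res2 W' ?I t' \<in> S2 ?I"
  using is_presheafD(1)[OF pre1 U'(1) o(1) _ U'(2)] is_presheafD(1)[OF pre2 W'(1) o(1) _ W'(2)] by auto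
 ultimately have "res ?I ?Z (f ?I (res1 U' ?I s') (res2 W' ?I t')) = res U ?Z (f U s t)"
  using res_res(1)[OF U'(1) o sub(1) _ U'(2)] res_res(2)[OF W'(1) o sub(1) _ W'(2)]
  by (simp add: res[OF o sub(1) c] res[OF U(1) o(2) sub(2) s t])
 thus "germ T S res p ?I (f ?I (res1 U' ?I s') (res2 W' ?I t')) = germ T S res p U (f U s t)"
  by (intro germ_eqI[OF pre o(1) closed[OF o(1) c] U(1) closed[OF U(1) s t] o(2) sub(3,1,2)])
qed

text \<open>The structure shared by all presheaves of rings and of modules considered below; it is weaker
  than \<^const>\<open>ring_sheaf\<close> because for spectra only these properties are needed.\<close>

definition pre_ring :: "('p, 'a) rspace \<Rightarrow> bool"
 where "pre_ring X \<longleftrightarrow> is_presheaf (tp X) (\<lambda>U. Os X U) (ores X) \<and>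
  (\<forall>U. opn X U \<longrightarrow> 1[osec X U] \<in> Os X U \<and> 0[osec X U] \<in> Os X U \<and>
   (\<forall>a\<in>Os X U. \<forall>b\<in>Os X U.
    a *[osec X U] b \<in> Os X U \<and> a +[osec X U] b \<in> Os X U)) \<and>
  (\<forall>U W. opn X U \<and> opn X W \<and> W \<subseteq> U \<longrightarrow> ores X U W \<in> ring_hom (osec X U) (osec X W) \<and>
   ores X U W 0[osec X U] = 0[osec X W])"

definition pre_mod :: "('p, 'a) rspace \<Rightarrow> ('p, 'a, 'm) msheaf \<Rightarrow> bool"
 where "pre_mod X F \<longleftrightarrow> is_presheaf (tp X) (\<lambda>U. Ms F U) (mres F) \<and>
  (\<forall>U. opn X U \<longrightarrow> 0[msec F U] \<in> Ms F U \<and>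
   (\<forall>s\<in>Ms F U. \<forall>t\<in>Ms F U. s +[msec F U] t \<in> Ms F U) \<and>
   (\<forall>a\<in>Os X U. \<forall>s\<in>Ms F U. a *.[msec F U] s \<in> Ms F U)) \<and>
  (\<forall>U W. opn X U \<and> opn X W \<and> W \<subseteq> U \<longrightarrow> mres F U W 0[msec F U] = 0[msec F W] \<and>
   (\<forall>s\<in>Ms F U. \<forall>t\<in>Ms F U.
    mres F U W (s +[msec F U] t) = mres F U W s +[msec F W] mres F U W t) \<and>
   (\<forall>a\<in>Os X U. \<forall>s\<in>Ms F U.
    mres F U W (a *.[msec F U] s) = ores X U W a *.[msec F W] mres F U W s))"

locale ringed_presheaf =
 fixes X :: "('p, 'a) rspace"
 assumes pre_ring: "pre_ring X"
begin

lemma opn_pts [simp]: "opn X (pts X)" by (rule openin_topspace)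

lemma presheaf_O: "is_presheaf (tp X) (\<lambda>U. Os X U) (ores X)"
 using pre_ring by (simp add: pre_ring_def)

lemmas ores_closed = is_presheafD(1)[OF presheaf_O]
 and ores_id = is_presheafD(2)[OF presheaf_O]
 and ores_ores = is_presheafD(3)[OF presheaf_O]

lemma osec_closed:
 assumes "opn X U"
 shows O_one_closed: "1[osec X U] \<in> Os X U" and O_zero_closed: "0[osec X U] \<in> Os X U"
  and O_mult_closed: "\<lbrakk>a \<in> Os X U; b \<in> Os X U\<rbrakk> \<Longrightarrow> a *[osec X U] b \<in> Os X U"
  and O_add_closed: "\<lbrakk>a \<in> Os X U; b \<in> Os X U\<rbrakk> \<Longrightarrow> a +[osec X U] b \<in> Os X U"
 using assms pre_ring unfolding pre_ring_def by simp_all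

lemma ores_ring_hom: "\<lbrakk>opn X U; opn X W; W \<subseteq> U\<rbrakk> \<Longrightarrow> ores X U W \<in> ring_hom (osec X U) (osec X W)"
 and ores_zero: "\<lbrakk>opn X U; opn X W; W \<subseteq> U\<rbrakk> \<Longrightarrow> ores X U W 0[osec X U] = 0[osec X W]"
 using pre_ring unfolding pre_ring_def by simp_all

lemmas ores_add = ring_hom_add[OF ores_ring_hom] and ores_mult = ring_hom_mult[OF ores_ring_hom]
 and ores_one = ring_hom_one[OF ores_ring_hom]

lemmas ogerm_res = germ_res[OF presheaf_O, folded ogerm_def]

lemma ogerm_closed: "\<lbrakk>opn X U; p \<in> U; s \<in> Os X U\<rbrakk> \<Longrightarrow> ogerm X p U s \<in> carrier (ostalk X p)"
 unfolding ostalk_def by auto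

lemma ostalkE:
 assumes "A \<in> carrier (ostalk X p)"
 obtains U s where "opn X U" "p \<in> U" "s \<in> Os X U" "A = ogerm X p U s"
 using assms unfolding ostalk_def by auto

lemma ostalk_ops:
 assumes U: "opn X U" "p \<in> U"
 shows ostalk_add: "\<lbrakk>s \<in> Os X U; t \<in> Os X U\<rbrakk> \<Longrightarrow> ogerm X p U s +[ostalk X p] ogerm X p U t =
   ogerm X p U (s +[osec X U] t)"
  and ostalk_mult: "\<lbrakk>s \<in> Os X U; t \<in> Os X U\<rbrakk> \<Longrightarrow> ogerm X p U s *[ostalk X p] ogerm X p U t =
    ogerm X p U (s *[osec X U] t)"
  and ostalk_one: "1[ostalk X p] = ogerm X p U 1[osec X U]"
  and ostalk_zero: "0[ostalk X p] = ogerm X p U 0[osec X U]"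
proof -
 note binop = germ_binop[OF presheaf_O presheaf_O presheaf_O _ _ U, folded ogerm_def]
 show "ogerm X p U s +[ostalk X p] ogerm X p U t = ogerm X p U (s +[osec X U] t)"
   if "s \<in> Os X U" "t \<in> Os X U"
  using binop[of "\<lambda>U. ring.add (osec X U)" s t] that O_add_closed ores_add by (simp add: ostalk_def)
 show "ogerm X p U s *[ostalk X p] ogerm X p U t = ogerm X p U (s *[osec X U] t)"
   if "s \<in> Os X U" "t \<in> Os X U"
  using binop[of "\<lambda>U. monoid.mult (osec X U)" s t] that O_mult_closed ores_mult
  by (simp add: ostalk_def)
 note germ_pts = ogerm_res[OF opn_pts U(1) openin_subset[OF U(1)] U(2)]
 show "1[ostalk X p] = ogerm X p U 1[osec X U]" "0[ostalk X p] = ogerm X p U 0[osec X U]"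
  using germ_pts[OF O_one_closed] germ_pts[OF O_zero_closed] ores_one ores_zero U(1)
    openin_subset[OF U(1)]
  by (simp_all add: ostalk_def)
qed

lemma ostalk_common_nhd:
 assumes "A \<in> carrier (ostalk X p)" "B \<in> carrier (ostalk X p)"
 obtains U s t where "opn X U" "p \<in> U" "s \<in> Os X U" "t \<in> Os X U" "A = ogerm X p U s" "B = ogerm X p U t"
proof -
 obtain U s where U: "opn X U" "p \<in> U" "s \<in> Os X U" "A = ogerm X p U s" by (rule ostalkE[OF assms(1)])
 obtain W t where W: "opn X W" "p \<in> W" "t \<in> Os X W" "B = ogerm X p W t" by (rule ostalkE[OF assms(2)])
 show thesis
  by (rule that[of "U \<inter> W" "ores X U (U \<inter> W) s" "ores X W (U \<inter> W) t"])
   (use U W in \<open>simp_all add: ores_closed ogerm_res openin_Int\<close>)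
qed

end

locale module_presheaf = ringed_presheaf X for X :: "('p, 'a) rspace" +
 fixes F :: "('p, 'a, 'm) msheaf"
 assumes pre_mod: "pre_mod X F"
begin

lemma presheaf: "is_presheaf (tp X) (\<lambda>U. Ms F U) (mres F)"
 using pre_mod by (simp add: pre_mod_def)

lemmas res_closed = is_presheafD(1)[OF presheaf]
 and res_id = is_presheafD(2)[OF presheaf]
 and res_res = is_presheafD(3)[OF presheaf]

lemma closed:
 assumes "opn X U"
 shows zero_closed: "0[msec F U] \<in> Ms F U"
  and add_closed: "\<lbrakk>s \<in> Ms F U; t \<in> Ms F U\<rbrakk> \<Longrightarrow> s +[msec F U] t \<in> Ms F U"
  and smult_closed: "\<lbrakk>a \<in> Os X U; s \<in> Ms F U\<rbrakk> \<Longrightarrow> a *.[msec F U] s \<in> Ms F U"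
 using assms pre_mod unfolding pre_mod_def by auto

lemma res_hom:
 assumes "opn X U" "opn X W" "W \<subseteq> U"
 shows res_zero: "mres F U W 0[msec F U] = 0[msec F W]"
  and res_add: "\<lbrakk>s \<in> Ms F U; t \<in> Ms F U\<rbrakk> \<Longrightarrow>
    mres F U W (s +[msec F U] t) = mres F U W s +[msec F W] mres F U W t"
  and res_smult: "\<lbrakk>a \<in> Os X U; s \<in> Ms F U\<rbrakk> \<Longrightarrow>
    mres F U W (a *.[msec F U] s) = ores X U W a *.[msec F W] mres F U W s"
 using assms pre_mod unfolding pre_mod_def by auto

lemmas mgerm_eqI = germ_eqI[OF presheaf, folded mgerm_def]
 and mgerm_eqE = germ_eqE[OF presheaf, folded mgerm_def]
 and mgerm_res = germ_res[OF presheaf, folded mgerm_def]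

lemma mgerm_closed: "\<lbrakk>opn X U; p \<in> U; s \<in> Ms F U\<rbrakk> \<Longrightarrow> mgerm X F p U s \<in> carrier (mstalk X F p)"
 unfolding mstalk_def by auto

lemma mstalkE:
 assumes "A \<in> carrier (mstalk X F p)"
 obtains U s where "opn X U" "p \<in> U" "s \<in> Ms F U" "A = mgerm X F p U s"
 using assms unfolding mstalk_def by auto

lemma mstalk_ops:
 assumes U: "opn X U" "p \<in> U"
 shows mstalk_add: "\<lbrakk>s \<in> Ms F U; t \<in> Ms F U\<rbrakk> \<Longrightarrow> mgerm X F p U s +[mstalk X F p] mgerm X F p U t =
   mgerm X F p U (s +[msec F U] t)"
  and mstalk_smult: "\<lbrakk>a \<in> Os X U; t \<in> Ms F U\<rbrakk> \<Longrightarrow> ogerm X p U a *.[mstalk X F p] mgerm X F p U t =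
    mgerm X F p U (a *.[msec F U] t)"
  and mstalk_zero: "0[mstalk X F p] = mgerm X F p U 0[msec F U]"
proof -
 show "mgerm X F p U s +[mstalk X F p] mgerm X F p U t = mgerm X F p U (s +[msec F U] t)"
   if "s \<in> Ms F U" "t \<in> Ms F U"
  using germ_binop[OF presheaf presheaf presheaf _ _ U that, folded mgerm_def,
    of "\<lambda>U. ring.add (msec F U)"] add_closed res_add
  by (simp add: mstalk_def)
 show "ogerm X p U a *.[mstalk X F p] mgerm X F p U t = mgerm X F p U (a *.[msec F U] t)"
   if "a \<in> Os X U" "t \<in> Ms F U"
  using germ_binop[OF presheaf_O presheaf presheaf _ _ U that, folded mgerm_def ogerm_def,
    of "\<lambda>U. module.smult (msec F U)"] smult_closed res_smult
  by (simp add: mstalk_def)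
 show "0[mstalk X F p] = mgerm X F p U 0[msec F U]"
  using mgerm_res[OF opn_pts U(1) openin_subset[OF U(1)] U(2) zero_closed] res_zero[OF opn_pts U(1)
    openin_subset[OF U(1)]]
  by (simp add: mstalk_def)
qed

lemma stalks_common_nhd:
 assumes "A \<in> carrier (ostalk X p)" "B \<in> carrier (ostalk X p)"
  "C \<in> carrier (mstalk X F p)" "D \<in> carrier (mstalk X F p)" "E \<in> carrier (mstalk X F p)"
 obtains U a b s t r where "opn X U" "p \<in> U" "a \<in> Os X U" "b \<in> Os X U" "s \<in> Ms F U" "t \<in> Ms F U"
   "r \<in> Ms F U"
  "A = ogerm X p U a" "B = ogerm X p U b" "C = mgerm X F p U s" "D = mgerm X F p U t"
    "E = mgerm X F p U r"
proof -
 obtain U0 a b where AB: "opn X U0" "p \<in> U0" "a \<in> Os X U0" "b \<in> Os X U0" "A = ogerm X p U0 a"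
   "B = ogerm X p U0 b"
  by (rule ostalk_common_nhd[OF assms(1,2)])
 obtain U1 s where C: "opn X U1" "p \<in> U1" "s \<in> Ms F U1" "C = mgerm X F p U1 s"
  by (rule mstalkE[OF assms(3)])
 obtain U2 t where D: "opn X U2" "p \<in> U2" "t \<in> Ms F U2" "D = mgerm X F p U2 t"
  by (rule mstalkE[OF assms(4)])
 obtain U3 r where E: "opn X U3" "p \<in> U3" "r \<in> Ms F U3" "E = mgerm X F p U3 r"
  by (rule mstalkE[OF assms(5)])
 let ?U = "U0 \<inter> (U1 \<inter> (U2 \<inter> U3))"
 have "opn X ?U" "p \<in> ?U" "?U \<subseteq> U0" "?U \<subseteq> U1" "?U \<subseteq> U2" "?U \<subseteq> U3" using AB C D E by auto
 with AB C D E show thesis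
  by (intro that[of ?U "ores X U0 ?U a" "ores X U0 ?U b" "mres F U1 ?U s" "mres F U2 ?U t"
    "mres F U3 ?U r"])
   (simp_all only: ores_closed res_closed ogerm_res mgerm_res)
qed

end

lemma mstalk_osheaf: "mstalk X (osheaf X) p = reg_module (ostalk X p)"
 and mgerm_osheaf: "mgerm X (osheaf X) = ogerm X"
 by (simp_all add: mstalk_def ostalk_def osheaf_def reg_module_def mgerm_def ogerm_def)

lemma osheaf_sel [simp]:
 "mres (osheaf X) = ores X" "Ms (osheaf X) U = Os X U"
 "add (msec (osheaf X) U) = add (osec X U)" "ring.zero (msec (osheaf X) U) = ring.zero (osec X U)"
 "module.smult (msec (osheaf X) U) = monoid.mult (osec X U)"
 by (simp_all add: osheaf_def reg_module_def)

lemma reg_module_sel [simp]: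
 "carrier (reg_module R) = carrier R" "add (reg_module R) = add R"
   "ring.zero (reg_module R) = ring.zero R"
 "module.smult (reg_module R) = monoid.mult R"
 by (simp_all add: reg_module_def)

lemma is_sheafD:
 assumes "is_sheaf T S res" "\<And>U. U \<in> \<C> \<Longrightarrow> openin T U" "\<And>U. U \<in> \<C> \<Longrightarrow> s U \<in> S U"
  "\<And>U W. U \<in> \<C> \<Longrightarrow> W \<in> \<C> \<Longrightarrow> res U (U \<inter> W) (s U) = res W (U \<inter> W) (s W)"
 shows "\<exists>!t. t \<in> S (\<Union>\<C>) \<and> (\<forall>U\<in>\<C>. res (\<Union>\<C>) U t = s U)"
 by (rule assms(1)[unfolded is_sheaf_def, THEN conjunct2, rule_format]) (use assms(2-4)
   in \<open>intro conjI ballI\<close>)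

lemma sheaf_glue:
 assumes sh: "is_sheaf T S res"
  and W: "\<And>i. i \<in> I \<Longrightarrow> openin T (W i)" "\<And>i. i \<in> I \<Longrightarrow> s i \<in> S (W i)"
  and eq: "\<And>i j. i \<in> I \<Longrightarrow> j \<in> I \<Longrightarrow> res (W i) (W i \<inter> W j) (s i) = res (W j) (W i \<inter> W j) (s j)"
 obtains t where "t \<in> S (\<Union>i\<in>I. W i)" "\<And>i. i \<in> I \<Longrightarrow> res (\<Union>i\<in>I. W i) (W i) t = s i"
proof -
 define idx where "idx A = (SOME i. i \<in> I \<and> W i = A)" for A
 have idx: "idx (W i) \<in> I" "W (idx (W i)) = W i" if "i \<in> I" for i
  using someI[of "\<lambda>j. j \<in> I \<and> W j = W i" i] that by (auto simp: idx_def)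
 have s_idx: "s (idx (W i)) = s i" if i: "i \<in> I" for i
  using eq[OF idx(1)[OF i] i] is_presheafD(2)[OF is_sheaf_presheaf[OF sh]] W idx[OF i] i
  by (metis Int_absorb)
 have "\<exists>!t. t \<in> S (\<Union>(W ` I)) \<and> (\<forall>A\<in>W ` I. res (\<Union>(W ` I)) A t = s (idx A))"
 proof (rule is_sheafD[OF sh])
  show "openin T A" "s (idx A) \<in> S A" if "A \<in> W ` I" for A using that W s_idx by auto
  fix A B assume "A \<in> W ` I" "B \<in> W ` I"
  then obtain i j where ij: "i \<in> I" "j \<in> I" "A = W i" "B = W j" by auto
  show "res A (A \<inter> B) (s (idx A)) = res B (A \<inter> B) (s (idx B))" using eq[OF ij(1,2)] s_idx ij by simp
 qed
 then obtain t where t: "t \<in> S (\<Union>(W ` I))" "\<forall>A\<in>W ` I. res (\<Union>(W ` I)) A t = s (idx A)"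
  by (elim ex1E conjE)
 show thesis by (rule that[OF t(1)]) (use t(2) s_idx in auto)
qed

lemma sheaf_eqI:
 assumes sh: "is_sheaf T S res" and U: "openin T U" "s \<in> S U" "t \<in> S U"
  and loc: "\<And>p. p \<in> U \<Longrightarrow> \<exists>W. openin T W \<and> p \<in> W \<and> W \<subseteq> U \<and> res U W s = res U W t"
 shows "s = t"
proof -
 let ?C = "{W. openin T W \<and> W \<subseteq> U \<and> res U W s = res U W t}"
 have un: "\<Union>?C = U" using loc by blast
 note pre = is_presheafD[OF is_sheaf_presheaf[OF sh]]
 have "\<exists>!r. r \<in> S (\<Union>?C) \<and> (\<forall>W\<in>?C. res (\<Union>?C) W r = res U W s)"
  by (rule is_sheafD[OF sh]) (use pre(1,3) U in \<open>auto simp: openin_Int\<close>)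
 thus ?thesis unfolding un using U by (elim ex1E) auto
qed

lemma is_sheafI:
 assumes "is_presheaf T S res"
  and "\<And>\<C> s. (\<And>U. U \<in> \<C> \<Longrightarrow> openin T U \<and> s U \<in> S U) \<Longrightarrow>
   (\<And>U W. U \<in> \<C> \<Longrightarrow> W \<in> \<C> \<Longrightarrow> res U (U \<inter> W) (s U) = res W (U \<inter> W) (s W)) \<Longrightarrow>
   \<exists>!t. t \<in> S (\<Union>\<C>) \<and> (\<forall>U\<in>\<C>. res (\<Union>\<C>) U t = s U)"
 shows "is_sheaf T S res"
 unfolding is_sheaf_def by (intro conjI allI impI assms(1), rule assms(2)) blast+

subsection \<open>Sheaves of rings and of modules\<close>

locale ringed_space =
 fixes X :: "('p, 'a) rspace"
 assumes ring_sheaf: "ring_sheaf X"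
begin

lemma sheaf_O: "is_sheaf (tp X) (\<lambda>U. Os X U) (ores X)"
 and cring_O: "opn X U \<Longrightarrow> cring (osec X U)"
 using ring_sheaf by (simp_all add: ring_sheaf_def)

sublocale ringed_presheaf X
proof
 have "ores X U W \<in> ring_hom (osec X U) (osec X W)" if "opn X U" "opn X W" "W \<subseteq> U" for U W
  using ring_sheaf that by (simp add: ring_sheaf_def)
 thus "pre_ring X" unfolding pre_ring_def using sheaf_O cring_O
  by (auto simp: is_sheaf_def cring.cring_simprules intro!: ring_hom_zero dest!: cring.axioms(1))
qed

lemma ores_pow:
 assumes "opn X U" "opn X W" "W \<subseteq> U" "a \<in> Os X U"
 shows "ores X U W (a ^[osec X U] (m::nat)) = ores X U W a ^[osec X W] m"
proof -
 interpret ring_hom_cring "osec X U" "osec X W" "ores X U W"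
  by (intro ring_hom_cring.intro ring_hom_cring_axioms.intro cring_O ores_ring_hom assms)
 show ?thesis using assms by simp
qed

lemma osec_empty: "a \<in> Os X {} \<Longrightarrow> b \<in> Os X {} \<Longrightarrow> a = b"
 by (rule sheaf_eqI[OF sheaf_O, of "{}"]) auto

lemma osec_eqI_ogerm:
 assumes "opn X U" "a \<in> Os X U" "b \<in> Os X U" "\<And>p. p \<in> U \<Longrightarrow> ogerm X p U a = ogerm X p U b"
 shows "a = b"
proof (rule sheaf_eqI[OF sheaf_O assms(1-3)])
 fix p assume p: "p \<in> U"
 show "\<exists>W. opn X W \<and> p \<in> W \<and> W \<subseteq> U \<and> ores X U W a = ores X U W b"
  by (rule germ_eqE[OF presheaf_O assms(4)[OF p, unfolded ogerm_def] assms(1) p assms(3)]) blast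
qed

end

locale module_sheaf = ringed_space X for X :: "('p, 'a) rspace" +
 fixes F :: "('p, 'a, 'm) msheaf"
 assumes mod_sheaf: "mod_sheaf X F"
begin

lemma sheaf: "is_sheaf (tp X) (\<lambda>U. Ms F U) (mres F)"
 and module_sec: "opn X U \<Longrightarrow> module (osec X U) (msec F U)"
 using mod_sheaf by (simp_all add: mod_sheaf_def)

sublocale module_presheaf X F
proof
 note pre = is_sheaf_presheaf[OF sheaf]
 have res_add: "mres F U W (s +[msec F U] t) = mres F U W s +[msec F W] mres F U W t"
  if "opn X U" "opn X W" "W \<subseteq> U" "s \<in> Ms F U" "t \<in> Ms F U" for U W s t
  using mod_sheaf that by (simp add: mod_sheaf_def)
 have res_smult: "mres F U W (a *.[msec F U] s) = ores X U W a *.[msec F W] mres F U W s"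
  if "opn X U" "opn X W" "W \<subseteq> U" "a \<in> Os X U" "s \<in> Ms F U" for U W a s
  using mod_sheaf that by (simp add: mod_sheaf_def)
 have res_zero: "mres F U W 0[msec F U] = 0[msec F W]" if UW: "opn X U" "opn X W" "W \<subseteq> U" for U W
 proof -
  interpret U: module "osec X U" "msec F U" by (rule module_sec[OF UW(1)])
  interpret W: module "osec X W" "msec F W" by (rule module_sec[OF UW(2)])
  have "mres F U W 0[msec F U] \<in> Ms F W" using is_presheafD(1)[OF pre UW] by auto
  moreover have "mres F U W 0[msec F U] = mres F U W 0[msec F U] +[msec F W] mres F U W 0[msec F U]"
   using res_add[OF UW U.zero_closed U.zero_closed] by simp
  ultimately show ?thesis by simp
 qed
 have closed: "0[msec F U] \<in> Ms F U" "\<lbrakk>s \<in> Ms F U; t \<in> Ms F U\<rbrakk> \<Longrightarrow> s +[msec F U] t \<in> Ms F U"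
  "\<lbrakk>a \<in> Os X U; s \<in> Ms F U\<rbrakk> \<Longrightarrow> a *.[msec F U] s \<in> Ms F U" if "opn X U" for U a s t
 proof -
  interpret module "osec X U" "msec F U" by (rule module_sec[OF that])
  show "0[msec F U] \<in> Ms F U" "\<lbrakk>s \<in> Ms F U; t \<in> Ms F U\<rbrakk> \<Longrightarrow> s +[msec F U] t \<in> Ms F U"
   "\<lbrakk>a \<in> Os X U; s \<in> Ms F U\<rbrakk> \<Longrightarrow> a *.[msec F U] s \<in> Ms F U" by auto
 qed
 show "pre_mod X F" unfolding pre_mod_def
  by (intro conjI allI impI ballI) (simp_all add: pre closed res_zero res_add res_smult)
qed

lemma mstalk_abelian_group:
 assumes p: "p \<in> pts X" and R: "cring (ostalk X p)"
 shows "abelian_group (mstalk X F p)"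
proof -
 interpret O: cring "ostalk X p" by (rule R)
 have group_laws: "A +[mstalk X F p] B \<in> carrier (mstalk X F p)"
   "A +[mstalk X F p] B = B +[mstalk X F p] A"
  "A +[mstalk X F p] B +[mstalk X F p] C = A +[mstalk X F p] (B +[mstalk X F p] C)"
  "0[mstalk X F p] +[mstalk X F p] A = A"
    "\<exists>D\<in>carrier (mstalk X F p). D +[mstalk X F p] A = 0[mstalk X F p]"
  if ABC: "A \<in> carrier (mstalk X F p)" "B \<in> carrier (mstalk X F p)" "C \<in> carrier (mstalk X F p)"
    for A B C
 proof -
  obtain U s t r where U: "opn X U" "p \<in> U" and str: "s \<in> Ms F U" "t \<in> Ms F U" "r \<in> Ms F U"
   and germs: "A = mgerm X F p U s" "B = mgerm X F p U t" "C = mgerm X F p U r"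
   by (rule stalks_common_nhd[OF O.one_closed O.one_closed ABC])
  interpret module "osec X U" "msec F U" by (rule module_sec[OF U(1)])
  note closed = mgerm_closed[OF U] and ops = mstalk_add[OF U] mstalk_zero[OF U]
  show "A +[mstalk X F p] B \<in> carrier (mstalk X F p)" "A +[mstalk X F p] B = B +[mstalk X F p] A"
   "A +[mstalk X F p] B +[mstalk X F p] C = A +[mstalk X F p] (B +[mstalk X F p] C)"
   "0[mstalk X F p] +[mstalk X F p] A = A"
   using str closed by (simp_all add: germs ops M.a_ac)
  show "\<exists>D\<in>carrier (mstalk X F p). D +[mstalk X F p] A = 0[mstalk X F p]"
   using str closed by (intro bexI[of _ "mgerm X F p U (\<ominus>\<^bsub>msec F U\<^esub> s)"]) (simp_all add: germs
     ops M.l_neg)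
 qed
 have zero_in: "0[mstalk X F p] \<in> carrier (mstalk X F p)"
  using mgerm_closed[OF opn_pts p zero_closed] mstalk_zero[OF opn_pts p] by simp
 show ?thesis by (rule abelian_groupI; (rule zero_in | rule group_laws; assumption))
qed

lemma mstalk_module:
 assumes p: "p \<in> pts X" and R: "cring (ostalk X p)"
 shows "module (ostalk X p) (mstalk X F p)"
proof -
 interpret O: cring "ostalk X p" by (rule R)
 have module_laws: "A *.[mstalk X F p] C \<in> carrier (mstalk X F p)"
  "(A +[ostalk X p] B) *.[mstalk X F p] C = A *.[mstalk X F p] C +[mstalk X F p] B *.[mstalk X F p] C"
  "A *.[mstalk X F p] (C +[mstalk X F p] D) = A *.[mstalk X F p] C +[mstalk X F p] A *.[mstalk X F p] D"
  "A *[ostalk X p] B *.[mstalk X F p] C = A *.[mstalk X F p] (B *.[mstalk X F p] C)"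
    "1[ostalk X p] *.[mstalk X F p] C = C"
  if ABCD: "A \<in> carrier (ostalk X p)" "B \<in> carrier (ostalk X p)" "C \<in> carrier (mstalk X F p)"
    "D \<in> carrier (mstalk X F p)" for A B C D
 proof -
  obtain U a b s t where U: "opn X U" "p \<in> U" and str: "a \<in> Os X U" "b \<in> Os X U" "s \<in> Ms F U"
    "t \<in> Ms F U"
   and germs: "A = ogerm X p U a" "B = ogerm X p U b" "C = mgerm X F p U s" "D = mgerm X F p U t"
   by (rule stalks_common_nhd[OF ABCD ABCD(4)])
  interpret module "osec X U" "msec F U" by (rule module_sec[OF U(1)])
  show "A *.[mstalk X F p] C \<in> carrier (mstalk X F p)"
   "(A +[ostalk X p] B) *.[mstalk X F p] C = A *.[mstalk X F p] C +[mstalk X F p] B *.[mstalk X F p] C"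
   "A *.[mstalk X F p] (C +[mstalk X F p] D) =
     A *.[mstalk X F p] C +[mstalk X F p] A *.[mstalk X F p] D"
   "A *[ostalk X p] B *.[mstalk X F p] C = A *.[mstalk X F p] (B *.[mstalk X F p] C)"
     "1[ostalk X p] *.[mstalk X F p] C = C"
   using str mgerm_closed[OF U]
   by (simp_all add: germs mstalk_ops[OF U] ostalk_ops[OF U] smult_l_distr smult_r_distr smult_assoc1)
 qed
 show ?thesis
  by (rule moduleI[OF R mstalk_abelian_group[OF p R]]; rule module_laws;
    (assumption | rule O.one_closed))
qed

end

lemma reg_module_module:
 assumes "cring R" shows "module R (reg_module R)"
proof -
 interpret cring R by fact
 have "abelian_group (reg_module R)"
  by (rule abelian_groupI) (auto simp: a_ac intro: bexI[of _ "\<ominus>\<^bsub>R\<^esub> _"] l_neg)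
 thus ?thesis
  by (intro moduleI) (auto simp: assms l_distr r_distr m_assoc)
qed

lemma (in ringed_space) mod_sheaf_osheaf: "mod_sheaf X (osheaf X)"
 unfolding mod_sheaf_def
proof (intro conjI allI impI ballI)
 show "module (osec X U) (msec (osheaf X) U)" if "opn X U" for U
  using reg_module_module[OF cring_O[OF that]] by (simp add: osheaf_def)
qed (simp_all add: sheaf_O ores_add ores_mult)

section \<open>Comorphisms on stalks\<close>

definition pre_hom :: "('p, 'a) rspace \<Rightarrow> ('q, 'b) rspace \<Rightarrow> ('p, 'a, 'q, 'b) rmor \<Rightarrow> bool"
 where "pre_hom X Y f \<longleftrightarrow>
  continuous_map (tp X) (tp Y) (mpt f) \<and>
  (\<forall>U. opn Y U \<longrightarrow> mco f U \<in> ring_hom (osec Y U) (osec X (preim X f U))) \<and>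
  (\<forall>U W. opn Y U \<and> opn Y W \<and> W \<subseteq> U \<longrightarrow> (\<forall>s\<in>Os Y U.
   mco f W (ores Y U W s) = ores X (preim X f U) (preim X f W) (mco f U s)))"

lemma lrs_hom_iff: "lrs_hom X Y f \<longleftrightarrow> pre_hom X Y f \<and>
  (\<forall>p\<in>pts X. \<forall>A\<in>carrier (ostalk Y (mpt f p)).
   stalk_map X f p A \<in> Units (ostalk X p) \<longrightarrow> A \<in> Units (ostalk Y (mpt f p)))"
 unfolding lrs_hom_def pre_hom_def by blast

lemma pre_homD:
 assumes "pre_hom X Y f"
 shows pre_hom_continuous: "continuous_map (tp X) (tp Y) (mpt f)"
  and pre_hom_opn: "opn Y U \<Longrightarrow> opn X (preim X f U)"
  and pre_hom_pts: "p \<in> pts X \<Longrightarrow> mpt f p \<in> pts Y"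
  and pre_hom_ring_hom: "opn Y U \<Longrightarrow> mco f U \<in> ring_hom (osec Y U) (osec X (preim X f U))"
  and pre_hom_res: "\<lbrakk>opn Y U; opn Y W; W \<subseteq> U; s \<in> Os Y U\<rbrakk> \<Longrightarrow>
   mco f W (ores Y U W s) = ores X (preim X f U) (preim X f W) (mco f U s)"
proof -
 show c: "continuous_map (tp X) (tp Y) (mpt f)" using assms by (simp add: pre_hom_def)
 show "opn Y U \<Longrightarrow> opn X (preim X f U)"
  using openin_continuous_map_preimage[OF c] by (simp add: preim_def)
 show "p \<in> pts X \<Longrightarrow> mpt f p \<in> pts Y" using continuous_map_image_subset_topspace[OF c] by blast
qed (use assms in \<open>simp_all add: pre_hom_def\<close>)

lemmas pre_hom_mco_closed = ring_hom_closed[OF pre_hom_ring_hom]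

lemma preim_mono: "W \<subseteq> U \<Longrightarrow> preim X f W \<subseteq> preim X f U"
 and preim_Int: "preim X f (U \<inter> W) = preim X f U \<inter> preim X f W"
 and preim_iff: "p \<in> preim X f U \<longleftrightarrow> p \<in> pts X \<and> mpt f p \<in> U"
 unfolding preim_def by auto

lemma preim_pts: "pre_hom X Y f \<Longrightarrow> preim X f (pts Y) = pts X"
 using pre_hom_pts[of X Y f] by (auto simp: preim_def)

locale ringed_presheaf_hom = X: ringed_presheaf X + Y: ringed_presheaf Y
 for X :: "('p, 'a) rspace" and Y :: "('q, 'b) rspace" +
 fixes f :: "('p, 'a, 'q, 'b) rmor"
 assumes pre_hom: "pre_hom X Y f"
begin

lemma stalk_map_ogerm:
 assumes p: "p \<in> pts X" and U: "opn Y U" "mpt f p \<in> U" and s: "s \<in> Os Y U"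
 shows "stalk_map X f p (ogerm Y (mpt f p) U s) = ogerm X p (preim X f U) (mco f U s)"
proof -
 have "ogerm X p (preim X f W) (mco f W t) = ogerm X p (preim X f U) (mco f U s)"
  if Wt: "(W, t) \<in> ogerm Y (mpt f p) U s" for W t
 proof -
  obtain Z where W: "opn Y W" "t \<in> Os Y W"
   and Z: "opn Y Z" "mpt f p \<in> Z" "Z \<subseteq> U" "Z \<subseteq> W" "ores Y U Z s = ores Y W Z t"
   by (rule germ_memE[OF Wt[unfolded ogerm_def]])
  have "ores X (preim X f W) (preim X f Z) (mco f W t) = ores X (preim X f U) (preim X f Z) (mco f U s)"
   using pre_hom_res[OF pre_hom U(1) Z(1,3) s] pre_hom_res[OF pre_hom W(1) Z(1,4) W(2)] Z(5) by simp
  thus ?thesis unfolding ogerm_def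
   by (intro germ_eqI[OF X.presheaf_O, where Z = "preim X f Z"])
    (use p U s W Z in \<open>simp_all add: pre_homD[OF pre_hom] pre_hom_mco_closed[OF pre_hom] preim_mono
      preim_iff\<close>)
 qed
 moreover have "(U, s) \<in> ogerm Y (mpt f p) U s"
  using germ_self[OF Y.presheaf_O U s] by (simp add: ogerm_def)
 ultimately show ?thesis unfolding stalk_map_def by fast
qed

lemma stalk_map_ring_hom:
 assumes p: "p \<in> pts X"
 shows "stalk_map X f p \<in> ring_hom (ostalk Y (mpt f p)) (ostalk X p)"
proof (rule ring_hom_memI)
 fix A B assume "A \<in> carrier (ostalk Y (mpt f p))" "B \<in> carrier (ostalk Y (mpt f p))"
 then obtain U s t where U: "opn Y U" "mpt f p \<in> U" and st: "s \<in> Os Y U" "t \<in> Os Y U"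
  and germs: "A = ogerm Y (mpt f p) U s" "B = ogerm Y (mpt f p) U t" by (rule Y.ostalk_common_nhd)
 have V: "opn X (preim X f U)" "p \<in> preim X f U"
  using pre_hom_opn[OF pre_hom U(1)] p U by (auto simp: preim_def)
 note hom = pre_hom_ring_hom[OF pre_hom U(1)]
 note stalk_ops = stalk_map_ogerm[OF p U] Y.ostalk_ops[OF U] X.ostalk_ops[OF V]
 show "stalk_map X f p A \<in> carrier (ostalk X p)"
  using X.ogerm_closed[OF V ring_hom_closed[OF hom]] st by (simp add: germs stalk_ops)
 show "stalk_map X f p (A *[ostalk Y (mpt f p)] B) = stalk_map X f p A *[ostalk X p] stalk_map X f p B"
  "stalk_map X f p (A +[ostalk Y (mpt f p)] B) = stalk_map X f p A +[ostalk X p] stalk_map X f p B"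
  using st U(1) ring_hom_closed[OF hom]
  by (simp_all add: germs stalk_ops Y.O_mult_closed Y.O_add_closed ring_hom_mult[OF hom]
    ring_hom_add[OF hom])
next
 note q = pre_hom_pts[OF pre_hom p]
 show "stalk_map X f p 1[ostalk Y (mpt f p)] = 1[ostalk X p]"
  using ring_hom_one[OF pre_hom_ring_hom[OF pre_hom Y.opn_pts]]
  by (simp add: preim_pts[OF pre_hom] stalk_map_ogerm[OF p Y.opn_pts q Y.O_one_closed]
    Y.ostalk_one[OF Y.opn_pts q] X.ostalk_one[OF X.opn_pts p])
qed

end

lemma ring_hom_Units:
 assumes h: "h \<in> ring_hom R S" and u: "u \<in> Units R"
 shows "h u \<in> Units S"
proof -
 obtain v where v: "v \<in> carrier R" "v *[R] u = 1[R]" "u *[R] v = 1[R]" and uR: "u \<in> carrier R"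
  using u by (auto simp: Units_def)
 have "h v *[S] h u = 1[S]" "h u *[S] h v = 1[S]"
  using ring_hom_mult[OF h v(1) uR] ring_hom_mult[OF h uR v(1)] ring_hom_one[OF h] v(2,3) by simp_all
 thus ?thesis using ring_hom_closed[OF h v(1)] ring_hom_closed[OF h uR] by (auto simp: Units_def)
qed

definition mutually_inverse ::
 "('p, 'a) rspace \<Rightarrow> ('q, 'b) rspace \<Rightarrow> ('p, 'a, 'q, 'b) rmor \<Rightarrow> ('q, 'b, 'p, 'a) rmor \<Rightarrow> bool"
 where "mutually_inverse X Y f g \<longleftrightarrow> pre_hom X Y f \<and> pre_hom Y X g \<and>
  mor_eq X X (mor_comp Y g f) mor_id \<and> mor_eq Y Y (mor_comp X f g) mor_id"

lemma mutually_inverse_sym: "mutually_inverse X Y f g \<Longrightarrow> mutually_inverse Y X g f"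
 by (auto simp: mutually_inverse_def)

lemma mutually_inverseD:
 assumes "mutually_inverse X Y f g"
 shows "pre_hom X Y f" "pre_hom Y X g"
  "p \<in> pts X \<Longrightarrow> mpt g (mpt f p) = p" "q \<in> pts Y \<Longrightarrow> mpt f (mpt g q) = q"
  "opn X U \<Longrightarrow> s \<in> Os X U \<Longrightarrow> mco f (preim Y g U) (mco g U s) = s"
  "opn Y W \<Longrightarrow> t \<in> Os Y W \<Longrightarrow> mco g (preim X f W) (mco f W t) = t"
  "opn Y W \<Longrightarrow> preim Y g (preim X f W) = W"
proof -
 show "pre_hom X Y f" and g: "pre_hom Y X g"
  and gf: "p \<in> pts X \<Longrightarrow> mpt g (mpt f p) = p" and fg: "q \<in> pts Y \<Longrightarrow> mpt f (mpt g q) = q" for p q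
  using assms by (simp_all add: mutually_inverse_def mor_eq_def mor_comp_def mor_id_def)
 show "opn X U \<Longrightarrow> s \<in> Os X U \<Longrightarrow> mco f (preim Y g U) (mco g U s) = s"
  "opn Y W \<Longrightarrow> t \<in> Os Y W \<Longrightarrow> mco g (preim X f W) (mco f W t) = t"
  using assms by (simp_all add: mutually_inverse_def mor_eq_def mor_comp_def mor_id_def)
 show "opn Y W \<Longrightarrow> preim Y g (preim X f W) = W"
  using openin_subset[of "tp Y" W] fg pre_hom_pts[OF g] by (auto simp: preim_def)
qed

text \<open>An inverse as a morphism of ringed spaces makes the stalk maps invertible, hence local.\<close>

lemma mutually_inverse_lrs_hom:
 assumes X: "pre_ring X" and Y: "pre_ring Y" and fg: "mutually_inverse X Y f g"
 shows "lrs_hom X Y f"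
proof -
 note f = mutually_inverseD(1)[OF fg] and g = mutually_inverseD(2)[OF fg]
 interpret f: ringed_presheaf_hom X Y f by unfold_locales (fact X Y f)+
 interpret g: ringed_presheaf_hom Y X g by unfold_locales (fact X Y g)+
 show ?thesis unfolding lrs_hom_iff
 proof (intro conjI ballI impI f)
  fix p A assume p: "p \<in> pts X" and A: "A \<in> carrier (ostalk Y (mpt f p))"
   and unit: "stalk_map X f p A \<in> Units (ostalk X p)"
  note gfp = mutually_inverseD(3)[OF fg p] and q = pre_hom_pts[OF f p]
  obtain U s where U: "opn Y U" "mpt f p \<in> U" "s \<in> Os Y U" "A = ogerm Y (mpt f p) U s"
   by (rule f.Y.ostalkE[OF A])
  have "mpt g (mpt f p) \<in> preim X f U" using p U gfp by (simp add: preim_def)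
  hence "stalk_map Y g (mpt f p) (stalk_map X f p A) = A"
   using f.stalk_map_ogerm[OF p U(1-3)] pre_hom_opn[OF f U(1)] pre_hom_mco_closed[OF f U(1,3)]
    g.stalk_map_ogerm[OF q, of "preim X f U" "mco f U s"] mutually_inverseD(6,7)[OF fg
      U(1)] U(3,4) gfp by simp
  with ring_hom_Units[OF g.stalk_map_ring_hom[OF q, unfolded gfp]
    unit] show "A \<in> Units (ostalk Y (mpt f p))" by simp
 qed
qed

lemma mutually_inverse_lrs_iso:
 assumes "pre_ring X" "pre_ring Y" "mutually_inverse X Y f g"
 shows "lrs_iso X Y f"
 using assms mutually_inverse_lrs_hom[OF assms] mutually_inverse_lrs_hom[OF assms(2,1)
   mutually_inverse_sym[OF assms(3)]]
 unfolding lrs_iso_def mutually_inverse_def by blast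

section \<open>Affine schemes\<close>

locale prime_at = primeideal p R for p and R :: "'a ring"
begin

lemma one_notin: "1[R] \<notin> p"
 using one_imp_carrier I_notcarr by blast

lemma zero_in: "0[R] \<in> p"
 by (rule additive_subgroup.zero_closed[OF is_additive_subgroup])

lemma mult_mem_iff: "\<lbrakk>a \<in> carrier R; b \<in> carrier R\<rbrakk> \<Longrightarrow> a *[R] b \<in> p \<longleftrightarrow> a \<in> p \<or> b \<in> p"
 using I_prime[of a b] I_l_closed[of b a] I_r_closed[of a b] by auto

lemma mult_notin: "\<lbrakk>s \<in> carrier R - p; t \<in> carrier R - p\<rbrakk> \<Longrightarrow> s *[R] t \<in> carrier R - p"
 by (simp add: mult_mem_iff)

end

lemma zariski_openin:
 assumes P: "P \<subseteq> {p. primeideal p R}" and R: "cring R"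
 shows "openin (zariski R P) U \<longleftrightarrow> (\<exists>S\<subseteq>carrier R. U = {p \<in> P. \<not> S \<subseteq> p})"
proof -
 interpret cring R by (rule R)
 let ?open = "\<lambda>U. \<exists>S\<subseteq>carrier R. U = {p \<in> P. \<not> S \<subseteq> p}"
 have "istopology ?open"
  unfolding istopology_def
 proof (intro conjI allI impI)
  fix A B assume "?open A" "?open B"
  then obtain S T where S: "S \<subseteq> carrier R" "A = {p \<in> P. \<not> S \<subseteq> p}" and T: "T \<subseteq> carrier R"
    "B = {p \<in> P. \<not> T \<subseteq> p}"
   by auto
  let ?ST = "{s *[R] t | s t. s \<in> S \<and> t \<in> T}"
  have "\<not> ?ST \<subseteq> p \<longleftrightarrow> \<not> S \<subseteq> p \<and> \<not> T \<subseteq> p" if "p \<in> P" for p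
  proof -
   interpret p: prime_at p R using that P by (auto simp: prime_at_def)
   show ?thesis using p.mult_mem_iff S(1) T(1) by blast
  qed
  hence "{p \<in> P. \<not> ?ST \<subseteq> p} = {p \<in> P. \<not> S \<subseteq> p \<and> \<not> T \<subseteq> p}" by (intro Collect_cong conj_cong refl)
  hence "A \<inter> B = {p \<in> P. \<not> ?ST \<subseteq> p}" unfolding S(2) T(2) by (simp add: Int_def conj_ac)
  moreover have "?ST \<subseteq> carrier R" using S T by auto
  ultimately show "?open (A \<inter> B)" by blast
 next
  fix \<K> assume "\<forall>A\<in>\<K>. ?open A"
  then obtain S where S: "\<forall>A\<in>\<K>. S A \<subseteq> carrier R \<and> A = {p \<in> P. \<not> S A \<subseteq> p}" by metis
  have "(\<Union>A\<in>\<K>. A) = (\<Union>A\<in>\<K>. {p \<in> P. \<not> S A \<subseteq> p})" by (rule SUP_cong[OF refl conjunct2[OF bspec[OF S]]])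
  also have "... = {p \<in> P. \<not> (\<Union>A\<in>\<K>. S A) \<subseteq> p}" by blast
  finally have "\<Union>\<K> = {p \<in> P. \<not> (\<Union>A\<in>\<K>. S A) \<subseteq> p}" by simp
  moreover have "(\<Union>A\<in>\<K>. S A) \<subseteq> carrier R" using bspec[OF S, THEN conjunct1] by blast
  ultimately show "?open (\<Union>\<K>)" by (intro exI conjI)
 qed
 thus ?thesis unfolding zariski_def by (simp add: topology_inverse')
qed

subsection \<open>Localization at a prime ideal\<close>

abbreviation lfrac :: "'a ring \<Rightarrow> 'a set \<Rightarrow> 'a \<times> 'a \<Rightarrow> ('a \<times> 'a) set"
 where "lfrac R p \<equiv> fraction R (loc_pairs R p) (loc_den R p)"

abbreviation localization :: "'a ring \<Rightarrow> 'a set \<Rightarrow> ('a \<times> 'a) set ring"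
 where "localization R p \<equiv> frac_ring R (loc_pairs R p) (loc_den R p)"

lemma loc_pairs_iff: "(a, s) \<in> loc_pairs R p \<longleftrightarrow> a \<in> carrier R \<and> s \<in> carrier R \<and> s \<notin> p"
 by (auto simp: loc_pairs_def)

context prime_at
begin

lemma lfrac_mem:
 assumes "(a, s) \<in> loc_pairs R p"
 shows "(b, t) \<in> lfrac R p (a, s) \<longleftrightarrow> (b, t) \<in> loc_pairs R p \<and>
   (\<exists>u\<in>carrier R - p. u *[R] (a *[R] t) = u *[R] (b *[R] s))"
proof -
 have "u *[R] (a *[R] t \<ominus>\<^bsub>R\<^esub> b *[R] s) = u *[R] (a *[R] t) \<ominus>\<^bsub>R\<^esub> u *[R] (b *[R] s)"
  if "u \<in> carrier R" "(b, t) \<in> loc_pairs R p" for u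
  using that assms by (simp add: loc_pairs_iff minus_eq r_distr r_minus)
 thus ?thesis using assms unfolding fraction_def loc_den_def by (auto simp: loc_pairs_iff)
qed

lemma lfrac_eq:
 assumes x: "(a, s) \<in> loc_pairs R p" and y: "(b, t) \<in> loc_pairs R p"
 shows "lfrac R p (a, s) = lfrac R p (b, t) \<longleftrightarrow> (\<exists>u\<in>carrier R - p. u *[R] (a *[R] t) = u *[R] (b *[R] s))"
proof
 assume "lfrac R p (a, s) = lfrac R p (b, t)"
 moreover have "(b, t) \<in> lfrac R p (b, t)"
  using y one_notin by (auto simp: lfrac_mem[OF y] intro!: bexI[of _ "1[R]"])
 ultimately show "\<exists>u\<in>carrier R - p. u *[R] (a *[R] t) = u *[R] (b *[R] s)"
  using lfrac_mem[OF x] by blast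
next
 assume a: "\<exists>u\<in>carrier R - p. u *[R] (a *[R] t) = u *[R] (b *[R] s)"
 have lfrac_subset: "lfrac R p (a, s) \<subseteq> lfrac R p (b, t)"
  if x: "(a, s) \<in> loc_pairs R p" and y: "(b, t) \<in> loc_pairs R p"
   and u: "u \<in> carrier R - p" "u *[R] (a *[R] t) = u *[R] (b *[R] s)" for a b s t u
 proof (rule subrelI)
  fix c w assume cw: "(c, w) \<in> lfrac R p (a, s)"
  then obtain v where v: "v \<in> carrier R - p" "v *[R] (a *[R] w) = v *[R] (c *[R] s)"
   using lfrac_mem[OF x] by blast
  have z: "(c, w) \<in> loc_pairs R p" using cw lfrac_mem[OF x] by blast
  have c: "a \<in> carrier R" "b \<in> carrier R" "c \<in> carrier R" "s \<in> carrier R" "t \<in> carrier R"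
    "w \<in> carrier R"
   "u \<in> carrier R" "v \<in> carrier R"
   using x y z u v by (auto simp: loc_pairs_iff)
  have "(s *[R] (u *[R] v)) *[R] (b *[R] w) = (v *[R] w) *[R] (u *[R] (b *[R] s))" using c
   by (simp add: m_ac)
  also have "... = (u *[R] t) *[R] (v *[R] (a *[R] w))" unfolding u(2)[symmetric] using c
   by (simp add: m_ac)
  also have "... = (s *[R] (u *[R] v)) *[R] (c *[R] t)" unfolding v(2) using c by (simp add: m_ac)
  finally show "(c, w) \<in> lfrac R p (b, t)"
   using z x u(1) v(1) mult_notin by (auto simp: lfrac_mem[OF y] loc_pairs_iff intro!: bexI)
 qed
 show "lfrac R p (a, s) = lfrac R p (b, t)"
  using a lfrac_subset[OF x y] lfrac_subset[OF y x] by (metis order_antisym)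
qed

lemma lfrac_memE:
 assumes "(a, s) \<in> loc_pairs R p" "(b, t) \<in> lfrac R p (a, s)"
 obtains u where "u \<in> carrier R - p" "u *[R] (a *[R] t) = u *[R] (b *[R] s)" "(b, t) \<in> loc_pairs R p"
 using assms lfrac_mem by blast

lemma lfrac_self: "x \<in> loc_pairs R p \<Longrightarrow> x \<in> lfrac R p x"
 using lfrac_mem[of "fst x" "snd x" "fst x" "snd x"] one_notin by (auto intro!: bexI[of _ "1[R]"])

lemma loc_pairs_mult: "\<lbrakk>(a, s) \<in> loc_pairs R p; (b, t) \<in> loc_pairs R p\<rbrakk> \<Longrightarrow>
  (a *[R] b, s *[R] t) \<in> loc_pairs R p"
 and loc_pairs_add: "\<lbrakk>(a, s) \<in> loc_pairs R p; (b, t) \<in> loc_pairs R p\<rbrakk> \<Longrightarrow>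
  (a *[R] t +[R] b *[R] s, s *[R] t) \<in> loc_pairs R p"
 by (auto simp: loc_pairs_iff mult_mem_iff)

lemma lfrac_mult:
 assumes x: "(a, s) \<in> loc_pairs R p" and y: "(b, t) \<in> loc_pairs R p"
 shows "lfrac R p (a, s) *[localization R p] lfrac R p (b, t) = lfrac R p (a *[R] b, s *[R] t)"
 unfolding frac_ring_def monoid.simps
proof (rule UN_pairs_const2[OF lfrac_self[OF x] lfrac_self[OF y]])
 fix a' s' b' t' assume "(a', s') \<in> lfrac R p (a, s)" "(b', t') \<in> lfrac R p (b, t)"
 then obtain u v where x': "(a', s') \<in> loc_pairs R p" and u: "u \<in> carrier R - p"
   "u *[R] (a *[R] s') = u *[R] (a' *[R] s)"
  and y': "(b', t') \<in> loc_pairs R p" and v: "v \<in> carrier R - p"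
    "v *[R] (b *[R] t') = v *[R] (b' *[R] t)"
  using lfrac_memE[OF x] lfrac_memE[OF y] by metis
 note c = x[unfolded loc_pairs_iff] y[unfolded loc_pairs_iff] x'[unfolded loc_pairs_iff] y'[unfolded
   loc_pairs_iff]
 have "(u *[R] v) *[R] (a' *[R] b' *[R] (s *[R] t)) = (u *[R] (a' *[R] s)) *[R] (v *[R] (b' *[R] t))"
  using c u(1) v(1) by (simp add: m_ac)
 also have "... = (u *[R] v) *[R] (a *[R] b *[R] (s' *[R] t'))"
  unfolding u(2)[symmetric] v(2)[symmetric] using c u(1) v(1) by (simp add: m_ac)
 finally show "lfrac R p (a' *[R] b', s' *[R] t') = lfrac R p (a *[R] b, s *[R] t)"
  unfolding lfrac_eq[OF loc_pairs_mult[OF x' y'] loc_pairs_mult[OF x y]]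
  using mult_notin[OF u(1) v(1)] by blast
qed

lemma lfrac_add:
 assumes x: "(a, s) \<in> loc_pairs R p" and y: "(b, t) \<in> loc_pairs R p"
 shows "lfrac R p (a, s) +[localization R p] lfrac R p (b, t) =
   lfrac R p (a *[R] t +[R] b *[R] s, s *[R] t)"
 unfolding frac_ring_def monoid.simps ring.simps
proof (rule UN_pairs_const2[OF lfrac_self[OF x] lfrac_self[OF y]])
 fix a' s' b' t' assume "(a', s') \<in> lfrac R p (a, s)" "(b', t') \<in> lfrac R p (b, t)"
 then obtain u v where x': "(a', s') \<in> loc_pairs R p" and u: "u \<in> carrier R - p"
   "u *[R] (a *[R] s') = u *[R] (a' *[R] s)"
  and y': "(b', t') \<in> loc_pairs R p" and v: "v \<in> carrier R - p"
    "v *[R] (b *[R] t') = v *[R] (b' *[R] t)"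
  using lfrac_memE[OF x] lfrac_memE[OF y] by metis
 note c = x[unfolded loc_pairs_iff] y[unfolded loc_pairs_iff] x'[unfolded loc_pairs_iff] y'[unfolded
   loc_pairs_iff]
 have "(u *[R] v) *[R] ((a' *[R] t' +[R] b' *[R] s') *[R] (s *[R] t))
   = (u *[R] (a' *[R] s)) *[R] (v *[R] (t *[R] t')) +[R] (v *[R] (b' *[R] t)) *[R] (u *[R] (s *[R] s'))"
  using c u(1) v(1) by (simp add: m_ac l_distr r_distr)
 also have "... = (u *[R] v) *[R] ((a *[R] t +[R] b *[R] s) *[R] (s' *[R] t'))"
  unfolding u(2)[symmetric] v(2)[symmetric] using c u(1) v(1) by (simp add: m_ac l_distr r_distr)
 finally show "lfrac R p (a' *[R] t' +[R] b' *[R] s', s' *[R] t') =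
   lfrac R p (a *[R] t +[R] b *[R] s, s *[R] t)"
  unfolding lfrac_eq[OF loc_pairs_add[OF x' y'] loc_pairs_add[OF x y]]
  using mult_notin[OF u(1) v(1)] by blast
qed

end

subsection \<open>The structure sheaf\<close>

definition fraction_on :: "'a ring \<Rightarrow> ('a set \<Rightarrow> ('a \<times> 'a) set) \<Rightarrow> 'a set set \<Rightarrow> 'a \<Rightarrow> 'a \<Rightarrow> bool"
 where "fraction_on R s W a t \<longleftrightarrow> (\<forall>p\<in>W. (a, t) \<in> loc_pairs R p \<and> s p = lfrac R p (a, t))"

lemma fraction_onD: "fraction_on R s W a t \<Longrightarrow> p \<in> W \<Longrightarrow> (a, t) \<in> loc_pairs R p"
 "fraction_on R s W a t \<Longrightarrow> p \<in> W \<Longrightarrow> s p = lfrac R p (a, t)"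
 by (simp_all add: fraction_on_def)

lemma Spec_sel:
 "tp (Spec R) = zariski R {p. primeideal p R}"
 "ores (Spec R) = (\<lambda>U W s. restrict s W)"
 "s *[osec (Spec R) U] t = (\<lambda>p\<in>U. s p *[localization R p] t p)"
 "s +[osec (Spec R) U] t = (\<lambda>p\<in>U. s p +[localization R p] t p)"
 "1[osec (Spec R) U] = (\<lambda>p\<in>U. lfrac R p (1[R], 1[R]))"
 "0[osec (Spec R) U] = (\<lambda>p\<in>U. lfrac R p (0[R], 1[R]))"
 by (simp_all add: Spec_def frac_space_def frac_ring_def)

lemma Spec_section_iff:
 "s \<in> Os (Spec R) U \<longleftrightarrow> s \<in> extensional U \<and>
  (\<forall>p\<in>U. \<exists>W a t. opn (Spec R) W \<and> p \<in> W \<and> W \<subseteq> U \<and> fraction_on R s W a t)"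
 by (auto simp: Spec_def frac_space_def fraction_on_def)

lemma Spec_section_extensional: "s \<in> Os (Spec R) U \<Longrightarrow> s \<in> extensional U"
 by (simp add: Spec_section_iff)

lemma Spec_sectionE:
 assumes "s \<in> Os (Spec R) U" "p \<in> U"
 obtains W a t where "opn (Spec R) W" "p \<in> W" "W \<subseteq> U" "fraction_on R s W a t"
 using assms unfolding Spec_section_iff by meson

lemma Spec_section_valueE:
 assumes "s \<in> Os (Spec R) U" "p \<in> U"
 obtains a t where "(a, t) \<in> loc_pairs R p" "s p = lfrac R p (a, t)"
 using assms by (meson Spec_sectionE fraction_onD)

locale affine_scheme = cring R for R :: "'a ring"
begin

lemma Spec_opn_iff: "opn (Spec R) U \<longleftrightarrow> (\<exists>S\<subseteq>carrier R. U = {p. primeideal p R \<and> \<not> S \<subseteq> p})"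
 unfolding Spec_sel(1) zariski_openin[OF order_refl is_cring] by simp

lemma Spec_pts: "pts (Spec R) = {p. primeideal p R}"
proof
 show "pts (Spec R) \<subseteq> {p. primeideal p R}" using openin_topspace[of "tp (Spec R)"]
  unfolding Spec_opn_iff by auto
 have "\<not> carrier R \<subseteq> p" if "primeideal p R" for p
  using primeideal.I_notcarr[OF that] ideal.Icarr[OF primeideal.axioms(1)[OF that]] by blast
 hence "opn (Spec R) {p. primeideal p R}" unfolding Spec_opn_iff by blast
 thus "{p. primeideal p R} \<subseteq> pts (Spec R)" by (rule openin_subset)
qed

lemma Spec_opn_prime: "opn (Spec R) U \<Longrightarrow> p \<in> U \<Longrightarrow> prime_at p R"
 using openin_subset[of "tp (Spec R)" U] Spec_pts by (auto simp: prime_at_def)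

lemma opn_basic_open: "x \<in> carrier R \<Longrightarrow> opn (Spec R) {p. primeideal p R \<and> x \<notin> p}"
 unfolding Spec_opn_iff by (rule exI[of _ "{x}"]) simp

lemma Spec_res_section:
 assumes "s \<in> Os (Spec R) U" "opn (Spec R) W" "W \<subseteq> U"
 shows "restrict s W \<in> Os (Spec R) W"
 unfolding Spec_section_iff
proof (intro conjI ballI)
 fix p assume p: "p \<in> W"
 then obtain Z a t where "opn (Spec R) Z" "p \<in> Z" "fraction_on R s Z a t"
  using assms(3) by (meson Spec_sectionE[OF assms(1)] subsetD)
 thus "\<exists>Z a t. opn (Spec R) Z \<and> p \<in> Z \<and> Z \<subseteq> W \<and> fraction_on R (restrict s W) Z a t"
  using assms(2) p by (intro exI[of _ "Z \<inter> W"] exI[of _ a] exI[of _ t]) (auto simp: fraction_on_def)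
qed simp

lemma Spec_presheaf: "is_presheaf (tp (Spec R)) (\<lambda>U. Os (Spec R) U) (ores (Spec R))"
 unfolding is_presheaf_def Spec_sel(2)
 by (auto simp: Spec_res_section extensional_restrict Spec_section_extensional Int_absorb1)

lemma Spec_fraction_section:
 assumes "opn (Spec R) U" "\<And>p. p \<in> U \<Longrightarrow> (a, t) \<in> loc_pairs R p"
 shows "(\<lambda>p\<in>U. lfrac R p (a, t)) \<in> Os (Spec R) U"
 using assms unfolding Spec_section_iff by (auto simp: fraction_on_def intro!: exI[of _ U])

lemma Spec_ops_section:
 assumes s: "s \<in> Os (Spec R) U" and t: "t \<in> Os (Spec R) U"
 shows Spec_mult_section: "s *[osec (Spec R) U] t \<in> Os (Spec R) U"
  and Spec_add_section: "s +[osec (Spec R) U] t \<in> Os (Spec R) U"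
proof -
 have "\<exists>W c w c' w'. opn (Spec R) W \<and> p \<in> W \<and> W \<subseteq> U \<and>
   fraction_on R (s *[osec (Spec R) U] t) W c w \<and>
   fraction_on R (s +[osec (Spec R) U] t) W c' w'" if p: "p \<in> U" for p
 proof -
  obtain W a u where W: "opn (Spec R) W" "p \<in> W" "W \<subseteq> U" "fraction_on R s W a u"
   by (rule Spec_sectionE[OF s p])
  obtain Z b v where Z: "opn (Spec R) Z" "p \<in> Z" "Z \<subseteq> U" "fraction_on R t Z b v"
   by (rule Spec_sectionE[OF t p])
  have "fraction_on R (s *[osec (Spec R) U] t) (W \<inter> Z) (a *[R] b) (u *[R] v)
    \<and> fraction_on R (s +[osec (Spec R) U] t) (W \<inter> Z) (a *[R] v +[R] b *[R] u) (u *[R] v)"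
   unfolding fraction_on_def ball_conj_distrib[symmetric]
  proof
   fix q assume q: "q \<in> W \<inter> Z"
   interpret q: prime_at q R using q by (intro Spec_opn_prime[OF W(1)]) simp
   have "q \<in> U" "(a, u) \<in> loc_pairs R q" "s q = lfrac R q (a, u)" "(b, v) \<in> loc_pairs R q"
     "t q = lfrac R q (b, v)"
    using q W(3) fraction_onD[OF W(4)] fraction_onD[OF Z(4)] by auto
   thus "((a *[R] b, u *[R] v) \<in> loc_pairs R q \<and> (s *[osec (Spec R) U] t) q =
     lfrac R q (a *[R] b, u *[R] v)) \<and>
     (a *[R] v +[R] b *[R] u, u *[R] v) \<in> loc_pairs R q \<and>
     (s +[osec (Spec R) U] t) q = lfrac R q (a *[R] v +[R] b *[R] u, u *[R] v)"
    by (simp add: Spec_sel q.lfrac_mult q.lfrac_add q.loc_pairs_mult q.loc_pairs_add)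
  qed
  moreover have "opn (Spec R) (W \<inter> Z)" "p \<in> W \<inter> Z" "W \<inter> Z \<subseteq> U" using W Z by auto
  ultimately show ?thesis by blast
 qed
 thus "s *[osec (Spec R) U] t \<in> Os (Spec R) U" "s +[osec (Spec R) U] t \<in> Os (Spec R) U"
  unfolding Spec_section_iff by (meson, simp_all add: Spec_sel, meson)
qed

lemma pre_ring_Spec: "pre_ring (Spec R)"
proof -
 have "(a, 1[R]) \<in> loc_pairs R p" if "opn (Spec R) U" "p \<in> U" "a \<in> carrier R" for U p a
  using prime_at.one_notin[OF Spec_opn_prime[OF that(1,2)]] that(3) by (simp add: loc_pairs_iff)
 hence const: "1[osec (Spec R) U] \<in> Os (Spec R) U" "0[osec (Spec R) U] \<in> Os (Spec R) U"
   if "opn (Spec R) U" for U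
  using that by (simp_all add: Spec_sel Spec_fraction_section)
 have "ores (Spec R) U W \<in> ring_hom (osec (Spec R) U) (osec (Spec R) W)"
  if "opn (Spec R) U" "opn (Spec R) W" "W \<subseteq> U" for U W
  by (rule ring_hom_memI)
   (use that in \<open>auto simp: Spec_sel(2) Spec_res_section, auto simp:
     Spec_sel restrict_def fun_eq_iff subset_iff\<close>)
 moreover have "ores (Spec R) U W 0[osec (Spec R) U] = 0[osec (Spec R) W]" if "W \<subseteq> U" for U W
  using that by (auto simp: Spec_sel restrict_def fun_eq_iff)
 ultimately show ?thesis
  unfolding pre_ring_def by (simp add: Spec_presheaf const Spec_mult_section Spec_add_section)
qed

end

subsection \<open>The morphism induced by a ring homomorphism\<close>

locale affine_hom = R: affine_scheme R + S: affine_scheme S + ring_hom_cring R S h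
 for R :: "'a ring" and S :: "'b ring" and h :: "'a \<Rightarrow> 'b"
begin

abbreviation contract :: "'b set \<Rightarrow> 'a set"
 where "contract q \<equiv> {a \<in> carrier R. h a \<in> q}"

lemma contract_prime: "primeideal q S \<Longrightarrow> primeideal (contract q) R"
 by (rule ring.primeideal_vimage[OF R.is_cring])

lemma contract_prime_at: "primeideal q S \<Longrightarrow> prime_at (contract q) R"
 unfolding prime_at_def by (rule contract_prime)

lemma loc_pairs_map: "(a, t) \<in> loc_pairs R (contract q) \<Longrightarrow> (h a, h t) \<in> loc_pairs S q"
 by (auto simp: loc_pairs_iff)

lemma lfrac_map:
 assumes q: "primeideal q S" and x: "(a, t) \<in> loc_pairs R (contract q)"
 shows "(\<Union>(b, s)\<in>lfrac R (contract q) (a, t). lfrac S q (h b, h s)) = lfrac S q (h a, h t)"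
proof -
 note p = contract_prime_at[OF q]
 interpret q: prime_at q S using q by (simp add: prime_at_def)
 have "lfrac S q (h b, h s) = lfrac S q (h a, h t)"
   if bs: "(b, s) \<in> lfrac R (contract q) (a, t)" for b s
 proof -
  obtain u where u: "u \<in> carrier R - contract q" "u *[R] (a *[R] s) = u *[R] (b *[R] t)"
   and y: "(b, s) \<in> loc_pairs R (contract q)" by (rule prime_at.lfrac_memE[OF p x bs])
  have "h u *[S] (h b *[S] h t) = h u *[S] (h a *[S] h s)"
   using arg_cong[OF u(2), of h] u(1) x y by (simp add: loc_pairs_iff)
  moreover have "h u \<in> carrier S - q" using u(1) by auto
  ultimately show ?thesis unfolding q.lfrac_eq[OF loc_pairs_map[OF y] loc_pairs_map[OF x]] by blast
 qed
 thus ?thesis using prime_at.lfrac_self[OF p x] by fast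
qed

lemma mpt_Spec_map: "mpt (Spec_map R S h) q = contract q"
 by (simp add: Spec_map_def)

lemma preim_Spec_map: "q \<in> preim (Spec S) (Spec_map R S h) U \<longleftrightarrow> primeideal q S \<and> contract q \<in> U"
 by (simp add: preim_iff S.Spec_pts mpt_Spec_map)

lemma Spec_map_value:
 assumes "primeideal q S" "contract q \<in> U" "(a, t) \<in> loc_pairs R (contract q)"
   "s (contract q) = lfrac R (contract q) (a, t)"
 shows "mco (Spec_map R S h) U s q = lfrac S q (h a, h t)"
 using assms lfrac_map[OF assms(1,3)] by (simp add: Spec_map_def)

lemma Spec_map_extensional: "mco (Spec_map R S h) U s \<in> extensional (preim (Spec S) (Spec_map R S h) U)"
proof -
 have pre: "preim (Spec S) (Spec_map R S h) U = {q. primeideal q S \<and> contract q \<in> U}"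
  by (auto simp: preim_Spec_map)
 show ?thesis unfolding pre by (simp add: Spec_map_def)
qed

lemma Spec_map_opn:
 assumes "opn (Spec R) U" shows "opn (Spec S) (preim (Spec S) (Spec_map R S h) U)"
proof -
 obtain T where T: "T \<subseteq> carrier R" "U = {p. primeideal p R \<and> \<not> T \<subseteq> p}"
  using assms unfolding R.Spec_opn_iff by blast
 have "preim (Spec S) (Spec_map R S h) U = {q. primeideal q S \<and> \<not> h ` T \<subseteq> q}"
  unfolding T(2) using T(1) contract_prime
  by (simp add: set_eq_iff preim_Spec_map image_subset_iff subset_iff) blast
 moreover have "h ` T \<subseteq> carrier S" using T(1) by auto
 ultimately show ?thesis unfolding S.Spec_opn_iff by blast
qed

lemma Spec_map_section:
 assumes s: "s \<in> Os (Spec R) U"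
 shows "mco (Spec_map R S h) U s \<in> Os (Spec S) (preim (Spec S) (Spec_map R S h) U)"
 unfolding Spec_section_iff
proof (intro conjI ballI Spec_map_extensional)
 let ?f = "Spec_map R S h"
 fix q assume q: "q \<in> preim (Spec S) ?f U"
 hence "contract q \<in> U" by (simp add: preim_Spec_map)
 then obtain W a t where W: "opn (Spec R) W" "contract q \<in> W" "W \<subseteq> U" and at: "fraction_on R s W a t"
  by (rule Spec_sectionE[OF s])
 have "fraction_on S (mco ?f U s) (preim (Spec S) ?f W) (h a) (h t)"
  unfolding fraction_on_def
 proof
  fix p assume "p \<in> preim (Spec S) ?f W"
  hence p: "primeideal p S" "contract p \<in> W" by (simp_all add: preim_Spec_map)
  thus "(h a, h t) \<in> loc_pairs S p \<and> mco ?f U s p = lfrac S p (h a, h t)"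
   using Spec_map_value[where s = s, OF p(1) subsetD[OF W(3) p(2)]
     fraction_onD[OF at p(2)]] loc_pairs_map[OF fraction_onD(1)[OF at p(2)]]
   by simp
 qed
 moreover have "q \<in> preim (Spec S) ?f W" using q W(2) by (simp add: preim_Spec_map)
 ultimately show "\<exists>W a t. opn (Spec S) W \<and> q \<in> W \<and> W \<subseteq> preim (Spec S) ?f U \<and>
   fraction_on S (mco ?f U s) W a t"
  using Spec_map_opn[OF W(1)] preim_mono[OF W(3)]
  by (intro exI[of _ "preim (Spec S) ?f W"] exI[of _ "h a"] exI[of _ "h t"] conjI)
qed

lemma Spec_map_ops:
 assumes s: "s \<in> Os (Spec R) U" and s': "s' \<in> Os (Spec R) U"
 defines "f \<equiv> Spec_map R S h"
 shows "mco f U (s *[osec (Spec R) U] s') = mco f U s *[osec (Spec S) (preim (Spec S) f U)] mco f U s'"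
  "mco f U (s +[osec (Spec R) U] s') = mco f U s +[osec (Spec S) (preim (Spec S) f U)] mco f U s'"
proof -
 have "mco f U (s *[osec (Spec R) U] s') q = mco f U s q *[localization S q] mco f U s' q
   \<and> mco f U (s +[osec (Spec R) U] s') q = mco f U s q +[localization S q] mco f U s' q"
  if "q \<in> preim (Spec S) f U" for q
 proof -
  have q: "primeideal q S" "contract q \<in> U" using that by (simp_all add: f_def preim_Spec_map)
  interpret q: prime_at q S using q(1) by (simp add: prime_at_def)
  note p = contract_prime_at[OF q(1)]
  obtain a t where x: "(a, t) \<in> loc_pairs R (contract q)" "s (contract q) = lfrac R (contract q) (a, t)"
   by (rule Spec_section_valueE[OF s q(2)])
  obtain b u where y: "(b, u) \<in> loc_pairs R (contract q)"
    "s' (contract q) = lfrac R (contract q) (b, u)"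
   by (rule Spec_section_valueE[OF s' q(2)])
  have xy: "(s *[osec (Spec R) U] s') (contract q) = lfrac R (contract q) (a *[R] b, t *[R] u)"
   "(s +[osec (Spec R) U] s') (contract q) = lfrac R (contract q) (a *[R] u +[R] b *[R] t, t *[R] u)"
   using x y q(2) by (simp_all add: Spec_sel prime_at.lfrac_mult[OF p] prime_at.lfrac_add[OF p])
  note vals = Spec_map_value[where s = s, OF q x] Spec_map_value[where s = s', OF q y]
   Spec_map_value[where s = "s *[osec (Spec R) U] s'",
     OF q prime_at.loc_pairs_mult[OF p x(1) y(1)] xy(1)]
   Spec_map_value[where s = "s +[osec (Spec R) U] s'",
     OF q prime_at.loc_pairs_add[OF p x(1) y(1)] xy(2)]
  show ?thesis unfolding f_def vals q.lfrac_mult[OF loc_pairs_map[OF x(1)] loc_pairs_map[OF y(1)]]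
    q.lfrac_add[OF loc_pairs_map[OF x(1)] loc_pairs_map[OF y(1)]]
   using x y by (simp add: loc_pairs_iff)
 qed
 thus "mco f U (s *[osec (Spec R) U] s') = mco f U s *[osec (Spec S) (preim (Spec S) f U)] mco f U s'"
  "mco f U (s +[osec (Spec R) U] s') = mco f U s +[osec (Spec S) (preim (Spec S) f U)] mco f U s'"
  unfolding f_def by (intro extensionalityI[OF Spec_map_extensional]; simp add: Spec_sel)+
qed

lemma Spec_map_one:
 "mco (Spec_map R S h) U 1[osec (Spec R) U] = 1[osec (Spec S) (preim (Spec S) (Spec_map R S h) U)]"
proof (rule extensionalityI[OF Spec_map_extensional])
 fix q assume q: "q \<in> preim (Spec S) (Spec_map R S h) U"
 hence "(1[R], 1[R]) \<in> loc_pairs R (contract q)"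
  using prime_at.one_notin[OF contract_prime_at] by (simp add: loc_pairs_iff preim_Spec_map)
 thus "mco (Spec_map R S h) U 1[osec (Spec R) U] q =
   1[osec (Spec S) (preim (Spec S) (Spec_map R S h) U)] q"
  using q Spec_map_value[of q U "1[R]" "1[R]" "1[osec (Spec R) U]"]
  by (simp add: preim_Spec_map Spec_sel)
qed (simp add: Spec_sel)

lemma Spec_map_pre_hom: "pre_hom (Spec S) (Spec R) (Spec_map R S h)"
 unfolding pre_hom_def
proof (intro conjI allI impI ballI)
 show "continuous_map (tp (Spec S)) (tp (Spec R)) (mpt (Spec_map R S h))"
  unfolding continuous_map_def using contract_prime Spec_map_opn
  by (auto simp: R.Spec_pts S.Spec_pts mpt_Spec_map preim_def)
 show "mco (Spec_map R S h) U \<in> ring_hom (osec (Spec R) U)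
   (osec (Spec S) (preim (Spec S) (Spec_map R S h) U))"
  if "opn (Spec R) U" for U
  by (rule ring_hom_memI) (simp_all add: Spec_map_section Spec_map_ops Spec_map_one)
 fix U W s assume "opn (Spec R) U \<and> opn (Spec R) W \<and> W \<subseteq> U"
 thus "mco (Spec_map R S h) W (ores (Spec R) U W s) =
   ores (Spec S) (preim (Spec S) (Spec_map R S h) U) (preim (Spec S) (Spec_map R S h) W)
    (mco (Spec_map R S h) U s)"
  by (intro extensionalityI[OF Spec_map_extensional]) (auto simp: Spec_sel preim_Spec_map, simp_all
    add: Spec_map_def subset_iff)
qed

end

lemma affine_homI: "cring R \<Longrightarrow> cring S \<Longrightarrow> h \<in> ring_hom R S \<Longrightarrow> affine_hom R S h"
 by (simp add: affine_hom_def affine_scheme_def ring_hom_cring_def ring_hom_cring_axioms_def)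

lemma Spec_map_comp:
 assumes f: "affine_hom R Q f" and g: "affine_hom Q A g" and h: "affine_hom R A h"
  and hgf: "\<And>a. a \<in> carrier R \<Longrightarrow> h a = g (f a)"
 shows "mor_eq (Spec A) (Spec R) (Spec_map R A h) (mor_comp (Spec Q) (Spec_map R Q f) (Spec_map Q A g))"
proof -
 interpret f: affine_hom R Q f by (rule f)
 interpret g: affine_hom Q A g by (rule g)
 interpret h: affine_hom R A h by (rule h)
 have contract_contract: "f.contract (g.contract q) = h.contract q" for q using hgf by auto
 show ?thesis
  unfolding mor_eq_def
 proof (intro conjI ballI allI impI)
  fix q show "mpt (Spec_map R A h) q = mpt (mor_comp (Spec Q) (Spec_map R Q f) (Spec_map Q A g)) q"
   by (simp only: mor_comp_def rmor.simps f.mpt_Spec_map g.mpt_Spec_map h.mpt_Spec_map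
     contract_contract)
 next
  fix U s assume U: "opn (Spec R) U" and s: "s \<in> Os (Spec R) U"
  let ?W = "preim (Spec Q) (Spec_map R Q f) U"
  have pre: "preim (Spec A) (Spec_map Q A g) ?W = preim (Spec A) (Spec_map R A h) U"
   using g.contract_prime contract_contract
   by (auto simp only: f.preim_Spec_map g.preim_Spec_map h.preim_Spec_map)
  have "mco (Spec_map R A h) U s = mco (Spec_map Q A g) ?W (mco (Spec_map R Q f) U s)"
  proof (rule extensionalityI[OF h.Spec_map_extensional g.Spec_map_extensional[of ?W, unfolded pre]])
   fix q assume "q \<in> preim (Spec A) (Spec_map R A h) U"
   hence q: "primeideal q A" "h.contract q \<in> U" by (simp_all only: h.preim_Spec_map)
   have gq: "primeideal (g.contract q) Q" "f.contract (g.contract q) \<in> U" "g.contract q \<in> ?W"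
    using q g.contract_prime[OF q(1)] unfolding f.preim_Spec_map contract_contract by blast+
   obtain a t where x: "(a, t) \<in> loc_pairs R (h.contract q)"
     "s (h.contract q) = lfrac R (h.contract q) (a, t)"
    by (rule Spec_section_valueE[OF s q(2)])
   hence x': "(a, t) \<in> loc_pairs R (f.contract (g.contract q))"
    "s (f.contract (g.contract q)) = lfrac R (f.contract (g.contract q)) (a, t)"
    by (simp_all only: contract_contract)
   have fs: "mco (Spec_map R Q f) U s (g.contract q) = lfrac Q (g.contract q) (f a, f t)"
    by (rule f.Spec_map_value[where s = s, OF gq(1,2) x'])
   have gfs: "mco (Spec_map Q A g) ?W (mco (Spec_map R Q f) U s) q = lfrac A q (g (f a), g (f t))"
    by (rule g.Spec_map_value[where s = "mco (Spec_map R Q f) U s", OF q(1) gq(3)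
      f.loc_pairs_map[OF x'(1)] fs])
   have hs: "mco (Spec_map R A h) U s q = lfrac A q (h a, h t)"
    by (rule h.Spec_map_value[where s = s, OF q x])
   show "mco (Spec_map R A h) U s q = mco (Spec_map Q A g) ?W (mco (Spec_map R Q f) U s) q"
    using x(1) by (simp add: hs gfs loc_pairs_iff hgf)
  qed
  thus "mco (Spec_map R A h) U s = mco (mor_comp (Spec Q) (Spec_map R Q f) (Spec_map Q A g)) U s"
   by (simp add: mor_comp_def)
 qed
qed

lemma Spec_map_id:
 assumes h: "affine_hom R R h" and id: "\<And>a. a \<in> carrier R \<Longrightarrow> h a = a"
 shows "mor_eq (Spec R) (Spec R) (Spec_map R R h) mor_id"
proof -
 interpret affine_hom R R h by (rule h)
 have contract_id: "contract q = q" if "primeideal q R" for q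
  using id ideal.Icarr[OF primeideal.axioms(1)[OF that]] by auto
 show ?thesis
  unfolding mor_eq_def
 proof (intro conjI ballI allI impI)
  show "mpt (Spec_map R R h) q = mpt mor_id q" if "q \<in> pts (Spec R)" for q
   using that contract_id by (simp add: R.Spec_pts mor_id_def mpt_Spec_map)
 next
  fix U s assume U: "opn (Spec R) U" and s: "s \<in> Os (Spec R) U"
  have prime: "primeideal q R" if "q \<in> U" for q using R.Spec_opn_prime[OF U that]
   by (simp add: prime_at_def)
  have pre: "preim (Spec R) (Spec_map R R h) U = U" using prime contract_id
   by (auto simp: preim_Spec_map)
  have "mco (Spec_map R R h) U s = s"
  proof (rule extensionalityI[OF Spec_map_extensional[of U, unfolded pre]
    Spec_section_extensional[OF s]])
   fix q assume q: "q \<in> U"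
   obtain a t where "(a, t) \<in> loc_pairs R q" "s q = lfrac R q (a, t)"
    by (rule Spec_section_valueE[OF s q])
   thus "mco (Spec_map R R h) U s q = s q"
    using Spec_map_value[OF prime[OF q], of U a t s] contract_id[OF prime[OF q]] q id
    by (simp add: loc_pairs_iff)
  qed
  thus "mco (Spec_map R R h) U s = mco mor_id U s" by (simp add: mor_id_def)
 qed
qed

lemma mor_eq_trans: "mor_eq X Y f g \<Longrightarrow> mor_eq X Y g k \<Longrightarrow> mor_eq X Y f k"
 and mor_eq_sym: "mor_eq X Y f g \<Longrightarrow> mor_eq X Y g f"
 unfolding mor_eq_def by auto

lemma Spec_map_inverse:
 assumes f: "affine_hom R S f" and g: "affine_hom S R g" and gf: "\<And>a. a \<in> carrier R \<Longrightarrow> g (f a) = a"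
 shows "mor_eq (Spec R) (Spec R) (mor_comp (Spec S) (Spec_map R S f) (Spec_map S R g)) mor_id"
proof -
 have gf_hom: "affine_hom R R (\<lambda>a. g (f a))"
  using f g ring_hom_trans[of f R S g R]
  by (simp add: affine_hom_def ring_hom_cring_def ring_hom_cring_axioms_def comp_def)
 show ?thesis
  by (rule mor_eq_trans[OF mor_eq_sym[OF Spec_map_comp[OF f g gf_hom refl]] Spec_map_id[OF gf_hom gf]])
qed

lemma Spec_map_iso:
 assumes Q: "cring Q" and A: "cring A" and k: "k \<in> ring_iso Q A"
 shows "lrs_iso (Spec A) (Spec Q) (Spec_map Q A k)"
proof -
 let ?k' = "inv_into (carrier Q) k"
 have bij: "bij_betw k (carrier Q) (carrier A)" using k by (simp add: ring_iso_def)
 have "?k' \<in> ring_iso A Q" by (rule ring_iso_set_sym[OF cring.axioms(1)[OF Q] k])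
 hence hom: "affine_hom Q A k" "affine_hom A Q ?k'" using k Q A
  by (auto simp: ring_iso_def intro!: affine_homI)
 have "mutually_inverse (Spec A) (Spec Q) (Spec_map Q A k) (Spec_map A Q ?k')"
  unfolding mutually_inverse_def
  by (intro conjI affine_hom.Spec_map_pre_hom Spec_map_inverse hom)
   (use bij in \<open>simp_all add: bij_betw_inv_into_left bij_betw_inv_into_right\<close>)
 thus ?thesis
  by (rule mutually_inverse_lrs_iso[rotated 2])
   (use Q A in \<open>simp_all add: affine_scheme.intro affine_scheme.pre_ring_Spec\<close>)
qed

subsection \<open>Components cut out by a kernel that is killed generically\<close>

definition zero_locus :: "'a ring \<Rightarrow> 'a set \<Rightarrow> 'a set set"
 where "zero_locus R S = {p. primeideal p R \<and> S \<subseteq> p}"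

context affine_scheme
begin

lemma closedin_zero_locus: "S \<subseteq> carrier R \<Longrightarrow> closedin (tp (Spec R)) (zero_locus R S)"
 unfolding closedin_def Spec_pts Spec_opn_iff zero_locus_def by (intro conjI exI[of _ S]) auto

lemma closedin_SpecE:
 assumes "closedin (tp (Spec R)) C"
 obtains S where "S \<subseteq> carrier R" "C = zero_locus R S"
proof -
 have C: "C \<subseteq> {p. primeideal p R}" and "opn (Spec R) ({p. primeideal p R} - C)"
  using assms unfolding closedin_def Spec_pts by simp_all
 then obtain S where S: "S \<subseteq> carrier R" "{p. primeideal p R} - C = {p. primeideal p R \<and> \<not> S \<subseteq> p}"
  unfolding Spec_opn_iff by blast
 have "C = zero_locus R S" using C S(2) unfolding zero_locus_def by blast
 with S(1) show thesis by (rule that)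
qed

lemma Inter_zero_locus: "primeideal P R \<Longrightarrow> \<Inter>(zero_locus R P) = P"
 by (auto simp: zero_locus_def)

lemma irreducible_zero_locus:
 assumes P: "primeideal P R"
 shows "irreducible_set (tp (Spec R)) (zero_locus R P)"
proof -
 have generic: "zero_locus R P \<subseteq> C" if closed: "closedin (tp (Spec R)) C" and C: "P \<in> C" for C
 proof -
  obtain S where "C = zero_locus R S" by (rule closedin_SpecE[OF closed])
  thus ?thesis using C by (auto simp: zero_locus_def)
 qed
 have P_in: "P \<in> zero_locus R P" using P by (simp add: zero_locus_def)
 show ?thesis
  unfolding irreducible_set_def
 proof (intro conjI allI impI)
  show "zero_locus R P \<subseteq> pts (Spec R)" by (auto simp: Spec_pts zero_locus_def)
  show "zero_locus R P \<noteq> {}" using P_in by blast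
  fix C D assume CD: "closedin (tp (Spec R)) C \<and> closedin (tp (Spec R)) D \<and> zero_locus R P \<subseteq> C \<union> D"
  hence "P \<in> C \<or> P \<in> D" using P_in by blast
  thus "zero_locus R P \<subseteq> C \<or> zero_locus R P \<subseteq> D" using generic[of C] generic[of D] CD by blast
 qed
qed

end

locale generic_kernel = affine_hom R A h + A: domain A
 for R :: "'a ring" and A :: "'b ring" and h :: "'a \<Rightarrow> 'b" +
 fixes u :: 'a
 assumes surj: "h ` carrier R = carrier A"
  and u: "u \<in> carrier R" "h u \<noteq> 0[A]"
  and kill: "\<And>b. b \<in> carrier R \<Longrightarrow> h b = 0[A] \<Longrightarrow> u *[R] b = 0[R]"
begin



abbreviation "K \<equiv> a_kernel R A h"

lemma kernel: "K = {a \<in> carrier R. h a = 0[A]}"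
 by (rule a_kernel_def')

sublocale K: prime_at K R
 using contract_prime[OF A.zeroprimeideal] unfolding kernel prime_at_def by simp

lemma component_ideal_kernel: "component_ideal R (zero_locus R K) = K"
 unfolding component_ideal_def R.Inter_zero_locus[OF K.primeideal]
proof (intro equalityI subsetI)
 fix a assume "a \<in> {a \<in> carrier R. \<exists>v\<in>carrier R - K. v *[R] a = 0[R]}"
 then obtain v where v: "a \<in> carrier R" "v \<in> carrier R" "v \<notin> K" "v *[R] a = 0[R]" by blast
 show "a \<in> K" using K.mult_mem_iff[OF v(2,1)] K.zero_in v(3,4) by metis
next
 fix a assume "a \<in> K"
 thus "a \<in> {a \<in> carrier R. \<exists>v\<in>carrier R - K. v *[R] a = 0[R]}" using u kill unfolding kernel by blast
qed

lemma kernel_or_killer_in_prime: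
 assumes "primeideal p R" shows "K \<subseteq> p \<or> u \<in> p"
proof -
 interpret p: prime_at p R using assms by (simp add: prime_at_def)
 have "b \<in> p" if b: "b \<in> K" "u \<notin> p" for b
  using b p.mult_mem_iff[OF u(1), of b] p.zero_in kill[of b] unfolding kernel by auto
 thus ?thesis by blast
qed

lemma component_zero_locus_kernel: "irreducible_component (tp (Spec R)) (zero_locus R K)"
 unfolding irreducible_component_def
proof (intro conjI allI impI R.irreducible_zero_locus K.primeideal)
 fix Z assume Z: "irreducible_set (tp (Spec R)) Z \<and> zero_locus R K \<subseteq> Z"
 have "Z \<subseteq> zero_locus R K \<union> zero_locus R {u}"
 proof
  fix p assume "p \<in> Z"
  hence "primeideal p R" using Z unfolding irreducible_set_def R.Spec_pts by blast
  thus "p \<in> zero_locus R K \<union> zero_locus R {u}" unfolding zero_locus_def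
   using kernel_or_killer_in_prime[of p] by blast
 qed
 moreover have "closedin (tp (Spec R)) (zero_locus R K)" "closedin (tp (Spec R)) (zero_locus R {u})"
  using u(1) unfolding kernel by (blast intro: R.closedin_zero_locus)+
 ultimately have "Z \<subseteq> zero_locus R K \<or> Z \<subseteq> zero_locus R {u}"
  using Z by (simp add: irreducible_set_def)
 moreover have "K \<in> zero_locus R K" "K \<notin> zero_locus R {u}"
  using K.primeideal u unfolding zero_locus_def kernel by blast+
 ultimately show "Z = zero_locus R K" using Z by blast
qed

lemma iso_onto_closed_kernel: "iso_onto_closed (Spec A) R (Spec_map R A h) K"
proof -
 let ?bar = "\<lambda>X. the_elem (h ` X)"
 have Q: "cring (R Quot K)" by (rule K.quotient_is_cring[OF R.is_cring])
 have bar: "?bar \<in> ring_iso (R Quot K) A" by (rule ring.FactRing_iso_set[OF surj])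
 have "affine_hom R (R Quot K) (\<lambda>a. K +>\<^bsub>R\<^esub> a)" "affine_hom (R Quot K) A ?bar"
  using K.rcos_ring_hom bar by (auto intro!: affine_homI R.is_cring Q S.is_cring simp: ring_iso_def)
 thus ?thesis
  unfolding iso_onto_closed_def
  by (intro conjI K.is_ideal exI[of _ "Spec_map (R Quot K) A ?bar"] Spec_map_iso[OF Q S.is_cring bar]
   Spec_map_comp affine_hom_axioms) simp_all
qed

end

section \<open>Tensor products of modules along a ring homomorphism\<close>

lemma tens_null_cong:
 assumes "\<And>r. r \<in> carrier R \<Longrightarrow> h r = k r" shows "tens_null R h M N = tens_null R k M N"
proof -
 have "z \<in> tens_null R k M N" if "z \<in> tens_null R h M N" "\<And>r. r \<in> carrier R \<Longrightarrow> h r = k r" for z h k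
  using that(1) by (induction rule: tens_null.induct) (simp_all add: that(2) tens_null.intros)
 from this[of _ h k] this[of _ k h] show ?thesis using assms by (auto simp only:)
qed

locale tensor_product = M: module R M + N: module S N
 for R :: "'r ring" and S :: "'s ring" and M :: "('r, 'm) module" and N :: "('s, 'n) module" +
 fixes h :: "'r \<Rightarrow> 's"
 assumes hom: "h \<in> ring_hom R S"
begin

abbreviation T where "T \<equiv> tens_module R h M N"
abbreviation cls where "cls \<equiv> tens_class R h M N"
abbreviation null where "null \<equiv> tens_null R h M N"
abbreviation "formal_sum z \<equiv> keys z \<subseteq> carrier M \<times> carrier N"
abbreviation pure where "pure m n \<equiv> cls (frag_of (m, n))"

lemma null_uminus: "z \<in> null \<Longrightarrow> - z \<in> null"
 using tens_null.diff[OF tens_null.zero] by fastforce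

lemma null_plus: "z \<in> null \<Longrightarrow> w \<in> null \<Longrightarrow> z + w \<in> null"
 using tens_null.diff[OF _ null_uminus] by fastforce

lemma cls_mem_iff: "v \<in> cls z \<longleftrightarrow> formal_sum v \<and> v - z \<in> null"
 by (simp add: tens_class_def)

lemma cls_self: "formal_sum z \<Longrightarrow> z \<in> cls z"
 by (simp add: cls_mem_iff tens_null.zero)

lemma cls_eqI:
 assumes "z - w \<in> null" shows "cls z = cls w"
proof -
 have cls_subset: "cls z \<subseteq> cls w" if "z - w \<in> null" for z w
  using null_plus[OF _ that] by (fastforce simp: cls_mem_iff)
 show ?thesis using cls_subset[OF assms] cls_subset[of w z] null_uminus[OF assms] by auto
qed

lemma cls_eqD: "cls z = cls w \<Longrightarrow> formal_sum z \<Longrightarrow> z - w \<in> null"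
 using cls_self[of z] cls_mem_iff[of z w] by simp

lemma cls_closed: "formal_sum z \<Longrightarrow> cls z \<in> carrier T"
 by (auto simp: tens_module_def)

lemma clsE:
 assumes "A \<in> carrier T" obtains z where "formal_sum z" "A = cls z"
 using assms by (auto simp: tens_module_def)

lemma formal_sum_plus: "formal_sum z \<Longrightarrow> formal_sum w \<Longrightarrow> formal_sum (z + w)"
 using keys_add[of z w] by blast

lemma formal_sum_minus: "formal_sum z \<Longrightarrow> formal_sum w \<Longrightarrow> formal_sum (z - w)"
 using keys_diff[of z w] by blast

lemma cls_add:
 assumes "formal_sum z" "formal_sum w" shows "cls z +[T] cls w = cls (z + w)"
proof -
 have "cls z +[T] cls w = (\<Union>z'\<in>cls z. \<Union>w'\<in>cls w. cls (z' + w'))" by (simp add: tens_module_def)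
 also have "... = cls (z + w)"
 proof (rule UN_const2[OF cls_self[OF assms(1)] cls_self[OF assms(2)]])
  fix z' w' assume "z' \<in> cls z" "w' \<in> cls w"
  thus "cls (z' + w') = cls (z + w)"
   using null_plus[of "z' - z" "w' - w"] by (intro cls_eqI) (simp add: cls_mem_iff algebra_simps)
 qed
 finally show ?thesis .
qed

lemma zero_eq_cls: "0[T] = cls 0" by (simp add: tens_module_def)

lemma abelian_group: "abelian_group T"
proof (rule abelian_groupI)
 show "0[T] \<in> carrier T" by (simp add: zero_eq_cls cls_closed)
 fix A assume "A \<in> carrier T"
 then obtain z where z: "formal_sum z" "A = cls z" by (rule clsE)
 show "0[T] +[T] A = A" using z by (simp add: zero_eq_cls cls_add)
 show "\<exists>B\<in>carrier T. B +[T] A = 0[T]"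
  using z cls_add[of "- z" z] by (intro bexI[of _ "cls (- z)"]) (simp_all add: zero_eq_cls cls_closed)
 fix B assume "B \<in> carrier T"
 then obtain w where w: "formal_sum w" "B = cls w" by (rule clsE)
 show "A +[T] B \<in> carrier T" "A +[T] B = B +[T] A"
  using z w by (simp_all add: cls_add cls_closed formal_sum_plus add.commute)
 fix C assume "C \<in> carrier T"
 then obtain v where "formal_sum v" "C = cls v" by (rule clsE)
 thus "A +[T] B +[T] C = A +[T] (B +[T] C)" using z w by (simp add: cls_add formal_sum_plus add.assoc)
qed

subsection \<open>Scalar multiplication\<close>

abbreviation scale :: "'s \<Rightarrow> ('m \<times> 'n \<Rightarrow>\<^sub>0 int) \<Rightarrow> ('m \<times> 'n \<Rightarrow>\<^sub>0 int)"
 where "scale a \<equiv> frag_extend (\<lambda>(m, n). frag_of (m, a *.[N] n))"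

lemma scale_formal_sum:
 assumes "a \<in> carrier S" "formal_sum z" shows "formal_sum (scale a z)"
proof (rule order_trans[OF keys_frag_extend])
 show "(\<Union>x\<in>keys z. keys (case x of (m, n) \<Rightarrow> frag_of (m, a *.[N] n))) \<subseteq> carrier M \<times> carrier N"
  using assms by auto
qed

lemma null_scale:
 assumes a: "a \<in> carrier S" and z: "z \<in> null" shows "scale a z \<in> null"
 using z
proof (induction rule: tens_null.induct)
 case (balanced r m n)
 have "a *.[N] (h r *.[N] n) = h r *.[N] (a *.[N] n)"
  using a balanced ring_hom_closed[OF hom] by (simp add: N.smult_assoc1[symmetric] N.R.m_comm)
 thus ?case using tens_null.balanced[of r R m M "a *.[N] n" N h] a balanced
  by (simp add: frag_extend_diff)
next
 case (add_right m n n')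
 thus ?case using tens_null.add_right[of m M "a *.[N] n" N "a *.[N] n'" R h] a
  by (simp add: frag_extend_diff N.smult_r_distr)
next
 case (add_left m m' n)
 thus ?case using tens_null.add_left[of m M m' "a *.[N] n" N R h] a by (simp add: frag_extend_diff)
qed (simp_all add: frag_extend_diff tens_null.intros)

lemma cls_smult:
 assumes a: "a \<in> carrier S" and z: "formal_sum z" shows "a *.[T] cls z = cls (scale a z)"
proof -
 have "cls (scale a w) = cls (scale a z)" if "w \<in> cls z" for w
  using null_scale[OF a, of "w - z"] that by (intro cls_eqI) (simp add: cls_mem_iff frag_extend_diff)
 hence "(\<Union>w\<in>cls z. cls (scale a w)) = cls (scale a z)" by (rule UN_const[OF cls_self[OF z]])
 thus ?thesis by (simp add: tens_module_def)
qed

lemma null_scale_add: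
 assumes ab: "a \<in> carrier S" "b \<in> carrier S" and z: "formal_sum z"
 shows "scale (a +[S] b) z - (scale a z + scale b z) \<in> null"
 using z
proof (induction z rule: frag_induction)
 case (one x)
 obtain m n where x: "x = (m, n)" "m \<in> carrier M" "n \<in> carrier N" using one by auto
 thus ?case using tens_null.add_right[of m M "a *.[N] n" N "b *.[N] n" R h] ab
  by (simp add: N.smult_l_distr diff_diff_eq)
next
 case (diff z w)
 from tens_null.diff[OF this] show ?case by (simp add: frag_extend_diff algebra_simps)
qed (simp add: tens_null.zero)

lemma scale_scale:
 assumes "a \<in> carrier S" "b \<in> carrier S" "formal_sum z" shows "scale a (scale b z) = scale (a *[S] b) z"
 using assms(3)
 by (induction z rule: frag_induction) (auto simp: frag_extend_diff N.smult_assoc1 assms(1,2))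

lemma scale_one:
 assumes "formal_sum z" shows "scale 1[S] z = z"
 using assms by (induction z rule: frag_induction) (auto simp: frag_extend_diff)

lemma module: "module S T"
proof (rule moduleI[OF N.R.is_cring abelian_group])
 fix A assume "A \<in> carrier T"
 then obtain z where z: "formal_sum z" "A = cls z" by (rule clsE)
 show "1[S] *.[T] A = A" using z by (simp add: cls_smult scale_one)
 fix a assume a: "a \<in> carrier S"
 show "a *.[T] A \<in> carrier T" using a z by (simp add: cls_smult cls_closed scale_formal_sum)
 fix b assume b: "b \<in> carrier S"
 show "(a +[S] b) *.[T] A = a *.[T] A +[T] b *.[T] A"
  using a b z by (simp add: cls_smult cls_add scale_formal_sum cls_eqI[OF null_scale_add])
 show "(a *[S] b) *.[T] A = a *.[T] (b *.[T] A)"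
  using a b z by (simp add: cls_smult scale_formal_sum scale_scale)
next
 fix a A B assume a: "a \<in> carrier S" and "A \<in> carrier T" "B \<in> carrier T"
 then obtain z w where "formal_sum z" "A = cls z" "formal_sum w" "B = cls w" by (elim clsE)
 thus "a *.[T] (A +[T] B) = a *.[T] A +[T] a *.[T] B"
  using a by (simp add: cls_add cls_smult formal_sum_plus scale_formal_sum frag_extend_add)
qed

subsection \<open>Pure tensors\<close>

lemma pure_closed: "m \<in> carrier M \<Longrightarrow> n \<in> carrier N \<Longrightarrow> pure m n \<in> carrier T"
 by (simp add: cls_closed)

lemma pure_balanced:
 assumes "r \<in> carrier R" "m \<in> carrier M"
   "n \<in> carrier N" shows "pure (r *.[M] m) n = pure m (h r *.[N] n)"
 by (rule cls_eqI[OF tens_null.balanced[OF assms]])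

lemma pure_add_right:
 assumes "m \<in> carrier M" "n \<in> carrier N"
   "n' \<in> carrier N" shows "pure m n +[T] pure m n' = pure m (n +[N] n')"
proof -
 have "cls (frag_of (m, n) + frag_of (m, n')) = pure m (n +[N] n')"
  by (rule cls_eqI[symmetric]) (use tens_null.add_right[OF assms] in \<open>simp add: diff_diff_eq\<close>)
 thus ?thesis using assms by (simp add: cls_add)
qed

lemma pure_smult: "\<lbrakk>a \<in> carrier S; m \<in> carrier M; n \<in> carrier N\<rbrakk> \<Longrightarrow> a *.[T] pure m n =
  pure m (a *.[N] n)"
 by (simp add: cls_smult)

lemma pure_zero_right:
 assumes "m \<in> carrier M" shows "pure m 0[N] = 0[T]"
proof -
 have "0 - frag_of (m, 0[N]) \<in> null" using tens_null.add_right[OF assms N.zero_closed N.zero_closed,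
   of R h] by simp
 from cls_eqI[OF this] show ?thesis by (simp add: zero_eq_cls)
qed

lemma pure_eqD_bilinear:
 assumes P: "abelian_group P" and closed: "\<And>m n. \<lbrakk>m \<in> carrier M; n \<in> carrier N\<rbrakk> \<Longrightarrow> b m n \<in> carrier P"
  and add_left: "\<And>m m' n. \<lbrakk>m \<in> carrier M; m' \<in> carrier M; n \<in> carrier N\<rbrakk> \<Longrightarrow> b (m +[M] m') n =
    b m n +[P] b m' n"
  and add_right: "\<And>m n n'. \<lbrakk>m \<in> carrier M; n \<in> carrier N; n' \<in> carrier N\<rbrakk> \<Longrightarrow> b m (n +[N] n') =
    b m n +[P] b m n'"
  and balanced: "\<And>r m n. \<lbrakk>r \<in> carrier R; m \<in> carrier M; n \<in> carrier N\<rbrakk> \<Longrightarrow> b (r *.[M] m) n =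
    b m (h r *.[N] n)"
  and mn: "m \<in> carrier M" "n \<in> carrier N" "m' \<in> carrier M"
    "n' \<in> carrier N" and eq: "pure m n = pure m' n'"
 shows "b m n = b m' n'"
proof -
 interpret P: abelian_group P by (rule P)
 have "(\<lambda>(m, n). b m n) ` (carrier M \<times> carrier N) \<subseteq> carrier (add_monoid P)" using closed by auto
 then obtain E where E: "E \<in> Group.hom (free_Abelian_group (carrier M \<times> carrier N)) (add_monoid P)"
  and E_of: "\<And>m n. \<lbrakk>m \<in> carrier M; n \<in> carrier N\<rbrakk> \<Longrightarrow> E (frag_of (m, n)) = b m n"
  using comm_group.free_Abelian_group_universal[OF P.a_comm_group]
  by (metis (no_types, lifting) SigmaI case_prod_conv)
 have E_closed: "E z \<in> carrier P" if "formal_sum z" for z using E that by (auto simp: hom_def)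
 have E_diff: "E (z - w) = E z \<ominus>\<^bsub>P\<^esub> E w" if "formal_sum z" "formal_sum w" for z w
 proof -
  have zw: "formal_sum (z - w)" by (rule formal_sum_minus[OF that])
  have "E z = E (z - w) +[P] E w" using hom_mult[OF E, of "z - w" w] that zw by simp
  thus ?thesis using E_closed[OF zw] E_closed[OF that(2)] by (simp add: P.minus_eq P.a_assoc P.r_neg)
 qed
 have E_zero: "E 0 = 0[P]" using E_diff[of 0 0] E_closed[of 0] by (simp add: P.r_neg P.minus_eq)
 have "formal_sum z \<and> E z = 0[P]" if "z \<in> null" for z
  using that
 proof (induction rule: tens_null.induct)
  case (add_left m m' n)
  thus ?case using E_diff E_of assms(2,3) formal_sum_minus[OF formal_sum_minus]
   by (simp add: formal_sum_minus P.minus_eq P.a_ac P.r_neg P.minus_add)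
 next
  case (add_right m n n')
  thus ?case using E_diff E_of assms(2,4)
   by (simp add: formal_sum_minus P.minus_eq P.a_ac P.r_neg P.minus_add)
 next
  case (balanced r m n)
  thus ?case using E_diff E_of assms(2,5) ring_hom_closed[OF hom]
   by (simp add: formal_sum_minus P.minus_eq P.r_neg)
 qed (simp_all add: E_zero E_diff formal_sum_minus P.minus_eq)
 hence "b m n \<ominus>\<^bsub>P\<^esub> b m' n' = 0[P]" using E_diff[of "frag_of (m, n)"
   "frag_of (m', n')"] cls_eqD[OF eq] mn E_of by simp
 thus ?thesis using P.minus_equality[of "b m n" "\<ominus>\<^bsub>P\<^esub> b m' n'"] closed mn by (simp add: P.minus_eq)
qed

end

locale tensor_product_rank_one = tensor_product R S M N h
 for R :: "'r ring" and S :: "'s ring" and M :: "('r, 'm) module" and N :: "('s, 'n) module"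
   and h :: "'r \<Rightarrow> 's" +
 fixes e :: 'm
 assumes e: "e \<in> carrier M" and basis: "\<And>m. m \<in> carrier M \<Longrightarrow> \<exists>!r. r \<in> carrier R \<and> m = r *.[M] e"
begin

definition coord :: "'m \<Rightarrow> 'r"
 where "coord m = (THE r. r \<in> carrier R \<and> m = r *.[M] e)"

lemma coord: "m \<in> carrier M \<Longrightarrow> coord m \<in> carrier R" "m \<in> carrier M \<Longrightarrow> coord m *.[M] e = m"
 using theI'[OF basis] by (simp_all add: coord_def)

lemma coord_eqI: "\<lbrakk>r \<in> carrier R; m = r *.[M] e\<rbrakk> \<Longrightarrow> coord m = r"
 unfolding coord_def by (rule the1_equality[OF basis]) (use e in simp_all)

lemma pure_basis_inj:
 assumes n: "n \<in> carrier N" "n' \<in> carrier N" and eq: "pure e n = pure e n'" shows "n = n'"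
proof -
 have "h (coord e) *.[N] n = h (coord e) *.[N] n'"
 proof (rule pure_eqD_bilinear[where b = "\<lambda>m n. h (coord m) *.[N] n", OF N.abelian_group_axioms _ _
   _ _ e n(1) e n(2) eq])
  fix m assume m: "m \<in> carrier M"
  hence hm: "h (coord m) \<in> carrier S" using coord(1) ring_hom_closed[OF hom] by blast
  fix n assume n: "n \<in> carrier N"
  show "h (coord m) *.[N] n \<in> carrier N" using hm n by simp
  show "h (coord m) *.[N] (n +[N] n') = h (coord m) *.[N] n +[N] h (coord m) *.[N] n'"
    if "n' \<in> carrier N" for n'
   using hm n that by (simp add: N.smult_r_distr)
  show "h (coord (m +[M] m')) *.[N] n = h (coord m) *.[N] n +[N] h (coord m') *.[N] n"
    if m': "m' \<in> carrier M" for m'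
  proof -
   have "coord (m +[M] m') = coord m +[R] coord m'"
    using coord m m' e by (intro coord_eqI) (simp_all add: M.smult_l_distr)
   thus ?thesis using hm n coord(1) m m' ring_hom_closed[OF hom]
    by (simp add: ring_hom_add[OF hom] N.smult_l_distr)
  qed
  show "h (coord (r *.[M] m)) *.[N] n = h (coord m) *.[N] (h r *.[N] n)" if r: "r \<in> carrier R" for r
  proof -
   have "coord (r *.[M] m) = r *[R] coord m" using coord m r e
    by (intro coord_eqI) (simp_all add: M.smult_assoc1)
   moreover have "h r \<in> carrier S" using r ring_hom_closed[OF hom] by blast
   ultimately show ?thesis using hm n coord(1) m r
    by (simp add: ring_hom_mult[OF hom] N.smult_assoc1[symmetric] N.R.m_comm)
  qed
 qed
 moreover have "coord e = 1[R]" using e by (intro coord_eqI) simp_all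
 ultimately show ?thesis using n ring_hom_one[OF hom] by simp
qed

end

section \<open>Free generators and line bundles\<close>

lemma free_genD:
 assumes "free_gen X F U e"
 shows "opn X U" "e \<in> Ms F U"
  "\<lbrakk>opn X W; W \<subseteq> U; s \<in> Ms F W\<rbrakk> \<Longrightarrow> \<exists>!a. a \<in> Os X W \<and> s = a *.[msec F W] mres F U W e"
 using assms unfolding free_gen_def by simp_all

lemma free_genE:
 assumes "free_gen X F U e" "opn X W" "W \<subseteq> U" "s \<in> Ms F W"
 obtains a where "a \<in> Os X W" "s = a *.[msec F W] mres F U W e"
 using free_genD(3)[OF assms] by blast

lemma line_bundleD:
 assumes "line_bundle X F"
 shows "mod_sheaf X F" "p \<in> pts X \<Longrightarrow> \<exists>U e. p \<in> U \<and> free_gen X F U e"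
 using assms by (simp_all add: line_bundle_def)

context module_sheaf
begin

lemma free_gen_cancel:
 assumes g: "free_gen X F U e" and W: "opn X W" "W \<subseteq> U" and ab: "a \<in> Os X W" "b \<in> Os X W"
  and eq: "a *.[msec F W] mres F U W e = b *.[msec F W] mres F U W e"
 shows "a = b"
proof -
 have "a *.[msec F W] mres F U W e \<in> Ms F W"
  by (rule smult_closed[OF W(1) ab(1) res_closed[OF free_genD(1)[OF g] W free_genD(2)[OF g]]])
 from free_genD(3)[OF g W this] show ?thesis using ab eq by metis
qed

lemma free_gen_res:
 assumes "free_gen X F U e" "opn X W" "W \<subseteq> U"
 shows "free_gen X F W (mres F U W e)"
 unfolding free_gen_def
proof (intro conjI allI impI ballI)
 note U = free_genD[OF assms(1)]
 show "opn X W" by fact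
 show "mres F U W e \<in> Ms F W" by (rule res_closed[OF U(1) assms(2,3) U(2)])
 fix Z s assume "opn X Z \<and> Z \<subseteq> W" "s \<in> Ms F Z"
 hence Z: "opn X Z" "Z \<subseteq> W" "Z \<subseteq> U" "s \<in> Ms F Z" using assms(3) by auto
 show "\<exists>!a. a \<in> Os X Z \<and> s = a *.[msec F Z] mres F W Z (mres F U W e)"
  unfolding res_res[OF U(1) assms(2) Z(1,2) assms(3) U(2)] by (rule U(3)[OF Z(1,3,4)])
qed

lemma free_gen_stalk_generates:
 assumes g: "free_gen X F U e" and p: "p \<in> U" and m: "m \<in> carrier (mstalk X F p)"
 shows "\<exists>a\<in>carrier (ostalk X p). m = a *.[mstalk X F p] mgerm X F p U e"
proof -
 note U = free_genD(1,2)[OF g]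
 obtain W s where W: "opn X W" "p \<in> W" "s \<in> Ms F W" "m = mgerm X F p W s" by (rule mstalkE[OF m])
 let ?Z = "U \<inter> W"
 have Z: "opn X ?Z" "p \<in> ?Z" "?Z \<subseteq> U" "?Z \<subseteq> W" using U W p by auto
 obtain a where a: "a \<in> Os X ?Z" "mres F W ?Z s = a *.[msec F ?Z] mres F U ?Z e"
  by (rule free_genE[OF g Z(1,3) res_closed[OF W(1) Z(1,4) W(3)]])
 have "m = ogerm X p ?Z a *.[mstalk X F p] mgerm X F p U e"
  using mstalk_smult[OF Z(1,2) a(1) res_closed[OF U(1) Z(1,3) U(2)]] mgerm_res[OF W(1) Z(1,4,2) W(3)]
   mgerm_res[OF U(1) Z(1,3,2) U(2)] a(2) W(4) by simp
 thus ?thesis using ogerm_closed[OF Z(1,2) a(1)] by blast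
qed

lemma free_gen_stalk_cancel:
 assumes g: "free_gen X F U e" and p: "p \<in> U"
  and ab: "a \<in> carrier (ostalk X p)" "b \<in> carrier (ostalk X p)"
  and eq: "a *.[mstalk X F p] mgerm X F p U e = b *.[mstalk X F p] mgerm X F p U e"
 shows "a = b"
proof -
 note U = free_genD(1,2)[OF g]
 obtain W s t where W: "opn X W" "p \<in> W" "s \<in> Os X W" "t \<in> Os X W" "a = ogerm X p W s"
   "b = ogerm X p W t"
  by (rule ostalk_common_nhd[OF ab])
 let ?Z = "U \<inter> W"
 have Z: "opn X ?Z" "p \<in> ?Z" "?Z \<subseteq> U" "?Z \<subseteq> W" using U W p by auto
 let ?s = "ores X W ?Z s" and ?t = "ores X W ?Z t" and ?e = "mres F U ?Z e"
 have c: "?s \<in> Os X ?Z" "?t \<in> Os X ?Z" "?e \<in> Ms F ?Z"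
  by (rule ores_closed[OF W(1) Z(1,4) W(3)], rule ores_closed[OF W(1) Z(1,4) W(4)], rule
    res_closed[OF U(1) Z(1,3) U(2)])
 have germs: "a = ogerm X p ?Z ?s" "b = ogerm X p ?Z ?t" "mgerm X F p U e = mgerm X F p ?Z ?e"
  using ogerm_res[OF W(1) Z(1,4,2)] mgerm_res[OF U(1) Z(1,3,2) U(2)] W by simp_all
 have "mgerm X F p ?Z (?s *.[msec F ?Z] ?e) = mgerm X F p ?Z (?t *.[msec F ?Z] ?e)"
  using eq unfolding germs mstalk_smult[OF Z(1,2) c(1,3)] mstalk_smult[OF Z(1,2) c(2,3)] .
 then obtain Q where Q: "opn X Q" "p \<in> Q" "Q \<subseteq> ?Z"
  "mres F ?Z Q (?s *.[msec F ?Z] ?e) = mres F ?Z Q (?t *.[msec F ?Z] ?e)"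
  by (rule mgerm_eqE[OF _ Z(1,2) smult_closed[OF Z(1) c(2,3)]])
 have QU: "Q \<subseteq> U" using Q Z by auto
 have "ores X ?Z Q ?s *.[msec F Q] mres F U Q e = ores X ?Z Q ?t *.[msec F Q] mres F U Q e"
  using Q(4) res_smult[OF Z(1) Q(1,3) c(1,3)] res_smult[OF Z(1) Q(1,3) c(2,3)] res_res[OF U(1) Z(1)
    Q(1,3) Z(3) U(2)] by simp
 hence "ores X ?Z Q ?s = ores X ?Z Q ?t"
  by (rule free_gen_cancel[OF g Q(1) QU ores_closed[OF Z(1) Q(1,3) c(1)]
    ores_closed[OF Z(1) Q(1,3) c(2)]])
 thus "a = b" unfolding germs(1,2)
  using ogerm_res[OF Z(1) Q(1,3,2) c(1)] ogerm_res[OF Z(1) Q(1,3,2) c(2)] by simp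
qed

end

section \<open>Sheaves of functions with values in stalks\<close>

definition locally_in :: "('p, 'a) rspace \<Rightarrow> ('p set \<Rightarrow> ('p \<Rightarrow> 't) set) \<Rightarrow> 'p set \<Rightarrow> ('p \<Rightarrow> 't) \<Rightarrow> bool"
 where "locally_in X loc U s \<longleftrightarrow> (\<forall>p\<in>U. \<exists>W t. opn X W \<and> p \<in> W \<and> W \<subseteq> U \<and> t \<in> loc W \<and> (\<forall>q\<in>W. s q = t q))"

lemma locally_inE:
 assumes "locally_in X loc U s" "p \<in> U"
 obtains W t where "opn X W" "p \<in> W" "W \<subseteq> U" "t \<in> loc W" "\<forall>q\<in>W. s q = t q"
 using assms unfolding locally_in_def by meson

lemma locally_inI: "\<lbrakk>opn X U; t \<in> loc U; \<forall>q\<in>U. s q = t q\<rbrakk> \<Longrightarrow> locally_in X loc U s"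
 unfolding locally_in_def by (intro ballI exI[of _ U] exI[of _ t]) simp

lemma locally_in_local:
 assumes "\<And>p. p \<in> U \<Longrightarrow> \<exists>W. opn X W \<and> p \<in> W \<and> W \<subseteq> U \<and> locally_in X loc W s" shows "locally_in X loc U s"
 unfolding locally_in_def
proof
 fix p assume "p \<in> U"
 then obtain W where W: "p \<in> W" "W \<subseteq> U" "locally_in X loc W s" using assms by blast
 from W(3,1) obtain Y t where "opn X Y" "p \<in> Y" "Y \<subseteq> W" "t \<in> loc Y" "\<forall>q\<in>Y. s q = t q"
  by (rule locally_inE)
 thus "\<exists>W t. opn X W \<and> p \<in> W \<and> W \<subseteq> U \<and> t \<in> loc W \<and> (\<forall>q\<in>W. s q = t q)" using W(2)
  by (intro exI[of _ Y] exI[of _ t]) auto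
qed

lemma locally_in_cong:
 assumes "locally_in X loc U s" "\<And>q. q \<in> U \<Longrightarrow> s' q = s q" shows "locally_in X loc U s'"
 unfolding locally_in_def
proof
 fix p assume "p \<in> U"
 with assms(1) obtain W t where "opn X W" "p \<in> W" "W \<subseteq> U" "t \<in> loc W" "\<forall>q\<in>W. s q = t q"
  by (rule locally_inE)
 thus "\<exists>W t. opn X W \<and> p \<in> W \<and> W \<subseteq> U \<and> t \<in> loc W \<and> (\<forall>q\<in>W. s' q = t q)"
  using assms(2) by (intro exI[of _ W] exI[of _ t]) (simp add: subset_iff)
qed

lemma locally_in_refine:
 assumes "locally_in X loc U s" "\<And>W t. \<lbrakk>opn X W; t \<in> loc W\<rbrakk> \<Longrightarrow> locally_in X loc' W t"
 shows "locally_in X loc' U s"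
proof (rule locally_in_local)
 fix p assume "p \<in> U"
 with assms(1) obtain W t where "opn X W" "p \<in> W" "W \<subseteq> U" "t \<in> loc W" "\<forall>q\<in>W. s q = t q"
  by (rule locally_inE)
 thus "\<exists>W. opn X W \<and> p \<in> W \<and> W \<subseteq> U \<and> locally_in X loc' W s"
  using locally_in_cong[OF assms(2), of W t s] by (intro exI[of _ W]) simp
qed

lemma etale_sheaf_section_iff: "s \<in> Ms (etale_sheaf X S loc) U \<longleftrightarrow> s \<in> extensional U \<and>
  locally_in X loc U s"
 by (simp add: etale_sheaf_def locally_in_def)

lemma etale_sheaf_sel:
 "0[msec (etale_sheaf X S loc) U] = (\<lambda>p\<in>U. 0[S p])"
 "s +[msec (etale_sheaf X S loc) U] t = (\<lambda>p\<in>U. s p +[S p] t p)"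
 "a *.[msec (etale_sheaf X S loc) U] s = (\<lambda>p\<in>U. ogerm X p U a *.[S p] s p)"
 "mres (etale_sheaf X S loc) U W s = restrict s W"
 by (simp_all add: etale_sheaf_def)

lemma etale_sheaf_refine:
 assumes "\<And>W t. \<lbrakk>opn X W; t \<in> loc W\<rbrakk> \<Longrightarrow> locally_in X loc' W t"
  and "\<And>W t. \<lbrakk>opn X W; t \<in> loc' W\<rbrakk> \<Longrightarrow> locally_in X loc W t"
 shows "etale_sheaf X S loc = etale_sheaf X S loc'"
proof -
 have "locally_in X loc = locally_in X loc'"
  using locally_in_refine[of X loc _ _ loc'] locally_in_refine[of X loc' _ _ loc] assms by blast
 thus ?thesis unfolding etale_sheaf_def locally_in_def fun_eq_iff by simp
qed

locale etale_module = ringed_space X for X :: "('p, 'a) rspace" +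
 fixes S :: "'p \<Rightarrow> (('p set \<times> 'a) set, 't) module" and loc :: "'p set \<Rightarrow> ('p \<Rightarrow> 't) set"
 assumes stalk_module: "p \<in> pts X \<Longrightarrow> module (ostalk X p) (S p)"
  and loc_closed: "\<lbrakk>opn X W; t \<in> loc W; q \<in> W\<rbrakk> \<Longrightarrow> t q \<in> carrier (S q)"
  and loc_res: "\<lbrakk>opn X W; opn X Y; Y \<subseteq> W; t \<in> loc W\<rbrakk> \<Longrightarrow> \<exists>r\<in>loc Y. \<forall>q\<in>Y. t q = r q"
  and loc_zero: "opn X W \<Longrightarrow> locally_in X loc W (\<lambda>q. 0[S q])"
  and loc_add: "\<lbrakk>opn X W; t \<in> loc W; t' \<in> loc W\<rbrakk> \<Longrightarrow> \<exists>r\<in>loc W. \<forall>q\<in>W. t q +[S q] t' q = r q"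
  and loc_smult: "\<lbrakk>opn X W; a \<in> Os X W; t \<in> loc W\<rbrakk> \<Longrightarrow> \<exists>r\<in>loc W. \<forall>q\<in>W. ogerm X q W a *.[S q] t q = r q"
begin

abbreviation E where "E \<equiv> etale_sheaf X S loc"

lemma etale_value_closed:
 assumes "s \<in> Ms E U" "p \<in> U" shows "s p \<in> carrier (S p)"
proof -
 obtain W t where "opn X W" "p \<in> W" "t \<in> loc W" "\<forall>q\<in>W. s q = t q"
  using assms locally_inE[of X loc U s p] unfolding etale_sheaf_section_iff by metis
 thus ?thesis using loc_closed by simp
qed

lemma etale_res_closed:
 assumes U: "opn X U" "opn X W" "W \<subseteq> U" and s: "s \<in> Ms E U" shows "restrict s W \<in> Ms E W"
 unfolding etale_sheaf_section_iff
proof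
 show "locally_in X loc W (restrict s W)"
 proof (rule locally_in_local)
  fix p assume p: "p \<in> W"
  have "locally_in X loc U s" "p \<in> U" using s p U(3) by (auto simp: etale_sheaf_section_iff)
  then obtain Y t where Y: "opn X Y" "p \<in> Y" "Y \<subseteq> U" "t \<in> loc Y" "\<forall>q\<in>Y. s q = t q" by (rule locally_inE)
  have I: "opn X (Y \<inter> W)" using Y U by auto
  obtain r where "r \<in> loc (Y \<inter> W)" "\<forall>q\<in>Y \<inter> W. t q = r q" using loc_res[OF Y(1) I _ Y(4)] by blast
  hence "locally_in X loc (Y \<inter> W) (restrict s W)" using Y(5) by (intro locally_inI[OF I, of r]) simp_all
  thus "\<exists>Y. opn X Y \<and> p \<in> Y \<and> Y \<subseteq> W \<and> locally_in X loc Y (restrict s W)" using I p Y(2)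
   by (intro exI[of _ "Y \<inter> W"]) simp
 qed
qed simp

lemma etale_common_nhd:
 assumes st: "s \<in> Ms E U" "t \<in> Ms E U" and p: "p \<in> U"
 obtains W s' t' where "opn X W" "p \<in> W" "W \<subseteq> U" "s' \<in> loc W" "t' \<in> loc W"
  "\<forall>q\<in>W. s q = s' q" "\<forall>q\<in>W. t q = t' q"
proof -
 have loc: "locally_in X loc U s" "locally_in X loc U t" using st
  by (auto simp: etale_sheaf_section_iff)
 obtain W s' where W: "opn X W" "p \<in> W" "W \<subseteq> U" "s' \<in> loc W" "\<forall>q\<in>W. s q = s' q"
  by (rule locally_inE[OF loc(1) p])
 obtain Y t' where Y: "opn X Y" "p \<in> Y" "Y \<subseteq> U" "t' \<in> loc Y" "\<forall>q\<in>Y. t q = t' q"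
  by (rule locally_inE[OF loc(2) p])
 have I: "opn X (W \<inter> Y)" using W Y by auto
 obtain s'' t'' where "s'' \<in> loc (W \<inter> Y)" "\<forall>q\<in>W \<inter> Y. s' q = s'' q" "t'' \<in> loc (W \<inter> Y)"
   "\<forall>q\<in>W \<inter> Y. t' q = t'' q"
  using loc_res[OF W(1) I _ W(4)] loc_res[OF Y(1) I _ Y(4)] by blast
 thus thesis using I W Y by (intro that[of "W \<inter> Y" s'' t'']) auto
qed

lemma etale_zero_closed: "opn X U \<Longrightarrow> 0[msec E U] \<in> Ms E U"
 using locally_in_cong[OF loc_zero] by (simp add: etale_sheaf_section_iff etale_sheaf_sel)

lemma etale_add_closed:
 assumes st: "s \<in> Ms E U" "t \<in> Ms E U" shows "s +[msec E U] t \<in> Ms E U"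
proof -
 have "locally_in X loc U (s +[msec E U] t)"
 proof (rule locally_in_local)
  fix p assume "p \<in> U"
  with st obtain W s' t' where W: "opn X W" "p \<in> W" "W \<subseteq> U" "s' \<in> loc W" "t' \<in> loc W"
   "\<forall>q\<in>W. s q = s' q" "\<forall>q\<in>W. t q = t' q" by (rule etale_common_nhd)
  obtain r where "r \<in> loc W" "\<forall>q\<in>W. s' q +[S q] t' q = r q" using loc_add[OF W(1,4,5)] by blast
  hence "locally_in X loc W (s +[msec E U] t)" using W
   by (intro locally_inI[of X W r]) (auto simp: etale_sheaf_sel)
  thus "\<exists>W. opn X W \<and> p \<in> W \<and> W \<subseteq> U \<and> locally_in X loc W (s +[msec E U] t)" using W(1-3) by blast
 qed
 thus ?thesis by (simp add: etale_sheaf_section_iff) (simp add: etale_sheaf_sel)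
qed

lemma etale_smult_closed:
 assumes U: "opn X U" and a: "a \<in> Os X U" and s: "s \<in> Ms E U" shows "a *.[msec E U] s \<in> Ms E U"
proof -
 have "locally_in X loc U (a *.[msec E U] s)"
 proof (rule locally_in_local)
  fix p assume "p \<in> U"
  with s s obtain W s' where W: "opn X W" "p \<in> W" "W \<subseteq> U" "s' \<in> loc W" "\<forall>q\<in>W. s q = s' q"
   by (rule etale_common_nhd)
  obtain r where "r \<in> loc W" "\<forall>q\<in>W. ogerm X q W (ores X U W a) *.[S q] s' q = r q"
   using loc_smult[OF W(1) ores_closed[OF U W(1,3) a] W(4)] by blast
  hence "locally_in X loc W (a *.[msec E U] s)"
   using W ogerm_res[OF U W(1,3) _ a] by (intro locally_inI[of X W r]) (auto simp: etale_sheaf_sel)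
  thus "\<exists>W. opn X W \<and> p \<in> W \<and> W \<subseteq> U \<and> locally_in X loc W (a *.[msec E U] s)" using W(1-3) by blast
 qed
 thus ?thesis by (simp add: etale_sheaf_section_iff) (simp add: etale_sheaf_sel)
qed

lemma etale_module_sec:
 assumes U: "opn X U" shows "module (osec X U) (msec E U)"
proof -
 interpret O: cring "osec X U" by (rule cring_O[OF U])
 {
  fix p assume p: "p \<in> U"
  interpret module "ostalk X p" "S p" using stalk_module p openin_subset[OF U] by blast
  note smult_closed smult_one smult_l_null smult_l_distr smult_assoc1 smult_r_distr M.l_zero
    M.a_closed M.a_comm M.a_assoc M.a_lcomm
 }
 note stalk_laws = this
 have ext: "s \<in> extensional U" if "s \<in> Ms E U" for s using that by (simp add: etale_sheaf_section_iff)
 have laws: "(a +[osec X U] b) *.[msec E U] s = a *.[msec E U] s +[msec E U] b *.[msec E U] s"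
  "a *[osec X U] b *.[msec E U] s = a *.[msec E U] (b *.[msec E U] s)" "1[osec X U] *.[msec E U] s = s"
  "0[osec X U] *.[msec E U] s = 0[msec E U]"
  "a *.[msec E U] (s +[msec E U] t) = a *.[msec E U] s +[msec E U] a *.[msec E U] t"
    "0[msec E U] +[msec E U] s = s"
  "s +[msec E U] t = t +[msec E U] s" "s +[msec E U] t +[msec E U] r = s +[msec E U] (t +[msec E U] r)"
  if "a \<in> Os X U" "b \<in> Os X U" "s \<in> Ms E U" "t \<in> Ms E U" "r \<in> Ms E U" for a b s t r
 proof -
  have p: "s p \<in> carrier (S p)" "t p \<in> carrier (S p)" "r p \<in> carrier (S p)"
   "ogerm X p U a \<in> carrier (ostalk X p)" "ogerm X p U b \<in> carrier (ostalk X p)" if "p \<in> U" for p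
   using etale_value_closed ogerm_closed[OF U that] that \<open>s \<in> _\<close> \<open>t \<in> _\<close> \<open>r \<in> _\<close> \<open>a \<in> _\<close> \<open>b \<in> _\<close>
   by simp_all
  show "(a +[osec X U] b) *.[msec E U] s = a *.[msec E U] s +[msec E U] b *.[msec E U] s"
   "a *[osec X U] b *.[msec E U] s = a *.[msec E U] (b *.[msec E U] s)" "1[osec X U] *.[msec E U] s = s"
   "0[osec X U] *.[msec E U] s = 0[msec E U]"
   "a *.[msec E U] (s +[msec E U] t) = a *.[msec E U] s +[msec E U] a *.[msec E U] t"
     "0[msec E U] +[msec E U] s = s"
   "s +[msec E U] t = t +[msec E U] s" "s +[msec E U] t +[msec E U] r = s +[msec E U] (t +[msec E U] r)"
   by (rule extensionalityI[of _ U];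
     use that p in \<open>simp add: etale_sheaf_sel ostalk_add[OF U, symmetric] ostalk_mult[OF U, symmetric]
      ostalk_one[OF U, symmetric] ostalk_zero[OF U, symmetric] stalk_laws ext\<close>)+
 qed
 have "abelian_group (msec E U)"
 proof (rule abelian_groupI)
  fix s assume s: "s \<in> Ms E U"
  have "(\<ominus>\<^bsub>osec X U\<^esub> 1[osec X U]) *.[msec E U] s +[msec E U] s = 0[msec E U]"
   using laws(1)[of "\<ominus>\<^bsub>osec X U\<^esub> 1[osec X U]" "1[osec X U]" s s s] laws(3,4)[OF O.one_closed
     O.one_closed s s s] s
   by (simp add: O.l_neg)
  thus "\<exists>t\<in>Ms E U. t +[msec E U] s = 0[msec E U]" using etale_smult_closed[OF U _ s] by blast
 qed ((rule etale_zero_closed[OF U] | (rule etale_add_closed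
   laws(6-8)[OF O.one_closed O.one_closed]; assumption))+)
 thus ?thesis
  by (rule moduleI[OF O.is_cring]) (assumption | rule O.one_closed etale_smult_closed[OF U]
    laws(1-3,5))+
qed

lemma etale_presheaf: "is_presheaf (tp X) (\<lambda>U. Ms E U) (mres E)"
 unfolding is_presheaf_def etale_sheaf_sel(4)
 using etale_res_closed by (auto simp: etale_sheaf_section_iff extensional_restrict Int_absorb1)

lemma etale_is_sheaf: "is_sheaf (tp X) (\<lambda>U. Ms E U) (mres E)"
proof (rule is_sheafI[OF etale_presheaf])
 fix \<C> s assume C: "\<And>U. U \<in> \<C> \<Longrightarrow> opn X U \<and> s U \<in> Ms E U"
  and eq: "\<And>U W. U \<in> \<C> \<Longrightarrow> W \<in> \<C> \<Longrightarrow> mres E U (U \<inter> W) (s U) = mres E W (U \<inter> W) (s W)"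
 define t where "t = (\<lambda>p\<in>\<Union>\<C>. s (SOME U. U \<in> \<C> \<and> p \<in> U) p)"
 have value_eq: "t p = s U p" if "U \<in> \<C>" "p \<in> U" for U p
 proof -
  let ?W = "SOME U. U \<in> \<C> \<and> p \<in> U"
  have W: "?W \<in> \<C>" "p \<in> ?W" using someI[of "\<lambda>U. U \<in> \<C> \<and> p \<in> U" U] that by auto
  have "s U p = s ?W p"
   using fun_cong[OF eq[OF that(1) W(1)], of p] that(2) W(2) by (simp add: etale_sheaf_sel(4))
  thus ?thesis using that by (auto simp: t_def)
 qed
 have t_closed: "t \<in> Ms E (\<Union>\<C>)"
  unfolding etale_sheaf_section_iff
 proof
  show "locally_in X loc (\<Union>\<C>) t"
  proof (rule locally_in_local)
   fix p assume "p \<in> \<Union>\<C>"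
   then obtain U where U: "U \<in> \<C>" "p \<in> U" by blast
   have "locally_in X loc U t"
    by (rule locally_in_cong[of X loc U "s U"]) (use C[OF U(1)] value_eq[OF U(1)]
      in \<open>simp_all add: etale_sheaf_section_iff\<close>)
   thus "\<exists>W. opn X W \<and> p \<in> W \<and> W \<subseteq> \<Union>\<C> \<and> locally_in X loc W t" using U C[OF U(1)] by blast
  qed
 qed (simp add: t_def)
 show "\<exists>!t. t \<in> Ms E (\<Union>\<C>) \<and> (\<forall>U\<in>\<C>. mres E (\<Union>\<C>) U t = s U)"
 proof (rule ex1I[of _ t])
  have "restrict t U = s U" if U: "U \<in> \<C>" for U
   by (rule extensionalityI[of _ U]) (use C[OF U] value_eq[OF U]
     in \<open>simp_all add: etale_sheaf_section_iff\<close>)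
  thus "t \<in> Ms E (\<Union>\<C>) \<and> (\<forall>U\<in>\<C>. mres E (\<Union>\<C>) U t = s U)" using t_closed by (simp add: etale_sheaf_sel(4))
  fix r assume r: "r \<in> Ms E (\<Union>\<C>) \<and> (\<forall>U\<in>\<C>. mres E (\<Union>\<C>) U r = s U)"
  have "r p = t p" if "p \<in> \<Union>\<C>" for p
  proof -
   obtain U where U: "U \<in> \<C>" "p \<in> U" using \<open>p : \<Union>\<C>\<close> by blast
   have "restrict r U = s U" using r U(1) by (simp add: etale_sheaf_sel(4))
   from fun_cong[OF this, of p] show ?thesis using U value_eq[OF U] by simp
  qed
  thus "r = t" using r t_closed by (intro extensionalityI[of _ "\<Union>\<C>"]) (auto simp:
    etale_sheaf_section_iff)
 qed
qed

lemma etale_mod_sheaf: "mod_sheaf X E"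
 unfolding mod_sheaf_def
proof (intro conjI allI impI ballI etale_is_sheaf etale_module_sec)
 fix U W s t assume UW: "opn X U \<and> opn X W \<and> W \<subseteq> U"
 show "mres E U W (s +[msec E U] t) = mres E U W s +[msec E W] mres E U W t"
  unfolding etale_sheaf_sel using UW by (auto simp: restrict_def fun_eq_iff)
 fix a assume a: "a \<in> Os X U"
 have "ogerm X p W (ores X U W a) = ogerm X p U a" if "p \<in> W" for p
  using ogerm_res[OF _ _ _ that a] UW by simp
 thus "mres E U W (a *.[msec E U] s) = ores X U W a *.[msec E W] mres E U W s"
  unfolding etale_sheaf_sel using UW by (auto simp: restrict_def fun_eq_iff)
qed

end

lemma (in ringed_space) osec_glue_germs:
 assumes Z: "opn X Z"
  and loc: "\<And>p. p \<in> Z \<Longrightarrow> \<exists>Y a. opn X Y \<and> p \<in> Y \<and> Y \<subseteq> Z \<and> a \<in> Os X Y \<and> (\<forall>q\<in>Y. ogerm X q Y a = c q)"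
 obtains b where "b \<in> Os X Z" "\<forall>p\<in>Z. ogerm X p Z b = c p"
proof -
 obtain Y a where Y: "\<And>p. p \<in> Z \<Longrightarrow> opn X (Y p) \<and> p \<in> Y p \<and> Y p \<subseteq> Z \<and> a p \<in> Os X (Y p)"
  and germ: "\<And>p q. \<lbrakk>p \<in> Z; q \<in> Y p\<rbrakk> \<Longrightarrow> ogerm X q (Y p) (a p) = c q"
  using loc by metis
 have cover: "(\<Union>p\<in>Z. Y p) = Z" using Y by blast
 obtain b where b: "b \<in> Os X Z" "\<And>p. p \<in> Z \<Longrightarrow> ores X Z (Y p) b = a p"
 proof (rule sheaf_glue[OF sheaf_O, where I = Z and W = Y and s = a, unfolded cover])
  fix p r assume pr: "p \<in> Z" "r \<in> Z"
  let ?I = "Y p \<inter> Y r"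
  have I: "opn X ?I" using Y pr by auto
  show "ores X (Y p) ?I (a p) = ores X (Y r) ?I (a r)"
   by (rule osec_eqI_ogerm[OF I])
    (use Y[OF pr(1)] Y[OF pr(2)] I pr germ in \<open>simp_all add: ores_closed ogerm_res\<close>)
 qed (use Y that in simp_all)
 show thesis
 proof (rule that[OF b(1)], rule ballI)
  fix p assume p: "p \<in> Z"
  thus "ogerm X p Z b = c p" using ogerm_res[OF Z _ _ _ b(1), of "Y p" p] Y[OF p] germ[OF p,
    of p] b(2)[OF p] by simp
 qed
qed

section \<open>The sheaf \<open>f\<^sup>*F \<otimes> G\<close> for a line bundle \<open>F\<close>\<close>

definition pullback_tensor_stalk ::
 "('q, 'b) rspace \<Rightarrow> ('p, 'a) rspace \<Rightarrow> ('q, 'b, 'p, 'a) rmor \<Rightarrow> ('p, 'a, 'm) msheaf \<Rightarrow> ('q, 'b, 'n)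
   msheaf \<Rightarrow> 'q
  \<Rightarrow> (('q set \<times> 'b) set, (('p set \<times> 'm) set \<times> ('q set \<times> 'n) set \<Rightarrow>\<^sub>0 int) set) module"
 where "pullback_tensor_stalk V X f F G q =
  tens_module (ostalk X (mpt f q)) (stalk_map V f q) (mstalk X F (mpt f q)) (mstalk V G q)"

definition pure_germ ::
 "('q, 'b) rspace \<Rightarrow> ('p, 'a) rspace \<Rightarrow> ('q, 'b, 'p, 'a) rmor \<Rightarrow> ('p, 'a, 'm) msheaf \<Rightarrow> ('q, 'b, 'n) msheaf
  \<Rightarrow> 'p set \<Rightarrow> 'm \<Rightarrow> 'q set \<Rightarrow> 'n \<Rightarrow> 'q \<Rightarrow> (('p set \<times> 'm) set \<times> ('q set \<times> 'n) set \<Rightarrow>\<^sub>0 int) set"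
 where "pure_germ V X f F G U u W v q = tens_class (ostalk X (mpt f q)) (stalk_map V f q)
   (mstalk X F (mpt f q))
  (mstalk V G q) (frag_of (mgerm X F (mpt f q) U u, mgerm V G q W v))"

definition pullback_tensor ::
 "('q, 'b) rspace \<Rightarrow> ('p, 'a) rspace \<Rightarrow> ('q, 'b, 'p, 'a) rmor \<Rightarrow> ('p, 'a, 'm) msheaf \<Rightarrow> ('q, 'b, 'n) msheaf
  \<Rightarrow> ('q, 'b, 'q \<Rightarrow> (('p set \<times> 'm) set \<times> ('q set \<times> 'n) set \<Rightarrow>\<^sub>0 int) set) msheaf"
 where "pullback_tensor V X f F G = etale_sheaf V (pullback_tensor_stalk V X f F G)
  (\<lambda>W. {(\<lambda>q. finsum (pullback_tensor_stalk V X f F G q)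
    (\<lambda>i. pure_germ V X f F G U (u i) W (v i) q) {..<l})
     | l U u v. opn X U \<and> mpt f ` W \<subseteq> U \<and> u \<in> {..<l::nat} \<rightarrow> Ms F U \<and> v \<in> {..<l} \<rightarrow> Ms G W})"

lemma pullback_eq_pullback_tensor: "pullback V X f F = pullback_tensor V X f F (osheaf V)"
 unfolding pullback_def pullback_tensor_def pullback_stalk_def pullback_tensor_stalk_def pure_germ_def
  mstalk_osheaf mgerm_osheaf osheaf_sel by simp

locale line_bundle_pullback_tensor =
 fixes V :: "('q, 'b) rspace" and X :: "('p, 'a) rspace" and f :: "('q, 'b, 'p, 'a) rmor"
  and F :: "('p, 'a, 'm) msheaf" and G :: "('q, 'b, 'n) msheaf"
 assumes lrs_V: "lrs V" and lrs_X: "lrs X" and pre_hom_f: "pre_hom V X f"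
  and line_bundle_F: "line_bundle X F" and mod_sheaf_G: "mod_sheaf V G"
begin

sublocale F: module_sheaf X F
 by unfold_locales (use lrs_X line_bundleD(1)[OF line_bundle_F] in \<open>simp_all add: lrs_def\<close>)

sublocale G: module_sheaf V G
 by unfold_locales (use lrs_V mod_sheaf_G in \<open>simp_all add: lrs_def\<close>)

sublocale f: ringed_presheaf_hom V X f
 by unfold_locales (rule pre_hom_f)

abbreviation FG where "FG \<equiv> pullback_tensor V X f F G"
abbreviation FG_stalk where "FG_stalk \<equiv> pullback_tensor_stalk V X f F G"
abbreviation pure_at where "pure_at \<equiv> pure_germ V X f F G"

lemma tensor_product_at:
 assumes q: "q \<in> pts V"
 shows "tensor_product (ostalk X (mpt f q)) (ostalk V q) (mstalk X F (mpt f q)) (mstalk V G q)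
   (stalk_map V f q)"
proof -
 have "cring (ostalk V q)" "cring (ostalk X (mpt f q))"
  using lrs_V lrs_X q pre_hom_pts[OF pre_hom_f q] by (simp_all add: lrs_def local_ring_def)
 thus ?thesis
  by (intro tensor_product.intro tensor_product_axioms.intro F.mstalk_module G.mstalk_module
    f.stalk_map_ring_hom
    pre_hom_pts[OF pre_hom_f] q)
qed

lemma rank_one_at:
 assumes q: "q \<in> pts V" and e: "free_gen X F U e" and U: "mpt f q \<in> U"
 shows "tensor_product_rank_one (ostalk X (mpt f q)) (ostalk V q) (mstalk X F (mpt f q))
   (mstalk V G q) (stalk_map V f q)
  (mgerm X F (mpt f q) U e)"
proof (intro tensor_product_rank_one.intro tensor_product_at[OF q] tensor_product_rank_one_axioms.intro)
 show "mgerm X F (mpt f q) U e \<in> carrier (mstalk X F (mpt f q))"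
  by (rule F.mgerm_closed[OF free_genD(1)[OF e] U free_genD(2)[OF e]])
 show "\<exists>!r. r \<in> carrier (ostalk X (mpt f q)) \<and> m = r *.[mstalk X F (mpt f q)] mgerm X F (mpt f q) U e"
  if "m \<in> carrier (mstalk X F (mpt f q))" for m
  using F.free_gen_stalk_generates[OF e U that] F.free_gen_stalk_cancel[OF e U] by metis
qed

lemma FG_stalk_module: "q \<in> pts V \<Longrightarrow> module (ostalk V q) (FG_stalk q)"
 unfolding pullback_tensor_stalk_def by (rule tensor_product.module[OF tensor_product_at])

lemma pure_at_ops:
 assumes W: "opn V W" "q \<in> W" and U: "opn X U" "mpt f q \<in> U" "u \<in> Ms F U"
 shows pure_at_closed: "v \<in> Ms G W \<Longrightarrow> pure_at U u W v q \<in> carrier (FG_stalk q)"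
  and pure_at_add: "\<lbrakk>v \<in> Ms G W; w \<in> Ms G W\<rbrakk> \<Longrightarrow>
   pure_at U u W v q +[FG_stalk q] pure_at U u W w q = pure_at U u W (v +[msec G W] w) q"
  and pure_at_smult: "\<lbrakk>a \<in> Os V W; v \<in> Ms G W\<rbrakk> \<Longrightarrow>
   ogerm V q W a *.[FG_stalk q] pure_at U u W v q = pure_at U u W (a *.[msec G W] v) q"
  and pure_at_zero: "0[FG_stalk q] = pure_at U u W 0[msec G W] q"
proof -
 have q: "q \<in> pts V" using openin_subset[OF W(1)] W(2) by blast
 interpret T: tensor_product "ostalk X (mpt f q)" "ostalk V q" "mstalk X F (mpt f q)" "mstalk V G q"
   "stalk_map V f q"
  by (rule tensor_product_at[OF q])
 note germ = F.mgerm_closed[OF U] G.mgerm_closed[OF W] G.ogerm_closed[OF W]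
 show "v \<in> Ms G W \<Longrightarrow> pure_at U u W v q \<in> carrier (FG_stalk q)"
  unfolding pure_germ_def pullback_tensor_stalk_def by (rule T.pure_closed[OF germ(1,2)])
 show "pure_at U u W v q +[FG_stalk q] pure_at U u W w q = pure_at U u W (v +[msec G W] w) q"
   if "v \<in> Ms G W" "w \<in> Ms G W"
  unfolding pure_germ_def pullback_tensor_stalk_def T.pure_add_right[OF germ(1) germ(2)[OF that(1)]
    germ(2)[OF that(2)]]
   G.mstalk_add[OF W that] by (rule refl)
 show "ogerm V q W a *.[FG_stalk q] pure_at U u W v q = pure_at U u W (a *.[msec G W] v) q"
   if "a \<in> Os V W" "v \<in> Ms G W"
  unfolding pure_germ_def pullback_tensor_stalk_def T.pure_smult[OF germ(3)[OF that(1)] germ(1)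
    germ(2)[OF that(2)]]
   G.mstalk_smult[OF W that] by (rule refl)
 show "0[FG_stalk q] = pure_at U u W 0[msec G W] q"
  unfolding pure_germ_def pullback_tensor_stalk_def G.mstalk_zero[OF W,
    symmetric] T.pure_zero_right[OF germ(1)] by (rule refl)
qed

lemma pure_at_res:
 assumes "opn V W" "opn V W'" "W' \<subseteq> W" "q \<in> W'" "v \<in> Ms G W" "opn X U" "opn X U'" "U' \<subseteq> U"
   "mpt f q \<in> U'" "u \<in> Ms F U"
 shows "pure_at U' (mres F U U' u) W' (mres G W W' v) q = pure_at U u W v q"
 unfolding pure_germ_def F.mgerm_res[OF assms(6-10)] G.mgerm_res[OF assms(1-5)] by (rule refl)

lemma pure_at_res_right:
 assumes "opn V W" "opn V W'" "W' \<subseteq> W" "q \<in> W'" "v \<in> Ms G W"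
 shows "pure_at U u W' (mres G W W' v) q = pure_at U u W v q"
 unfolding pure_germ_def G.mgerm_res[OF assms] by (rule refl)

abbreviation pull :: "'p set \<Rightarrow> 'q set \<Rightarrow> 'a \<Rightarrow> 'b" where "pull U W a \<equiv> ores V (preim V f U) W (mco f U a)"

lemma pull_closed: "\<lbrakk>opn X U; opn V W; W \<subseteq> preim V f U; a \<in> Os X U\<rbrakk> \<Longrightarrow> pull U W a \<in> Os V W"
 by (rule G.ores_closed[OF pre_hom_opn[OF pre_hom_f] _ _ pre_hom_mco_closed[OF pre_hom_f]])

lemma pure_at_balanced:
 assumes W: "opn V W" "q \<in> W" "W \<subseteq> preim V f U" and v: "v \<in> Ms G W"
  and U: "opn X U" and u: "u \<in> Ms F U" and a: "a \<in> Os X U"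
 shows "pure_at U (a *.[msec F U] u) W v q = pure_at U u W (pull U W a *.[msec G W] v) q"
proof -
 have q: "q \<in> pts V" and fU: "mpt f q \<in> U" using W by (auto simp: preim_def)
 have "stalk_map V f q (ogerm X (mpt f q) U a) = ogerm V q W (pull U W a)"
  unfolding f.stalk_map_ogerm[OF q U fU a]
  by (rule G.ogerm_res[OF pre_hom_opn[OF pre_hom_f U] W(1,3,2)
    pre_hom_mco_closed[OF pre_hom_f U a], symmetric])
 thus ?thesis
  unfolding pure_germ_def F.mstalk_smult[OF U fU a u, symmetric] G.mstalk_smult[OF W(1,2)
    pull_closed[OF U W(1,3) a] v, symmetric]
  using tensor_product.pure_balanced[OF tensor_product_at[OF q] F.ogerm_closed[OF U fU a]
    F.mgerm_closed[OF U fU u]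
   G.mgerm_closed[OF W(1,2) v]] by simp
qed

lemma pure_at_basisE:
 assumes e: "free_gen X F U e" and U': "opn X U'" "u \<in> Ms F U'"
  and W: "opn V W" "W \<subseteq> preim V f U" "W \<subseteq> preim V f U'" and v: "v \<in> Ms G W"
 obtains w where "w \<in> Ms G W" "\<forall>q\<in>W. pure_at U' u W v q = pure_at U e W w q"
proof -
 note U = free_genD(1,2)[OF e]
 let ?I = "U \<inter> U'"
 have I: "opn X ?I" "?I \<subseteq> U" "?I \<subseteq> U'" "W \<subseteq> preim V f ?I" using U U' W by (auto simp: preim_def)
 have eI: "mres F U ?I e \<in> Ms F ?I" by (rule F.res_closed[OF U(1) I(1,2) U(2)])
 obtain a where a: "a \<in> Os X ?I" "mres F U' ?I u = a *.[msec F ?I] mres F U ?I e"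
  by (rule free_genE[OF e I(1,2) F.res_closed[OF U'(1) I(1,3) U'(2)]])
 let ?w = "pull ?I W a *.[msec G W] v"
 have w: "?w \<in> Ms G W" by (rule G.smult_closed[OF W(1) pull_closed[OF I(1) W(1) I(4) a(1)] v])
 have "pure_at U' u W v q = pure_at U e W ?w q" if q: "q \<in> W" for q
 proof -
  have fq: "mpt f q \<in> ?I" using q I(4) by (auto simp: preim_def)
  note res = pure_at_res[OF W(1) W(1) order_refl q, unfolded G.res_id[OF W(1)]]
  have "pure_at U' u W v q = pure_at ?I (a *.[msec F ?I] mres F U ?I e) W v q"
   using res[OF v U'(1) I(1,3) fq U'(2)] G.res_id[OF W(1) v] a(2) by simp
  also have "... = pure_at ?I (mres F U ?I e) W ?w q"
   by (rule pure_at_balanced[OF W(1) q I(4) v I(1) eI a(1)])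
  also have "... = pure_at U e W ?w q" using res[OF w U(1) I(1,2) fq U(2)] G.res_id[OF W(1) w] by simp
  finally show ?thesis .
 qed
 with w show thesis by (intro that) blast+
qed

lemma line_bundle_genE:
 assumes "opn V W" "p \<in> W"
 obtains U e Y where "free_gen X F U e" "opn V Y" "p \<in> Y" "Y \<subseteq> W" "Y \<subseteq> preim V f U"
proof -
 have p: "p \<in> pts V" using openin_subset[OF assms(1)] assms(2) by blast
 obtain U e where e: "mpt f p \<in> U" "free_gen X F U e"
  using line_bundleD(2)[OF line_bundle_F pre_hom_pts[OF pre_hom_f p]] by blast
 show thesis
  by (rule that[OF e(2), of "W \<inter> preim V f U"])
   (use assms p e(1) pre_hom_opn[OF pre_hom_f free_genD(1)[OF e(2)]] in \<open>auto simp: preim_iff\<close>)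
qed

definition basis_functions :: "'q set \<Rightarrow> ('q \<Rightarrow> (('p set \<times> 'm) set \<times> ('q set \<times> 'n) set \<Rightarrow>\<^sub>0 int) set) set"
 where "basis_functions W = {pure_at U e W g | U e g. free_gen X F U e \<and> W \<subseteq> preim V f U \<and> g \<in> Ms G W}"

lemma basis_functionsI: "\<lbrakk>free_gen X F U e; W \<subseteq> preim V f U; g \<in> Ms G W\<rbrakk> \<Longrightarrow>
  pure_at U e W g \<in> basis_functions W"
 by (auto simp: basis_functions_def)

lemma basis_functionsE:
 assumes "t \<in> basis_functions W"
 obtains U e g where "free_gen X F U e" "W \<subseteq> preim V f U" "g \<in> Ms G W" "t = pure_at U e W g"
 using assms by (auto simp: basis_functions_def)

lemma locally_in_basis_functionsI:
 assumes "free_gen X F U e" "opn V W" "W \<subseteq> preim V f U" "g \<in> Ms G W" "\<forall>q\<in>W. s q = pure_at U e W g q"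
 shows "locally_in V basis_functions W s"
 using assms by (intro locally_inI[of V W "pure_at U e W g"] basis_functionsI)

lemma finsum_pure_at_basis:
 assumes e: "free_gen X F U e" and W: "opn V W"
   "W \<subseteq> preim V f U" and g: "g \<in> {..<l::nat} \<rightarrow> Ms G W" and q: "q \<in> W"
 shows "finsum (FG_stalk q) (\<lambda>i. pure_at U e W (g i) q) {..<l} =
   pure_at U e W (finsum (msec G W) g {..<l}) q"
proof -
 have qU: "q \<in> pts V" "mpt f q \<in> U" using W(2) q by (auto simp: preim_def)
 interpret S: module "ostalk V q" "FG_stalk q" by (rule FG_stalk_module[OF qU(1)])
 interpret M: module "osec V W" "msec G W" by (rule G.module_sec[OF W(1)])
 note ops = pure_at_ops[OF W(1) q free_genD(1)[OF e] qU(2) free_genD(2)[OF e]]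
 show ?thesis using g
 proof (induction l)
  case 0 show ?case using ops(4) by simp
 next
  case (Suc l)
  have "g \<in> {..<l} \<rightarrow> Ms G W" "g l \<in> Ms G W" using Suc.prems by (auto simp: Pi_iff)
  thus ?case using Suc.IH ops(1,2) by (simp add: lessThan_Suc Pi_iff S.finsum_insert M.finsum_insert)
 qed
qed

lemma locally_in_basis_functions_finsum:
 assumes W: "opn V W" and U: "opn X U" "mpt f ` W \<subseteq> U" and u: "u \<in> {..<l::nat} \<rightarrow> Ms F U"
   and v: "v \<in> {..<l} \<rightarrow> Ms G W"
 shows "locally_in V basis_functions W (\<lambda>q. finsum (FG_stalk q) (\<lambda>i. pure_at U (u i) W (v i) q) {..<l})"
proof (rule locally_in_local)
 fix p assume "p \<in> W"
 with W obtain U0 e Y where e: "free_gen X F U0 e" and Y: "opn V Y" "p \<in> Y" "Y \<subseteq> W" "Y \<subseteq> preim V f U0"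
  by (rule line_bundle_genE)
 have YU: "Y \<subseteq> preim V f U" using Y(3) U(2) openin_subset[OF Y(1)] by (auto simp: preim_def)
 have "\<exists>w\<in>Ms G Y. \<forall>q\<in>Y. pure_at U (u i) W (v i) q = pure_at U0 e Y w q" if "i < l" for i
 proof -
  have i: "u i \<in> Ms F U" "v i \<in> Ms G W" using u v that by auto
  obtain w where "w \<in> Ms G Y" "\<forall>q\<in>Y. pure_at U (u i) Y (mres G W Y (v i)) q = pure_at U0 e Y w q"
   by (rule pure_at_basisE[OF e U(1) i(1) Y(1,4) YU G.res_closed[OF W Y(1,3) i(2)]])
  thus ?thesis using pure_at_res_right[OF W Y(1,3) _ i(2)] by auto
 qed
 then obtain w where w: "\<And>i. i < l \<Longrightarrow> w i \<in> Ms G Y"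
  "\<And>i q. \<lbrakk>i < l; q \<in> Y\<rbrakk> \<Longrightarrow> pure_at U (u i) W (v i) q = pure_at U0 e Y (w i) q" by metis
 have w_closed: "w \<in> {..<l} \<rightarrow> Ms G Y" using w(1) by simp
 interpret M: module "osec V Y" "msec G Y" by (rule G.module_sec[OF Y(1)])
 have "finsum (FG_stalk q) (\<lambda>i. pure_at U (u i) W (v i) q) {..<l} =
   pure_at U0 e Y (finsum (msec G Y) w {..<l}) q" if q: "q \<in> Y" for q
 proof -
  have qU: "q \<in> pts V" "mpt f q \<in> U0" using Y(4) q by (auto simp: preim_def)
  interpret S: module "ostalk V q" "FG_stalk q" by (rule FG_stalk_module[OF qU(1)])
  have "finsum (FG_stalk q) (\<lambda>i. pure_at U (u i) W (v i) q) {..<l} =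
    finsum (FG_stalk q) (\<lambda>i. pure_at U0 e Y (w i) q) {..<l}"
   by (rule S.finsum_cong') (use w q pure_at_closed[OF Y(1) q free_genD(1)[OF e] qU(2)
     free_genD(2)[OF e]] in auto)
  thus ?thesis using finsum_pure_at_basis[OF e Y(1,4) w_closed q] by simp
 qed
 hence "locally_in V basis_functions Y (\<lambda>q. finsum (FG_stalk q) (\<lambda>i. pure_at U (u i) W (v i) q) {..<l})"
  by (intro locally_in_basis_functionsI[OF e Y(1,4) M.finsum_closed[OF w_closed]]) simp
 thus "\<exists>Y. opn V Y \<and> p \<in> Y \<and> Y \<subseteq> W \<and> locally_in V basis_functions Y
   (\<lambda>q. finsum (FG_stalk q) (\<lambda>i. pure_at U (u i) W (v i) q) {..<l})"
  using Y by blast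
qed

lemma pullback_tensor_eq_basis_functions: "FG = etale_sheaf V FG_stalk basis_functions"
 unfolding pullback_tensor_def
proof (rule etale_sheaf_refine)
 let ?sums = "\<lambda>W. {(\<lambda>q. finsum (FG_stalk q) (\<lambda>i. pure_at U (u i) W (v i) q) {..<l})
     | l U u v. opn X U \<and> mpt f ` W \<subseteq> U \<and> u \<in> {..<l::nat} \<rightarrow> Ms F U \<and> v \<in> {..<l} \<rightarrow> Ms G W}"
 fix W t assume W: "opn V W"
 show "locally_in V basis_functions W t" if "t \<in> ?sums W"
  using that locally_in_basis_functions_finsum[OF W] by auto
 assume "t \<in> basis_functions W"
 then obtain U e g where e: "free_gen X F U e" "W \<subseteq> preim V f U" "g \<in> Ms G W" "t = pure_at U e W g"
  by (rule basis_functionsE)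
 let ?t = "\<lambda>q. finsum (FG_stalk q) (\<lambda>i. pure_at U e W g q) {..<1::nat}"
 have "t q = ?t q" if q: "q \<in> W" for q
 proof -
  have qU: "q \<in> pts V" "mpt f q \<in> U" using e(2) q by (auto simp: preim_def)
  interpret S: module "ostalk V q" "FG_stalk q" by (rule FG_stalk_module[OF qU(1)])
  show ?thesis using pure_at_closed[OF W q free_genD(1)[OF e(1)] qU(2) free_genD(2)[OF e(1)] e(3)] e(4)
   by (simp add: lessThan_Suc)
 qed
 moreover have "mpt f ` W \<subseteq> U" using e(2) by (auto simp: preim_def)
 hence "?t \<in> ?sums W" using e(3) free_genD(1,2)[OF e(1)] unfolding mem_Collect_eq
  by (intro exI[of _ 1] exI[of _ U] exI[of _ "\<lambda>i. e"] exI[of _ "\<lambda>i. g"]) simp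
 ultimately show "locally_in V ?sums W t" by (intro locally_inI[OF W, of ?t]) simp_all
qed

sublocale etale_module V FG_stalk basis_functions
proof (intro etale_module.intro etale_module_axioms.intro G.ringed_space_axioms FG_stalk_module)
 fix W assume W: "opn V W"
 have fq: "mpt f q \<in> U" if "q \<in> W" "W \<subseteq> preim V f U" for q U using that by (auto simp: preim_def)
 show "locally_in V basis_functions W (\<lambda>q. 0[FG_stalk q])"
 proof (rule locally_in_local)
  fix p assume "p \<in> W"
  with W obtain U e Y where e: "free_gen X F U e" and Y: "opn V Y" "p \<in> Y" "Y \<subseteq> W" "Y \<subseteq> preim V f U"
   by (rule line_bundle_genE)
  have "locally_in V basis_functions Y (\<lambda>q. 0[FG_stalk q])"
   using pure_at_zero[OF Y(1) _ free_genD(1)[OF e] _ free_genD(2)[OF e]] Y(4)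
   by (intro locally_in_basis_functionsI[OF e Y(1,4) G.zero_closed[OF Y(1)]]) (auto simp: preim_def)
  thus "\<exists>Y. opn V Y \<and> p \<in> Y \<and> Y \<subseteq> W \<and> locally_in V basis_functions Y (\<lambda>q. 0[FG_stalk q])"
   using Y by blast
 qed
 fix t assume "t \<in> basis_functions W"
 then obtain U e g where e: "free_gen X F U e" and WU: "W \<subseteq> preim V f U" and g: "g \<in> Ms G W"
   and t: "t = pure_at U e W g"
  by (rule basis_functionsE)
 note ops = pure_at_ops[OF W _ free_genD(1)[OF e] fq[OF _ WU] free_genD(2)[OF e]]
 show "t q \<in> carrier (FG_stalk q)" if "q \<in> W" for q using ops(1)[OF that that g] by (simp add: t)
 show "\<exists>r\<in>basis_functions Y. \<forall>q\<in>Y. t q = r q" if "opn V Y" "Y \<subseteq> W" for Y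
  using pure_at_res_right[OF W that _ g] WU that
  by (intro bexI[OF _ basis_functionsI[OF e _ G.res_closed[OF W that g]]]) (auto simp: t)
 show "\<exists>r\<in>basis_functions W. \<forall>q\<in>W. ogerm V q W a *.[FG_stalk q] t q = r q" if "a \<in> Os V W" for a
  using ops(3) that g by (intro bexI[OF _ basis_functionsI[OF e WU G.smult_closed[OF W that g]]])
    (auto simp: t)
 fix t' assume "t' \<in> basis_functions W"
 then obtain U' e' g' where e': "free_gen X F U' e'" and WU': "W \<subseteq> preim V f U'"
   and g': "g' \<in> Ms G W" and t': "t' = pure_at U' e' W g'"
  by (rule basis_functionsE)
 obtain h where h: "h \<in> Ms G W" "\<forall>q\<in>W. pure_at U' e' W g' q = pure_at U e W h q"
  by (rule pure_at_basisE[OF e free_genD(1,2)[OF e'] W WU WU' g'])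
 show "\<exists>r\<in>basis_functions W. \<forall>q\<in>W. t q +[FG_stalk q] t' q = r q"
  using ops(2) g h by (intro bexI[OF _ basis_functionsI[OF e WU G.add_closed[OF W g h(1)]]])
    (auto simp: t t')
qed

lemma mod_sheaf_FG: "mod_sheaf V FG"
 unfolding pullback_tensor_eq_basis_functions by (rule etale_mod_sheaf)

subsection \<open>Pure sections\<close>

definition pure_section :: "'p set \<Rightarrow> 'm \<Rightarrow> 'q set \<Rightarrow> 'n \<Rightarrow> 'q \<Rightarrow>
  (('p set \<times> 'm) set \<times> ('q set \<times> 'n) set \<Rightarrow>\<^sub>0 int) set"
 where "pure_section U u W v = (\<lambda>q\<in>W. pure_at U u W v q)"

lemma FG_sel:
 "s +[msec FG U] t = (\<lambda>p\<in>U. s p +[FG_stalk p] t p)"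
 "a *.[msec FG U] s = (\<lambda>p\<in>U. ogerm V p U a *.[FG_stalk p] s p)"
 "mres FG U W s = restrict s W"
 by (simp_all add: pullback_tensor_def etale_sheaf_sel)

lemma pure_section_closed:
 assumes "opn V W" "W \<subseteq> preim V f U" "free_gen X F U e" "g \<in> Ms G W"
 shows "pure_section U e W g \<in> Ms FG W"
 unfolding pullback_tensor_eq_basis_functions etale_sheaf_section_iff pure_section_def
 by (intro conjI restrict_extensional locally_in_basis_functionsI[OF assms(3,1,2,4)]) simp

lemma pure_section_smult:
 assumes W: "opn V W" "W \<subseteq> preim V f U" and u: "opn X U"
   "u \<in> Ms F U" and v: "v \<in> Ms G W" and a: "a \<in> Os V W"
 shows "pure_section U u W (a *.[msec G W] v) = a *.[msec FG W] pure_section U u W v"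
 using pure_at_smult[OF W(1) _ u(1) _ u(2) a v] W(2)
 by (auto simp: pure_section_def FG_sel preim_def fun_eq_iff restrict_def)

lemma pure_section_res:
 assumes W: "opn V W" "opn V W'" "W' \<subseteq> W" "W' \<subseteq> preim V f U'" and v: "v \<in> Ms G W"
  and U: "opn X U" "opn X U'" "U' \<subseteq> U" and u: "u \<in> Ms F U"
 shows "mres FG W W' (pure_section U u W v) = pure_section U' (mres F U U' u) W' (mres G W W' v)"
 using pure_at_res[OF W(1-3) _ v U _ u] W(3,4)
 by (auto simp: pure_section_def FG_sel preim_def fun_eq_iff restrict_def)

lemma pure_section_balanced:
 assumes W: "opn V W" "W \<subseteq> preim V f U" and v: "v \<in> Ms G W" and U: "opn X U" and u: "u \<in> Ms F U"
   and a: "a \<in> Os X U"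
 shows "pure_section U (a *.[msec F U] u) W v = pure_section U u W (pull U W a *.[msec G W] v)"
 using pure_at_balanced[OF W(1) _ W(2) v U u a] by (auto simp: pure_section_def fun_eq_iff restrict_def)

lemma pure_at_basis_cancel:
 assumes e: "free_gen X F U e" and g: "free_gen V G W g" and W: "W \<subseteq> preim V f U" and q: "q \<in> W"
  and AB: "A \<in> carrier (ostalk V q)" "B \<in> carrier (ostalk V q)"
  and eq: "A *.[FG_stalk q] pure_at U e W g q = B *.[FG_stalk q] pure_at U e W g q"
 shows "A = B"
proof -
 have qU: "q \<in> pts V" "mpt f q \<in> U" using W q by (auto simp: preim_def)
 interpret T: tensor_product_rank_one "ostalk X (mpt f q)" "ostalk V q" "mstalk X F (mpt f q)"
   "mstalk V G q"
  "stalk_map V f q" "mgerm X F (mpt f q) U e" by (rule rank_one_at[OF qU(1) e qU(2)])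
 have g_germ: "mgerm V G q W g \<in> carrier (mstalk V G q)"
  by (rule G.mgerm_closed[OF free_genD(1)[OF g] q free_genD(2)[OF g]])
 have "A *.[mstalk V G q] mgerm V G q W g = B *.[mstalk V G q] mgerm V G q W g"
  by (rule T.pure_basis_inj[OF T.N.smult_closed[OF AB(1) g_germ] T.N.smult_closed[OF AB(2) g_germ]])
   (use eq T.pure_smult[OF AB(1) T.e g_germ] T.pure_smult[OF AB(2) T.e g_germ] in
     \<open>simp only: pure_germ_def pullback_tensor_stalk_def\<close>)
 from G.free_gen_stalk_cancel[OF g q AB this] show ?thesis .
qed

lemma FG_local_coefficient:
 assumes e: "free_gen X F U e" and g: "free_gen V G W g" and W: "W \<subseteq> preim V f U"
  and Z: "opn V Z" "Z \<subseteq> W" and s: "s \<in> Ms FG Z" and p: "p \<in> Z"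
 obtains Y a where "opn V Y" "p \<in> Y" "Y \<subseteq> Z" "a \<in> Os V Y"
   "\<forall>q\<in>Y. s q = ogerm V q Y a *.[FG_stalk q] pure_at U e W g q"
proof -
 have "locally_in V basis_functions Z s" using s
  by (simp add: pullback_tensor_eq_basis_functions etale_sheaf_section_iff)
 then obtain Y t where Y: "opn V Y" "p \<in> Y" "Y \<subseteq> Z" "t \<in> basis_functions Y" "\<forall>q\<in>Y. s q = t q"
  by (rule locally_inE[OF _ p])
 obtain U' e' v where e': "free_gen X F U' e'" "Y \<subseteq> preim V f U'" "v \<in> Ms G Y" "t = pure_at U' e' Y v"
  by (rule basis_functionsE[OF Y(4)])
 have YW: "Y \<subseteq> W" "Y \<subseteq> preim V f U" using Y(3) Z(2) W by auto
 obtain w where w: "w \<in> Ms G Y" "\<forall>q\<in>Y. pure_at U' e' Y v q = pure_at U e Y w q"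
  by (rule pure_at_basisE[OF e free_genD(1,2)[OF e'(1)] Y(1) YW(2) e'(2,3)])
 obtain a where a: "a \<in> Os V Y" "w = a *.[msec G Y] mres G W Y g"
  by (rule free_genE[OF g Y(1) YW(1) w(1)])
 have "s q = ogerm V q Y a *.[FG_stalk q] pure_at U e W g q" if q: "q \<in> Y" for q
 proof -
  have fq: "mpt f q \<in> U" using q YW(2) by (auto simp: preim_def)
  have "s q = pure_at U e Y (a *.[msec G Y] mres G W Y g) q" using Y(5) e'(4) w(2) a(2) q by simp
  also have "... = ogerm V q Y a *.[FG_stalk q] pure_at U e Y (mres G W Y g) q"
   by (rule pure_at_smult[OF Y(1) q free_genD(1)[OF e] fq free_genD(2)[OF e] a(1)
     G.res_closed[OF free_genD(1)[OF g] Y(1) YW(1) free_genD(2)[OF g]], symmetric])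
  finally show ?thesis using pure_at_res_right[OF free_genD(1)[OF g] Y(1) YW(1)
    q free_genD(2)[OF g]] by simp
 qed
 thus thesis using Y(1-3) a(1) by (intro that) blast+
qed

lemma free_gen_pure_section:
 assumes W: "W \<subseteq> preim V f U" and e: "free_gen X F U e" and g: "free_gen V G W g"
 shows "free_gen V FG W (pure_section U e W g)"
 unfolding free_gen_def
proof (intro conjI allI impI ballI free_genD(1)[OF g] pure_section_closed W e free_genD(2)[OF g])
 fix Z s assume "opn V Z \<and> Z \<subseteq> W" and s: "s \<in> Ms FG Z"
 hence Z: "opn V Z" "Z \<subseteq> W" by auto
 let ?E = "mres FG W Z (pure_section U e W g)"
 have smult_value: "(a *.[msec FG Z] ?E) q = ogerm V q Z a *.[FG_stalk q] pure_at U e W g q"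
   if "q \<in> Z" for a q
  using that Z(2) by (auto simp: FG_sel pure_section_def)
 have cancel: "A = B" if "q \<in> Z" "A \<in> carrier (ostalk V q)" "B \<in> carrier (ostalk V q)"
  "A *.[FG_stalk q] pure_at U e W g q = B *.[FG_stalk q] pure_at U e W g q" for q A B
  using pure_at_basis_cancel[OF e g W _ that(2-4)] that(1) Z(2) by blast
 define c where "c q = (SOME A. A \<in> carrier (ostalk V q) \<and> s q =
   A *.[FG_stalk q] pure_at U e W g q)" for q
 have local_coeff: "\<exists>Y a. opn V Y \<and> p \<in> Y \<and> Y \<subseteq> Z \<and> a \<in> Os V Y \<and> (\<forall>q\<in>Y. ogerm V q Y a = c q)"
  and coeff: "s p = c p *.[FG_stalk p] pure_at U e W g p" if p: "p \<in> Z" for p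
 proof -
  obtain Y a where Y: "opn V Y" "p \<in> Y" "Y \<subseteq> Z" "a \<in> Os V Y"
   "\<forall>q\<in>Y. s q = ogerm V q Y a *.[FG_stalk q] pure_at U e W g q"
     by (rule FG_local_coefficient[OF e g W Z s p])
  have c: "c q \<in> carrier (ostalk V q) \<and> s q = c q *.[FG_stalk q] pure_at U e W g q" if "q \<in> Y" for q
   unfolding c_def by (rule someI[of _ "ogerm V q Y a"]) (use that Y(5)
     G.ogerm_closed[OF Y(1) that Y(4)] in simp)
  have "ogerm V q Y a = c q" if q: "q \<in> Y" for q
   by (rule cancel[of q]) (use q c[OF q] Y(3,5) G.ogerm_closed[OF Y(1) q Y(4)] in auto)
  with Y(1-4) c[OF Y(2)] show "\<exists>Y a. opn V Y \<and> p \<in> Y \<and> Y \<subseteq> Z \<and> a \<in> Os V Y \<and> (\<forall>q\<in>Y. ogerm V q Y a = c q)"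
   "s p = c p *.[FG_stalk p] pure_at U e W g p" by blast+
 qed
 obtain b where b: "b \<in> Os V Z" "\<forall>p\<in>Z. ogerm V p Z b = c p"
  by (rule G.osec_glue_germs[OF Z(1) local_coeff])
 have "s \<in> extensional Z" using s by (simp add: pullback_tensor_eq_basis_functions
   etale_sheaf_section_iff)
 hence s_eq: "s = b *.[msec FG Z] ?E"
  by (rule extensionalityI) (simp add: FG_sel, simp only: smult_value b(2) coeff)
 show "\<exists>!a. a \<in> Os V Z \<and> s = a *.[msec FG Z] ?E"
 proof (rule ex1I[of _ b])
  show "b \<in> Os V Z \<and> s = b *.[msec FG Z] ?E" using b(1) s_eq by blast
  fix a assume a: "a \<in> Os V Z \<and> s = a *.[msec FG Z] ?E"
  show "a = b"
  proof (rule G.osec_eqI_ogerm[OF Z(1) _ b(1)])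
   fix p assume p: "p \<in> Z"
   show "ogerm V p Z a = ogerm V p Z b"
    by (rule cancel[OF p]) (use a b(1) p s_eq smult_value G.ogerm_closed[OF Z(1) p] in metis)+
  qed (use a in simp)
 qed
qed

lemma line_bundle_FG:
 assumes G: "line_bundle V G" shows "line_bundle V FG"
 unfolding line_bundle_def
proof (intro conjI ballI mod_sheaf_FG)
 fix p assume p: "p \<in> pts V"
 obtain W g where g: "p \<in> W" "free_gen V G W g" using line_bundleD(2)[OF G p] by blast
 obtain U e Y where e: "free_gen X F U e" and Y: "opn V Y" "p \<in> Y" "Y \<subseteq> W" "Y \<subseteq> preim V f U"
  by (rule line_bundle_genE[OF free_genD(1)[OF g(2)] g(1)])
 from free_gen_pure_section[OF Y(4) e G.free_gen_res[OF g(2) Y(1,3)]] Y(2)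
 show "\<exists>U e. p \<in> U \<and> free_gen V FG U e" by blast
qed

end

subsection \<open>The tensor product as the case \<open>f = id\<close>\<close>

lemma preim_mor_id: "opn X U \<Longrightarrow> preim X mor_id U = U"
 using openin_subset[of "tp X" U] by (auto simp: preim_def mor_id_def)

lemma mor_id_pre_hom: "pre_hom X X mor_id"
proof -
 have "(\<lambda>s. s) \<in> ring_hom (osec X U) (osec X U)" for U by (rule ring_hom_memI) simp_all
 thus ?thesis unfolding pre_hom_def
  by (simp add: preim_mor_id) (simp add: mor_id_def continuous_map_id[unfolded id_def] eta_contract_eq)
qed

locale line_bundle_tensor = line_bundle_pullback_tensor X X mor_id F G
 for X :: "('p, 'a) rspace" and F :: "('p, 'a, 'm) msheaf" and G :: "('p, 'a, 'n) msheaf"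
begin

lemma mpt_mor_id: "mpt (mor_id :: ('p, 'a, 'p, 'a) rmor) q = q" by (simp add: mor_id_def)

lemma stalk_map_mor_id:
 assumes A: "A \<in> carrier (ostalk X q)" shows "stalk_map X mor_id q A = A"
proof -
 obtain U s where U: "opn X U" "q \<in> U" "s \<in> Os X U" "A = ogerm X q U s" by (rule F.ostalkE[OF A])
 have "q \<in> pts X" using U openin_subset by blast
 thus ?thesis using f.stalk_map_ogerm[of q U s] U
  by (simp add: mpt_mor_id preim_mor_id) (simp add: mor_id_def)
qed

lemma tensor_stalk_eq:
 shows tens_module_stalk: "tens_module (ostalk X q) (\<lambda>a. a) (mstalk X F q) (mstalk X G q) = FG_stalk q"
  and tens_class_stalk: "tens_class (ostalk X q) (\<lambda>a. a) (mstalk X F q) (mstalk X G q)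
    (frag_of (mgerm X F q U u, mgerm X G q W v)) = pure_at U u W v q"
proof -
 have "tens_null (ostalk X q) (\<lambda>a. a) (mstalk X F q) (mstalk X G q)
   = tens_null (ostalk X q) (stalk_map X mor_id q) (mstalk X F q) (mstalk X G q)"
  by (rule tens_null_cong) (simp add: stalk_map_mor_id)
 thus "tens_module (ostalk X q) (\<lambda>a. a) (mstalk X F q) (mstalk X G q) = FG_stalk q"
  "tens_class (ostalk X q) (\<lambda>a. a) (mstalk X F q) (mstalk X G q)
    (frag_of (mgerm X F q U u, mgerm X G q W v)) = pure_at U u W v q"
  by (simp_all add: pullback_tensor_stalk_def pure_germ_def mpt_mor_id tens_module_def tens_class_def)
qed

lemma tensor_eq: "tensor X F G = FG"
 unfolding tensor_def tensor_stalk_def tens_module_stalk tens_class_stalk pullback_tensor_def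
proof (rule etale_sheaf_refine)
 let ?sums = "\<lambda>W. {(\<lambda>q. finsum (FG_stalk q) (\<lambda>i. pure_at W (u i) W (v i) q) {..<l})
     | l u v. u \<in> {..<l::nat} \<rightarrow> Ms F W \<and> v \<in> {..<l} \<rightarrow> Ms G W}"
 let ?sums' = "\<lambda>W. {(\<lambda>q. finsum (FG_stalk q) (\<lambda>i. pure_at U (u i) W (v i) q) {..<l})
     | l U u v. opn X U \<and> mpt (mor_id :: ('p, 'a, 'p, 'a)
       rmor) ` W \<subseteq> U \<and> u \<in> {..<l::nat} \<rightarrow> Ms F U \<and> v \<in> {..<l} \<rightarrow> Ms G W}"
 fix W t assume W: "opn X W"
 {
  assume "t \<in> ?sums W"
  hence "t \<in> ?sums' W" using W by (fastforce simp: mpt_mor_id)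
  thus "locally_in X ?sums' W t" by (rule locally_inI[OF W]) simp
 next
  assume "t \<in> ?sums' W"
  then obtain l :: nat and U u v where t: "t =
    (\<lambda>q. finsum (FG_stalk q) (\<lambda>i. pure_at U (u i) W (v i) q) {..<l})"
   and U: "opn X U" "W \<subseteq> U" and uv: "u \<in> {..<l} \<rightarrow> Ms F U" "v \<in> {..<l} \<rightarrow> Ms G W"
     by (auto simp: mpt_mor_id)
  have res_u: "(\<lambda>i. mres F U W (u i)) \<in> {..<l} \<rightarrow> Ms F W"
   using uv(1) F.res_closed[OF U(1) W U(2)] by auto
  have "t q = finsum (FG_stalk q) (\<lambda>i. pure_at W (mres F U W (u i)) W (v i) q) {..<l}"
    if q: "q \<in> W" for q
  proof -
   interpret S: module "ostalk X q" "FG_stalk q" using FG_stalk_module q openin_subset[OF W] by blast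
   have closed: "pure_at W (mres F U W (u i)) W (v i) q \<in> carrier (FG_stalk q)" if "i \<in> {..<l}" for i
    using pure_at_closed[OF W q W, of _ "v i"] funcset_mem[OF uv(2) that] funcset_mem[OF res_u
      that] q by (simp add: mpt_mor_id)
   have eq: "pure_at U (u i) W (v i) q = pure_at W (mres F U W (u i)) W (v i) q" if "i \<in> {..<l}" for i
    using pure_at_res[OF W W order_refl q _ U(1) W U(2), of "v i" "u i"]
     G.res_id[OF W] funcset_mem[OF uv(1) that] funcset_mem[OF uv(2) that] q by (simp add: mpt_mor_id)
   show ?thesis unfolding t by (rule S.finsum_cong') (use eq closed in auto)
  qed
  moreover have "(\<lambda>q. finsum (FG_stalk q) (\<lambda>i. pure_at W (mres F U W (u i)) W
    (v i) q) {..<l}) \<in> ?sums W"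
   unfolding mem_Collect_eq using res_u uv(2)
   by (intro exI[of _ l] exI[of _ "\<lambda>i. mres F U W (u i)"] exI[of _ v]) simp
  ultimately show "locally_in X ?sums W t" by (intro locally_inI[OF W]) blast+
 }
qed

end

lemma line_bundle_tensorI:
 assumes "lrs X" "line_bundle X F" "mod_sheaf X G" shows "line_bundle_tensor X F G"
 by (intro line_bundle_tensor.intro line_bundle_pullback_tensor.intro mor_id_pre_hom assms)

section \<open>Integral schemes\<close>

locale affine_domain = affine_scheme R + domain R for R :: "'a ring"
begin

lemma lfrac_eq_iff:
 assumes p: "primeideal p R" and x: "(a, s) \<in> loc_pairs R p" "(b, t) \<in> loc_pairs R p"
 shows "lfrac R p (a, s) = lfrac R p (b, t) \<longleftrightarrow> a *[R] t = b *[R] s"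
proof -
 interpret p: prime_at p R using p by (simp add: prime_at_def)
 have c: "a *[R] t \<in> carrier R" "b *[R] s \<in> carrier R" using x by (simp_all add: loc_pairs_def)
 have "a *[R] t = b *[R] s" if "u \<in> carrier R - p" "u *[R] (a *[R] t) = u *[R] (b *[R] s)" for u
  using m_lcancel[OF _ _ c, of u] that p.zero_in by (metis DiffD1 DiffD2)
 thus ?thesis unfolding p.lfrac_eq[OF x] using p.one_notin one_closed by (metis DiffI)
qed

lemma Spec_add_zero:
 assumes U: "opn (Spec R) U" and s: "s \<in> Os (Spec R) U"
   shows "s +[osec (Spec R) U] 0[osec (Spec R) U] = s"
proof (rule extensionalityI[OF _ Spec_section_extensional[OF s]])
 fix q assume q: "q \<in> U"
 interpret q: prime_at q R by (rule Spec_opn_prime[OF U q])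
 obtain a t where "(a, t) \<in> loc_pairs R q" "s q = lfrac R q (a, t)"
  by (rule Spec_section_valueE[OF s q])
 thus "(s +[osec (Spec R) U] 0[osec (Spec R) U]) q = s q"
  using q q.lfrac_add[of a t "0[R]" "1[R]"] q.one_notin by (simp add: Spec_sel loc_pairs_iff)
qed (simp add: Spec_sel)

lemma generic_point_mem:
 assumes "opn (Spec R) W" "W \<noteq> {}" shows "{0[R]} \<in> W"
proof -
 obtain S where S: "S \<subseteq> carrier R" "W = {p. primeideal p R \<and> \<not> S \<subseteq> p}" using assms(1)
  unfolding Spec_opn_iff by blast
 then obtain p where p: "primeideal p R" "\<not> S \<subseteq> p" using assms(2) by blast
 have "0[R] \<in> p" using prime_at.zero_in[of p R] p(1) by (simp add: prime_at_def)
 thus ?thesis using S(2) p(2) zeroprimeideal by blast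
qed

lemma Spec_section_eqI:
 assumes s: "s \<in> Os (Spec R) U" and t: "t \<in> Os (Spec R) U" and p: "p \<in> U" "s p = t p"
 shows "s = t"
proof -
 let ?g = "{0[R]}"
 have eq_iff_generic: "s q = t q \<longleftrightarrow> s ?g = t ?g" if q: "q \<in> U" for q
 proof -
  obtain W a u where W: "opn (Spec R) W" "q \<in> W" "W \<subseteq> U" "fraction_on R s W a u"
   by (rule Spec_sectionE[OF s q])
  obtain Y b v where Y: "opn (Spec R) Y" "q \<in> Y" "Y \<subseteq> U" "fraction_on R t Y b v"
   by (rule Spec_sectionE[OF t q])
  have "s r = t r \<longleftrightarrow> a *[R] v = b *[R] u" if r: "r \<in> W" "r \<in> Y" for r
   using lfrac_eq_iff[OF _ fraction_onD(1)[OF W(4) r(1)]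
     fraction_onD(1)[OF Y(4) r(2)]] Spec_opn_prime[OF W(1) r(1)]
   by (simp add: fraction_onD(2)[OF W(4) r(1)] fraction_onD(2)[OF Y(4) r(2)] prime_at_def)
  from this[of q] this[of ?g] show ?thesis using generic_point_mem W Y by blast
 qed
 have "s q = t q" if "q \<in> U" for q using eq_iff_generic[OF that] eq_iff_generic[OF p(1)] p(2) by simp
 thus ?thesis by (rule extensionalityI[OF Spec_section_extensional[OF s]
   Spec_section_extensional[OF t]])
qed

end

subsection \<open>Isomorphisms of open subspaces\<close>

lemma open_sub_sel [simp]: "osec (open_sub X U) = osec X" "ores (open_sub X U) = ores X"
 by (simp_all add: open_sub_def)

lemma open_sub_opn: "opn X U \<Longrightarrow> opn (open_sub X U) W \<longleftrightarrow> opn X W \<and> W \<subseteq> U"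
 by (simp add: open_sub_def openin_open_subtopology)

lemma open_sub_pts: "opn X U \<Longrightarrow> pts (open_sub X U) = U"
 using openin_subset[of "tp X" U] by (auto simp: open_sub_def)

lemma open_sub_open_sub: "W \<subseteq> U \<Longrightarrow> open_sub (open_sub X U) W = open_sub X W"
 by (simp add: open_sub_def subtopology_subtopology Int_absorb1)

lemma pre_ring_open_sub: "pre_ring X \<Longrightarrow> opn X U \<Longrightarrow> pre_ring (open_sub X U)"
 unfolding pre_ring_def is_presheaf_def by (simp add: open_sub_opn)

lemma preim_open_sub: "U \<subseteq> D \<Longrightarrow> preim (open_sub X (preim X f D)) f U = preim X f U"
 by (auto simp: preim_def open_sub_def)

lemma pre_hom_open_sub:
 assumes f: "pre_hom X Y f" and D: "opn Y D"
 shows "pre_hom (open_sub X (preim X f D)) (open_sub Y D) f"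
proof -
 have "continuous_map (tp (open_sub X (preim X f D))) (tp (open_sub Y D)) (mpt f)"
  using continuous_map_from_subtopology[OF pre_hom_continuous[OF f]]
  by (auto simp: continuous_map_in_subtopology preim_def open_sub_def)
 thus ?thesis unfolding pre_hom_def open_sub_opn[OF D]
  using pre_hom_ring_hom[OF f] pre_hom_res[OF f] by (simp add: preim_open_sub)
qed

lemma pre_hom_to_open_sub:
 assumes f: "pre_hom X Y f" and D: "opn Y D" "preim X f D = pts X"
 shows "pre_hom X (open_sub Y D) f"
 using pre_hom_open_sub[OF f D(1)] unfolding D(2) open_sub_def subtopology_topspace
 by (simp add: pre_hom_def preim_def)

lemma mutually_inverse_open_sub:
 assumes fg: "mutually_inverse X Y f g" and D: "opn Y D"
 shows "mutually_inverse (open_sub X (preim X f D)) (open_sub Y D) f g"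
proof -
 note inv = mutually_inverseD[OF fg]
 let ?E = "preim X f D"
 have E: "opn X ?E" by (rule pre_hom_opn[OF inv(1) D])
 have sub: "D \<subseteq> pts Y" "?E \<subseteq> pts X" using openin_subset[OF D] openin_subset[OF E] by auto
 have g: "pre_hom (open_sub Y D) (open_sub X ?E) g" using pre_hom_open_sub[OF inv(2) E]
  by (simp add: inv(7)[OF D])
 have pre: "preim (open_sub X ?E) f U = preim X f U" if "U \<subseteq> D" for U using that
  by (rule preim_open_sub)
 have pre': "preim (open_sub Y D) g U = preim Y g U" if "U \<subseteq> ?E" for U
  using preim_open_sub[OF that, of Y g] by (simp add: inv(7)[OF D])
 show ?thesis
  unfolding mutually_inverse_def mor_eq_def open_sub_opn[OF D] open_sub_opn[OF E] open_sub_pts[OF D]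
    open_sub_pts[OF E]
  using pre_hom_open_sub[OF inv(1) D] g inv(3-6) sub by (auto simp: mor_comp_def mor_id_def pre pre')
qed

lemma preim_mor_comp: "pre_hom X Y f \<Longrightarrow> preim X (mor_comp Y g f) U = preim X f (preim Y g U)"
 using pre_hom_pts by (fastforce simp: preim_def mor_comp_def)

lemma pre_hom_comp:
 assumes f: "pre_hom X Y f" and g: "pre_hom Y Z g" shows "pre_hom X Z (mor_comp Y g f)"
 unfolding pre_hom_def preim_mor_comp[OF f]
proof (intro conjI allI impI ballI)
 show "continuous_map (tp X) (tp Z) (mpt (mor_comp Y g f))"
  using continuous_map_compose[OF pre_hom_continuous[OF f] pre_hom_continuous[OF g]]
  by (simp add: mor_comp_def comp_def)
 show "mco (mor_comp Y g f) U \<in> ring_hom (osec Z U) (osec X (preim X f (preim Y g U)))"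
   if "opn Z U" for U
  using ring_hom_trans[OF pre_hom_ring_hom[OF g that] pre_hom_ring_hom[OF f pre_hom_opn[OF g that]]]
  by (simp add: mor_comp_def comp_def)
 fix U W s assume "opn Z U \<and> opn Z W \<and> W \<subseteq> U" and s: "s \<in> Os Z U"
 hence UW: "opn Z U" "opn Z W" "W \<subseteq> U" by auto
 show "mco (mor_comp Y g f) W (ores Z U W s)
   = ores X (preim X f (preim Y g U)) (preim X f (preim Y g W)) (mco (mor_comp Y g f) U s)"
  using pre_hom_res[OF g UW s] pre_hom_res[OF f pre_hom_opn[OF g UW(1)] pre_hom_opn[OF g UW(2)]
    preim_mono[OF UW(3)]
   pre_hom_mco_closed[OF g UW(1) s]] by (simp add: mor_comp_def)
qed

lemma mor_comp_left_inverse: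
 assumes fg: "mutually_inverse X Y f g" and hk: "mutually_inverse Y Z h k"
 shows "mor_eq X X (mor_comp Z (mor_comp Y g k) (mor_comp Y h f)) mor_id"
 unfolding mor_eq_def
proof (intro conjI ballI allI impI)
 note inv = mutually_inverseD[OF fg] and inv' = mutually_inverseD[OF hk]
 show "mpt (mor_comp Z (mor_comp Y g k) (mor_comp Y h f)) p = mpt mor_id p" if "p \<in> pts X" for p
  using inv(3)[OF that] inv'(3)[OF pre_hom_pts[OF inv(1) that]] by (simp add: mor_comp_def mor_id_def)
 fix U s assume U: "opn X U" and s: "s \<in> Os X U"
 note V = pre_hom_opn[OF inv(2) U] and gs = pre_hom_mco_closed[OF inv(2) U s]
 have "preim Y h (preim Z k (preim Y g U)) = preim Y g U"
  by (rule mutually_inverseD(7)[OF mutually_inverse_sym[OF hk] V])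
 thus "mco (mor_comp Z (mor_comp Y g k) (mor_comp Y h f)) U s = mco mor_id U s"
  using inv(5)[OF U s] inv'(5)[OF V gs] preim_mor_comp[OF inv'(2), of g U]
  by (simp add: mor_comp_def mor_id_def)
qed

lemma mutually_inverse_comp:
 assumes fg: "mutually_inverse X Y f g" and hk: "mutually_inverse Y Z h k"
 shows "mutually_inverse X Z (mor_comp Y h f) (mor_comp Y g k)"
 unfolding mutually_inverse_def
 using mor_comp_left_inverse[OF fg hk] mor_comp_left_inverse[OF mutually_inverse_sym[OF hk]
   mutually_inverse_sym[OF fg]]
  pre_hom_comp[OF mutually_inverseD(1)[OF fg] mutually_inverseD(1)[OF hk]]
  pre_hom_comp[OF mutually_inverseD(2)[OF hk] mutually_inverseD(2)[OF fg]] by blast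

lemma ring_hom_inv_into:
 assumes h: "h \<in> ring_hom R S" and bij: "bij_betw h (carrier R) (carrier S)"
  and closed: "\<And>a b. \<lbrakk>a \<in> carrier R; b \<in> carrier R\<rbrakk> \<Longrightarrow> a *[R] b \<in> carrier R"
   "\<And>a b. \<lbrakk>a \<in> carrier R; b \<in> carrier R\<rbrakk> \<Longrightarrow> a +[R] b \<in> carrier R" "1[R] \<in> carrier R"
 shows "inv_into (carrier R) h \<in> ring_hom S R"
proof (rule ring_hom_memI)
 let ?g = "inv_into (carrier R) h"
 have gh: "?g (h a) = a" if "a \<in> carrier R" for a using bij that by (simp add: bij_betw_def)
 have g: "?g s \<in> carrier R" "h (?g s) = s" if "s \<in> carrier S" for s
  using bij that by (auto simp: bij_betw_def inv_into_into f_inv_into_f)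
 fix s t assume st: "s \<in> carrier S" "t \<in> carrier S"
 show "?g s \<in> carrier R" by (rule g(1)[OF st(1)])
 show "?g (s *[S] t) = ?g s *[R] ?g t" "?g (s +[S] t) = ?g s +[R] ?g t"
  using gh[OF closed(1)[OF g(1)[OF st(1)] g(1)[OF st(2)]]] gh[OF closed(2)[OF g(1)[OF st(1)]
    g(1)[OF st(2)]]] st
  by (simp_all add: ring_hom_mult[OF h] ring_hom_add[OF h] g)
next
 show "inv_into (carrier R) h 1[S] = 1[R]"
  using inv_into_f_f[OF bij_betw_imp_inj_on[OF bij] closed(3)] ring_hom_one[OF h] by simp
qed

lemma mutually_inverseI_bij:
 assumes Y: "pre_ring Y" and X: "pre_ring X" and f: "pre_hom X Y f"
   and k: "continuous_map (tp Y) (tp X) k"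
  and kf: "\<And>p. p \<in> pts X \<Longrightarrow> k (mpt f p) = p" and fk: "\<And>q. q \<in> pts Y \<Longrightarrow> mpt f (k q) = q"
  and bij: "\<And>U. opn Y U \<Longrightarrow> bij_betw (mco f U) (Os Y U) (Os X (preim X f U))"
 shows "\<exists>g. mutually_inverse X Y f g"
proof -
 interpret X: ringed_presheaf X by unfold_locales (rule X)
 interpret Y: ringed_presheaf Y by unfold_locales (rule Y)
 define g where "g = \<lparr>mpt = k, mco = (\<lambda>U s.
   inv_into (Os Y {q \<in> pts Y. k q \<in> U}) (mco f {q \<in> pts Y. k q \<in> U}) s)\<rparr>"
 have mpt_g: "mpt g = k" and mco_g: "mco g U = inv_into (Os Y (preim Y g U)) (mco f (preim Y g U))"
   for U
  by (auto simp: g_def preim_def)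
 have opn: "opn Y (preim Y g U)" and pre: "preim X f (preim Y g U) = U" if U: "opn X U" for U
  using openin_continuous_map_preimage[OF k U] openin_subset[OF U] kf pre_hom_pts[OF f]
  by (auto simp: preim_def mpt_g)
 have pre': "preim Y g (preim X f U) = U" if "opn Y U" for U
  using openin_subset[OF that] fk continuous_map_image_subset_topspace[OF k]
  by (auto simp: preim_def mpt_g)
 have bij_g: "bij_betw (mco f (preim Y g U)) (Os Y (preim Y g U)) (Os X U)" if "opn X U" for U
  using bij[OF opn[OF that]] by (simp add: pre[OF that])
 have fg: "mco f (preim Y g U) (mco g U s) = s" and g_closed: "mco g U s \<in> Os Y (preim Y g U)"
   if "opn X U" "s \<in> Os X U" for U s
  using bij_g[OF that(1)] that(2) by (auto simp: mco_g bij_betw_def f_inv_into_f inv_into_into)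
 have gf: "mco g U (mco f (preim Y g U) t) = t" if "opn X U" "t \<in> Os Y (preim Y g U)" for U t
  using bij_g[OF that(1)] that(2) by (simp add: mco_g bij_betw_def)
 have hom: "mco f (preim Y g U) \<in> ring_hom (osec Y (preim Y g U)) (osec X U)" if "opn X U" for U
  using pre_hom_ring_hom[OF f opn[OF that]] by (simp add: pre[OF that])
 have "pre_hom Y X g" unfolding pre_hom_def
 proof (intro conjI allI impI ballI)
  show "continuous_map (tp Y) (tp X) (mpt g)" using k by (simp add: mpt_g)
  show "mco g U \<in> ring_hom (osec X U) (osec Y (preim Y g U))" if U: "opn X U" for U
   unfolding mco_g by (rule ring_hom_inv_into[OF hom[OF U] bij_g[OF U]
     Y.osec_closed(3,4,1)[OF opn[OF U]]])
  fix U W s assume "opn X U \<and> opn X W \<and> W \<subseteq> U" and s: "s \<in> Os X U"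
  hence UW: "opn X U" "opn X W" "W \<subseteq> U" by auto
  note g = g_closed[OF UW(1) s] and sub = preim_mono[OF UW(3), of Y g]
  have "mco f (preim Y g W) (ores Y (preim Y g U) (preim Y g W) (mco g U s)) = ores X U W s"
   using pre_hom_res[OF f opn[OF UW(1)] opn[OF UW(2)] sub g]
   by (simp add: pre[OF UW(1)] pre[OF UW(2)] fg[OF UW(1) s])
  thus "mco g W (ores X U W s) = ores Y (preim Y g U) (preim Y g W) (mco g U s)"
   using gf[OF UW(2) Y.ores_closed[OF opn[OF UW(1)] opn[OF UW(2)] sub g]] by simp
 qed
 moreover have "mco g (preim X f U) (mco f U t) = t" if "opn Y U" "t \<in> Os Y U" for U t
  using gf[OF pre_hom_opn[OF f that(1)], of t] that by (simp add: pre')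
 ultimately have "mutually_inverse X Y f g"
  using f fg kf fk by (simp add: mutually_inverse_def mor_eq_def mor_comp_def mor_id_def mpt_g)
 thus ?thesis by (rule exI)
qed

subsection \<open>Basic open subsets of affine integral schemes\<close>

text \<open>The hypotheses say that \<open>S\<close> lies between \<open>R\<close> and every localization of \<open>R\<close> at a point of \<open>D(x)\<close>. They hold for
  \<open>S = \<O>(D(x))\<close> without an explicit description of this ring as \<open>R\<^sub>x\<close>.\<close>

locale basic_open = affine_hom R S i + R: affine_domain R + S: affine_domain S
 for R :: "'r ring" and S :: "'s ring" and i :: "'r \<Rightarrow> 's" +
 fixes x :: 'r
 assumes inj: "inj_on i (carrier R)" and x: "x \<in> carrier R" and ix: "i x \<in> Units S"
  and frac: "\<And>s q. \<lbrakk>s \<in> carrier S; primeideal q R; x \<notin> q\<rbrakk> \<Longrightarrow>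
   \<exists>a t. a \<in> carrier R \<and> t \<in> carrier R - q \<and> i t *[S] s = i a"
begin

abbreviation D :: "'r set set" where "D \<equiv> {q. primeideal q R \<and> x \<notin> q}"

abbreviation f where "f \<equiv> Spec_map R S i"

lemma D_open: "opn (Spec R) D" by (rule R.opn_basic_open[OF x])

lemma i_eq_iff: "a \<in> carrier R \<Longrightarrow> b \<in> carrier R \<Longrightarrow> i a = i b \<longleftrightarrow> a = b"
 using inj by (simp add: inj_on_eq_iff)

definition extend :: "'r set \<Rightarrow> 's set"
 where "extend q = {s \<in> carrier S. \<exists>a\<in>q. \<exists>t\<in>carrier R - q. i t *[S] s = i a}"

lemma extend_iff:
 assumes q: "q \<in> D" and s: "s \<in> carrier S" and a: "a \<in> carrier R" and t: "t \<in> carrier R - q"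
   and eq: "i t *[S] s = i a"
 shows "s \<in> extend q \<longleftrightarrow> a \<in> q"
proof
 interpret q: prime_at q R using q by (simp add: prime_at_def)
 assume "s \<in> extend q"
 then obtain b u where b: "b \<in> q" "u \<in> carrier R - q" "i u *[S] s = i b" unfolding extend_def by blast
 have c: "b \<in> carrier R" "t \<in> carrier R" "u \<in> carrier R" using b t q.Icarr by auto
 have "i (u *[R] a) = i u *[S] (i t *[S] s)" using eq c a by simp
 also have "... = i t *[S] (i u *[S] s)" using c s by (simp add: S.m_lcomm)
 also have "... = i (t *[R] b)" using b(3) c by simp
 finally have "u *[R] a = t *[R] b" by (rule inj_onD[OF inj]) (use c a in simp_all)
 hence "u *[R] a \<in> q" using q.mult_mem_iff[OF c(2,1)] b(1) by simp
 thus "a \<in> q" using q.mult_mem_iff[OF c(3) a] b(2) by simp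
next
 assume "a \<in> q" thus "s \<in> extend q" unfolding extend_def using s t eq by blast
qed

lemma extendE:
 assumes "q \<in> D" "s \<in> carrier S"
 obtains a t where "a \<in> carrier R" "t \<in> carrier R" "t \<notin> q" "i t *[S] s = i a" "s \<in> extend q \<longleftrightarrow> a \<in> q"
 using frac[of s q] extend_iff[OF assms] assms by blast

lemma extend_mult_iff:
 assumes q: "q \<in> D" and s: "s \<in> carrier S" and s': "s' \<in> carrier S"
 shows "s *[S] s' \<in> extend q \<longleftrightarrow> s \<in> extend q \<or> s' \<in> extend q"
proof -
 interpret q: prime_at q R using q by (simp add: prime_at_def)
 obtain a t where a: "a \<in> carrier R" "t \<in> carrier R" "t \<notin> q" "i t *[S] s = i a"
   "s \<in> extend q \<longleftrightarrow> a \<in> q" by (rule extendE[OF q s])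
 obtain b u where b: "b \<in> carrier R" "u \<in> carrier R" "u \<notin> q" "i u *[S] s' = i b"
   "s' \<in> extend q \<longleftrightarrow> b \<in> q" by (rule extendE[OF q s'])
 have "i (t *[R] u) *[S] (s *[S] s') = (i t *[S] s) *[S] (i u *[S] s')" using a(1,2) b(1,2) s s'
  by (simp add: S.m_ac)
 hence eq: "i (t *[R] u) *[S] (s *[S] s') = i (a *[R] b)" using a(1,4) b(1,4) by simp
 have "s *[S] s' \<in> extend q \<longleftrightarrow> a *[R] b \<in> q"
  using q.mult_notin[of t u] a(1-3) b(1-3) s s' by (intro extend_iff[OF q _ _ _ eq]) simp_all
 thus ?thesis using q.mult_mem_iff[OF a(1) b(1)] a(5) b(5) by simp
qed

lemma extend_add:
 assumes q: "q \<in> D" and s: "s \<in> extend q" and s': "s' \<in> extend q" shows "s +[S] s' \<in> extend q"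
proof -
 interpret q: prime_at q R using q by (simp add: prime_at_def)
 have c: "s \<in> carrier S" "s' \<in> carrier S" using s s' by (simp_all add: extend_def)
 obtain a t where a: "a \<in> carrier R" "t \<in> carrier R" "t \<notin> q" "i t *[S] s = i a"
   "s \<in> extend q \<longleftrightarrow> a \<in> q" by (rule extendE[OF q c(1)])
 obtain b u where b: "b \<in> carrier R" "u \<in> carrier R" "u \<notin> q" "i u *[S] s' = i b"
   "s' \<in> extend q \<longleftrightarrow> b \<in> q" by (rule extendE[OF q c(2)])
 have "i (t *[R] u) *[S] (s +[S] s') = i u *[S] (i t *[S] s) +[S] i t *[S] (i u *[S] s')"
  using a(1,2) b(1,2) c by (simp add: S.m_ac S.r_distr)
 hence eq: "i (t *[R] u) *[S] (s +[S] s') = i (u *[R] a +[R] t *[R] b)" using a(1,2,4) b(1,2,4) by simp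
 have "u *[R] a \<in> q" "t *[R] b \<in> q" using q.mult_mem_iff a b s s' by simp_all
 hence "u *[R] a +[R] t *[R] b \<in> q" by (rule additive_subgroup.a_closed[OF q.is_additive_subgroup])
 thus ?thesis using extend_iff[OF q _ _ _ eq] q.mult_notin[of t u] a(1-3) b(1-3) c by simp
qed

lemma extend_prime:
 assumes q: "q \<in> D" shows "primeideal (extend q) S"
proof -
 interpret q: prime_at q R using q by (simp add: prime_at_def)
 have sub: "extend q \<subseteq> carrier S" by (auto simp: extend_def)
 show ?thesis
 proof (rule primeidealI[OF idealI[OF S.ring_axioms]])
  show "subgroup (extend q) (add_monoid S)"
  proof (rule subgroup.intro)
   show "extend q \<subseteq> carrier (add_monoid S)" using sub by simp
   show "a *[add_monoid S] b \<in> extend q" if "a \<in> extend q" "b \<in> extend q" for a b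
    using extend_add[OF q that] by simp
   show "1[add_monoid S] \<in> extend q"
    using extend_iff[OF q, of "0[S]" "0[R]" "1[R]"] q.zero_in q.one_notin by simp
   fix a assume a: "a \<in> extend q"
   have "\<ominus>\<^bsub>S\<^esub> a = (\<ominus>\<^bsub>S\<^esub> 1[S]) *[S] a" using a sub by (auto simp: S.l_minus)
   hence "\<ominus>\<^bsub>S\<^esub> a \<in> extend q" using extend_mult_iff[OF q, of "\<ominus>\<^bsub>S\<^esub> 1[S]" a] a sub by auto
   thus "inv\<^bsub>add_monoid S\<^esub> a \<in> extend q" by (simp add: a_inv_def)
  qed
  show "y *[S] a \<in> extend q" "a *[S] y \<in> extend q" if "a \<in> extend q" "y \<in> carrier S" for a y
   using extend_mult_iff[OF q] that sub by auto
  show "cring S" by (rule S.is_cring)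
  have "1[S] \<notin> extend q" using extend_iff[OF q, of "1[S]" "1[R]" "1[R]"] q.one_notin by simp
  thus "carrier S \<noteq> extend q" using S.one_closed by metis
  show "a \<in> extend q \<or> b \<in> extend q" if "a \<in> carrier S" "b \<in> carrier S" "a *[S] b \<in> extend q" for a b
   using extend_mult_iff[OF q that(1,2)] that(3) by simp
 qed
qed

lemma contract_extend:
 assumes q: "q \<in> D" shows "contract (extend q) = q"
proof -
 interpret q: prime_at q R using q by (simp add: prime_at_def)
 have "i a \<in> extend q \<longleftrightarrow> a \<in> q" if "a \<in> carrier R" for a
  using extend_iff[OF q, of "i a" a "1[R]"] q.one_notin that by simp
 thus ?thesis using q.Icarr by blast
qed

lemma contract_in_D:
 assumes P: "primeideal P S" shows "contract P \<in> D"
proof -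
 interpret P: prime_at P S using P by (simp add: prime_at_def)
 obtain y where y: "y \<in> carrier S" "y *[S] i x = 1[S]" using ix by (auto simp: Units_def)
 have "i x \<notin> P" using P.mult_mem_iff[OF y(1), of "i x"] x y(2) P.one_notin by auto
 thus ?thesis using contract_prime[OF P] by simp
qed

lemma extend_contract:
 assumes P: "primeideal P S" shows "extend (contract P) = P"
proof -
 interpret P: prime_at P S using P by (simp add: prime_at_def)
 have q: "contract P \<in> D" by (rule contract_in_D[OF P])
 have "s \<in> extend (contract P) \<longleftrightarrow> s \<in> P" if s: "s \<in> carrier S" for s
 proof -
  obtain a t where a: "a \<in> carrier R" "t \<in> carrier R" "t \<notin> contract P" "i t *[S] s = i a"
   "s \<in> extend (contract P) \<longleftrightarrow> a \<in> contract P" by (rule extendE[OF q s])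
  have "s \<in> extend (contract P) \<longleftrightarrow> i t *[S] s \<in> P" using a by simp
  thus ?thesis using P.mult_mem_iff[of "i t" s] a(2,3) s by simp
 qed
 thus ?thesis using P.Icarr by (auto simp: extend_def)
qed

lemma extend_open:
 assumes W: "opn (Spec S) W" shows "opn (Spec R) {q \<in> D. extend q \<in> W}"
proof (subst openin_subopen, rule ballI)
 fix q assume "q \<in> {q \<in> D. extend q \<in> W}"
 hence q: "q \<in> D" "extend q \<in> W" by auto
 obtain T where T: "T \<subseteq> carrier S" "W = {P. primeideal P S \<and> \<not> T \<subseteq> P}" using W
  unfolding S.Spec_opn_iff by blast
 obtain s where s: "s \<in> T" "s \<notin> extend q" using q T(2) by auto
 have sS: "s \<in> carrier S" using s T by auto
 obtain a t where a: "a \<in> carrier R" "t \<in> carrier R" "t \<notin> q" "i t *[S] s = i a"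
   "s \<in> extend q \<longleftrightarrow> a \<in> q" by (rule extendE[OF q(1) sS])
 let ?N = "D \<inter> ({q. primeideal q R \<and> a \<notin> q} \<inter> {q. primeideal q R \<and> t \<notin> q})"
 have "opn (Spec R) ?N" using a by (intro openin_Int D_open R.opn_basic_open)
 moreover have "q \<in> ?N" using q(1) a s(2) by simp
 moreover have "extend r \<in> W" if r: "r \<in> ?N" for r
 proof -
  have "r \<in> D" "t \<in> carrier R - r" using r a(2) by auto
  thus ?thesis using extend_iff[OF _ sS a(1) _ a(4)] extend_prime s(1) T(2) r by blast
 qed
 ultimately show "\<exists>N. opn (Spec R) N \<and> q \<in> N \<and> N \<subseteq> {q \<in> D. extend q \<in> W}" by blast
qed

subsection \<open>Sections over a basic open subset\<close>

lemma loc_pairs_extend: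
 assumes q: "q \<in> D" and x: "(a, t) \<in> loc_pairs R q" shows "(i a, i t) \<in> loc_pairs S (extend q)"
 by (rule loc_pairs_map) (simp only: contract_extend[OF q] x)

lemma lfrac_extend_eq_iff:
 assumes q: "q \<in> D" and x: "(a, t) \<in> loc_pairs R q" and y: "(b, u) \<in> loc_pairs R q"
 shows "lfrac S (extend q) (i a, i t) = lfrac S (extend q) (i b, i u) \<longleftrightarrow> lfrac R q (a, t) =
   lfrac R q (b, u)"
proof -
 have c: "a \<in> carrier R" "t \<in> carrier R" "b \<in> carrier R" "u \<in> carrier R" using x y
  by (auto simp: loc_pairs_def)
 have "primeideal q R" using q by simp
 thus ?thesis
  using i_eq_iff[of "a *[R] u" "b *[R] t"] c
  by (simp add: R.lfrac_eq_iff[OF _ x y]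
    S.lfrac_eq_iff[OF extend_prime[OF q] loc_pairs_extend[OF q x] loc_pairs_extend[OF q y]])
qed

lemma mco_value_extend:
 assumes q: "q \<in> D" "q \<in> Y" and x: "(a, t) \<in> loc_pairs R q" "s q = lfrac R q (a, t)"
 shows "mco f Y s (extend q) = lfrac S (extend q) (i a, i t)"
 using Spec_map_value[where s = s, OF extend_prime[OF q(1)], of Y a t] q(2) x
 by (simp only: contract_extend[OF q(1)])

lemma lfrac_liftE:
 assumes q: "q \<in> D" and x: "(s, s') \<in> loc_pairs S (extend q)"
 obtains a t where "(a, t) \<in> loc_pairs R q" "s *[S] i t = i a *[S] s'"
proof -
 interpret q: prime_at q R using q by (simp add: prime_at_def)
 have c: "s \<in> carrier S" "s' \<in> carrier S" "s' \<notin> extend q" using x by (auto simp: loc_pairs_iff)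
 obtain a t where a: "a \<in> carrier R" "t \<in> carrier R" "t \<notin> q" "i t *[S] s = i a"
  by (rule extendE[OF q c(1)])
 obtain b u where b: "b \<in> carrier R" "u \<in> carrier R" "u \<notin> q" "i u *[S] s' = i b"
   "s' \<in> extend q \<longleftrightarrow> b \<in> q" by (rule extendE[OF q c(2)])
 show thesis
 proof (rule that)
  show "(a *[R] u, t *[R] b) \<in> loc_pairs R q" using a b c(3) by (simp add: loc_pairs_iff q.mult_mem_iff)
  have "s *[S] i (t *[R] b) = (i t *[S] s) *[S] (i u *[S] s')" using a(2) b(1,4) c by (simp add: S.m_ac)
  thus "s *[S] i (t *[R] b) = i (a *[R] u) *[S] s'" using a b(1,2) c by (simp add: S.m_ac)
 qed
qed

lemma section_lift_local:
 assumes Y: "opn (Spec R) Y" "Y \<subseteq> D" and s: "s \<in> Os (Spec S) (preim (Spec S) f Y)" and q: "q \<in> Y"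
 obtains N a t where "opn (Spec R) N" "q \<in> N" "N \<subseteq> Y"
  "\<forall>r\<in>N. (a, t) \<in> loc_pairs R r \<and> s (extend r) = lfrac S (extend r) (i a, i t)"
proof -
 have qD: "q \<in> D" using q Y by blast
 have "extend q \<in> preim (Spec S) f Y" using q extend_prime[OF qD]
  by (simp only: preim_Spec_map contract_extend[OF qD])
 then obtain W b b' where W: "opn (Spec S) W" "extend q \<in> W" and b: "fraction_on S s W b b'"
  by (rule Spec_sectionE[OF s])
 obtain a t where a: "(a, t) \<in> loc_pairs R q" "b *[S] i t = i a *[S] b'"
  by (rule lfrac_liftE[OF qD fraction_onD(1)[OF b W(2)]])
 let ?N = "Y \<inter> ({r \<in> D. extend r \<in> W} \<inter> {r. primeideal r R \<and> t \<notin> r})"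
 have t: "a \<in> carrier R" "t \<in> carrier R" "t \<notin> q" using a(1) by (auto simp: loc_pairs_iff)
 show thesis
 proof (rule that[of ?N a t])
  show "opn (Spec R) ?N" using t(2) by (intro openin_Int Y(1) extend_open[OF W(1)] R.opn_basic_open)
  show "q \<in> ?N" using q qD W(2) t(3) by simp
  show "\<forall>r\<in>?N. (a, t) \<in> loc_pairs R r \<and> s (extend r) = lfrac S (extend r) (i a, i t)"
  proof
   fix r assume "r \<in> ?N"
   hence r: "r \<in> D" "extend r \<in> W" "(a, t) \<in> loc_pairs R r" using t by (auto simp: loc_pairs_iff)
   have "s (extend r) = lfrac S (extend r) (i a, i t)"
    unfolding fraction_onD(2)[OF b r(2)]
     S.lfrac_eq_iff[OF extend_prime[OF r(1)] fraction_onD(1)[OF b r(2)] loc_pairs_extend[OF r(1,3)]]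
       by (rule a(2))
   with r(3) show "(a, t) \<in> loc_pairs R r \<and> s (extend r) = lfrac S (extend r) (i a, i t)" by blast
  qed
 qed blast
qed

lemma mco_inj:
 assumes Y: "Y \<subseteq> D" and s: "s \<in> Os (Spec R) Y" and s': "s' \<in> Os (Spec R) Y"
   and eq: "mco f Y s = mco f Y s'"
 shows "s = s'"
proof (rule extensionalityI[OF Spec_section_extensional[OF s] Spec_section_extensional[OF s']])
 fix q assume q: "q \<in> Y"
 hence qD: "q \<in> D" using Y by blast
 obtain a t where a: "(a, t) \<in> loc_pairs R q" "s q = lfrac R q (a, t)"
  by (rule Spec_section_valueE[OF s q])
 obtain b u where b: "(b, u) \<in> loc_pairs R q" "s' q = lfrac R q (b, u)"
  by (rule Spec_section_valueE[OF s' q])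
 show "s q = s' q"
  using eq lfrac_extend_eq_iff[OF qD a(1) b(1)] mco_value_extend[where s = s, OF qD
    q a] mco_value_extend[where s = s', OF qD q b] a(2) b(2)
  by simp
qed

lemma mco_surj:
 assumes Y: "opn (Spec R) Y" "Y \<subseteq> D" and s: "s \<in> Os (Spec S) (preim (Spec S) f Y)"
 shows "s \<in> mco f Y ` Os (Spec R) Y"
proof -
 note lift = section_lift_local[OF Y s]
 define r where "r = (\<lambda>q\<in>Y. THE F. \<exists>a t. (a, t) \<in> loc_pairs R q \<and> s (extend q) =
   lfrac S (extend q) (i a, i t) \<and> F = lfrac R q (a, t))"
 have r_eq: "r q = lfrac R q (a, t)"
  if q: "q \<in> Y" and x: "(a, t) \<in> loc_pairs R q" "s (extend q) = lfrac S (extend q) (i a, i t)" for q a t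
 proof -
  have qD: "q \<in> D" using q Y(2) by blast
  have "(THE F. \<exists>a t. (a, t) \<in> loc_pairs R q \<and> s (extend q) = lfrac S (extend q) (i a, i t) \<and> F =
    lfrac R q (a, t)) = lfrac R q (a, t)"
   using x lfrac_extend_eq_iff[OF qD] by (intro the_equality) (blast, metis)
  thus ?thesis using q by (simp add: r_def)
 qed
 have r: "r \<in> Os (Spec R) Y"
  unfolding Spec_section_iff
 proof (intro conjI ballI)
  fix q assume "q \<in> Y"
  then obtain N a t where N: "opn (Spec R) N" "q \<in> N" "N \<subseteq> Y"
   "\<forall>r\<in>N. (a, t) \<in> loc_pairs R r \<and> s (extend r) = lfrac S (extend r) (i a, i t)" by (rule lift)
  have "fraction_on R r N a t" unfolding fraction_on_def using N(3,4) r_eq by (simp add: subset_iff)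
  with N(1-3) show "\<exists>N a t. opn (Spec R) N \<and> q \<in> N \<and> N \<subseteq> Y \<and> fraction_on R r N a t" by blast
 qed (simp add: r_def)
 have "mco f Y r = s"
 proof (rule extensionalityI[OF Spec_map_extensional Spec_section_extensional[OF s]])
  fix P assume "P \<in> preim (Spec S) f Y"
  hence P: "primeideal P S" "contract P \<in> Y" by (simp_all only: preim_Spec_map)
  from P(2) obtain N a t where "contract P \<in> N"
    "\<forall>r\<in>N. (a, t) \<in> loc_pairs R r \<and> s (extend r) = lfrac S (extend r) (i a, i t)"
   by (rule lift)
  hence at: "(a, t) \<in> loc_pairs R (contract P)"
    "s (extend (contract P)) = lfrac S (extend (contract P)) (i a, i t)" by blast+
  show "mco f Y r P = s P"
   using Spec_map_value[where s = r, OF P at(1) r_eq[OF P(2) at]] at(2)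
   by (simp only: extend_contract[OF P(1)])
 qed
 thus ?thesis using r by blast
qed

lemma Spec_iso_basic_open: "\<exists>g. mutually_inverse (Spec S) (open_sub (Spec R) D) f g"
proof (rule mutually_inverseI_bij)
 show "pre_ring (open_sub (Spec R) D)" "pre_ring (Spec S)"
  by (intro pre_ring_open_sub R.pre_ring_Spec D_open S.pre_ring_Spec)+
 have "preim (Spec S) f D = pts (Spec S)" using contract_in_D
  by (auto simp: preim_iff mpt_Spec_map S.Spec_pts)
 thus "pre_hom (Spec S) (open_sub (Spec R) D) f"
  by (rule pre_hom_to_open_sub[OF Spec_map_pre_hom D_open])
 have "{q \<in> D. extend q \<in> W} = {q \<in> pts (open_sub (Spec R) D). extend q \<in> W}" for W
  unfolding open_sub_pts[OF D_open] by (rule refl)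
 thus "continuous_map (tp (open_sub (Spec R) D)) (tp (Spec S)) extend"
  unfolding continuous_map_def S.Spec_pts using extend_open extend_prime
  by (auto simp only: open_sub_pts[OF D_open] open_sub_opn[OF D_open])
 show "extend (mpt f P) = P" if "P \<in> pts (Spec S)" for P
  using that extend_contract by (simp only: mpt_Spec_map S.Spec_pts mem_Collect_eq)
 show "mpt f (extend q) = q" if "q \<in> pts (open_sub (Spec R) D)" for q
  using that contract_extend by (simp only: mpt_Spec_map open_sub_pts[OF D_open])
 fix Y assume "opn (open_sub (Spec R) D) Y"
 hence Y: "opn (Spec R) Y" "Y \<subseteq> D" by (simp_all only: open_sub_opn[OF D_open])
 show "bij_betw (mco f Y) (Os (open_sub (Spec R) D) Y) (Os (Spec S) (preim (Spec S) f Y))"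
  unfolding bij_betw_def open_sub_sel
  using mco_inj[OF Y(2)] mco_surj[OF Y] Spec_map_section by (blast intro: inj_onI)
qed

end

context affine_domain
begin

definition const_section :: "'a set set \<Rightarrow> 'a \<Rightarrow> 'a set \<Rightarrow> ('a \<times> 'a) set"
 where "const_section D a = (\<lambda>q\<in>D. lfrac R q (a, 1[R]))"

lemma const_section_ring_hom:
 assumes D: "opn (Spec R) D" shows "const_section D \<in> ring_hom R (osec (Spec R) D)"
proof (rule ring_hom_memI)
 have pair: "(a, 1[R]) \<in> loc_pairs R q" if "a \<in> carrier R" "q \<in> D" for a q
  using that prime_at.one_notin[OF Spec_opn_prime[OF D]] by (simp add: loc_pairs_def)
 fix a b assume a: "a \<in> carrier R" and b: "b \<in> carrier R"
 show "const_section D a \<in> Os (Spec R) D" unfolding const_section_def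
  by (rule Spec_fraction_section[OF D pair[OF a]])
 show "const_section D (a *[R] b) = const_section D a *[osec (Spec R) D] const_section D b"
  "const_section D (a +[R] b) = const_section D a +[osec (Spec R) D] const_section D b"
  using a b by (auto simp: const_section_def Spec_sel fun_eq_iff restrict_def pair
    prime_at.lfrac_mult[OF Spec_opn_prime[OF D]] prime_at.lfrac_add[OF Spec_opn_prime[OF D]])
qed (simp add: const_section_def Spec_sel)

abbreviation basic_open_set where "basic_open_set x \<equiv> {q. primeideal q R \<and> x \<notin> q}"

context
 fixes x assumes x: "x \<in> carrier R"
begin

private lemma D: "opn (Spec R) (basic_open_set x)" by (rule opn_basic_open[OF x])

private lemma pair_one: "\<lbrakk>a \<in> carrier R; q \<in> basic_open_set x\<rbrakk> \<Longrightarrow> (a, 1[R]) \<in> loc_pairs R q"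
 using prime_at.one_notin[of q R] by (simp add: loc_pairs_def prime_at_def)

private lemma const_section_value: "q \<in> basic_open_set x \<Longrightarrow> const_section (basic_open_set x) a q =
  lfrac R q (a, 1[R])"
 by (simp add: const_section_def)

private lemmas lfrac_mult = prime_at.lfrac_mult[OF Spec_opn_prime[OF D]]
 and pair_mult = prime_at.loc_pairs_mult[OF Spec_opn_prime[OF D]]

lemma const_section_inj_on:
 assumes "x \<noteq> 0[R]" shows "inj_on (const_section (basic_open_set x)) (carrier R)"
proof (rule inj_onI)
 have generic: "{0[R]} \<in> basic_open_set x" using zeroprimeideal assms by simp
 fix a b assume ab: "a \<in> carrier R" "b \<in> carrier R"
   "const_section (basic_open_set x) a = const_section (basic_open_set x) b"
 have "lfrac R {0[R]} (a, 1[R]) = lfrac R {0[R]} (b, 1[R])"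
  unfolding const_section_value[OF generic, symmetric] ab(3) by (rule refl)
 thus "a = b" using ab(1,2) by (simp add:
   lfrac_eq_iff[OF zeroprimeideal pair_one[OF _ generic] pair_one[OF _ generic]])
qed

lemma const_section_Units:
 assumes S: "cring (osec (Spec R) (basic_open_set x))"
 shows "const_section (basic_open_set x) x \<in> Units (osec (Spec R) (basic_open_set x))"
proof -
 let ?D = "basic_open_set x" and ?S = "osec (Spec R) (basic_open_set x)"
 interpret S: cring ?S by (rule S)
 let ?inv = "\<lambda>q\<in>?D. lfrac R q (1[R], x)"
 have inv_pair: "(1[R], x) \<in> loc_pairs R q" if "q \<in> ?D" for q using that x by (simp add: loc_pairs_def)
 have inv: "?inv \<in> carrier ?S" by (rule Spec_fraction_section[OF D inv_pair])
 have "?inv *[?S] const_section ?D x = 1[?S]"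
 proof (rule extensionalityI[of _ ?D])
  fix q assume q: "q \<in> ?D"
  have "lfrac R q (1[R] *[R] x, x *[R] 1[R]) = lfrac R q (1[R], 1[R])"
   using q x lfrac_eq_iff[OF _ pair_mult[OF q inv_pair[OF q] pair_one[OF x q]]
     pair_one[OF one_closed q]] by simp
  thus "(?inv *[?S] const_section ?D x) q = 1[?S] q"
   using q lfrac_mult[OF q inv_pair[OF q] pair_one[OF x q]] by (simp add: Spec_sel const_section_def)
 qed (simp_all add: Spec_sel)
 thus ?thesis using inv ring_hom_closed[OF const_section_ring_hom[OF D] x] S.m_comm
  unfolding Units_def by (auto intro!: bexI[of _ ?inv])
qed

lemma clear_denominator:
 assumes S: "cring (osec (Spec R) (basic_open_set x))" and s: "s \<in> Os (Spec R) (basic_open_set x)"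
   and q: "q \<in> basic_open_set x"
 shows "\<exists>a t. a \<in> carrier R \<and> t \<in> carrier R - q \<and>
  const_section (basic_open_set x) t *[osec (Spec R)
    (basic_open_set x)] s = const_section (basic_open_set x) a"
proof -
 let ?S = "osec (Spec R) (basic_open_set x)" and ?c = "const_section (basic_open_set x)"
 interpret S: cring ?S by (rule S)
 note c_closed = ring_hom_closed[OF const_section_ring_hom[OF D]]
 obtain a t where fraction: "(a, t) \<in> loc_pairs R q" "s q = lfrac R q (a, t)"
  by (rule Spec_section_valueE[OF s q])
 have at: "a \<in> carrier R" "t \<in> carrier R" "t \<notin> q" using fraction(1) by (auto simp: loc_pairs_iff)
 have "?c t *[?S] s = ?c a"
 proof (rule Spec_section_eqI[OF S.m_closed[OF c_closed[OF at(2)] s] c_closed[OF at(1)] q])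
  have "lfrac R q (t *[R] a, 1[R] *[R] t) = lfrac R q (a, 1[R])"
   using q at lfrac_eq_iff[OF _ pair_mult[OF q pair_one[OF at(2) q] fraction(1)]
     pair_one[OF at(1) q]] by (simp add: m_comm)
  thus "(?c t *[?S] s) q = ?c a q"
   using q lfrac_mult[OF q pair_one[OF at(2) q] fraction(1)] fraction(2)
   by (simp add: Spec_sel const_section_def)
 qed
 with at show ?thesis by blast
qed

lemma basic_open_sections:
 assumes "x \<noteq> 0[R]" and S: "domain (osec (Spec R) (basic_open_set x))"
 shows "basic_open R (osec (Spec R) (basic_open_set x)) (const_section (basic_open_set x)) x"
proof -
 interpret S: domain "osec (Spec R) (basic_open_set x)" by (rule S)
 show ?thesis
  by (intro basic_open.intro basic_open_axioms.intro affine_homI is_cring S.is_cring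
    const_section_ring_hom[OF D] affine_domain.intro
    affine_scheme.intro domain_axioms S x const_section_inj_on assms(1) const_section_Units
      clear_denominator) simp_all
qed

end

end

subsection \<open>Injectivity of restriction and irreducibility\<close>

lemma affine_openE:
 assumes "affine_open X U"
 obtains f g where "opn X U" "mutually_inverse (open_sub X U) (Spec (osec X U)) f g"
 using assms unfolding affine_open_def lrs_iso_def lrs_hom_iff mutually_inverse_def by blast

lemma affine_openI:
 assumes X: "pre_ring X" and U: "opn X U"
   "cring (osec X U)" and fg: "mutually_inverse (open_sub X U) (Spec (osec X U)) f g"
 shows "affine_open X U"
 unfolding affine_open_def
 using U(1) mutually_inverse_lrs_iso[OF pre_ring_open_sub[OF X U(1)]
   affine_scheme.pre_ring_Spec[OF affine_scheme.intro[OF U(2)]] fg]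
 by blast

context ringed_space
begin

lemma affine_domain_osec: "opn X U \<Longrightarrow> domain (osec X U) \<Longrightarrow> affine_domain (osec X U)"
 by (simp add: affine_domain_def affine_scheme_def cring_O)

lemma affine_ores_inj:
 assumes U: "affine_open X U" and dom: "domain (osec X U)"
  and Y: "opn X Y" "Y \<subseteq> U" and W: "opn X W" "W \<subseteq> Y" "W \<noteq> {}"
  and st: "s \<in> Os X Y" "t \<in> Os X Y" "ores X Y W s = ores X Y W t"
 shows "s = t"
proof -
 let ?R = "osec X U"
 obtain f g where oU: "opn X U" and fg: "mutually_inverse (open_sub X U) (Spec ?R) f g"
  by (rule affine_openE[OF U])
 interpret R: affine_domain ?R by (rule affine_domain_osec[OF oU dom])
 note inv = mutually_inverseD[OF fg]
 have YW: "opn (open_sub X U) Y" "opn (open_sub X U) W" using Y W unfolding open_sub_opn[OF oU] by auto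
 obtain w where w: "w \<in> W" using W(3) by blast
 have "w \<in> U" using w W Y by blast
 hence p: "mpt f w \<in> preim (Spec ?R) g W"
  using pre_hom_pts[OF inv(1), of w] inv(3)[of w] w by (simp add: preim_iff open_sub_pts[OF oU])
 have "mco g Y s = mco g Y t"
 proof (rule R.Spec_section_eqI)
  show "mco g Y s \<in> Os (Spec ?R) (preim (Spec ?R) g Y)" "mco g Y t \<in> Os (Spec ?R) (preim (Spec ?R) g Y)"
   using pre_hom_mco_closed[OF inv(2) YW(1)] st by simp_all
  show "mpt f w \<in> preim (Spec ?R) g Y" by (rule subsetD[OF preim_mono[OF W(2)] p])
  have "restrict (mco g Y s) (preim (Spec ?R) g W) = restrict (mco g Y t) (preim (Spec ?R) g W)"
   using pre_hom_res[OF inv(2) YW W(2), of s] pre_hom_res[OF inv(2) YW W(2), of t] st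
   by (simp add: Spec_sel(2))
  from fun_cong[OF this, of "mpt f w"] p show "mco g Y s (mpt f w) = mco g Y t (mpt f w)" by simp
 qed
 thus ?thesis using inv(5)[OF YW(1), unfolded open_sub_sel, OF st(1)] inv(5)[OF YW(1), unfolded
   open_sub_sel, OF st(2)] by metis
qed

lemma affine_opn_meet:
 assumes U: "affine_open X U" and dom: "domain (osec X U)"
  and Y: "opn X Y" "Y \<subseteq> U" "Y \<noteq> {}" and W: "opn X W" "W \<subseteq> U" "W \<noteq> {}"
 shows "Y \<inter> W \<noteq> {}"
proof -
 let ?R = "osec X U"
 obtain f g where oU: "opn X U" and fg: "mutually_inverse (open_sub X U) (Spec ?R) f g"
  by (rule affine_openE[OF U])
 interpret R: affine_domain ?R by (rule affine_domain_osec[OF oU dom])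
 note inv = mutually_inverseD[OF fg]
 have "mpt g {0[?R]} \<in> Z" if Z: "opn X Z" "Z \<subseteq> U" "Z \<noteq> {}" for Z
 proof -
  obtain z where z: "z \<in> Z" "z \<in> U" using Z by blast
  hence "mpt f z \<in> preim (Spec ?R) g Z"
   using pre_hom_pts[OF inv(1), of z] inv(3)[of z] by (simp add: preim_iff open_sub_pts[OF oU])
  moreover have "opn (Spec ?R) (preim (Spec ?R) g Z)" using pre_hom_opn[OF inv(2), of Z] Z
   by (simp add: open_sub_opn[OF oU])
  ultimately have "{0[?R]} \<in> preim (Spec ?R) g Z" by (intro R.generic_point_mem) auto
  thus ?thesis by (simp add: preim_iff)
 qed
 from this[OF Y] this[OF W] show ?thesis by blast
qed

end

locale integral_space = ringed_space X for X :: "('p, 'a) rspace" +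
 assumes ores_inj: "\<lbrakk>opn X U; opn X W; W \<subseteq> U; W \<noteq> {}; s \<in> Os X U; t \<in> Os X U; ores X U W s =
   ores X U W t\<rbrakk> \<Longrightarrow> s = t"
  and opn_meet: "\<lbrakk>opn X U; opn X W; U \<noteq> {}; W \<noteq> {}\<rbrakk> \<Longrightarrow> U \<inter> W \<noteq> {}"

lemma integral_spaceI:
 assumes X: "ring_sheaf X" and A: "\<And>U. U \<in> \<U> \<Longrightarrow> affine_open X U" "\<And>U. U \<in> \<U> \<Longrightarrow> domain (osec X U)"
  and cover: "\<And>p. p \<in> pts X \<Longrightarrow> \<exists>U\<in>\<U>. p \<in> U" and int: "\<And>U W. U \<in> \<U> \<Longrightarrow> W \<in> \<U> \<Longrightarrow> U \<inter> W \<noteq> {}"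
 shows "integral_space X"
proof -
 interpret ringed_space X by unfold_locales (rule X)
 have opn: "opn X U" if "U \<in> \<U>" for U using A(1)[OF that] by (simp add: affine_open_def)
 have meet: "U \<inter> W \<noteq> {}" if U: "opn X U" "U \<noteq> {}" and W: "opn X W" "W \<noteq> {}" for U W
 proof -
  obtain u w where u: "u \<in> U" and w: "w \<in> W" using U W by blast
  obtain B where B: "B \<in> \<U>" "u \<in> B" using cover[of u] openin_subset[OF U(1)] u by blast
  obtain C where C: "C \<in> \<U>" "w \<in> C" using cover[of w] openin_subset[OF W(1)] w by blast
  have UBC: "(U \<inter> B) \<inter> (B \<inter> C) \<noteq> {}"
   by (rule affine_opn_meet[OF A[OF B(1)]]) (use U opn B C u int in auto)
  have "(U \<inter> B \<inter> C) \<inter> (W \<inter> C) \<noteq> {}"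
   by (rule affine_opn_meet[OF A[OF C(1)]]) (use U W opn B C w UBC in auto)
  thus ?thesis by blast
 qed
 have "s = t" if U: "opn X U" and W: "opn X W" "W \<subseteq> U" "W \<noteq> {}" and st: "s \<in> Os X U" "t \<in> Os X U"
   "ores X U W s = ores X U W t"
  for U W s t
 proof (rule sheaf_eqI[OF sheaf_O U st(1,2)])
  fix p assume p: "p \<in> U"
  obtain B where B: "B \<in> \<U>" "p \<in> B" using cover[of p] openin_subset[OF U] p by blast
  let ?Y = "U \<inter> B" and ?Z = "W \<inter> B"
  have o: "opn X ?Y" "opn X ?Z" "?Y \<subseteq> B" "?Z \<subseteq> ?Y" "?Y \<subseteq> U" "?Z \<subseteq> W" "?Z \<subseteq> U"
   using U W opn[OF B(1)] by auto
  have "?Z \<noteq> {}" using meet[OF W(1,3) opn[OF B(1)]] B(2) by blast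
  hence "ores X U ?Y s = ores X U ?Y t"
  proof (rule affine_ores_inj[OF A[OF B(1)] o(1,3,2,4)])
   show "ores X U ?Y s \<in> Os X ?Y" "ores X U ?Y t \<in> Os X ?Y"
    using ores_closed[OF U o(1,5)] st by simp_all
   show "ores X ?Y ?Z (ores X U ?Y s) = ores X ?Y ?Z (ores X U ?Y t)"
    using ores_ores[OF U o(1,2,4,5)] ores_ores[OF U W(1) o(2,6) W(2)] st by metis
  qed
  thus "\<exists>Y. opn X Y \<and> p \<in> Y \<and> Y \<subseteq> U \<and> ores X U Y s = ores X U Y t" using o p B(2) by blast
 qed
 thus ?thesis using meet by unfold_locales blast+
qed

lemma (in integral_space) domain_osec:
 assumes Y: "opn X Y" and U: "opn X U" "U \<subseteq> Y" "U \<noteq> {}" and dom: "domain (osec X U)"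
 shows "domain (osec X Y)"
proof -
 interpret Y: cring "osec X Y" by (rule cring_O[OF Y])
 interpret U: domain "osec X U" by (rule dom)
 note hom = ores_add[OF Y U(1,2)] ores_mult[OF Y U(1,2)] ores_one[OF Y U(1,2)] ores_zero[OF Y
   U(1,2)] and closed = ores_closed[OF Y U(1,2)]
 have eq_zero: "a = 0[osec X Y]" if "a \<in> Os X Y" "ores X Y U a = 0[osec X U]" for a
  by (rule ores_inj[OF Y U that(1) Y.zero_closed]) (use that(2) hom(4) in simp)
 show ?thesis
 proof (unfold_locales)
  show "1[osec X Y] \<noteq> 0[osec X Y]" using hom(3,4) U.one_not_zero by metis
  fix a b assume ab: "a *[osec X Y] b = 0[osec X Y]" "a \<in> Os X Y" "b \<in> Os X Y"
  hence "ores X Y U a *[osec X U] ores X Y U b = 0[osec X U]" using hom(2)[OF ab(2,3)] hom(4) by simp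
  hence "ores X Y U a = 0[osec X U] \<or> ores X Y U b = 0[osec X U]"
   using U.integral[OF _ closed[OF ab(2)] closed[OF ab(3)]] by simp
  thus "a = 0[osec X Y] \<or> b = 0[osec X Y]" using eq_zero ab by blast
 qed
qed

lemma (in ringed_space) osec_disjoint_union:
 assumes U: "opn X U" and W: "opn X W" and disj: "U \<inter> W = {}" and ab: "a \<in> Os X U" "b \<in> Os X W"
 obtains c where "c \<in> Os X (U \<union> W)" "ores X (U \<union> W) U c = a" "ores X (U \<union> W) W c = b"
proof -
 have empty: "ores X U {} a = ores X W {} b"
  by (rule osec_empty[OF ores_closed[OF U openin_empty empty_subsetI ab(1)]
    ores_closed[OF W openin_empty empty_subsetI ab(2)]])
 have disj': "W \<inter> U = {}" using disj by blast
 let ?W = "\<lambda>i. if i then U else W" and ?s = "\<lambda>i. if i then a else b"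
 have cover: "(\<Union>i\<in>UNIV. ?W i) = U \<union> W" unfolding UNIV_bool by auto
 obtain c where c: "c \<in> Os X (U \<union> W)" "\<And>i. i \<in> UNIV \<Longrightarrow> ores X (U \<union> W) (?W i) c = ?s i"
 proof (rule sheaf_glue[OF sheaf_O, of UNIV ?W ?s, unfolded cover])
  show "ores X (?W i) (?W i \<inter> ?W j) (?s i) = ores X (?W j) (?W i \<inter> ?W j) (?s j)" for i j
   by (cases i; cases j) (simp_all add: disj disj' empty)
 qed (use U W ab that in simp_all)
 show thesis using that[OF c(1)] c(2)[of True] c(2)[of False] by simp
qed

lemma integral_schemeD:
 assumes "integral_scheme X"
 shows "lrs X" "ring_sheaf X" "pts X \<noteq> {}" "\<lbrakk>opn X U; U \<noteq> {}\<rbrakk> \<Longrightarrow> domain (osec X U)"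
   "p \<in> pts X \<Longrightarrow> \<exists>U. affine_open X U \<and> p \<in> U"
 using assms by (simp_all add: integral_scheme_def scheme_def lrs_def)

lemma (in ringed_space) opn_meet_if_domain:
 assumes U: "opn X U" "domain (osec X U)" and W: "opn X W"
   "domain (osec X W)" and UW: "domain (osec X (U \<union> W))"
 shows "U \<inter> W \<noteq> {}"
proof
 assume disj: "U \<inter> W = {}"
 interpret UW: domain "osec X (U \<union> W)" by (rule UW)
 interpret U: domain "osec X U" by (rule U(2))
 interpret W: domain "osec X W" by (rule W(2))
 have o: "opn X (U \<union> W)" "U \<subseteq> U \<union> W" "W \<subseteq> U \<union> W" using U W by auto
 obtain c where c: "c \<in> Os X (U \<union> W)" "ores X (U \<union> W) U c = 1[osec X U]"
   "ores X (U \<union> W) W c = 0[osec X W]"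
  by (rule osec_disjoint_union[OF U(1) W(1) disj U.one_closed W.zero_closed])
 obtain d where d: "d \<in> Os X (U \<union> W)" "ores X (U \<union> W) U d = 0[osec X U]"
   "ores X (U \<union> W) W d = 1[osec X W]"
  by (rule osec_disjoint_union[OF U(1) W(1) disj U.zero_closed W.one_closed])
 note resU = ores_mult[OF o(1) U(1) o(2)] ores_zero[OF o(1) U(1) o(2)]
  and resW = ores_mult[OF o(1) W(1) o(3)] ores_zero[OF o(1) W(1) o(3)]
 have "c *[osec X (U \<union> W)] d = 0[osec X (U \<union> W)]"
 proof (rule sheaf_eqI[OF sheaf_O o(1)])
  fix p assume "p \<in> U \<union> W"
  thus "\<exists>Z. opn X Z \<and> p \<in> Z \<and> Z \<subseteq> U \<union> W \<and> ores X (U \<union> W) Z (c *[osec X (U \<union> W)] d) =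
    ores X (U \<union> W) Z 0[osec X (U \<union> W)]"
   using U(1) W(1) o resU(1)[OF c(1) d(1)] resW(1)[OF c(1) d(1)] resU(2) resW(2) c(2,3) d(2,3) by auto
 qed (use c d in simp_all)
 hence "c = 0[osec X (U \<union> W)] \<or> d = 0[osec X (U \<union> W)]" using UW.integral[OF _ c(1) d(1)] by simp
 thus False using c(2) d(3) resU(2) resW(2) by auto
qed

lemma integral_scheme_integral_space:
 assumes X: "integral_scheme X" shows "integral_space X"
proof (rule integral_spaceI[OF integral_schemeD(2)[OF X], where \<U> = "{U. affine_open X U \<and> U \<noteq> {}}"])
 interpret ringed_space X by unfold_locales (rule integral_schemeD(2)[OF X])
 note dom = integral_schemeD(4)[OF X]
 fix U W assume "U \<in> {U. affine_open X U \<and> U \<noteq> {}}" "W \<in> {U. affine_open X U \<and> U \<noteq> {}}"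
 hence U: "opn X U" "U \<noteq> {}" and W: "opn X W" "W \<noteq> {}" by (auto simp: affine_open_def)
 thus "U \<inter> W \<noteq> {}" using dom by (intro opn_meet_if_domain) auto
next
 show "\<exists>U\<in>{U. affine_open X U \<and> U \<noteq> {}}. p \<in> U" if "p \<in> pts X" for p
  using integral_schemeD(5)[OF X that] by blast
qed (use integral_schemeD(4)[OF X] in \<open>auto simp: affine_open_def\<close>)

subsection \<open>Affine open sets form a base\<close>

lemma ring_iso_zero:
 assumes h: "h \<in> ring_iso S T" and S: "ring S" and zero: "0[T] \<in> carrier T"
   "\<And>t. t \<in> carrier T \<Longrightarrow> t +[T] 0[T] = t"
 shows "h 0[S] = 0[T]"
proof -
 interpret S: ring S by (rule S)
 obtain s where s: "s \<in> carrier S" "h s = 0[T]"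
  using zero(1) bij_betw_imp_surj_on[OF ring_iso_memE(5)[OF h]] by (metis imageE)
 have "h 0[S] +[T] 0[T] = 0[T]" using ring_iso_memE(3)[OF h S.zero_closed s(1)] s by simp
 thus ?thesis using zero(2)[OF ring_iso_memE(1)[OF h S.zero_closed]] by simp
qed

lemma affine_open_preim_basic_open:
 assumes X: "pre_ring X" and R: "domain (osec X U)" and U: "opn X U"
   and fg: "mutually_inverse (open_sub X U) (Spec (osec X U)) f g"
  and x: "x \<in> Os X U" "x \<noteq> 0[osec X U]" and D: "D = {q. primeideal q (osec X U) \<and> x \<notin> q}"
  and W: "W = preim (open_sub X U) f D" "domain (osec X W)"
 shows "affine_open X W"
proof -
 let ?R = "osec X U" and ?S = "osec X W"
 interpret R: affine_domain ?R using R by (simp add: affine_domain_def affine_scheme_def domain_def)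
 interpret S: domain ?S by (rule W(2))
 have oD: "opn (Spec ?R) D" unfolding D by (rule R.opn_basic_open[OF x(1)])
 let ?T = "osec (Spec ?R) D"
 note inv = mutually_inverseD[OF fg]
 have oW: "opn X W" "W \<subseteq> U" using pre_hom_opn[OF inv(1) oD] by (simp_all add: W(1) open_sub_opn[OF U])
 have preW: "preim (Spec ?R) g W = D" unfolding W(1) by (rule inv(7)[OF oD])
 have iso: "mco g W \<in> ring_iso ?S ?T"
  unfolding ring_iso_def
 proof (intro CollectI conjI bij_betwI[where g = "mco f D"])
  have opn: "opn (open_sub X U) W" unfolding open_sub_opn[OF U] using oW by blast
  show hom: "mco g W \<in> ring_hom ?S ?T" using pre_hom_ring_hom[OF inv(2) opn]
   unfolding preW open_sub_sel .
  show "mco g W \<in> carrier ?S \<rightarrow> carrier ?T" by (rule funcsetI) (rule ring_hom_closed[OF hom])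
  show "mco f D \<in> carrier ?T \<rightarrow> carrier ?S"
   using pre_hom_mco_closed[OF inv(1) oD] unfolding W(1)[symmetric] open_sub_sel by (rule funcsetI)
  show "mco f D (mco g W s) = s" if "s \<in> carrier ?S" for s using inv(5)[OF opn, of s] that
   unfolding preW open_sub_sel by blast
  show "mco g W (mco f D t) = t" if "t \<in> carrier ?T" for t using inv(6)[OF oD that]
   unfolding W(1)[symmetric] .
 qed
 have "mco g W 0[?S] = 0[?T]"
 proof (rule ring_iso_zero[OF iso S.ring_axioms])
  show zero: "0[?T] \<in> carrier ?T" by (rule
    ringed_presheaf.O_zero_closed[OF ringed_presheaf.intro[OF R.pre_ring_Spec] oD])
  show "t +[?T] 0[?T] = t" if "t \<in> carrier ?T" for t by (rule R.Spec_add_zero[OF oD that])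
 qed
 hence T: "domain ?T" using S.ring_iso_imp_img_domain[OF iso] by simp
 obtain k where k: "mutually_inverse (Spec ?T) (open_sub (Spec ?R) D)
   (Spec_map ?R ?T (R.const_section D)) k"
  using basic_open.Spec_iso_basic_open[OF R.basic_open_sections[OF x T[unfolded D]]]
  unfolding D by blast
 have X_D: "mutually_inverse (open_sub X W) (open_sub (Spec ?R) D) f g"
  using mutually_inverse_open_sub[OF fg oD] unfolding W(1)[symmetric] open_sub_open_sub[OF oW(2)] .
 obtain l m where "mutually_inverse (Spec ?T) (Spec ?S) l m"
  using Spec_map_iso[OF S.is_cring domain.axioms(1)[OF T] iso]
  unfolding lrs_iso_def lrs_hom_iff mutually_inverse_def by blast
 from mutually_inverse_comp[OF mutually_inverse_comp[OF X_D mutually_inverse_sym[OF k]] this]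
 show ?thesis by (rule affine_openI[OF X oW(1) S.is_cring])
qed

lemma affine_open_base:
 assumes X: "integral_scheme X" and N: "opn X N" "p \<in> N"
 obtains W where "affine_open X W" "p \<in> W" "W \<subseteq> N"
proof -
 interpret ringed_space X by unfold_locales (rule integral_schemeD(2)[OF X])
 note dom = integral_schemeD(4)[OF X]
 have "p \<in> pts X" using N openin_subset by blast
 then obtain U where U: "affine_open X U" "p \<in> U" using integral_schemeD(5)[OF X] by blast
 let ?R = "osec X U"
 obtain f g where oU: "opn X U" and fg: "mutually_inverse (open_sub X U) (Spec ?R) f g"
  by (rule affine_openE[OF U(1)])
 have R: "domain ?R" using dom[OF oU] U(2) by blast
 interpret R: affine_domain ?R by (rule affine_domain_osec[OF oU R])
 note inv = mutually_inverseD[OF fg]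
 let ?N = "preim (Spec ?R) g (N \<inter> U)"
 have "opn (Spec ?R) ?N" using pre_hom_opn[OF inv(2), of "N \<inter> U"] N(1) oU
  by (simp add: open_sub_opn[OF oU] openin_Int)
 then obtain T where T: "T \<subseteq> carrier ?R" "?N = {q. primeideal q ?R \<and> \<not> T \<subseteq> q}"
  unfolding R.Spec_opn_iff by blast
 have fp: "mpt f p \<in> ?N" using pre_hom_pts[OF inv(1), of p] inv(3)[of p] U(2) N(2)
  by (simp add: preim_iff open_sub_pts[OF oU])
 then obtain x where x: "x \<in> T" "x \<notin> mpt f p" unfolding T(2) by blast
 have xR: "x \<in> carrier ?R" using x T by auto
 let ?D = "{q. primeideal q ?R \<and> x \<notin> q}"
 let ?W = "preim (open_sub X U) f ?D"
 have fpD: "mpt f p \<in> ?D" using fp x(2) unfolding T(2) by blast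
 hence "x \<noteq> 0[?R]" using prime_at.zero_in[of "mpt f p" ?R] by (auto simp: prime_at_def)
 have W: "opn X ?W" "p \<in> ?W"
  using pre_hom_opn[OF inv(1) R.opn_basic_open[OF xR]] fpD U(2)
  by (simp_all add: open_sub_opn[OF oU] preim_iff open_sub_pts[OF oU])
 have "affine_open X ?W"
  by (rule affine_open_preim_basic_open[OF pre_ring R oU fg xR \<open>x ~= 0[?R]\<close> refl refl]) (use
    dom W in blast)
 moreover have "?W \<subseteq> N"
 proof
  fix y assume "y \<in> ?W"
  hence y: "y \<in> U" "mpt f y \<in> ?N" using x(1) unfolding T(2)
   by (auto simp: preim_iff open_sub_pts[OF oU])
  thus "y \<in> N" using inv(3)[of y] by (simp add: preim_iff open_sub_pts[OF oU])
 qed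
 ultimately show thesis using W(2) by (intro that)
qed

section \<open>Homomorphisms of sheaves of modules\<close>

lemma mod_homD:
 assumes "f \<in> mod_hom X F G" "opn X U"
 shows "s \<in> Ms F U \<Longrightarrow> f U s \<in> Ms G U"
  "\<lbrakk>s \<in> Ms F U; t \<in> Ms F U\<rbrakk> \<Longrightarrow> f U (s +[msec F U] t) = f U s +[msec G U] f U t"
  "\<lbrakk>a \<in> Os X U; s \<in> Ms F U\<rbrakk> \<Longrightarrow> f U (a *.[msec F U] s) = a *.[msec G U] f U s"
  "\<lbrakk>opn X W; W \<subseteq> U; s \<in> Ms F U\<rbrakk> \<Longrightarrow> f W (mres F U W s) = mres G U W (f U s)"
 using assms unfolding mod_hom_def by (auto simp: PiE_iff)

lemma mod_hom_eqI:
 assumes f: "f \<in> mod_hom X F G" and g: "g \<in> mod_hom X F G"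
  and eq: "\<And>U s. opn X U \<Longrightarrow> s \<in> Ms F U \<Longrightarrow> f U s = g U s"
 shows "f = g"
proof
 fix U show "f U = g U"
 proof (cases "opn X U")
  case True
  have "f U \<in> Ms F U \<rightarrow>\<^sub>E Ms G U" "g U \<in> Ms F U \<rightarrow>\<^sub>E Ms G U"
   using f g True unfolding mod_hom_def by auto
  thus ?thesis using eq[OF True] by (rule PiE_ext)
 next
  case False
  have "f \<in> extensional {U. opn X U}" "g \<in> extensional {U. opn X U}" using f g
   unfolding mod_hom_def by auto
  thus ?thesis using False unfolding extensional_def by auto
 qed
qed

lemma mod_homI:
 assumes "\<And>U s. \<lbrakk>opn X U; s \<in> Ms F U\<rbrakk> \<Longrightarrow> \<phi> U s \<in> Ms G U"
  "\<And>U s t. \<lbrakk>opn X U; s \<in> Ms F U; t \<in> Ms F U\<rbrakk> \<Longrightarrow> \<phi> U (s +[msec F U] t) = \<phi> U s +[msec G U] \<phi> U t"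
  "\<And>U a s. \<lbrakk>opn X U; a \<in> Os X U; s \<in> Ms F U\<rbrakk> \<Longrightarrow> \<phi> U (a *.[msec F U] s) = a *.[msec G U] \<phi> U s"
  "\<And>U W s. \<lbrakk>opn X U; opn X W; W \<subseteq> U; s \<in> Ms F U\<rbrakk> \<Longrightarrow> \<phi> W (mres F U W s) = mres G U W (\<phi> U s)"
  and F: "ring_sheaf X" "mod_sheaf X F"
 shows "(\<lambda>U\<in>{U. opn X U}. \<lambda>s\<in>Ms F U. \<phi> U s) \<in> mod_hom X F G"
proof -
 interpret F: module_sheaf X F by unfold_locales (fact F)+
 show ?thesis unfolding mod_hom_def using assms(1-4)
  by (auto simp: F.add_closed F.smult_closed F.res_closed)
qed

lemma hom_apply:
 assumes "opn X U" "s \<in> Ms F U"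
 shows "hom_id X F U s = s" "hom_comp X F g f U s = g U (f U s)"
  "hom_add X F G f g U s = f U s +[msec G U] g U s"
  "hom_smult X F G a f U s = ores X (pts X) U a *.[msec G U] f U s"
 using assms by (simp_all add: hom_id_def hom_comp_def hom_add_def hom_smult_def)

context ringed_space begin

lemma hom_id_closed: "mod_sheaf X F \<Longrightarrow> hom_id X F \<in> mod_hom X F F"
 unfolding hom_id_def by (rule mod_homI) (auto intro: ring_sheaf)

lemma hom_comp_closed:
 assumes "mod_sheaf X F" and f: "f \<in> mod_hom X F G" and g: "g \<in> mod_hom X G H"
 shows "hom_comp X F g f \<in> mod_hom X F H"
 unfolding hom_comp_def
 by (rule mod_homI[OF _ _ _ _ ring_sheaf assms(1)]) (simp_all add: mod_homD[OF f] mod_homD[OF g])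

lemma hom_add_closed:
 assumes F: "mod_sheaf X F" and G: "mod_sheaf X G" and f: "f \<in> mod_hom X F G" and g: "g \<in> mod_hom X F G"
 shows "hom_add X F G f g \<in> mod_hom X F G"
proof -
 interpret G: module_sheaf X G by unfold_locales (fact G)
 show ?thesis unfolding hom_add_def
 proof (rule mod_homI[OF _ _ _ _ ring_sheaf F])
  fix U s assume U: "opn X U" and s: "s \<in> Ms F U"
  interpret M: module "osec X U" "msec G U" by (rule G.module_sec[OF U])
  note fs = mod_homD(1)[OF f U] mod_homD(1)[OF g U]
  show "f U s +[msec G U] g U s \<in> Ms G U" using fs s by simp
  { fix t assume t: "t \<in> Ms F U"
   show "f U (s +[msec F U] t) +[msec G U] g U (s +[msec F U] t) =
     f U s +[msec G U] g U s +[msec G U] (f U t +[msec G U] g U t)"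
    using fs s t mod_homD(2)[OF f U s t] mod_homD(2)[OF g U s t] by (simp add: M.M.add.m_ac) }
  { fix a assume a: "a \<in> Os X U"
   show "f U (a *.[msec F U] s) +[msec G U] g U (a *.[msec F U] s) =
     a *.[msec G U] (f U s +[msec G U] g U s)"
    using fs s a mod_homD(3)[OF f U a s] mod_homD(3)[OF g U a s] by (simp add: M.smult_r_distr) }
  { fix W assume W: "opn X W" "W \<subseteq> U"
   show "f W (mres F U W s) +[msec G W] g W (mres F U W s) = mres G U W (f U s +[msec G U] g U s)"
    using mod_homD(4)[OF f U W s] mod_homD(4)[OF g U W s] G.res_add[OF U W fs(1)[OF s] fs(2)[OF s]]
    by simp }
 qed
qed

lemma hom_smult_closed:
 assumes F: "mod_sheaf X F" and G: "mod_sheaf X G" and f: "f \<in> mod_hom X F G" and c: "c \<in> Os X (pts X)"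
 shows "hom_smult X F G c f \<in> mod_hom X F G"
proof -
 interpret G: module_sheaf X G by unfold_locales (fact G)
 show ?thesis unfolding hom_smult_def
 proof (rule mod_homI[OF _ _ _ _ ring_sheaf F])
  fix U s assume U: "opn X U" and s: "s \<in> Ms F U"
  interpret M: module "osec X U" "msec G U" by (rule G.module_sec[OF U])
  note U_subset = openin_subset[OF U]
  note cU = ores_closed[OF opn_pts U U_subset c]
  note fs = mod_homD(1)[OF f U]
  show "ores X (pts X) U c *.[msec G U] f U s \<in> Ms G U" using fs s cU by simp
  { fix t assume t: "t \<in> Ms F U"
   show "ores X (pts X) U c *.[msec G U] f U (s +[msec F U] t) =
     ores X (pts X) U c *.[msec G U] f U s +[msec G U] ores X (pts X) U c *.[msec G U] f U t"
    using fs s t cU mod_homD(2)[OF f U s t] by (simp add: M.smult_r_distr) }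
  { fix a assume a: "a \<in> Os X U"
   show "ores X (pts X) U c *.[msec G U] f U (a *.[msec F U] s) =
     a *.[msec G U] (ores X (pts X) U c *.[msec G U] f U s)"
    using fs s a cU mod_homD(3)[OF f U a s] by (simp add: M.smult_assoc1[symmetric] M.R.m_comm) }
  { fix W assume W: "opn X W" "W \<subseteq> U"
   show "ores X (pts X) W c *.[msec G W] f W (mres F U W s) =
     mres G U W (ores X (pts X) U c *.[msec G U] f U s)"
    using mod_homD(4)[OF f U W s] G.res_smult[OF U W cU fs(1)[OF s]] ores_ores[OF opn_pts U W(1,2)
      U_subset c] by simp }
 qed
qed

lemma line_bundle_module_sheaf: "line_bundle X F \<Longrightarrow> module_sheaf X F"
 unfolding line_bundle_def by unfold_locales blast

end

subsection \<open>Endomorphisms of line bundles\<close>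

definition acts_by :: "('p, 'a) rspace \<Rightarrow> ('p, 'a, 'm) msheaf \<Rightarrow> ('p set \<Rightarrow> 'm \<Rightarrow> 'm) \<Rightarrow> 'p set \<Rightarrow> 'a \<Rightarrow> bool"
 where "acts_by X F f U c \<longleftrightarrow> (\<forall>W s. opn X W \<and> W \<subseteq> U \<and> s \<in> Ms F W \<longrightarrow> f W s = ores X U W c *.[msec F W] s)"

lemma acts_byD: "acts_by X F f U c \<Longrightarrow> opn X W \<Longrightarrow> W \<subseteq> U \<Longrightarrow> s \<in> Ms F W \<Longrightarrow> f W s = ores X U W c *.[msec F W] s"
 by (simp add: acts_by_def)

context module_sheaf
begin

lemma free_gen_acts_by:
 assumes f: "f \<in> mod_hom X F F" and e: "free_gen X F U e"
 obtains c where "c \<in> Os X U" "acts_by X F f U c"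
proof -
 note U = free_genD(1,2)[OF e]
 obtain c where c: "c \<in> Os X U" "f U e = c *.[msec F U] e"
  using free_genE[OF e U(1) order_refl mod_homD(1)[OF f U]] res_id[OF U] by metis
 have "f W s = ores X U W c *.[msec F W] s" if W: "opn X W" "W \<subseteq> U" and s: "s \<in> Ms F W" for W s
 proof -
  obtain d where d: "d \<in> Os X W" "s = d *.[msec F W] mres F U W e" by (rule free_genE[OF e W s])
  interpret M: module "osec X W" "msec F W" by (rule module_sec[OF W(1)])
  note eW = res_closed[OF U(1) W U(2)] and cW = ores_closed[OF U(1) W c(1)]
  have "f W s = d *.[msec F W] (ores X U W c *.[msec F W] mres F U W e)"
   unfolding d(2) mod_homD(3)[OF f W(1) d(1) eW] mod_homD(4)[OF f U(1) W
     U(2)] c(2) res_smult[OF U(1) W c(1) U(2)] ..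
  also have "... = ores X U W c *.[msec F W] s"
   unfolding d(2) using M.smult_assoc1[OF d(1) cW eW] M.smult_assoc1[OF cW d(1)
     eW] M.R.m_comm[OF d(1) cW] by simp
  finally show ?thesis .
 qed
 hence "acts_by X F f U c" by (simp add: acts_by_def)
 with c(1) show thesis by (rule that)
qed

lemma acts_by_unique:
 assumes e: "free_gen X F U e" and c: "c \<in> Os X U" "acts_by X F f U c" and d: "opn X W" "d \<in> Os X W"
   "acts_by X F f W d"
 shows "ores X U (U \<inter> W) c = ores X W (U \<inter> W) d"
proof -
 note U = free_genD(1,2)[OF e]
 have I: "opn X (U \<inter> W)" "U \<inter> W \<subseteq> U" "U \<inter> W \<subseteq> W" using U d(1) by auto
 have eI: "mres F U (U \<inter> W) e \<in> Ms F (U \<inter> W)" by (rule res_closed[OF U(1) I(1,2) U(2)])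
 show ?thesis
  using free_gen_cancel[OF e I(1,2) ores_closed[OF U(1) I(1,2) c(1)] ores_closed[OF d(1) I(1,3) d(2)]]
   acts_byD[OF c(2) I(1,2) eI] acts_byD[OF d(3) I(1,3) eI] by metis
qed

lemma acts_by_eq_hom_smult:
 assumes f: "f \<in> mod_hom X F F" and a: "a \<in> Os X (pts X)"
  and loc: "\<And>p. p \<in> pts X \<Longrightarrow> \<exists>U. opn X U \<and> p \<in> U \<and> acts_by X F f U (ores X (pts X) U a)"
 shows "f = hom_smult X F F a (hom_id X F)"
proof (rule mod_hom_eqI[OF f hom_smult_closed[OF mod_sheaf mod_sheaf hom_id_closed[OF mod_sheaf] a]])
 fix U s assume U: "opn X U" and s: "s \<in> Ms F U"
 note aU = ores_closed[OF opn_pts U openin_subset[OF U] a]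
 have "f U s = ores X (pts X) U a *.[msec F U] s"
 proof (rule sheaf_eqI[OF sheaf U mod_homD(1)[OF f U s] smult_closed[OF U aU s]])
  fix p assume p: "p \<in> U"
  obtain W where W: "opn X W" "p \<in> W" "acts_by X F f W (ores X (pts X) W a)"
   using loc openin_subset[OF U] p by blast
  have I: "opn X (U \<inter> W)" "U \<inter> W \<subseteq> U" "U \<inter> W \<subseteq> W" using U W by auto
  have "mres F U (U \<inter> W) (f U s) = ores X W (U \<inter> W) (ores X (pts X) W a) *.[msec F (U \<inter> W)] mres F U
    (U \<inter> W) s"
   using acts_byD[OF W(3) I(1,3) res_closed[OF U I(1,2) s]] mod_homD(4)[OF f U I(1,2) s] by simp
  also have "... = mres F U (U \<inter> W) (ores X (pts X) U a *.[msec F U] s)"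
   using res_smult[OF U I(1,2) aU s] ores_ores[OF opn_pts U I(1,2) openin_subset[OF U] a]
    ores_ores[OF opn_pts W(1) I(1,3) openin_subset[OF W(1)] a] by simp
  finally show "\<exists>W. opn X W \<and> p \<in> W \<and> W \<subseteq> U \<and> mres F U W (f U s) =
    mres F U W (ores X (pts X) U a *.[msec F U] s)"
   using I p W(2) by blast
 qed
 thus "f U s = hom_smult X F F a (hom_id X F) U s" using hom_apply[OF U s] by simp
qed

end

lemma (in ringed_space) line_bundle_endomorphism:
 assumes F: "line_bundle X F" and f: "f \<in> mod_hom X F F"
 obtains a where "a \<in> Os X (pts X)" "f = hom_smult X F F a (hom_id X F)"
proof -
 interpret F: module_sheaf X F by (rule line_bundle_module_sheaf[OF F])
 have "\<exists>U e c. p \<in> U \<and> free_gen X F U e \<and> c \<in> Os X U \<and> acts_by X F f U c" if "p \<in> pts X" for p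
  using line_bundleD(2)[OF F that] F.free_gen_acts_by[OF f] by metis
 then obtain U e c where U: "\<And>p. p \<in> pts X \<Longrightarrow> p \<in> U p" "\<And>p. p \<in> pts X \<Longrightarrow> free_gen X F (U p) (e p)"
  and c: "\<And>p. p \<in> pts X \<Longrightarrow> c p \<in> Os X (U p)" "\<And>p. p \<in> pts X \<Longrightarrow> acts_by X F f (U p) (c p)" by metis
 note opn = free_genD(1)[OF U(2)]
 have cover: "(\<Union>p\<in>pts X. U p) = pts X" using U(1) openin_subset[OF opn] by blast
 obtain a where a: "a \<in> Os X (pts X)" "\<And>p. p \<in> pts X \<Longrightarrow> ores X (pts X) (U p) a = c p"
 proof (rule sheaf_glue[OF sheaf_O, of "pts X" U c, unfolded cover])
  show "ores X (U p) (U p \<inter> U q) (c p) = ores X (U q) (U p \<inter> U q) (c q)"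
    if "p \<in> pts X" "q \<in> pts X" for p q
   by (rule F.acts_by_unique[OF U(2)[OF that(1)] c[OF that(1)] opn[OF that(2)] c[OF that(2)]])
 qed (use opn c that in simp_all)
 have "\<exists>W. opn X W \<and> p \<in> W \<and> acts_by X F f W (ores X (pts X) W a)" if "p \<in> pts X" for p
  using opn[OF that] U(1)[OF that] c(2)[OF that] a(2)[OF that] by (intro exI[of _ "U p"]) simp
 from F.acts_by_eq_hom_smult[OF f a(1) this] a(1) show thesis by (rule that[rotated])
qed

section \<open>Polynomials in many variables\<close>

lemma mpoly_ring_sel [simp]:
 "carrier (mpoly_ring S) = {q. \<forall>m\<in>keys q. keys m \<subseteq> S}"
 "monoid.mult (mpoly_ring S) = (*)" "monoid.one (mpoly_ring S) = 1" "ring.zero (mpoly_ring S) = 0"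
   "ring.add (mpoly_ring S) = (+)"
 by (simp_all add: mpoly_ring_def)

lemma mpoly_ring_closed:
 assumes "p \<in> carrier (mpoly_ring S)" "q \<in> carrier (mpoly_ring S)"
 shows "p + q \<in> carrier (mpoly_ring S)" "p * q \<in> carrier (mpoly_ring S)" "- p \<in> carrier (mpoly_ring S)"
  "p - q \<in> carrier (mpoly_ring S)"
proof -
 show "p + q \<in> carrier (mpoly_ring S)" using assms keys_add[of p q] by auto
 have "keys m \<subseteq> S" if h: "m \<in> keys (p * q)" for m
 proof -
  obtain a b where ab: "m = a + b" "a \<in> keys p" "b \<in> keys q"
   using subsetD[OF keys_mult h] by auto
  have "keys a \<subseteq> S" "keys b \<subseteq> S" using ab assms by auto
  thus ?thesis using keys_add[of a b] ab(1) by auto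
 qed
 thus "p * q \<in> carrier (mpoly_ring S)" by auto
 show "- p \<in> carrier (mpoly_ring S)" using assms by simp
 show "p - q \<in> carrier (mpoly_ring S)" using assms keys_diff[of p q] by auto
qed

lemma mpoly_ring_elems:
 "0 \<in> carrier (mpoly_ring S)" "1 \<in> carrier (mpoly_ring S)" "mConst c \<in> carrier (mpoly_ring S)"
 "v \<in> S \<Longrightarrow> mVar v \<in> carrier (mpoly_ring S)"
 "keys m \<subseteq> S \<Longrightarrow> single m c \<in> carrier (mpoly_ring S)"
 by (auto simp: mConst_def mVar_def single_one[symmetric] simp del: single_one split: if_splits)

lemma mpoly_ring_cring: "cring (mpoly_ring S)"
proof (rule cringI)
 show "abelian_group (mpoly_ring S)"
 proof (rule abelian_groupI)
  fix x assume x: "x \<in> carrier (mpoly_ring S)"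
  show "\<exists>y\<in>carrier (mpoly_ring S). y +[mpoly_ring S] x = 0[mpoly_ring S]"
   by (rule bexI[OF _ mpoly_ring_closed(3)[OF x x]]) simp
 qed (use mpoly_ring_closed(1) mpoly_ring_elems(1) in \<open>simp_all add: add_ac del: mpoly_ring_sel(1)\<close>)
 show "comm_monoid (mpoly_ring S)"
  by (rule comm_monoidI) (use mpoly_ring_closed(2) mpoly_ring_elems(2)
    in \<open>simp_all add: mult_ac del: mpoly_ring_sel(1)\<close>)
qed (simp add: distrib_right)

lemma mpoly_ring_minus:
 assumes "p \<in> carrier (mpoly_ring S)" "q \<in> carrier (mpoly_ring S)"
 shows "p \<ominus>\<^bsub>mpoly_ring S\<^esub> q = p - q"
proof -
 interpret P: cring "mpoly_ring S" by (rule mpoly_ring_cring)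
 have "\<ominus>\<^bsub>mpoly_ring S\<^esub> q = - q"
  by (rule P.minus_equality) (use assms mpoly_ring_closed(3)[OF assms(2,2)] in simp_all)
 thus ?thesis by (simp add: a_minus_def)
qed

definition mono_prod :: "('v \<Rightarrow> 'c::comm_semiring_1) \<Rightarrow> ('v \<Rightarrow>\<^sub>0 nat) \<Rightarrow> 'c"
 where "mono_prod w m = (\<Prod>v\<in>keys m. w v ^ lookup m v)"

lemma mono_prod_add: "mono_prod w (m + m') = mono_prod w m * mono_prod w m'"
proof -
 let ?K = "keys m \<union> keys m'"
 have extend: "mono_prod w r = (\<Prod>v\<in>?K. w v ^ lookup r v)" if "keys r \<subseteq> ?K" for r
  unfolding mono_prod_def using that by (intro prod.mono_neutral_left) (auto simp: in_keys_iff)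
 show ?thesis using extend[of m] extend[of m'] extend[OF keys_add]
  by (simp add: lookup_add power_add prod.distrib)
qed

lemma mono_prod_single: "mono_prod w (single v 1) = w v" "mono_prod w 0 = 1"
 by (simp_all add: mono_prod_def)

lemma mono_prod_single_add: "mono_prod w (single v 1 + m) = w v * mono_prod w m"
 unfolding mono_prod_add mono_prod_single(1) ..

lemma mono_deg_single_add: "mono_deg (single v 1 + m) = Suc (mono_deg m)"
proof -
 let ?K = "insert v (keys m)"
 have "mono_deg r = (\<Sum>v\<in>?K. lookup r v)" if "keys r \<subseteq> ?K" for r
  unfolding mono_deg_def using that by (intro sum.mono_neutral_left) (auto simp: in_keys_iff)
 from this[of "single v 1 + m"] this[OF subset_insertI] keys_add[of "single v 1" m]
 show ?thesis by (simp add: lookup_add sum.distrib lookup_single when_def sum.delta)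
qed

lemma monomial_splitE:
 assumes "v \<in> keys (m :: 'v \<Rightarrow>\<^sub>0 nat)"
 obtains r where "m = single v 1 + r" "keys r \<subseteq> keys m"
proof (rule that)
 show "m = single v 1 + (m - single v 1)"
  using assms by (intro poly_mapping_eqI) (auto simp: lookup_add lookup_minus lookup_single when_def
    in_keys_iff)
 show "keys (m - single v 1) \<subseteq> keys m" by (auto simp: in_keys_iff lookup_minus)
qed

lemma monomial_induct:
 assumes "keys m \<subseteq> S" and zero: "P 0"
  and step: "\<And>v m. \<lbrakk>v \<in> S; keys m \<subseteq> S; P m\<rbrakk> \<Longrightarrow> P (single v (1::nat) + m)"
 shows "P m"
 using assms(1)
proof (induction "mono_deg m" arbitrary: m rule: less_induct)
 case less
 show ?case
 proof (cases "m = 0")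
  case False
  then obtain v where v: "v \<in> keys m" by (metis ex_in_conv keys_eq_empty)
  obtain r where r: "m = single v 1 + r" "keys r \<subseteq> keys m" by (rule monomial_splitE[OF v])
  have "P r" using less.hyps[of r] r(2) less.prems mono_deg_single_add[of v r]
   unfolding r(1)[symmetric] by simp
  thus ?thesis unfolding r(1) using v r(2) less.prems by (intro step) auto
 qed (simp add: zero)
qed

lemma mpoly_induct:
 fixes q :: "('v, 'k::field) mpol"
 assumes "q \<in> carrier (mpoly_ring S)"
  and single: "\<And>m c. keys m \<subseteq> S \<Longrightarrow> P (single m c)"
  and plus: "\<And>p q. \<lbrakk>p \<in> carrier (mpoly_ring S); q \<in> carrier (mpoly_ring S); P p; P q\<rbrakk> \<Longrightarrow> P (p + q)"
 shows "P q"
proof -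
 have eq: "(\<Sum>m\<in>keys q. single m (lookup q m)) = q"
  by (rule poly_mapping_eqI) (simp add: lookup_sum lookup_single when_def in_keys_iff)
 have "(\<Sum>m\<in>K. single m (lookup q m)) \<in> carrier (mpoly_ring S) \<and>
   P (\<Sum>m\<in>K. single m (lookup q m))" if h: "K \<subseteq> keys q" for K
  using finite_subset[OF h finite_keys] h
 proof (induction K)
  case empty
  show ?case using single[of 0 0] mpoly_ring_elems(1)[of S] by (simp del: mpoly_ring_sel)
 next
  case (insert m K)
  have m: "keys m \<subseteq> S" using insert.prems assms(1) by auto
  have IH: "(\<Sum>m\<in>K. single m (lookup q m)) \<in> carrier (mpoly_ring S)"
   "P (\<Sum>m\<in>K. single m (lookup q m))" using insert.IH insert.prems by blast+
  show ?case unfolding sum.insert[OF insert.hyps]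
   by (intro conjI mpoly_ring_closed(1) plus mpoly_ring_elems(5) m IH single)
 qed
 thus ?thesis using eq by (metis order_refl)
qed

lemma const_ring_hom:
 fixes c :: "'k::field \<Rightarrow> 'a"
 assumes R: "cring R" and c: "c \<in> ring_hom k_ring R"
 shows "c a \<in> carrier R" "c (a + b) = c a +[R] c b" "c (a * b) = c a *[R] c b" "c 1 = 1[R]" "c 0 = 0[R]"
proof -
 interpret R: cring R by (rule R)
 show closed: "c a \<in> carrier R" for a using ring_hom_closed[OF c, of a] by (simp add: k_ring_def)
 show add: "c (a + b) = c a +[R] c b" for a b using ring_hom_add[OF c, of a b] by (simp add: k_ring_def)
 show "c (a * b) = c a *[R] c b" using ring_hom_mult[OF c, of a b] by (simp add: k_ring_def)
 show "c 1 = 1[R]" using ring_hom_one[OF c] by (simp add: k_ring_def)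
 show "c 0 = 0[R]" using add[of 0 0] closed[of 0] by (simp add: R.add.r_cancel_one)
qed

locale mpoly_evaluation =
 fixes c :: "'k::field \<Rightarrow> 'a" and R :: "'a ring" and x :: "'v \<Rightarrow> 'a" and S :: "'v set"
 assumes R: "cring R" and c: "c \<in> ring_hom k_ring R" and x: "x \<in> S \<rightarrow> carrier R"
begin

sublocale R: cring R by (rule R)

lemmas const_ops = const_ring_hom[OF R c]

abbreviation eval :: "('v, 'k) mpol \<Rightarrow> 'a" where "eval \<equiv> mp_eval c R x"

abbreviation mono_eval :: "('v \<Rightarrow>\<^sub>0 nat) \<Rightarrow> 'a"
 where "mono_eval m \<equiv> finprod R (\<lambda>v. x v ^[R] lookup m v) (keys m)"

lemma x_closed: "v \<in> S \<Longrightarrow> x v \<in> carrier R" using x by auto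

lemma mono_eval_closed: "keys m \<subseteq> S \<Longrightarrow> mono_eval m \<in> carrier R"
 by (rule R.finprod_closed) (use x_closed in auto)

lemma mono_eval_add:
 assumes "keys m \<subseteq> S" "keys m' \<subseteq> S" shows "mono_eval (m + m') = mono_eval m *[R] mono_eval m'"
proof -
 let ?K = "keys m \<union> keys m'"
 have extend: "mono_eval r = finprod R (\<lambda>v. x v ^[R] lookup r v) ?K" if "keys r \<subseteq> ?K" for r
  by (rule R.finprod_mono_neutral_cong_left) (use that assms x_closed in \<open>auto simp: in_keys_iff\<close>)
 have closed: "(\<lambda>v. x v ^[R] lookup r v) \<in> ?K \<rightarrow> carrier R" for r :: "'v \<Rightarrow>\<^sub>0 nat"
  using assms x_closed by auto
 have "mono_eval (m + m') = finprod R (\<lambda>v. x v ^[R] lookup m v *[R] x v ^[R] lookup m' v) ?K"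
  unfolding extend[OF keys_add] using assms x_closed
  by (intro R.finprod_cong') (auto simp: lookup_add R.nat_pow_mult)
 also have "... = mono_eval m *[R] mono_eval m'"
  unfolding extend[OF Un_upper1] extend[OF Un_upper2] by (rule R.finprod_multf[OF closed closed])
 finally show ?thesis .
qed

lemma eval_eq_finsum:
 assumes "finite K" "keys q \<subseteq> K" "\<And>m. m \<in> K \<Longrightarrow> keys m \<subseteq> S"
 shows "eval q = finsum R (\<lambda>m. c (lookup q m) *[R] mono_eval m) K"
 unfolding mp_eval_def
 by (rule R.add.finprod_mono_neutral_cong_left[OF assms(1,2)])
  (use assms(3) mono_eval_closed const_ops in \<open>auto simp: in_keys_iff\<close>)

lemma eval_closed: "q \<in> carrier (mpoly_ring S) \<Longrightarrow> eval q \<in> carrier R"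
 unfolding mp_eval_def by (rule R.finsum_closed) (use mono_eval_closed const_ops in auto)

lemma eval_add:
 assumes "p \<in> carrier (mpoly_ring S)" "q \<in> carrier (mpoly_ring S)"
   shows "eval (p + q) = eval p +[R] eval q"
proof -
 let ?K = "keys p \<union> keys q"
 have K: "finite ?K" "\<And>m. m \<in> ?K \<Longrightarrow> keys m \<subseteq> S" using assms by auto
 note extend = eval_eq_finsum[OF K(1) _ K(2)]
 have closed: "(\<lambda>m. c (lookup r m) *[R] mono_eval m) \<in> ?K \<rightarrow> carrier R" for r
  using mono_eval_closed[OF K(2)] const_ops(1) by auto
 have "eval (p + q) = finsum R (\<lambda>m. c (lookup (p + q) m) *[R] mono_eval m) ?K"
  by (rule extend[OF keys_add])
 also have "... = finsum R (\<lambda>m. c (lookup p m) *[R] mono_eval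
   m +[R] c (lookup q m) *[R] mono_eval m) ?K"
 proof (rule R.finsum_cong')
  show "(\<lambda>m. c (lookup p m) *[R] mono_eval m +[R] c (lookup q m) *[R] mono_eval m) \<in> ?K \<rightarrow> carrier R"
   using closed[of p] closed[of q] by auto
  fix m assume "m \<in> ?K"
  from mono_eval_closed[OF K(2)[OF this]] show "c (lookup (p + q) m) *[R] mono_eval m =
    c (lookup p m) *[R] mono_eval m +[R] c (lookup q m) *[R] mono_eval m"
   unfolding lookup_add const_ops(2) by (intro R.l_distr const_ops(1))
 qed simp
 also have "... = eval p +[R] eval q"
  using R.finsum_addf[OF closed closed] extend[OF Un_upper1] extend[OF Un_upper2] by simp
 finally show ?thesis .
qed

lemma eval_single: "keys m \<subseteq> S \<Longrightarrow> eval (single m a) = c a *[R] mono_eval m"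
 using eval_eq_finsum[of "{m}" "single m a"] mono_eval_closed const_ops(1)
 by (simp add: R.finsum_singleton)

lemma eval_mConst: "eval (mConst a) = c a"
 using eval_single[of 0 a] const_ops(1) by (simp add: mConst_def)

lemma eval_mVar: "v \<in> S \<Longrightarrow> eval (mVar v) = x v"
 using eval_single[of "single v 1" 1] const_ops x_closed by (simp add: mVar_def R.finprod_singleton)

lemma eval_single_mult:
 assumes m: "keys m \<subseteq> S" and q: "q \<in> carrier (mpoly_ring S)"
 shows "eval (single m a * q) = eval (single m a) *[R] eval q"
 using q
proof (rule mpoly_induct)
 fix m' :: "'v \<Rightarrow>\<^sub>0 nat" and b :: 'k assume m': "keys m' \<subseteq> S"
 have mm: "keys (m + m') \<subseteq> S" using m m' keys_add[of m m'] by auto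
 show "eval (single m a * single m' b) = eval (single m a) *[R] eval (single m' b)"
  unfolding mult_single eval_single[OF m] eval_single[OF m'] eval_single[OF mm]
    mono_eval_add[OF m m'] const_ops(3)
  using const_ops(1)[of a] const_ops(1)[of b] mono_eval_closed[OF m] mono_eval_closed[OF m']
  by (simp add: R.m_ac)
next
 note sm = mpoly_ring_elems(5)[OF m, of a]
 fix r s :: "('v, 'k) mpol" assume rs: "r \<in> carrier (mpoly_ring S)" "s \<in> carrier (mpoly_ring S)"
  and IH: "eval (single m a * r) = eval (single m a) *[R] eval r"
    "eval (single m a * s) = eval (single m a) *[R] eval s"
 show "eval (single m a * (r + s)) = eval (single m a) *[R] eval (r + s)"
  unfolding distrib_left eval_add[OF mpoly_ring_closed(2)[OF sm rs(1)]
    mpoly_ring_closed(2)[OF sm rs(2)]] eval_add[OF rs] IH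
  using R.r_distr[OF eval_closed[OF rs(1)] eval_closed[OF rs(2)] eval_closed[OF sm]] by simp
qed

lemma eval_mult:
 assumes p: "p \<in> carrier (mpoly_ring S)" and q: "q \<in> carrier (mpoly_ring S)"
   shows "eval (p * q) = eval p *[R] eval q"
 using p
proof (rule mpoly_induct)
 fix r s :: "('v, 'k) mpol" assume rs: "r \<in> carrier (mpoly_ring S)" "s \<in> carrier (mpoly_ring S)"
  and IH: "eval (r * q) = eval r *[R] eval q" "eval (s * q) = eval s *[R] eval q"
 show "eval ((r + s) * q) = eval (r + s) *[R] eval q"
  unfolding distrib_right eval_add[OF mpoly_ring_closed(2)[OF rs(1) q]
    mpoly_ring_closed(2)[OF rs(2) q]] eval_add[OF rs] IH
  using R.l_distr[OF eval_closed[OF rs(1)] eval_closed[OF rs(2)] eval_closed[OF q]] by simp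
qed (rule eval_single_mult[OF _ q])

lemma eval_ring_hom: "eval \<in> ring_hom (mpoly_ring S) R"
proof (rule ring_hom_memI)
 show "eval 1[mpoly_ring S] = 1[R]" using eval_mConst[of 1] const_ops by (simp add: mConst_def)
qed (use eval_closed eval_add eval_mult in \<open>simp_all del: mpoly_ring_sel(1)\<close>)

end

lemma genideal_hom_zero:
 assumes P: "cring P" and S: "cring S" and h: "h \<in> ring_hom P S" and G: "G \<subseteq> carrier P"
  "\<And>r. r \<in> G \<Longrightarrow> h r = 0[S]" and q: "q \<in> genideal P G"
 shows "h q = 0[S]"
proof -
 interpret P: cring P by (rule P)
 interpret S: cring S by (rule S)
 interpret ring_hom_ring P S h by (rule ring_hom_ringI2[OF P.ring_axioms S.ring_axioms h])
 have "G \<subseteq> a_kernel P S h" using G unfolding a_kernel_def' by auto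
 from subsetD[OF P.genideal_minimal[OF kernel_is_ideal this] q] show ?thesis
  unfolding a_kernel_def' by auto
qed

lemma ex_power_ne_one:
 assumes "N > 0"
 shows "\<exists>c::'k::alg_closed_field. c \<noteq> 0 \<and> c ^ N \<noteq> 1"
proof -
 let ?f = "\<lambda>k. if k = 0 then 1 else if k = 1 then - 1 else if k = Suc N then 1 else (0::'k)"
 obtain x where x: "(\<Sum>k\<le>Suc N. ?f k * x ^ k) = 0" using alg_closed[of "Suc N" ?f] assms by auto
 have "(\<Sum>k\<le>Suc N. ?f k * x ^ k) = (\<Sum>k\<in>{0, 1, Suc N}. ?f k * x ^ k)"
  using assms by (intro sum.mono_neutral_right) auto
 also have "... = 1 - x + x ^ Suc N" using assms by simp
 finally have e: "1 - x + x ^ Suc N = 0" using x by simp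
 have "x \<noteq> 0" using e by auto
 moreover have "x ^ N \<noteq> 1" using e by auto
 ultimately show ?thesis by blast
qed

declare mpoly_ring_sel(1) [simp del]

lemma lookup_mConst: "lookup (mConst d * q) m = d * lookup q m"
proof -
 have "q \<in> carrier (mpoly_ring UNIV)" by (simp add: mpoly_ring_sel(1))
 thus ?thesis
  by (rule mpoly_induct) (simp_all add: mConst_def mult_single lookup_single when_def
    distrib_left lookup_add)
qed

lemma mConst_mult: "mConst a * mConst b = mConst (a * b)" by (simp add: mConst_def mult_single)

lemma mConst_one: "mConst 1 = 1" by (simp add: mConst_def)

lemma (in domain) finprod_nonzero:
 assumes "finite B" "\<And>i. i \<in> B \<Longrightarrow> h i \<in> carrier R" "\<And>i. i \<in> B \<Longrightarrow> h i \<noteq> \<zero>"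
 shows "finprod R h B \<noteq> \<zero>"
 using assms
proof (induction B)
 case (insert i B)
 have c: "h i \<in> carrier R" "h \<in> B \<rightarrow> carrier R" using insert by auto
 have "finprod R h B \<noteq> \<zero>" using insert by blast
 moreover have "h i \<noteq> \<zero>" using insert by blast
 ultimately show ?case using finprod_insert[OF insert.hyps(1,2) c(2,1)] integral[OF _ c(1)
   finprod_closed[OF c(2)]] by auto
qed simp

section \<open>Invariant functions on the representation space\<close>

definition nonzero_round_trip :: "('v, 'b) rspace \<Rightarrow> ('v, 'b, 'n) msheaf \<Rightarrow> ('v, 'b, 'm) msheaf \<Rightarrow> bool"
 where "nonzero_round_trip V E F \<longleftrightarrow> (\<exists>f g h. f \<in> mod_hom V E F \<and> g \<in> mod_hom V F E \<and>
  h \<in> Os V (pts V) \<and> h \<noteq> 0[osec V (pts V)] \<and> hom_comp V E g f = hom_smult V E E h (hom_id V E))"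

locale bondal = ringed_space V for V :: "('v, 'b) rspace" +
 fixes \<kappa> :: "'k::alg_closed_field \<Rightarrow> 'b" and n :: nat and F :: "int \<Rightarrow> ('v, 'b, 'n) msheaf"
 assumes kappa_hom: "\<kappa> \<in> ring_hom k_ring (osec V (pts V))"
  and line_bundle_F: "i \<in> {1..int n} \<Longrightarrow> line_bundle V (F i)"
  and n_pos: "n \<ge> 1"
  and domain_A: "domain (osec V (pts V))"
  and round_trips: "i \<in> {1..int n} \<Longrightarrow> nonzero_round_trip V (F 1) (F i)"
begin

abbreviation N where "N \<equiv> {1..int n}"
abbreviation A where "A \<equiv> osec V (pts V)"
abbreviation S where "S \<equiv> bondal_vars V n F"
abbreviation P :: "(('v, 'n) bvar, 'k) mpol ring" where "P \<equiv> mpoly_ring S"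
abbreviation relations where "relations \<equiv> bondal_relations \<kappa> V n F"
abbreviation I where "I \<equiv> genideal P relations"
abbreviation Q where "Q \<equiv> rep_ring \<kappa> V n F"
abbreviation cl where "cl q \<equiv> I +>\<^bsub>P\<^esub> q"
abbreviation \<theta> :: "(int \<Rightarrow> 'k) \<Rightarrow> (('v, 'n) bvar, 'k) mpol \<Rightarrow> (('v, 'n) bvar, 'k) mpol"
  where "\<theta> \<equiv> torus_act V n F"
abbreviation scalar where "scalar i a \<equiv> hom_smult V (F i) (F i) a (hom_id V (F i))"
abbreviation loop where "loop i a \<equiv> (i, i, scalar i a)"
abbreviation to_global where "to_global U \<equiv> ores V (pts V) U"

lemma one_in_N: "1 \<in> N" using n_pos by simp

lemma module_sheaf_F: "i \<in> N \<Longrightarrow> module_sheaf V (F i)"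
 by (rule line_bundle_module_sheaf[OF line_bundle_F])

lemma mod_sheaf_F: "i \<in> N \<Longrightarrow> mod_sheaf V (F i)" by (rule line_bundleD(1)[OF line_bundle_F])

lemma S_iff: "(i, j, f) \<in> S \<longleftrightarrow> i \<in> N \<and> j \<in> N \<and> f \<in> mod_hom V (F i) (F j)" by (auto simp: bondal_vars_def)

lemmas kappa_ops = const_ring_hom[OF cring_O[OF opn_pts] kappa_hom]

lemma scalar_hom: "i \<in> N \<Longrightarrow> a \<in> carrier A \<Longrightarrow> scalar i a \<in> mod_hom V (F i) (F i)"
 by (intro hom_smult_closed hom_id_closed mod_sheaf_F)

lemma S_add: "(i, j, f) \<in> S \<Longrightarrow> (i, j, g) \<in> S \<Longrightarrow> (i, j, hom_add V (F i) (F j) f g) \<in> S"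
 and S_smult: "(i, j, f) \<in> S \<Longrightarrow> a \<in> carrier A \<Longrightarrow> (i, j, hom_smult V (F i) (F j) a f) \<in> S"
 and S_id: "i \<in> N \<Longrightarrow> (i, i, hom_id V (F i)) \<in> S"
 and S_comp: "(i, j, f) \<in> S \<Longrightarrow> (j, l, g) \<in> S \<Longrightarrow> (i, l, hom_comp V (F i) g f) \<in> S"
 and S_loop: "i \<in> N \<Longrightarrow> a \<in> carrier A \<Longrightarrow> loop i a \<in> S"
 unfolding S_iff by ((elim conjE)?, intro conjI hom_add_closed hom_smult_closed hom_id_closed
   hom_comp_closed mod_sheaf_F; assumption)+

lemma relations_subset: "relations \<subseteq> carrier P"
proof
 fix r assume "r \<in> relations"
 thus "r \<in> carrier P" by cases (auto intro!: mpoly_ring_closed mpoly_ring_elems S_add S_smult S_id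
   S_comp kappa_ops)
qed

interpretation P: cring P by (rule mpoly_ring_cring)

lemma I_ideal: "ideal I P" by (rule P.genideal_ideal[OF relations_subset])

interpretation I: ideal I P by (rule I_ideal)

lemma Q_eq: "Q = P Quot I" by (simp add: rep_ring_def)

lemma Q_cring: "cring Q" unfolding Q_eq by (rule I.quotient_is_cring[OF P.is_cring])

interpretation Q: cring Q by (rule Q_cring)

lemma cl_ring_hom: "cl \<in> ring_hom P Q" unfolding Q_eq by (rule I.rcos_ring_hom)

lemma cl_closed: "p \<in> carrier P \<Longrightarrow> cl p \<in> carrier Q" by (rule ring_hom_closed[OF cl_ring_hom])

lemma cl_mult: "\<lbrakk>p \<in> carrier P; q \<in> carrier P\<rbrakk> \<Longrightarrow> cl (p * q) = cl p *[Q] cl q"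
 and cl_add: "\<lbrakk>p \<in> carrier P; q \<in> carrier P\<rbrakk> \<Longrightarrow> cl (p + q) = cl p +[Q] cl q"
 using ring_hom_mult[OF cl_ring_hom] ring_hom_add[OF cl_ring_hom] by simp_all

lemma cl_one: "cl 1 = 1[Q]" using ring_hom_one[OF cl_ring_hom] by simp

lemma cl_zero: "cl 0 = 0[Q]" using ring_hom_zero[OF cl_ring_hom P.ring_axioms Q.ring_axioms] by simp

lemma clE:
 assumes "b \<in> carrier Q" obtains q where "q \<in> carrier P" "b = cl q"
 using assms unfolding Q_eq FactRing_def A_RCOSETS_def' by auto

lemma cl_eq_iff: "p \<in> carrier P \<Longrightarrow> q \<in> carrier P \<Longrightarrow> cl p = cl q \<longleftrightarrow> p - q \<in> I"
 using P.quotient_eq_iff_same_a_r_cos[OF I_ideal, of p q] mpoly_ring_minus[of p S q] by auto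

lemma cl_eq_zero_iff: "q \<in> carrier P \<Longrightarrow> cl q = 0[Q] \<longleftrightarrow> q \<in> I"
 using cl_eq_iff[of q 0] mpoly_ring_elems(1)[of S] unfolding cl_zero by simp

lemma cl_eq_image: "cl q = (\<lambda>i. i + q) ` I"
 by (auto simp: a_r_coset_def')

lemma cl_self: "q \<in> cl q"
 using I.zero_closed by (force simp: cl_eq_image)

lemma relation_in_I: "r \<in> relations \<Longrightarrow> r \<in> I" using P.genideal_self[OF relations_subset] by auto

lemma cl_relation:
 assumes "p - q \<in> relations" "p \<in> carrier P" "q \<in> carrier P" shows "cl p = cl q"
 using relation_in_I[OF assms(1)] cl_eq_iff[OF assms(2,3)] by simp

abbreviation var :: "int \<Rightarrow> int \<Rightarrow> ('v set \<Rightarrow> 'n \<Rightarrow> 'n) \<Rightarrow> (('v, 'n) bvar, 'k) mpol set"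
 where "var i j f \<equiv> cl (mVar (i, j, f))"

lemma var_closed: "(i, j, f) \<in> S \<Longrightarrow> var i j f \<in> carrier Q"
 by (rule cl_closed[OF mpoly_ring_elems(4)])

lemma var_add: "\<lbrakk>(i, j, f) \<in> S; (i, j, g) \<in> S\<rbrakk> \<Longrightarrow> var i j (hom_add V (F i) (F j) f g) =
  var i j f +[Q] var i j g"
 and var_smult: "(i, j, f) \<in> S \<Longrightarrow> var i j (hom_smult V (F i) (F j) (\<kappa> c) f) =
   cl (mConst c) *[Q] var i j f"
 and var_id: "i \<in> N \<Longrightarrow> var i i (hom_id V (F i)) = 1[Q]"
 and var_comp: "\<lbrakk>(i, j, f) \<in> S; (j, l, g) \<in> S\<rbrakk> \<Longrightarrow> var i l (hom_comp V (F i) g f) =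
   var i j f *[Q] var j l g"
proof -
 note elems = mpoly_ring_elems(2,3) mpoly_ring_elems(4)[of _ S]
 show "var i j (hom_add V (F i) (F j) f g) = var i j f +[Q] var i j g"
   if h: "(i, j, f) \<in> S" "(i, j, g) \<in> S" for i j f g
  unfolding cl_add[OF elems(3)[OF h(1)] elems(3)[OF h(2)], symmetric]
  using bondal_relations.add[OF h, of \<kappa>] S_add[OF h] h elems
  by (intro cl_relation mpoly_ring_closed(1)) (simp_all add: diff_diff_eq)
 show "var i j (hom_smult V (F i) (F j) (\<kappa> c) f) = cl (mConst c) *[Q] var i j f"
   if h: "(i, j, f) \<in> S" for i j f
  unfolding cl_mult[OF elems(2) elems(3)[OF h], symmetric]
  by (intro cl_relation mpoly_ring_closed(2) elems bondal_relations.smult S_smult kappa_ops h)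
 show "var i i (hom_id V (F i)) = 1[Q]" if h: "i \<in> N" for i
  unfolding cl_one[symmetric] by (intro cl_relation elems bondal_relations.ident S_id h)
 show "var i l (hom_comp V (F i) g f) = var i j f *[Q] var j l g"
   if h: "(i, j, f) \<in> S" "(j, l, g) \<in> S" for i j l f g
  unfolding cl_mult[OF elems(3)[OF h(1)] elems(3)[OF h(2)], symmetric]
  by (intro cl_relation mpoly_ring_closed(2) elems bondal_relations.comp S_comp[OF h] h)
qed

subsection \<open>The torus action\<close>

definition wt :: "(int \<Rightarrow> 'k) \<Rightarrow> ('v, 'n) bvar \<Rightarrow> 'k"
 where "wt g = (\<lambda>(i, j, f). g i * inverse (g j))"

abbreviation valid :: "(int \<Rightarrow> 'k) \<Rightarrow> bool" where "valid g \<equiv> \<forall>i\<in>N. g i \<noteq> 0"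

lemma torus_evaluation: "mpoly_evaluation mConst P (\<lambda>(i, j, f).
  mConst (g i * inverse (g j)) * mVar (i, j, f)) S"
proof (rule mpoly_evaluation.intro[OF P.is_cring])
 show "mConst \<in> ring_hom (k_ring :: 'k ring) P"
  by (rule ring_hom_memI) (auto simp: k_ring_def mConst_one mConst_mult mpoly_ring_elems(3), simp
    add: mConst_def single_add)
qed (auto intro!: mpoly_ring_closed mpoly_ring_elems)

lemma theta_ring_hom: "\<theta> g \<in> ring_hom P P"
 unfolding torus_act_def by (rule mpoly_evaluation.eval_ring_hom[OF torus_evaluation])

lemma theta_closed: "p \<in> carrier P \<Longrightarrow> \<theta> g p \<in> carrier P" by (rule ring_hom_closed[OF theta_ring_hom])

lemma theta_mult: "\<lbrakk>p \<in> carrier P; q \<in> carrier P\<rbrakk> \<Longrightarrow> \<theta> g (p * q) = \<theta> g p * \<theta> g q"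
 and theta_add: "\<lbrakk>p \<in> carrier P; q \<in> carrier P\<rbrakk> \<Longrightarrow> \<theta> g (p + q) = \<theta> g p + \<theta> g q"
 using ring_hom_mult[OF theta_ring_hom] ring_hom_add[OF theta_ring_hom] by simp_all

lemma theta_mConst: "\<theta> g (mConst c) = mConst c"
 unfolding torus_act_def by (rule mpoly_evaluation.eval_mConst[OF torus_evaluation])

lemma theta_mVar: "v \<in> S \<Longrightarrow> \<theta> g (mVar v) = mConst (wt g v) * mVar v"
 unfolding torus_act_def wt_def using mpoly_evaluation.eval_mVar[OF torus_evaluation, of v g]
 by (cases v) simp

lemma theta_single:
 assumes "keys m \<subseteq> S" shows "\<theta> g (single m c) = single m (mono_prod (wt g) m * c)"
 using assms
proof (rule monomial_induct)
 show "\<theta> g (single 0 c) = single 0 (mono_prod (wt g) 0 * c)"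
  using theta_mConst[of g c] by (simp add: mConst_def mono_prod_single)
 fix v m assume v: "v \<in> S" and m: "keys m \<subseteq> S"
   and IH: "\<theta> g (single m c) = single m (mono_prod (wt g) m * c)"
 have "single (single v 1 + m) c = mVar v * single m c" by (simp add: mVar_def mult_single)
 thus "\<theta> g (single (single v 1 + m) c) =
   single (single v 1 + m) (mono_prod (wt g) (single v 1 + m) * c)"
  using theta_mult[OF mpoly_ring_elems(4)[OF v] mpoly_ring_elems(5)[OF m], of g c] IH theta_mVar[OF v]
  by (simp add: mVar_def mConst_def mult_single mono_prod_single_add[simplified] mult.assoc)
qed

lemma lookup_theta:
 assumes "q \<in> carrier P" shows "lookup (\<theta> g q) m = mono_prod (wt g) m * lookup q m"
 using assms
 by (rule mpoly_induct) (simp_all add: theta_single theta_add lookup_single when_def lookup_add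
   distrib_left)

lemma theta_homogeneous:
 assumes "q \<in> carrier P" "\<And>m. m \<in> keys q \<Longrightarrow> mono_prod (wt g) m = d" shows "\<theta> g q = mConst d * q"
 using assms(2) by (intro poly_mapping_eqI) (auto simp: lookup_theta[OF assms(1)] lookup_mConst
   in_keys_iff)

lemma theta_inverse:
 assumes q: "q \<in> carrier P" and g: "valid g" shows "\<theta> g (\<theta> (\<lambda>i. inverse (g i)) q) = q"
proof (rule poly_mapping_eqI)
 let ?g = "\<lambda>i. inverse (g i)"
 have weight: "wt g v * wt ?g v = 1" if "v \<in> S" for v
 proof -
  obtain i j f where v: "v = (i, j, f)" by (cases v)
  have "g i \<noteq> 0" "g j \<noteq> 0" using that g unfolding v S_iff by auto
  thus ?thesis by (simp add: wt_def v field_simps)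
 qed
 have weights: "mono_prod (wt g) m * mono_prod (wt ?g) m = 1" if m: "keys m \<subseteq> S" for m
 proof -
  have "mono_prod (wt g) m * mono_prod (wt ?g) m = (\<Prod>v\<in>keys m. (wt g v * wt ?g v) ^ lookup m v)"
   unfolding mono_prod_def prod.distrib[symmetric] power_mult_distrib ..
  also have "... = 1" using m weight by (intro prod.neutral) (auto simp: subset_iff)
  finally show ?thesis .
 qed
 fix m
 have "lookup (\<theta> g (\<theta> ?g q)) m = mono_prod (wt g) m * mono_prod (wt ?g) m * lookup q m"
  by (simp add: lookup_theta[OF theta_closed[OF q]] lookup_theta[OF q])
 thus "lookup (\<theta> g (\<theta> ?g q)) m = lookup q m"
  using weights[of m] q by (cases "m \<in> keys q") (auto simp: mpoly_ring_sel(1) in_keys_iff)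
qed

lemma relation_homogeneous:
 assumes r: "r \<in> relations" and g: "valid g"
 obtains d where "\<And>m. m \<in> keys r \<Longrightarrow> mono_prod (wt g) m = d"
proof -
 have keys_mVar: "keys (mVar v :: (('v, 'n) bvar, 'k) mpol) = {single v 1}" for v
  by (simp add: mVar_def)
 have weight: "mono_prod (wt g) (single (i, j, f) (Suc 0)) = g i * inverse (g j)" for i j f
  using mono_prod_single(1)[of "wt g" "(i, j, f)"] by (simp add: wt_def)
 show thesis using r
 proof cases
  case (add i j f h)
  have "keys r \<subseteq> keys (mVar (i, j, hom_add V (F i) (F j) f h) ::
    (('v, 'n) bvar, 'k) mpol) \<union> keys (mVar (i, j, f) :: (('v, 'n) bvar, 'k) mpol)
    \<union> keys (mVar (i, j, h) :: (('v, 'n) bvar, 'k) mpol)"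
   unfolding add(1) using keys_diff by (meson Un_mono order_refl order_trans)
  thus thesis by (intro that[of "g i * inverse (g j)"]) (auto simp: keys_mVar weight)
 next
  case (smult i j f c)
  have "keys (mConst c * mVar (i, j, f) :: (('v, 'n) bvar, 'k) mpol) \<subseteq> {single (i, j, f) 1}"
   by (simp add: mConst_def mVar_def mult_single)
  hence "keys r \<subseteq> {single (i, j, hom_smult V (F i) (F j) (\<kappa> c) f) 1, single (i, j, f) 1}"
   unfolding smult(1) using keys_diff[of "mVar (i, j, hom_smult V (F i) (F j) (\<kappa> c) f)"
     "mConst c * mVar (i, j, f)"]
   by (auto simp: keys_mVar)
  thus thesis by (intro that[of "g i * inverse (g j)"]) (auto simp: weight)
 next
  case (ident i)
  have "keys r \<subseteq> {single (i, i, hom_id V (F i)) 1, 0}"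
   unfolding ident(1) using keys_diff[of "mVar (i, i, hom_id V (F i))" 1] by (auto simp: keys_mVar)
  thus thesis using g ident(2) by (intro that[of 1]) (auto simp: weight mono_prod_single(2))
 next
  case (comp i j f l h)
  have "g j \<noteq> 0" using comp(2) g unfolding S_iff by auto
  hence "mono_prod (wt g) (single (i, j, f) (Suc 0) + single (j, l, h) (Suc 0)) = g i * inverse (g l)"
   using mono_prod_single_add[of "wt g" "(i, j, f)" "single (j, l, h) 1"] weight by (simp add: wt_def)
  moreover have "keys r \<subseteq> {single (i, l, hom_comp V (F i) h f) 1, single (i, j, f) 1 + single
    (j, l, h) 1}"
   unfolding comp(1) using keys_diff[of "mVar (i, l, hom_comp V (F i) h f)"
     "mVar (i, j, f) * mVar (j, l, h)"]
   by (auto simp: keys_mVar mVar_def mult_single)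
  ultimately show thesis by (intro that[of "g i * inverse (g l)"]) (auto simp: weight)
 qed
qed

lemma theta_relation:
 assumes r: "r \<in> relations" and g: "valid g" shows "\<theta> g r \<in> I"
proof -
 obtain d where "\<And>m. m \<in> keys r \<Longrightarrow> mono_prod (wt g) m = d" using relation_homogeneous[OF r g] by metis
 hence "\<theta> g r = mConst d * r" using relations_subset r by (intro theta_homogeneous) auto
 thus ?thesis using I.I_l_closed[OF relation_in_I[OF r] mpoly_ring_elems(3)[of d S]] by simp
qed

lemma theta_I:
 assumes q: "q \<in> I" and g: "valid g" shows "\<theta> g q \<in> I"
proof -
 have "(cl \<circ> \<theta> g) q = 0[Q]"
 proof (rule genideal_hom_zero[OF P.is_cring Q_cring ring_hom_trans[OF theta_ring_hom cl_ring_hom]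
   relations_subset _ q])
  fix r assume r: "r \<in> relations"
  thus "(cl \<circ> \<theta> g) r = 0[Q]"
   using theta_relation[OF r g] cl_eq_zero_iff[OF theta_closed] relations_subset by auto
 qed
 thus ?thesis using cl_eq_zero_iff[OF theta_closed[OF I.a_Hcarr[OF q]]] by simp
qed

lemma theta_image_cl:
 assumes q: "q \<in> carrier P" and g: "valid g" shows "\<theta> g ` cl q = cl (\<theta> g q)"
proof -
 have g': "valid (\<lambda>i. inverse (g i))" using g by simp
 have "\<theta> g ` I = I"
 proof
  show "\<theta> g ` I \<subseteq> I" using theta_I[OF _ g] by blast
  show "I \<subseteq> \<theta> g ` I"
  proof
   fix i assume i: "i \<in> I"
   show "i \<in> \<theta> g ` I"
    using theta_I[OF i g'] theta_inverse[OF I.a_Hcarr[OF i] g]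
    by (intro image_eqI[of _ _ "\<theta> (\<lambda>i. inverse (g i)) i"]) simp_all
  qed
 qed
 hence "cl (\<theta> g q) = (\<lambda>i. i + \<theta> g q) ` (\<theta> g ` I)" unfolding cl_eq_image by (rule arg_cong[OF sym])
 also have "... = (\<lambda>i. \<theta> g i + \<theta> g q) ` I" unfolding image_image ..
 also have "... = (\<lambda>i. \<theta> g (i + q)) ` I" using theta_add[OF I.a_Hcarr q] by (intro image_cong refl) simp
 also have "... = \<theta> g ` cl q" unfolding cl_eq_image image_image ..
 finally show ?thesis ..
qed

subsection \<open>The ring of invariants\<close>

abbreviation R where "R \<equiv> inv_ring \<kappa> V n F"

lemma R_sel: "monoid.mult R = monoid.mult Q" "ring.add R = ring.add Q" "monoid.one R = monoid.one Q"
  "ring.zero R = ring.zero Q"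
 "carrier R \<subseteq> carrier Q" "R = Q\<lparr>carrier := carrier R\<rparr>"
 by (auto simp: inv_ring_def)

lemma cl_invariant_iff:
 assumes "q \<in> carrier P" shows "cl q \<in> carrier R \<longleftrightarrow> (\<forall>g. valid g \<longrightarrow> cl (\<theta> g q) = cl q)"
 using theta_image_cl[OF assms] cl_closed[OF assms] unfolding inv_ring_def by auto

lemma invariantE:
 assumes "b \<in> carrier R"
 obtains q where "q \<in> carrier P" "b = cl q" "\<forall>g. valid g \<longrightarrow> cl (\<theta> g q) = cl q"
proof -
 have "b \<in> carrier Q" using assms R_sel(5) by blast
 then obtain q where q: "q \<in> carrier P" "b = cl q" by (rule clE)
 thus thesis using assms that[OF q] cl_invariant_iff[OF q(1)] by simp
qed

lemma mConst_invariant: "cl (mConst c) \<in> carrier R"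
 by (simp add: cl_invariant_iff[OF mpoly_ring_elems(3)] theta_mConst)

lemma invariant_ops:
 assumes b: "b \<in> carrier R" and b': "b' \<in> carrier R"
 shows "b *[Q] b' \<in> carrier R" "b +[Q] b' \<in> carrier R"
proof -
 obtain q where q: "q \<in> carrier P" "b = cl q" "\<forall>g. valid g \<longrightarrow> cl (\<theta> g q) = cl q"
  by (rule invariantE[OF b])
 obtain q' where q': "q' \<in> carrier P" "b' = cl q'" "\<forall>g. valid g \<longrightarrow> cl (\<theta> g q') = cl q'"
  by (rule invariantE[OF b'])
 note closed = theta_closed[OF q(1)] theta_closed[OF q'(1)]
 show "b *[Q] b' \<in> carrier R"
  unfolding q(2) q'(2) cl_mult[OF q(1) q'(1),
    symmetric] cl_invariant_iff[OF mpoly_ring_closed(2)[OF q(1) q'(1)]]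
  using q(3) q'(3) by (simp add: theta_mult[OF q(1) q'(1)] cl_mult[OF closed] cl_mult[OF q(1) q'(1)])
 show "b +[Q] b' \<in> carrier R"
  unfolding q(2) q'(2) cl_add[OF q(1) q'(1),
    symmetric] cl_invariant_iff[OF mpoly_ring_closed(1)[OF q(1) q'(1)]]
  using q(3) q'(3) by (simp add: theta_add[OF q(1) q'(1)] cl_add[OF closed] cl_add[OF q(1) q'(1)])
qed

lemma R_cring: "cring R"
proof -
 have one: "1[Q] \<in> carrier R" using mConst_invariant[of 1] by (simp add: mConst_one cl_one)
 have "cl (mConst (- 1)) +[Q] 1[Q] = 0[Q]"
  using cl_add[OF mpoly_ring_elems(3)[of "- 1"] mpoly_ring_elems(2)]
  by (simp add: mConst_def single_one[symmetric] single_add[symmetric] cl_one[symmetric]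
  cl_zero[symmetric] del: single_one)
 hence minus_one: "\<ominus>\<^bsub>Q\<^esub> 1[Q] = cl (mConst (- 1))"
  by (rule Q.minus_equality) (simp_all add: cl_closed mpoly_ring_elems(3))
 have "subring (carrier R) Q"
 proof (rule Q.subringI[OF R_sel(5) one _ invariant_ops])
  fix b assume b: "b \<in> carrier R"
  have "\<ominus>\<^bsub>Q\<^esub> b = (\<ominus>\<^bsub>Q\<^esub> 1[Q]) *[Q] b" using b R_sel(5) by (auto simp: Q.l_minus)
  thus "\<ominus>\<^bsub>Q\<^esub> b \<in> carrier R" using invariant_ops(1)[OF mConst_invariant b] by (simp add: minus_one)
 qed
 hence "subcring (carrier R) Q" by (rule Q.subcringI')
 thus ?thesis using Q.subcring_iff[OF R_sel(5)] R_sel(6) by simp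
qed

text \<open>Applying \<open>(\<theta>\<^sub>g - \<chi>(g)) / (1 - \<chi>(g))\<close> to an invariant class does not change it, but removes the
  monomials of character \<open>\<chi>\<close>.\<close>

lemma remove_weight:
 assumes q: "q \<in> carrier P" and inv: "cl q \<in> carrier R" and g: "valid g" and x: "x \<noteq> 1"
 obtains r where "r \<in> carrier P" "cl r = cl q"
   "\<forall>m. lookup r m = inverse (1 - x) * (mono_prod (wt g) m - x) * lookup q m"
proof -
 define d where "d = inverse (1 - x)"
 define r where "r = mConst d * (\<theta> g q - mConst x * q)"
 note Tq = theta_closed[OF q, of g]
 have r: "r \<in> carrier P" unfolding r_def by (intro mpoly_ring_closed(2,4) mpoly_ring_elems(3) Tq q)
 have lookup_r: "lookup r m = d * (mono_prod (wt g) m - x) * lookup q m" for m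
  unfolding r_def by (simp add: lookup_mConst lookup_minus lookup_theta[OF q] left_diff_distrib
    right_diff_distrib mult.assoc)
 have "\<theta> g q - q \<in> I" using cl_eq_iff[OF Tq q] inv g cl_invariant_iff[OF q] by simp
 hence "mConst d * (\<theta> g q - q) \<in> I" using I.I_l_closed[OF _ mpoly_ring_elems(3)[of d S]] by simp
 moreover have "mConst d * (\<theta> g q - q) = r - q"
 proof (rule poly_mapping_eqI)
  fix m
  let ?y = "mono_prod (wt g) m" and ?l = "lookup q m"
  have "d * (?y * ?l - ?l) = d * (?y - x) * ?l - d * (1 - x) * ?l" by (simp add: algebra_simps)
  moreover have "d * (1 - x) = 1" using x by (simp add: d_def)
  ultimately show "lookup (mConst d * (\<theta> g q - q)) m = lookup (r - q) m"
   by (simp add: lookup_mConst lookup_minus lookup_theta[OF q] lookup_r)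
 qed
 ultimately have "cl r = cl q" using cl_eq_iff[OF r q] by simp
 with r show thesis using lookup_r unfolding d_def by (intro that) blast+
qed

lemma weight_zero_representative:
 assumes "q \<in> carrier P" "cl q \<in> carrier R"
 shows "\<exists>r \<in> carrier P. cl r = cl q \<and> (\<forall>m\<in>keys r. \<forall>g. valid g \<longrightarrow> mono_prod (wt g) m = 1)"
 using assms
proof (induction "card {m \<in> keys q. \<exists>g. valid g \<and> mono_prod (wt g) m \<noteq> 1}" arbitrary: q rule:
  less_induct)
 case less
 let ?bad = "\<lambda>q. {m \<in> keys q. \<exists>g. valid g \<and> mono_prod (wt g) m \<noteq> 1}"
 show ?case
 proof (cases "?bad q = {}")
  case True
  thus ?thesis using less.prems(1) by (intro bexI[of _ q]) auto
 next
  case False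
  then obtain m g where m: "m \<in> ?bad q" "valid g" "mono_prod (wt g) m \<noteq> 1" by auto
  obtain r where r: "r \<in> carrier P" "cl r = cl q"
   "\<forall>m'. lookup r m' = inverse (1 - mono_prod (wt g) m) * (mono_prod (wt g) m' - mono_prod (wt g) m)
     * lookup q m'"
   by (rule remove_weight[OF less.prems m(2,3)])
  have "?bad r \<subseteq> ?bad q - {m}" using r(3) by (auto simp: in_keys_iff)
  hence "card (?bad r) < card (?bad q)" using m(1) by (intro psubset_card_mono) auto
  moreover have "cl r \<in> carrier R" using less.prems(2) unfolding r(2) .
  ultimately show ?thesis using less.hyps[OF _ r(1)] unfolding r(2) by blast
 qed
qed

subsection \<open>Evaluation in local frames\<close>

abbreviation frame where "frame U e \<equiv> opn V U \<and> (\<forall>i\<in>N. free_gen V (F i) U (e i))"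
abbreviation ev :: "'v set \<Rightarrow> (int \<Rightarrow> 'n) \<Rightarrow> (('v, 'n) bvar, 'k) mpol \<Rightarrow> 'b"
 where "ev U e \<equiv> mp_eval (k_const \<kappa> V U) (osec V U) (taut_coord V F U e)"

lemma frame_free_gen: "frame U e \<Longrightarrow> i \<in> N \<Longrightarrow> free_gen V (F i) U (e i)" by blast

lemma frame_closed: "frame U e \<Longrightarrow> i \<in> N \<Longrightarrow> e i \<in> Ms (F i) U" by (rule free_genD(2)[OF frame_free_gen])

lemma frames_cover:
 assumes p: "p \<in> pts V"
 obtains U e where "frame U e" "p \<in> U"
proof -
 have "\<exists>U e. opn V U \<and> p \<in> U \<and> (\<forall>i\<in>J. free_gen V (F i) U (e i))" if "finite J" "J \<subseteq> N" for J
  using that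
 proof (induction J)
  case empty
  show ?case using p by (intro exI[of _ "pts V"]) simp
 next
  case (insert j J)
  then obtain U e where U: "opn V U" "p \<in> U" "\<forall>i\<in>J. free_gen V (F i) U (e i)" by auto
  obtain W e' where W: "p \<in> W" "free_gen V (F j) W e'"
   using line_bundleD(2)[OF line_bundle_F[of j] p] insert.prems by auto
  have I: "opn V (U \<inter> W)" "U \<inter> W \<subseteq> U" "U \<inter> W \<subseteq> W" using U(1) free_genD(1)[OF W(2)] by auto
  have res: "free_gen V (F i) (U \<inter> W) (mres (F i) Y (U \<inter> W) y)"
    if "i \<in> insert j J" "free_gen V (F i) Y y" "U \<inter> W \<subseteq> Y" for i Y y
   using module_sheaf.free_gen_res[OF module_sheaf_F that(2) I(1) that(3)] that(1) insert.prems by blast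
  show ?case using I U W(1) res[OF _ W(2) I(3)] res[OF _ _ I(2)]
   by (intro exI[of _ "U \<inter> W"] exI[of _ "\<lambda>i. if i =
     j then mres (F j) W (U \<inter> W) e' else mres (F i) U (U \<inter> W) (e i)"]) auto
 qed
 from this[of N] show thesis using that by auto
qed

lemma k_const_ring_hom: "opn V U \<Longrightarrow> k_const \<kappa> V U \<in> ring_hom k_ring (osec V U)"
 using ring_hom_trans[OF kappa_hom ores_ring_hom[OF opn_pts _ openin_subset]]
 by (simp add: k_const_def[abs_def] comp_def)

lemma taut_coord:
 assumes fr: "frame U e" and v: "(i, j, f) \<in> S"
 shows taut_coord_closed: "taut_coord V F U e (i, j, f) \<in> Os V U"
  and taut_coord_apply: "f U (e i) = taut_coord V F U e (i, j, f) *.[msec (F j) U] e j"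
  and taut_coord_eqI: "\<And>c. \<lbrakk>c \<in> Os V U; f U (e i) = c *.[msec (F j) U] e j\<rbrakk> \<Longrightarrow>
    taut_coord V F U e (i, j, f) = c"
proof -
 have ij: "i \<in> N" "j \<in> N" "f \<in> mod_hom V (F i) (F j)" using v by (auto simp: S_iff)
 interpret module_sheaf V "F j" by (rule module_sheaf_F[OF ij(2)])
 have U: "opn V U" and ei: "e i \<in> Ms (F i) U" using fr frame_closed[OF fr] ij by auto
 note ej = frame_free_gen[OF fr ij(2)]
 have "\<exists>!a. a \<in> Os V U \<and> f U (e i) = a *.[msec (F j) U] mres (F j) U U (e j)"
  by (rule free_genD(3)[OF ej U order_refl mod_homD(1)[OF ij(3) U ei]])
 hence ex: "\<exists>!a. a \<in> Os V U \<and> f U (e i) = a *.[msec (F j) U] e j"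
  unfolding res_id[OF U free_genD(2)[OF ej]] .
 have eq: "taut_coord V F U e (i, j, f) = (THE c. c \<in> Os V U \<and> f U (e i) = c *.[msec (F j) U] e j)"
  by (simp add: taut_coord_def)
 from theI'[OF ex] show "taut_coord V F U e (i, j, f) \<in> Os V U"
  "f U (e i) = taut_coord V F U e (i, j, f) *.[msec (F j) U] e j" unfolding eq by auto
 show "\<And>c. \<lbrakk>c \<in> Os V U; f U (e i) = c *.[msec (F j) U] e j\<rbrakk> \<Longrightarrow> taut_coord V F U e (i, j, f) = c"
  unfolding eq by (rule the1_equality[OF ex]) simp
qed

lemma taut_coord_ops:
 assumes fr: "frame U e"
 shows taut_coord_add: "\<lbrakk>(i, j, f) \<in> S; (i, j, g) \<in> S\<rbrakk> \<Longrightarrow>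
   taut_coord V F U e (i, j, hom_add V (F i) (F j) f g)
   = taut_coord V F U e (i, j, f) +[osec V U] taut_coord V F U e (i, j, g)"
  and taut_coord_smult: "(i, j, f) \<in> S \<Longrightarrow> taut_coord V F U e (i, j, hom_smult V (F i) (F j) (\<kappa> c) f)
   = k_const \<kappa> V U c *[osec V U] taut_coord V F U e (i, j, f)"
  and taut_coord_id: "i \<in> N \<Longrightarrow> taut_coord V F U e (i, i, hom_id V (F i)) = 1[osec V U]"
  and taut_coord_comp: "\<lbrakk>(i, j, f) \<in> S; (j, l, g) \<in> S\<rbrakk> \<Longrightarrow> taut_coord V F U e (i, l, hom_comp V (F i) g f)
   = taut_coord V F U e (i, j, f) *[osec V U] taut_coord V F U e (j, l, g)"
proof -
 have U: "opn V U" using fr by simp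
 note e = frame_closed[OF fr] and T = taut_coord[OF fr]
   and k = ring_hom_closed[OF k_const_ring_hom[OF U], of c]
 have mod: "module (osec V U) (msec (F j) U)" if "j \<in> N" for j
  by (rule module_sheaf.module_sec[OF module_sheaf_F[OF that] U])
 interpret O: cring "osec V U" by (rule cring_O[OF U])
 show "taut_coord V F U e (i, j, hom_add V (F i) (F j) f g) =
   taut_coord V F U e (i, j, f) +[osec V U] taut_coord V F U e (i, j, g)"
  if v: "(i, j, f) \<in> S" "(i, j, g) \<in> S"
 proof (rule T(3)[OF S_add[OF v]])
  have ij: "i \<in> N" "j \<in> N" using v by (auto simp: S_iff)
  show "hom_add V (F i) (F j) f g U (e i) =
    (taut_coord V F U e (i, j, f) +[osec V U] taut_coord V F U e (i, j, g)) *.[msec (F j) U] e j"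
   unfolding hom_apply(3)[OF U e[OF ij(1)]] T(2)[OF v(1)] T(2)[OF v(2)]
   by (rule module.smult_l_distr[OF mod[OF ij(2)] T(1)[OF v(1)] T(1)[OF v(2)] e[OF ij(2)], symmetric])
 qed (use T(1) v in simp)
 show "taut_coord V F U e (i, j, hom_smult V (F i) (F j) (\<kappa> c) f) =
   k_const \<kappa> V U c *[osec V U] taut_coord V F U e (i, j, f)"
  if v: "(i, j, f) \<in> S"
 proof (rule T(3)[OF S_smult[OF v kappa_ops(1)]])
  have ij: "i \<in> N" "j \<in> N" using v by (auto simp: S_iff)
  show "hom_smult V (F i) (F j) (\<kappa> c) f U (e i) =
    (k_const \<kappa> V U c *[osec V U] taut_coord V F U e (i, j, f)) *.[msec (F j) U] e j"
   unfolding hom_apply(4)[OF U e[OF ij(1)]] T(2)[OF v] k_const_def[symmetric]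
   using module.smult_assoc1[OF mod[OF ij(2)] _ T(1)[OF v] e[OF ij(2)], of "k_const \<kappa> V U c"] k
   by (simp add: k_ring_def)
 qed (use T(1)[OF v] k in \<open>simp add: k_ring_def\<close>)
 show "taut_coord V F U e (i, i, hom_id V (F i)) = 1[osec V U]" if i: "i \<in> N"
  by (rule T(3)[OF S_id[OF i]]) (use hom_apply(1)[OF U e[OF i]]
    module.smult_one[OF mod[OF i] e[OF i]] in simp_all)
 show "taut_coord V F U e (i, l, hom_comp V (F i) g f) =
   taut_coord V F U e (i, j, f) *[osec V U] taut_coord V F U e (j, l, g)"
  if v: "(i, j, f) \<in> S" "(j, l, g) \<in> S"
 proof (rule T(3)[OF S_comp[OF v]])
  have ijl: "i \<in> N" "j \<in> N" "l \<in> N" "g \<in> mod_hom V (F j) (F l)" using v by (auto simp: S_iff)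
  show "hom_comp V (F i) g f U (e i) = (taut_coord V F U e (i, j, f) *[osec V U] taut_coord V F U
    e (j, l, g)) *.[msec (F l) U] e l"
   unfolding hom_apply(2)[OF U e[OF ijl(1)]] T(2)[OF v(1)] mod_homD(3)[OF ijl(4) U T(1)[OF v(1)]
     e[OF ijl(2)]] T(2)[OF v(2)]
   by (rule module.smult_assoc1[OF mod[OF ijl(3)] T(1)[OF v(1)] T(1)[OF v(2)] e[OF ijl(3)], symmetric])
 qed (use T(1) v in simp)
qed

lemma frame_evaluation: "frame U e \<Longrightarrow> mpoly_evaluation (k_const \<kappa> V U) (osec V U) (taut_coord V F U e) S"
 using taut_coord_closed by (intro mpoly_evaluation.intro cring_O k_const_ring_hom) (auto simp:
   bondal_vars_def)

lemmas ev_ring_hom = mpoly_evaluation.eval_ring_hom[OF frame_evaluation]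
 and ev_mVar = mpoly_evaluation.eval_mVar[OF frame_evaluation]
 and ev_mConst = mpoly_evaluation.eval_mConst[OF frame_evaluation]
 and ev_closed = mpoly_evaluation.eval_closed[OF frame_evaluation]

lemma ev_mult: "\<lbrakk>frame U e; p \<in> carrier P; q \<in> carrier P\<rbrakk> \<Longrightarrow> ev U e (p * q) =
  ev U e p *[osec V U] ev U e q"
 and ev_add: "\<lbrakk>frame U e; p \<in> carrier P; q \<in> carrier P\<rbrakk> \<Longrightarrow> ev U e (p + q) =
   ev U e p +[osec V U] ev U e q"
 by (rule mpoly_evaluation.eval_mult[OF frame_evaluation]
   mpoly_evaluation.eval_add[OF frame_evaluation]; assumption)+

lemma ev_diff_eq_zero:
 assumes fr: "frame U e" and p: "p \<in> carrier P" and q: "q \<in> carrier P" and eq: "ev U e p = ev U e q"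
 shows "ev U e (p - q) = 0[osec V U]"
proof -
 interpret O: cring "osec V U" using fr by (intro cring_O) simp
 note pq = mpoly_ring_closed(4)[OF p q]
 have "ev U e p = ev U e (p - q) +[osec V U] ev U e q" using ev_add[OF fr pq q] by simp
 thus ?thesis using eq O.add.r_cancel_one'[OF ev_closed[OF fr q] ev_closed[OF fr pq]] by simp
qed

lemma ev_relation:
 assumes fr: "frame U e" and r: "r \<in> relations" shows "ev U e r = 0[osec V U]"
 using r
proof cases
 case (add i j f g)
 note S = S_add[OF add(2,3)] add(2,3)
 show ?thesis unfolding add(1) diff_diff_eq
  by (intro ev_diff_eq_zero[OF fr] mpoly_ring_elems(4) S mpoly_ring_closed(1))
   (simp add: ev_add[OF fr] mpoly_ring_elems(4) S ev_mVar[OF fr] taut_coord_add[OF fr])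
next
 case (smult i j f c)
 note S = S_smult[OF smult(2) kappa_ops(1)] smult(2)
 show ?thesis unfolding smult(1)
  by (intro ev_diff_eq_zero[OF fr] mpoly_ring_elems(3,4) S mpoly_ring_closed(2))
   (simp add: ev_mult[OF fr] mpoly_ring_elems(3,4) S ev_mVar[OF fr] ev_mConst[OF fr]
     taut_coord_smult[OF fr])
next
 case (ident i)
 show ?thesis unfolding ident(1)
  by (intro ev_diff_eq_zero[OF fr] mpoly_ring_elems(2,4) S_id ident(2))
   (use ring_hom_one[OF ev_ring_hom[OF fr]]
     in \<open>simp add: ev_mVar[OF fr] S_id[OF ident(2)] taut_coord_id[OF fr ident(2)]\<close>)
next
 case (comp i j f l g)
 note S = S_comp[OF comp(2,3)] comp(2,3)
 show ?thesis unfolding comp(1)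
  by (intro ev_diff_eq_zero[OF fr] mpoly_ring_elems(4) S mpoly_ring_closed(2))
   (simp add: ev_mult[OF fr] mpoly_ring_elems(4) S ev_mVar[OF fr] taut_coord_comp[OF fr comp(2,3)])
qed

lemma ev_cl:
 assumes fr: "frame U e" and q: "q \<in> carrier P" and r: "r \<in> cl q" shows "ev U e r = ev U e q"
proof -
 interpret O: cring "osec V U" using fr by (intro cring_O) simp
 obtain i where i: "i \<in> I" "r = i + q" using r unfolding cl_eq_image by blast
 have "ev U e i = 0[osec V U]"
  by (rule genideal_hom_zero[OF P.is_cring O.is_cring ev_ring_hom[OF fr] relations_subset
    ev_relation[OF fr] i(1)])
 thus ?thesis unfolding i(2) using ev_add[OF fr I.a_Hcarr[OF i(1)] q] ev_closed[OF fr q] by simp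
qed

subsection \<open>The functions \<open>\<chi>\<^sub>i\<close>\<close>

abbreviation chi where "chi i a \<equiv> cl (mVar (loop i a))"

lemma scalar_apply: "\<lbrakk>opn V U; s \<in> Ms (F i) U\<rbrakk> \<Longrightarrow> scalar i a U s = to_global U a *.[msec (F i) U] s"
 by (simp add: hom_apply)

lemma global_res_closed: "opn V U \<Longrightarrow> a \<in> carrier A \<Longrightarrow> to_global U a \<in> Os V U"
 by (rule ores_closed[OF opn_pts _ openin_subset])

lemma scalar_eqI:
 assumes i: "i \<in> N" and f: "f \<in> mod_hom V (F i) (F i)" and a: "a \<in> carrier A"
  and eq: "\<And>U s. \<lbrakk>opn V U; s \<in> Ms (F i) U\<rbrakk> \<Longrightarrow> f U s = to_global U a *.[msec (F i) U] s"
 shows "f = scalar i a"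
 by (rule mod_hom_eqI[OF f scalar_hom[OF i a]]) (simp add: scalar_apply eq)

lemma scalar_ops:
 assumes i: "i \<in> N" and a: "a \<in> carrier A" and b: "b \<in> carrier A"
 shows scalar_add: "hom_add V (F i) (F i) (scalar i a) (scalar i b) = scalar i (a +[A] b)"
  and scalar_comp: "hom_comp V (F i) (scalar i b) (scalar i a) = scalar i (a *[A] b)"
proof -
 interpret A: cring A by (rule cring_O[OF opn_pts])
 note hom = scalar_hom[OF i a] scalar_hom[OF i b]
 show "hom_add V (F i) (F i) (scalar i a) (scalar i b) = scalar i (a +[A] b)"
 proof (rule scalar_eqI[OF i hom_add_closed[OF mod_sheaf_F[OF i] mod_sheaf_F[OF i] hom]
   A.a_closed[OF a b]])
  fix U s assume U: "opn V U" and s: "s \<in> Ms (F i) U"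
  interpret M: module "osec V U" "msec (F i) U"
    by (rule module_sheaf.module_sec[OF module_sheaf_F[OF i] U])
  show "hom_add V (F i) (F i) (scalar i a) (scalar i b) U s = to_global U (a +[A] b) *.[msec (F i) U] s"
   using s global_res_closed[OF U] a b
   by (simp add: hom_apply(3)[OF U s] scalar_apply[OF U s]
     ores_add[OF opn_pts U openin_subset[OF U]] M.smult_l_distr)
 qed
 show "hom_comp V (F i) (scalar i b) (scalar i a) = scalar i (a *[A] b)"
 proof (rule scalar_eqI[OF i hom_comp_closed[OF mod_sheaf_F[OF i] hom] A.m_closed[OF a b]])
  fix U s assume U: "opn V U" and s: "s \<in> Ms (F i) U"
  interpret M: module "osec V U" "msec (F i) U"
    by (rule module_sheaf.module_sec[OF module_sheaf_F[OF i] U])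
  note closed = global_res_closed[OF U a] global_res_closed[OF U b]
  show "hom_comp V (F i) (scalar i b) (scalar i a) U s = to_global U (a *[A] b) *.[msec (F i) U] s"
   unfolding hom_apply(2)[OF U s] scalar_apply[OF U s] scalar_apply[OF U M.smult_closed[OF closed(1) s]]
    ores_mult[OF opn_pts U openin_subset[OF U] a b] M.R.m_comm[OF closed]
   by (rule M.smult_assoc1[OF closed(2,1) s, symmetric])
 qed
qed

lemma chi_closed: "i \<in> N \<Longrightarrow> a \<in> carrier A \<Longrightarrow> chi i a \<in> carrier Q"
 by (rule var_closed[OF S_loop])

lemma chi_add: "\<lbrakk>i \<in> N; a \<in> carrier A; b \<in> carrier A\<rbrakk> \<Longrightarrow> chi i (a +[A] b) = chi i a +[Q] chi i b"
 and chi_mult: "\<lbrakk>i \<in> N; a \<in> carrier A; b \<in> carrier A\<rbrakk> \<Longrightarrow> chi i (a *[A] b) = chi i a *[Q] chi i b"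
 using var_add[OF S_loop S_loop] var_comp[OF S_loop S_loop] by (simp_all add: scalar_add scalar_comp)

lemma chi_kappa: "i \<in> N \<Longrightarrow> chi i (\<kappa> c) = cl (mConst c)"
 using var_smult[OF S_id, of i c] var_id[of i] cl_closed[OF mpoly_ring_elems(3), of c] by simp

lemma chi_zero: "i \<in> N \<Longrightarrow> chi i 0[A] = 0[Q]"
 using chi_kappa[of i 0] kappa_ops(5) cl_zero by (simp add: mConst_def)

lemma chi_one: "i \<in> N \<Longrightarrow> chi i 1[A] = 1[Q]"
 using chi_kappa[of i 1] kappa_ops(4) cl_one by (simp add: mConst_one)

lemma chi_invariant: "i \<in> N \<Longrightarrow> a \<in> carrier A \<Longrightarrow> chi i a \<in> carrier R"
 by (simp add: cl_invariant_iff[OF mpoly_ring_elems(4)[OF S_loop]] theta_mVar[OF S_loop]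
   wt_def mConst_one)

text \<open>Moving a scalar through \<open>f : F\<^sub>1 \<rightarrow> F\<^sub>i\<close> shows that all the \<open>\<chi>\<^sub>i\<close> agree after multiplication with
  \<open>\<chi>\<^sub>1(h)\<close>, where \<open>h\<close> is a composition \<open>F\<^sub>1 \<rightarrow> F\<^sub>i \<rightarrow> F\<^sub>1\<close>.\<close>

lemma chi_move:
 assumes i: "i \<in> N" and f: "f \<in> mod_hom V (F 1) (F i)" and g: "g \<in> mod_hom V (F i) (F 1)"
  and gf: "hom_comp V (F 1) g f = scalar 1 h" and a: "a \<in> carrier A"
 shows "chi 1 h *[Q] chi i a = chi 1 h *[Q] chi 1 a"
proof -
 note one = one_in_N
 have S: "(1, i, f) \<in> S" "(i, 1, g) \<in> S" using i f g one by (auto simp: S_iff)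
 have "hom_comp V (F 1) (scalar i a) f = hom_comp V (F 1) f (scalar 1 a)"
 proof (rule mod_hom_eqI)
  show "hom_comp V (F 1) (scalar i a) f \<in> mod_hom V (F 1) (F i)"
   by (rule hom_comp_closed[OF mod_sheaf_F[OF one] f scalar_hom[OF i a]])
  show "hom_comp V (F 1) f (scalar 1 a) \<in> mod_hom V (F 1) (F i)"
   by (rule hom_comp_closed[OF mod_sheaf_F[OF one] scalar_hom[OF one a] f])
  fix U s assume U: "opn V U" and s: "s \<in> Ms (F 1) U"
  show "hom_comp V (F 1) (scalar i a) f U s = hom_comp V (F 1) f (scalar 1 a) U s"
   unfolding hom_apply(2)[OF U s] scalar_apply[OF U s] scalar_apply[OF U mod_homD(1)[OF f U s]]
   by (rule mod_homD(3)[OF f U global_res_closed[OF U a] s, symmetric])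
 qed
 hence commute: "var 1 i f *[Q] chi i a = chi 1 a *[Q] var 1 i f"
  using var_comp[OF S(1) S_loop[OF i a]] var_comp[OF S_loop[OF one a] S(1)] by simp
 have chi_h: "chi 1 h = var 1 i f *[Q] var i 1 g" using var_comp[OF S] gf by simp
 note closed = var_closed[OF S(1)] var_closed[OF S(2)] chi_closed[OF i a] chi_closed[OF one a]
 have "chi 1 h *[Q] chi i a = var i 1 g *[Q] (var 1 i f *[Q] chi i a)"
  unfolding chi_h using closed by (simp add: Q.m_ac)
 also have "... = chi 1 h *[Q] chi 1 a" unfolding commute chi_h using closed by (simp add: Q.m_ac)
 finally show ?thesis .
qed

lemma ex_universal_denominator:
 "\<exists>h. h \<in> carrier A \<and> h \<noteq> 0[A] \<and> (\<forall>i\<in>N. \<forall>a\<in>carrier A. chi 1 h *[Q] chi i a = chi 1 h *[Q] chi 1 a)"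
proof -
 interpret A: domain A by (rule domain_A)
 have "\<exists>h. h \<in> carrier A \<and> h \<noteq> 0[A] \<and> (\<forall>a\<in>carrier A. chi 1 h *[Q] chi i a = chi 1 h *[Q] chi 1 a)"
   if i: "i \<in> N" for i
 proof -
  obtain f g h where trip: "f \<in> mod_hom V (F 1) (F i)" "g \<in> mod_hom V (F i) (F 1)"
    "hom_comp V (F 1) g f = scalar 1 h" and h: "h \<in> carrier A" "h \<noteq> 0[A]"
   using round_trips[OF i] unfolding nonzero_round_trip_def by auto
  thus ?thesis using chi_move[OF i trip] by (intro exI[of _ h]) simp
 qed
 then obtain h where "\<forall>i\<in>N. h i \<in> carrier A \<and> h i \<noteq> 0[A] \<and>
   (\<forall>a\<in>carrier A. chi 1 (h i) *[Q] chi i a = chi 1 (h i) *[Q] chi 1 a)"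
  by metis
 hence h: "\<And>i. i \<in> N \<Longrightarrow> h i \<in> carrier A" "\<And>i. i \<in> N \<Longrightarrow> h i \<noteq> 0[A]"
  "\<And>i a. \<lbrakk>i \<in> N; a \<in> carrier A\<rbrakk> \<Longrightarrow> chi 1 (h i) *[Q] chi i a = chi 1 (h i) *[Q] chi 1 a" by simp_all
 let ?H = "finprod A h N"
 have "chi 1 ?H *[Q] chi i a = chi 1 ?H *[Q] chi 1 a" if i: "i \<in> N" and a: "a \<in> carrier A" for i a
 proof -
  let ?r = "finprod A h (N - {i})"
  have r: "?r \<in> carrier A" using h(1) by (intro A.finprod_closed) auto
  have "finprod A h (insert i (N - {i})) = h i *[A] ?r" using h(1) i by (intro A.finprod_insert) auto
  hence H: "chi 1 ?H = chi 1 (h i) *[Q] chi 1 ?r" using i chi_mult[OF one_in_N h(1)[OF i] r]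
   by (simp add: insert_absorb)
  note closed = chi_closed[OF one_in_N h(1)[OF i]] chi_closed[OF one_in_N
    r] chi_closed[OF i a] chi_closed[OF one_in_N a]
  have "chi 1 ?H *[Q] chi i a = chi 1 ?r *[Q] (chi 1 (h i) *[Q] chi i a)" unfolding H using closed
   by (simp add: Q.m_ac)
  also have "... = chi 1 ?H *[Q] chi 1 a" unfolding H h(3)[OF i a] using closed by (simp add: Q.m_ac)
  finally show ?thesis .
 qed
 moreover have "?H \<in> carrier A" "?H \<noteq> 0[A]"
  using h(1,2) A.finprod_closed[of h N] A.finprod_nonzero[of N h] by (auto simp: Pi_iff)
 ultimately show ?thesis by blast
qed

definition denom :: 'b where "denom = (SOME h. h \<in> carrier A \<and> h \<noteq> 0[A] \<and>
  (\<forall>i\<in>N. \<forall>a\<in>carrier A. chi 1 h *[Q] chi i a = chi 1 h *[Q] chi 1 a))"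

abbreviation u where "u \<equiv> chi 1 denom"

lemma denom: "denom \<in> carrier A" "denom \<noteq> 0[A]"
  "\<lbrakk>i \<in> N; a \<in> carrier A\<rbrakk> \<Longrightarrow> u *[Q] chi i a = u *[Q] chi 1 a"
 using someI_ex[OF ex_universal_denominator, folded denom_def] by blast+

lemma u_closed: "u \<in> carrier Q" by (rule chi_closed[OF one_in_N denom(1)])

subsection \<open>Polynomials representing a function\<close>

definition represents :: "(('v, 'n) bvar, 'k) mpol \<Rightarrow> 'b \<Rightarrow> bool"
 where "represents q a \<longleftrightarrow> a \<in> carrier A \<and> u *[Q] cl q = u *[Q] chi 1 a \<and>
  (\<forall>U e. frame U e \<longrightarrow> ev U e q = to_global U a)"

lemma representsD:
 assumes "represents q a"
 shows "a \<in> carrier A" "u *[Q] cl q = u *[Q] chi 1 a" "frame U e \<Longrightarrow> ev U e q = to_global U a"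
 using assms unfolding represents_def by blast+

lemma represents_ops:
 assumes p: "p \<in> carrier P" "represents p a" and q: "q \<in> carrier P" "represents q b"
 shows represents_add: "represents (p + q) (a +[A] b)"
   and represents_mult: "represents (p * q) (a *[A] b)"
proof -
 interpret A: cring A by (rule cring_O[OF opn_pts])
 note p' = representsD[OF p(2)] and q' = representsD[OF q(2)]
 note closed = cl_closed[OF p(1)] cl_closed[OF q(1)] chi_closed[OF one_in_N
   p'(1)] chi_closed[OF one_in_N q'(1)] u_closed
 have "u *[Q] cl (p + q) = u *[Q] chi 1 (a +[A] b)"
  using closed p'(2) q'(2) by (simp add: cl_add[OF p(1) q(1)]
    chi_add[OF one_in_N p'(1) q'(1)] Q.r_distr)
 thus "represents (p + q) (a +[A] b)"
  using p'(1,3) q'(1,3) ores_add[OF opn_pts _ openin_subset p'(1) q'(1)]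
  by (auto simp: represents_def ev_add[OF _ p(1) q(1)])
 have "u *[Q] (cl p *[Q] cl q) = (u *[Q] cl p) *[Q] cl q" using closed by (simp add: Q.m_assoc)
 also have "... = chi 1 a *[Q] (u *[Q] cl q)" unfolding p'(2) using closed by (simp add: Q.m_ac)
 also have "... = u *[Q] (chi 1 a *[Q] chi 1 b)" unfolding q'(2) using closed by (simp add: Q.m_ac)
 finally have "u *[Q] cl (p * q) = u *[Q] chi 1 (a *[A] b)"
  unfolding chi_mult[OF one_in_N p'(1) q'(1)] cl_mult[OF p(1) q(1)] .
 thus "represents (p * q) (a *[A] b)"
  using p'(1,3) q'(1,3) ores_mult[OF opn_pts _ openin_subset p'(1) q'(1)]
  by (auto simp: represents_def ev_mult[OF _ p(1) q(1)])
qed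

lemma represents_mConst: "represents (mConst c) (\<kappa> c)"
 unfolding represents_def using kappa_ops(1) chi_kappa[OF one_in_N] ev_mConst
 by (auto simp: k_const_def)

lemma represents_loop:
 assumes i: "i \<in> N" and a: "a \<in> carrier A"
 shows "represents (mVar (loop i a)) a"
 unfolding represents_def
proof (intro conjI allI impI a denom(3)[OF i a])
 fix U e assume fr: "frame U e"
 hence U: "opn V U" by simp
 show "ev U e (mVar (loop i a)) = to_global U a"
  unfolding ev_mVar[OF fr S_loop[OF i a]]
  by (rule taut_coord_eqI[OF fr S_loop[OF i a] global_res_closed[OF U a]
    scalar_apply[OF U frame_closed[OF fr i]]])
qed

lemma represents_cong:
 assumes q: "q \<in> carrier P" and pq: "cl p = cl q" and r: "represents q a"
 shows "represents p a"
 unfolding represents_def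
proof (intro conjI allI impI)
 show "a \<in> carrier A" "u *[Q] cl p = u *[Q] chi 1 a" using representsD(1,2)[OF r] pq by simp_all
 fix U e assume fr: "frame U e"
 show "ev U e p = to_global U a" using ev_cl[OF fr q] pq cl_self representsD(3)[OF r fr] by metis
qed

lemma weight_zero_next_arrow:
 assumes wt: "\<And>g. valid g \<Longrightarrow> mono_prod (wt g) m = 1" and v: "(i, j, f) \<in> keys m" "i \<noteq> j"
 shows "\<exists>l h. (j, l, h) \<in> keys m"
proof (rule ccontr)
 assume no_arrow: "\<nexists>l h. (j, l, h) \<in> keys m"
 let ?J = "{v \<in> keys m. fst (snd v) = j}"
 define M where "M = (\<Sum>v\<in>?J. lookup m v)"
 have "lookup m (i, j, f) \<le> M" unfolding M_def using v by (intro member_le_sum) auto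
 hence "M > 0" using v by (simp add: in_keys_iff)
 then obtain c :: 'k where c: "c \<noteq> 0" "c ^ M \<noteq> 1" using ex_power_ne_one by blast
 let ?g = "\<lambda>i. if i = j then c else 1"
 have wt_arrow: "wt ?g v = (if fst (snd v) = j then inverse c else 1)" if "v \<in> keys m" for v
  using no_arrow that by (cases v) (auto simp: wt_def)
 have "mono_prod (wt ?g) m = (\<Prod>v\<in>keys m. if fst (snd v) = j then inverse c ^ lookup m v else 1)"
  unfolding mono_prod_def by (rule prod.cong) (auto simp: wt_arrow)
 also have "... = (\<Prod>v\<in>?J. inverse c ^ lookup m v)" by (rule prod.inter_filter[symmetric]) simp
 also have "... = inverse c ^ M" unfolding M_def by (simp add: power_sum)
 finally show False using wt[of ?g] c by (simp add: power_inverse)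
qed

abbreviation monom1 :: "(('v, 'n) bvar \<Rightarrow>\<^sub>0 nat) \<Rightarrow> (('v, 'n) bvar, 'k) mpol"
  where "monom1 m \<equiv> single m 1"

lemma single_add_eq_mVar: "monom1 (single v 1 + m) = mVar v * monom1 m"
 by (simp add: mVar_def mult_single)

lemma cl_contract:
 assumes S: "(i, j, f) \<in> S" "(j, l, h) \<in> S" and t: "keys t \<subseteq> S"
 shows "cl (monom1 (single (i, j, f) 1 + (single (j, l, h) 1 + t))) =
   cl (monom1 (single (i, l, hom_comp V (F i) h f) 1 + t))"
proof -
 note elems = mpoly_ring_elems(4)[OF S(1)] mpoly_ring_elems(4)[OF S(2)]
   mpoly_ring_elems(4)[OF S_comp[OF S]] mpoly_ring_elems(5)[OF t, of 1]
 have "cl (mVar (i, j, f) * (mVar (j, l, h) * monom1 t)) = var i j f *[Q] var j l h *[Q] cl (monom1 t)"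
  unfolding cl_mult[OF elems(1) mpoly_ring_closed(2)[OF elems(2,4)]] cl_mult[OF elems(2,4)]
  by (rule Q.m_assoc[OF cl_closed cl_closed cl_closed, OF elems(1,2,4), symmetric])
 thus ?thesis unfolding single_add_eq_mVar cl_mult[OF elems(3,4)] var_comp[OF S] .
qed

text \<open>A monomial of weight zero is a product of closed walks: if \<open>(i, j, f)\<close> occurs with \<open>i \<noteq> j\<close>, then so
  does some \<open>(j, l, g)\<close>, and the two contract to \<open>(i, l, g \<circ> f)\<close>.\<close>

lemma ex_contraction:
 assumes m: "keys m \<subseteq> S" and weight: "\<And>g. valid g \<Longrightarrow> mono_prod (wt g) m = 1"
   and v: "(i, j, f) \<in> keys m" and ij: "i \<noteq> j"
 obtains m' where "keys m' \<subseteq> S" "\<forall>g. valid g \<longrightarrow> mono_prod (wt g) m' = 1" "mono_deg m' < mono_deg m"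
   "cl (monom1 m) = cl (monom1 m')"
proof -
 obtain r where r: "m = single (i, j, f) 1 + r" "keys r \<subseteq> keys m" by (rule monomial_splitE[OF v])
 obtain l h where w: "(j, l, h) \<in> keys m" using weight_zero_next_arrow[OF weight v ij] by blast
 have "(j, l, h) \<in> keys r" using w ij keys_add[of "single (i, j, f) 1" r] unfolding r(1) by auto
 then obtain t where t: "r = single (j, l, h) 1 + t" "keys t \<subseteq> keys r" by (rule monomial_splitE)
 let ?w = "(i, l, hom_comp V (F i) h f)"
 let ?m = "single ?w 1 + t"
 have S: "(i, j, f) \<in> S" "(j, l, h) \<in> S" "keys t \<subseteq> S" using v w m r(2) t(2) by auto
 hence "j \<in> N" by (simp add: S_iff)
 show thesis
 proof (rule that[of ?m])
  show "keys ?m \<subseteq> S" using keys_add[of "single ?w 1" t] S(3) S_comp[OF S(1,2)] by auto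
  show "mono_deg ?m < mono_deg m" unfolding r(1) t(1) mono_deg_single_add by simp
  show "cl (monom1 m) = cl (monom1 ?m)" unfolding r(1) t(1) by (rule cl_contract[OF S])
  have "mono_prod (wt g) ?m = 1" if g: "valid g" for g
  proof -
   have "inverse (g j) * g j = 1" using g \<open>j : N\<close> by simp
   moreover have "g i * inverse (g j) * (g j * inverse (g l) * mono_prod (wt g) t) = 1"
    using weight[OF g] unfolding r(1) t(1) mono_prod_single_add by (simp add: wt_def)
   ultimately have "g i * inverse (g l) * mono_prod (wt g) t = 1" by (metis mult.assoc mult_1)
   thus ?thesis unfolding mono_prod_single_add by (simp add: wt_def)
  qed
  thus "\<forall>g. valid g \<longrightarrow> mono_prod (wt g) ?m = 1" by blast
 qed
qed

lemma represents_monomial: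
 assumes "keys m \<subseteq> S" "\<And>g. valid g \<Longrightarrow> mono_prod (wt g) m = 1"
 shows "\<exists>a. represents (monom1 m) a"
 using assms
proof (induction "mono_deg m" arbitrary: m rule: less_induct)
 case less
 show ?case
 proof (cases "m = 0")
  case True
  show ?thesis unfolding True using represents_mConst[of 1] unfolding mConst_def by (rule exI)
 next
  case False
  then obtain i j f where v: "(i, j, f) \<in> keys m" by (metis ex_in_conv keys_eq_empty prod_cases3)
  show ?thesis
  proof (cases "i = j")
   case True
   obtain r where r: "m = single (i, j, f) 1 + r" "keys r \<subseteq> keys m" by (rule monomial_splitE[OF v])
   have S: "(i, j, f) \<in> S" "keys r \<subseteq> S" using v r(2) less.prems(1) by auto
   hence i: "i \<in> N" "f \<in> mod_hom V (F i) (F i)" using True by (auto simp: S_iff)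
   obtain a where a: "a \<in> carrier A" "f = scalar i a"
    by (rule line_bundle_endomorphism[OF line_bundle_F[OF i(1)] i(2)])
   have "mono_prod (wt g) r = 1" if g: "valid g" for g
    using less.prems(2)[OF g] g i(1) True unfolding r(1) mono_prod_single_add by (simp add: wt_def)
   then obtain b where b: "represents (monom1 r) b"
    using less.hyps[OF _ S(2)] mono_deg_single_add[of "(i, j, f)" r] r(1) by auto
   have "represents (mVar (i, j, f)) a" using represents_loop[OF i(1) a(1)] True a(2) by simp
   from represents_mult[OF mpoly_ring_elems(4)[OF S(1)] this mpoly_ring_elems(5)[OF S(2)] b]
   show ?thesis unfolding r(1) single_add_eq_mVar by (rule exI)
  next
   case False
   obtain m' where m': "keys m' \<subseteq> S" "\<forall>g. valid g \<longrightarrow> mono_prod (wt g) m' = 1"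
     "mono_deg m' < mono_deg m" "cl (monom1 m) = cl (monom1 m')"
    by (rule ex_contraction[OF less.prems v False])
   have "\<exists>a. represents (monom1 m') a" using less.hyps[OF m'(3,1)] m'(2) by simp
   with represents_cong[OF mpoly_ring_elems(5)[OF m'(1)] m'(4)] show ?thesis by blast
  qed
 qed
qed

lemma ex_represents:
 assumes q: "q \<in> carrier P" and inv: "cl q \<in> carrier R"
 shows "\<exists>a. represents q a"
proof -
 obtain r where r: "r \<in> carrier P" "cl r = cl q" "\<forall>m\<in>keys r. \<forall>g. valid g \<longrightarrow> mono_prod (wt g) m = 1"
  using weight_zero_representative[OF q inv] by blast
 have eq: "(\<Sum>m\<in>keys r. mConst (lookup r m) * monom1 m) = r"
  by (rule poly_mapping_eqI) (simp add: lookup_sum lookup_mConst lookup_single when_def in_keys_iff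
    if_distrib[of "(*) _"] cong: if_cong)
 have "(\<Sum>m\<in>K. mConst (lookup r m) * monom1 m) \<in> carrier P \<and>
   (\<exists>a. represents (\<Sum>m\<in>K. mConst (lookup r m) * monom1 m) a)" if "K \<subseteq> keys r" for K
  using finite_subset[OF that finite_keys] that
 proof (induction K)
  case empty
  show ?case using represents_mConst[of 0] mpoly_ring_elems(1)[of S] by (auto simp: mConst_def)
 next
  case (insert m K)
  let ?s = "\<Sum>m\<in>K. mConst (lookup r m) * monom1 m"
  have m: "keys m \<subseteq> S" using insert.prems r(1) by (auto simp: mpoly_ring_sel(1))
  obtain a where a: "represents (monom1 m) a" using represents_monomial[OF m] r(3) insert.prems by blast
  obtain b where b: "?s \<in> carrier P" "represents ?s b" using insert.IH insert.prems by auto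
  note closed = mpoly_ring_closed(2)[OF mpoly_ring_elems(3) mpoly_ring_elems(5)[OF m]]
  from represents_add[OF closed represents_mult[OF mpoly_ring_elems(3) represents_mConst
    mpoly_ring_elems(5)[OF m] a] b]
  show ?case unfolding sum.insert[OF insert.hyps]
   by (intro conjI mpoly_ring_closed(1) closed b(1)) (rule exI)
 qed
 from this[OF order_refl] obtain a where "represents r a" unfolding eq by blast
 thus ?thesis using represents_cong[OF r(1) r(2)[symmetric]] by blast
qed

subsection \<open>Pullback along the tautological map\<close>

abbreviation taut where "taut \<equiv> taut_pullback \<kappa> V n F"

lemma taut_eqI:
 assumes q: "q \<in> carrier P" and a: "represents q a" shows "taut (cl q) = a"
 unfolding taut_pullback_def
proof (rule the_equality)
 show "a \<in> carrier A \<and> (\<forall>U e. frame U e \<longrightarrow> (\<forall>r\<in>cl q. to_global U a = ev U e r))"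
  using ev_cl[OF _ q] representsD[OF a] by simp
 fix b assume b: "b \<in> carrier A \<and> (\<forall>U e. frame U e \<longrightarrow> (\<forall>r\<in>cl q. to_global U b = ev U e r))"
 show "b = a"
 proof (rule sheaf_eqI[OF sheaf_O opn_pts])
  show "b \<in> carrier A" "a \<in> carrier A" using b representsD(1)[OF a] by simp_all
  fix p assume "p \<in> pts V"
  then obtain U e where fr: "frame U e" and p: "p \<in> U" by (rule frames_cover)
  have "to_global U b = to_global U a" using b fr cl_self[of q] representsD(3)[OF a fr] by metis
  thus "\<exists>W. opn V W \<and> p \<in> W \<and> W \<subseteq> pts V \<and> to_global W b = to_global W a"
   using fr p openin_subset by blast
 qed
qed

lemma tautE:
 assumes "b \<in> carrier R"
 obtains q where "q \<in> carrier P" "b = cl q" "represents q (taut b)"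
proof -
 obtain q where q: "q \<in> carrier P" "b = cl q" using assms by (rule invariantE)
 obtain a where "represents q a" using ex_represents[OF q(1)] assms q(2) by blast
 thus thesis using that[OF q] taut_eqI[OF q(1)] q(2) by simp
qed

lemma taut_chi: "a \<in> carrier A \<Longrightarrow> taut (chi 1 a) = a"
 by (rule taut_eqI[OF mpoly_ring_elems(4)[OF S_loop[OF one_in_N]] represents_loop[OF one_in_N]])

lemma taut_ring_hom: "taut \<in> ring_hom R A"
proof (rule ring_hom_memI)
 fix b b' assume "b \<in> carrier R" "b' \<in> carrier R"
 then obtain q q' where q: "q \<in> carrier P" "b = cl q" "represents q (taut b)"
  and q': "q' \<in> carrier P" "b' = cl q'" "represents q' (taut b')" by (elim tautE)
 note ops = represents_ops[OF q(1,3) q'(1,3)]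
 show "taut b \<in> carrier A" by (rule representsD(1)[OF q(3)])
 show "taut (b *[R] b') = taut b *[A] taut b'" "taut (b +[R] b') = taut b +[A] taut b'"
  using taut_eqI[OF mpoly_ring_closed(2)[OF q(1) q'(1)]
    ops(2)] taut_eqI[OF mpoly_ring_closed(1)[OF q(1) q'(1)] ops(1)]
  by (simp_all add: R_sel(1-4) q(2) q'(2) cl_mult[OF q(1) q'(1)] cl_add[OF q(1) q'(1)])
next
 interpret A: domain A by (rule domain_A)
 show "taut 1[R] = 1[A]" using taut_chi[OF A.one_closed] chi_one[OF one_in_N] by (simp add: R_sel(1-4))
qed

lemma generic_kernel_taut: "generic_kernel R A taut u"
proof (intro generic_kernel.intro generic_kernel_axioms.intro affine_homI R_cring domain_A
  taut_ring_hom)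
 show "cring A" by (rule cring_O[OF opn_pts])
 show "taut ` carrier R = carrier A"
 proof
  show "taut ` carrier R \<subseteq> carrier A" using ring_hom_closed[OF taut_ring_hom] by blast
  show "carrier A \<subseteq> taut ` carrier R" using taut_chi chi_invariant[OF one_in_N]
   by (metis image_eqI subsetI)
 qed
 show "u \<in> carrier R" by (rule chi_invariant[OF one_in_N denom(1)])
 show "taut u \<noteq> 0[A]" using taut_chi[OF denom(1)] denom(2) by simp
 fix b assume b: "b \<in> carrier R" "taut b = 0[A]"
 obtain q where q: "b = cl q" "represents q (taut b)" using b(1) by (rule tautE)
 show "u *[R] b = 0[R]" using representsD(2)[OF q(2)] q(1) b(2) chi_zero[OF one_in_N] u_closed
  by (simp add: R_sel(1-4))
qed

theorem iso_onto_component: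
 "\<exists>Z. irreducible_component (tp (M\<^sub>0 \<kappa> V n F)) Z \<and>
   iso_onto_closed (V\<^sub>0 V) R (\<phi>\<^sub>0 \<kappa> V n F) (reduced_ideal Z) \<and>
  iso_onto_closed (V\<^sub>0 V) R (\<phi>\<^sub>0 \<kappa> V n F) (component_ideal R Z)"
proof -
 interpret K: generic_kernel R A taut u by (rule generic_kernel_taut)
 show ?thesis unfolding M\<^sub>0_def V\<^sub>0_def \<phi>\<^sub>0_def reduced_ideal_def
  by (intro exI[of _ "zero_locus R K.K"] conjI K.component_zero_locus_kernel)
   (simp_all only: K.R.Inter_zero_locus[OF K.K.primeideal] K.component_ideal_kernel
     K.iso_onto_closed_kernel)
qed

end

section \<open>Transition coefficients\<close>

definition transition :: "('p, 'a) rspace \<Rightarrow> ('p, 'a, 'm) msheaf \<Rightarrow> 'p set \<Rightarrow> 'p set \<Rightarrow> 'm \<Rightarrow> 'p set \<Rightarrow> 'm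
  \<Rightarrow> 'a \<Rightarrow> bool"
 where "transition X F D U s W t a \<longleftrightarrow> opn X D \<and> D \<subseteq> U \<and> D \<subseteq> W \<and> a \<in> Os X D \<and>
  mres F U D s = a *.[msec F D] mres F W D t"

lemma transitionI:
 "\<lbrakk>opn X D; D \<subseteq> U; D \<subseteq> W; a \<in> Os X D; mres F U D s = a *.[msec F D] mres F W D t\<rbrakk> \<Longrightarrow>
   transition X F D U s W t a"
 by (simp add: transition_def)

lemma transitionD:
 assumes "transition X F D U s W t a"
 shows "opn X D" "D \<subseteq> U" "D \<subseteq> W" "a \<in> Os X D" "mres F U D s = a *.[msec F D] mres F W D t"
 using assms by (simp_all add: transition_def)

context module_sheaf
begin

lemma free_gen_transitionE:
 assumes "free_gen X F W t" "opn X U" "s \<in> Ms F U" "opn X D" "D \<subseteq> U" "D \<subseteq> W"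
 obtains a where "transition X F D U s W t a"
 using free_genE[OF assms(1,4,6) res_closed[OF assms(2,4,5,3)]] transitionI[OF assms(4-6)] by metis

lemma transition_unique:
 assumes "free_gen X F W t" "transition X F D U s W t a" "transition X F D U s W t b" shows "a = b"
proof -
 note a = transitionD[OF assms(2)] and b = transitionD[OF assms(3)]
 show ?thesis by (rule free_gen_cancel[OF assms(1) a(1,3,4) b(4) trans[OF a(5)[symmetric] b(5)]])
qed

lemma transition_refl:
 assumes "opn X U" "s \<in> Ms F U" "opn X D" "D \<subseteq> U" shows "transition X F D U s U s 1[osec X D]"
proof -
 interpret M: module "osec X D" "msec F D" by (rule module_sec[OF assms(3)])
 show ?thesis using res_closed[OF assms(1,3,4,2)] by (intro transitionI assms) simp_all
qed

lemma transition_trans: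
 assumes a: "transition X F D U s V t a" and b: "transition X F D V t W r b" and r: "opn X W"
   "r \<in> Ms F W"
 shows "transition X F D U s W r (a *[osec X D] b)"
proof -
 note a = transitionD[OF a] and b = transitionD[OF b]
 interpret M: module "osec X D" "msec F D" by (rule module_sec[OF a(1)])
 show ?thesis unfolding transition_def
  using a b M.smult_assoc1[OF a(4) b(4) res_closed[OF r(1) b(1,3) r(2)]] by simp
qed

lemma transition_inverse:
 assumes s: "free_gen X F U s" and "transition X F D U s W t a" "transition X F D W t U s b"
 shows "a *[osec X D] b = 1[osec X D]"
 by (rule transition_unique[OF s transition_trans[OF assms(2,3) free_genD(1,2)[OF s]]
   transition_refl[OF free_genD(1,2)[OF s] transitionD(1,2)[OF assms(2)]]])

lemma transition_res:
 assumes "transition X F D U s W t a" and s: "opn X U" "s \<in> Ms F U" and t: "opn X W" "t \<in> Ms F W"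
  and D': "opn X D'" "D' \<subseteq> D"
 shows "transition X F D' U s W t (ores X D D' a)"
proof -
 note a = transitionD[OF assms(1)]
 have "mres F D D' (mres F U D s) = ores X D D' a *.[msec F D'] mres F D D' (mres F W D t)"
  unfolding a(5) by (rule res_smult[OF a(1) D' a(4) res_closed[OF t(1) a(1,3) t(2)]])
 thus ?thesis
  unfolding res_res[OF s(1) a(1) D' a(2) s(2)] res_res[OF t(1) a(1) D' a(3) t(2)]
  using ores_closed[OF a(1) D' a(4)] a(2,3) D' by (intro transitionI) auto
qed

lemma transition_res_left:
 assumes "opn X U" "s \<in> Ms F U" "opn X U'" "U' \<subseteq> U" "D \<subseteq> U'"
 shows "transition X F D U' (mres F U U' s) W t a \<longleftrightarrow> transition X F D U s W t a"
 using res_res[OF assms(1,3) _ assms(5,4,2)] assms(4,5) by (auto simp: transition_def)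

lemma transition_smult:
 assumes "transition X F D U s W t a" and s: "opn X U" "s \<in> Ms F U" and t: "opn X W"
   "t \<in> Ms F W" and c: "c \<in> Os X U"
 shows "transition X F D U (c *.[msec F U] s) W t (ores X U D c *[osec X D] a)"
proof -
 note a = transitionD[OF assms(1)]
 interpret M: module "osec X D" "msec F D" by (rule module_sec[OF a(1)])
 note cD = ores_closed[OF s(1) a(1,2) c]
 show ?thesis
  using a cD res_smult[OF s(1) a(1,2) c s(2)] M.smult_assoc1[OF cD a(4) res_closed[OF t(1) a(1,3) t(2)]]
  by (intro transitionI) simp_all
qed

lemma transition_add:
 assumes "transition X F D U s W t a" "transition X F D U s' W t a'"
  and s: "opn X U" "s \<in> Ms F U" "s' \<in> Ms F U" and t: "opn X W" "t \<in> Ms F W"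
 shows "transition X F D U (s +[msec F U] s') W t (a +[osec X D] a')"
proof -
 note a = transitionD[OF assms(1)] and a' = transitionD[OF assms(2)]
 interpret M: module "osec X D" "msec F D" by (rule module_sec[OF a(1)])
 show ?thesis
  using a a' res_add[OF s(1) a(1,2) s(2,3)] M.smult_l_distr[OF a(4) a'(4)
    res_closed[OF t(1) a(1,3) t(2)]]
  by (intro transitionI) simp_all
qed

end

lemma (in line_bundle_pullback_tensor) transition_pure_section:
 assumes a: "transition X F D U u U' u' a" and b: "transition V G D' W v W' v' b"
  and u: "opn X U" "u \<in> Ms F U" and e': "free_gen X F U' u'" and v: "opn V W"
    "v \<in> Ms G W" and v': "opn V W'" "v' \<in> Ms G W'"
  and pre: "W \<subseteq> preim V f U" "W' \<subseteq> preim V f U'" "D' \<subseteq> preim V f D"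
 shows "transition V FG D' W (pure_section U u W v) W' (pure_section U' u' W' v')
   (pull D D' a *[osec V D'] b)"
proof (rule transitionI)
 note D = transitionD[OF a] and D' = transitionD[OF b] and u' = free_genD(1,2)[OF e']
 show "opn V D'" "D' \<subseteq> W" "D' \<subseteq> W'" by (fact D'(1-3))+
 interpret M: module "osec V D'" "msec G D'" by (rule G.module_sec[OF D'(1)])
 note aD = pull_closed[OF D(1) D'(1) pre(3) D(4)]
 show ab: "pull D D' a *[osec V D'] b \<in> Os V D'" using aD D'(4) by simp
 note u'D = F.free_gen_res[OF e' D(1,3)] and v'D = G.res_closed[OF v'(1) D'(1,3) v'(2)]
 note u'D_closed = free_genD(2)[OF u'D]
 have "mres FG W D' (pure_section U u W v) =
   pure_section D (a *.[msec F D] mres F U' D u') D' (b *.[msec G D'] mres G W' D' v')"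
  unfolding pure_section_res[OF v(1) D'(1,2) pre(3) v(2) u(1) D(1,2) u(2)] D(5) D'(5) ..
 also have "... = pure_section D (mres F U' D u') D'
   (pull D D' a *.[msec G D'] (b *.[msec G D'] mres G W' D' v'))"
  by (rule pure_section_balanced[OF D'(1) pre(3) M.smult_closed[OF D'(4) v'D] D(1) u'D_closed D(4)])
 also have "... = (pull D D' a *[osec V D'] b) *.[msec FG D'] pure_section D (mres F U' D u') D'
   (mres G W' D' v')"
  unfolding M.smult_assoc1[OF aD D'(4) v'D, symmetric]
  by (rule pure_section_smult[OF D'(1) pre(3) D(1) u'D_closed v'D ab])
 also have "pure_section D (mres F U' D u') D' (mres G W' D' v') =
   mres FG W' D' (pure_section U' u' W' v')"
  by (rule pure_section_res[OF v'(1) D'(1,3) pre(3) v'(2) u'(1) D(1,3) u'(2), symmetric])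
 finally show "mres FG W D' (pure_section U u W v) =
   (pull D D' a *[osec V D'] b) *.[msec FG D'] mres FG W' D' (pure_section U' u' W' v')" .
qed

section \<open>Homomorphisms defined on a dense open set\<close>

subsection \<open>Subsheaves and sheaves of sections over an open set\<close>

lemma is_sheaf_local_subset:
 assumes sh: "is_sheaf T S res"
  and res: "\<And>U W s. \<lbrakk>openin T U; openin T W; W \<subseteq> U; s \<in> S U; P U s\<rbrakk> \<Longrightarrow> P W (res U W s)"
  and loc: "\<And>U s. \<lbrakk>openin T U; s \<in> S U; \<And>p. p \<in> U \<Longrightarrow> \<exists>W. openin T W \<and> p \<in> W \<and> W \<subseteq> U \<and>
    P W (res U W s)\<rbrakk> \<Longrightarrow> P U s"
 shows "is_sheaf T (\<lambda>U. {s. s \<in> S U \<and> P U s}) res"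
proof (rule is_sheafI)
 note pre = is_presheafD[OF is_sheaf_presheaf[OF sh]]
 show "is_presheaf T (\<lambda>U. {s. s \<in> S U \<and> P U s}) res"
  unfolding is_presheaf_def using pre res by auto
 fix \<C> s assume C: "\<And>U. U \<in> \<C> \<Longrightarrow> openin T U \<and> s U \<in> {s. s \<in> S U \<and> P U s}"
  and eq: "\<And>U W. U \<in> \<C> \<Longrightarrow> W \<in> \<C> \<Longrightarrow> res U (U \<inter> W) (s U) = res W (U \<inter> W) (s W)"
 have ex1: "\<exists>!t. t \<in> S (\<Union>\<C>) \<and> (\<forall>U\<in>\<C>. res (\<Union>\<C>) U t = s U)" by (rule is_sheafD[OF sh]) (use C eq in auto)
 then obtain t where t: "t \<in> S (\<Union>\<C>)" "\<forall>U\<in>\<C>. res (\<Union>\<C>) U t = s U" by (elim ex1E conjE)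
 have "P (\<Union>\<C>) t"
 proof (rule loc[OF _ t(1)])
  fix p assume "p \<in> \<Union>\<C>"
  then obtain U where "U \<in> \<C>" "p \<in> U" by blast
  thus "\<exists>W. openin T W \<and> p \<in> W \<and> W \<subseteq> \<Union>\<C> \<and> P W (res (\<Union>\<C>) W t)" using C[of U] t(2)
   by (intro exI[of _ U]) auto
 qed (use C in blast)
 with ex1 t show "\<exists>!t. t \<in> {s. s \<in> S (\<Union>\<C>) \<and> P (\<Union>\<C>) s} \<and> (\<forall>U\<in>\<C>. res (\<Union>\<C>) U t = s U)"
  by (intro ex1I[of _ t]) blast+
qed

lemma is_sheaf_Int:
 assumes sh: "is_sheaf T S res" and U0: "openin T U0"
 shows "is_sheaf T (\<lambda>U. S (U \<inter> U0)) (\<lambda>U W. res (U \<inter> U0) (W \<inter> U0))"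
proof (rule is_sheafI)
 note pre = is_presheafD[OF is_sheaf_presheaf[OF sh]]
 have o: "openin T (U \<inter> U0)" if "openin T U" for U using that U0 by blast
 have mono: "W \<inter> U0 \<subseteq> U \<inter> U0" if "W \<subseteq> U" for U W using that by blast
 show "is_presheaf T (\<lambda>U. S (U \<inter> U0)) (\<lambda>U W. res (U \<inter> U0) (W \<inter> U0))"
  unfolding is_presheaf_def
 proof (intro conjI allI impI ballI; (elim conjE)?)
  show "res (U \<inter> U0) (W \<inter> U0) \<in> S (U \<inter> U0) \<rightarrow> S (W \<inter> U0)" if "openin T U" "openin T W" "W \<subseteq> U" for U W
   using pre(1)[OF o o mono] that by blast
  show "res (U \<inter> U0) (U \<inter> U0) s = s" if "openin T U" "s \<in> S (U \<inter> U0)" for U s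
   using that(2) by (rule pre(2)[OF o[OF that(1)]])
  show "res (W \<inter> U0) (Z \<inter> U0) (res (U \<inter> U0) (W \<inter> U0) s) = res (U \<inter> U0) (Z \<inter> U0) s"
   if "openin T U" "openin T W" "openin T Z" "Z \<subseteq> W" "W \<subseteq> U" "s \<in> S (U \<inter> U0)" for U W Z s
   using that(6) by (rule pre(3)[OF o[OF that(1)] o[OF that(2)] o[OF that(3)] mono[OF that(4)]
     mono[OF that(5)]])
 qed
 fix \<C> s assume C: "\<And>U. U \<in> \<C> \<Longrightarrow> openin T U \<and> s U \<in> S (U \<inter> U0)"
  and eq: "\<And>U W. U \<in> \<C> \<Longrightarrow> W \<in> \<C> \<Longrightarrow> res (U \<inter> U0) (U \<inter> W \<inter> U0) (s U) = res (W \<inter> U0) (U \<inter> W \<inter> U0) (s W)"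
 have Un: "(\<Union>U\<in>\<C>. U \<inter> U0) = \<Union>\<C> \<inter> U0" by blast
 have int: "(U \<inter> U0) \<inter> (W \<inter> U0) = U \<inter> W \<inter> U0" for U W by blast
 obtain t where t: "t \<in> S (\<Union>\<C> \<inter> U0)" "\<And>U. U \<in> \<C> \<Longrightarrow> res (\<Union>\<C> \<inter> U0) (U \<inter> U0) t = s U"
 proof (rule sheaf_glue[OF sh, of \<C> "\<lambda>U. U \<inter> U0" s, unfolded Un int])
  show "res (U \<inter> U0) (U \<inter> W \<inter> U0) (s U) = res (W \<inter> U0) (U \<inter> W \<inter> U0) (s W)" if "U \<in> \<C>" "W \<in> \<C>" for U W
   by (rule eq[OF that])
 qed (use C o that in simp_all)
 show "\<exists>!t. t \<in> S (\<Union>\<C> \<inter> U0) \<and> (\<forall>U\<in>\<C>. res (\<Union>\<C> \<inter> U0) (U \<inter> U0) t = s U)"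
 proof (rule ex1I[of _ t])
  show "t \<in> S (\<Union>\<C> \<inter> U0) \<and> (\<forall>U\<in>\<C>. res (\<Union>\<C> \<inter> U0) (U \<inter> U0) t = s U)" using t by blast
  fix t' assume t': "t' \<in> S (\<Union>\<C> \<inter> U0) \<and> (\<forall>U\<in>\<C>. res (\<Union>\<C> \<inter> U0) (U \<inter> U0) t' = s U)"
  show "t' = t"
  proof (rule sheaf_eqI[OF sh _ _ t(1)])
   show "openin T (\<Union>\<C> \<inter> U0)" using C by (intro o) blast
   fix p assume "p \<in> \<Union>\<C> \<inter> U0"
   then obtain U where U: "U \<in> \<C>" "p \<in> U" "p \<in> U0" by blast
   show "\<exists>W. openin T W \<and> p \<in> W \<and> W \<subseteq> \<Union>\<C> \<inter> U0 \<and> res (\<Union>\<C> \<inter> U0) W t' = res (\<Union>\<C> \<inter> U0) W t"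
    using U o C[OF U(1)] t(2)[OF U(1)] t' by (intro exI[of _ "U \<inter> U0"]) auto
  qed (use t' in blast)
 qed
qed

lemma module_restrict_scalars:
 assumes R: "cring R" and h: "h \<in> ring_hom R S" and M: "module S M"
 shows "module R (M\<lparr>module.smult := \<lambda>a. module.smult M (h a)\<rparr>)"
proof -
 interpret module S M by (rule M)
 have "abelian_group (M\<lparr>module.smult := \<lambda>a. module.smult M (h a)\<rparr>)"
  using M.abelian_group_axioms by (simp add: abelian_group_def abelian_monoid_def
    abelian_group_axioms_def)
 with R show ?thesis
  by (rule moduleI)
   (simp_all add: ring_hom_closed[OF h] ring_hom_add[OF h] ring_hom_mult[OF h] ring_hom_one[OF h]
     smult_l_distr smult_r_distr smult_assoc1)
qed

definition open_image :: "('p, 'a) rspace \<Rightarrow> 'p set \<Rightarrow> ('p, 'a, 'm) msheaf \<Rightarrow> ('p, 'a, 'm) msheaf"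
 where "open_image X U0 F = \<lparr>msec = \<lambda>U. (msec F (U \<inter> U0))\<lparr>module.smult :=
   \<lambda>a. module.smult (msec F (U \<inter> U0)) (ores X U (U \<inter> U0) a)\<rparr>,
  mres = \<lambda>U W. mres F (U \<inter> U0) (W \<inter> U0)\<rparr>"

lemma open_image_sel [simp]:
 "Ms (open_image X U0 F) U = Ms F (U \<inter> U0)" "0[msec (open_image X U0 F) U] = 0[msec F (U \<inter> U0)]"
 "ring.add (msec (open_image X U0 F) U) = ring.add (msec F (U \<inter> U0))"
 "a *.[msec (open_image X U0 F) U] s = ores X U (U \<inter> U0) a *.[msec F (U \<inter> U0)] s"
 "mres (open_image X U0 F) U W = mres F (U \<inter> U0) (W \<inter> U0)"
 by (simp_all add: open_image_def)

definition subsheaf :: "('p, 'a, 'm) msheaf \<Rightarrow> ('p set \<Rightarrow> 'm \<Rightarrow> bool) \<Rightarrow> ('p, 'a, 'm) msheaf"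
 where "subsheaf F P = F\<lparr>msec := \<lambda>U. (msec F U)\<lparr>carrier := {s. s \<in> Ms F U \<and> P U s}\<rparr>\<rparr>"

lemma subsheaf_sel [simp]:
 "Ms (subsheaf F P) U = {s. s \<in> Ms F U \<and> P U s}" "0[msec (subsheaf F P) U] = 0[msec F U]"
 "ring.add (msec (subsheaf F P) U) = ring.add (msec F U)"
 "module.smult (msec (subsheaf F P) U) = module.smult (msec F U)" "mres (subsheaf F P) = mres F"
 by (simp_all add: subsheaf_def)

context module_sheaf
begin

lemma mod_sheaf_open_image:
 assumes U0: "opn X U0" shows "mod_sheaf X (open_image X U0 F)"
 unfolding mod_sheaf_def
proof (intro conjI allI impI ballI)
 have o: "opn X (U \<inter> U0)" if "opn X U" for U using that U0 by blast
 show "module (osec X U) (msec (open_image X U0 F) U)" if "opn X U" for U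
  unfolding open_image_def msheaf.simps
  by (rule module_restrict_scalars[OF cring_O[OF that] ores_ring_hom[OF that o[OF that] Int_lower1]
    module_sec[OF o[OF that]]])
 fix U W assume "opn X U \<and> opn X W \<and> W \<subseteq> U"
 hence U: "opn X U" and W: "opn X W" "W \<subseteq> U" "W \<inter> U0 \<subseteq> U \<inter> U0" by auto
 note res = o[OF U] o[OF W(1)] W(3)
 show "mres (open_image X U0 F) U W (s +[msec (open_image X U0 F) U] t)
   = mres (open_image X U0 F) U W s +[msec (open_image X U0 F) W] mres (open_image X U0 F) U W t"
  if "s \<in> Ms (open_image X U0 F) U" "t \<in> Ms (open_image X U0 F) U" for s t
  using res_add[OF res] that by simp
 show "mres (open_image X U0 F) U W (a *.[msec (open_image X U0 F) U] s)
   = ores X U W a *.[msec (open_image X U0 F) W] mres (open_image X U0 F) U W s"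
  if a: "a \<in> Os X U" and s: "s \<in> Ms (open_image X U0 F) U" for a s
  using res_smult[OF res ores_closed[OF U res(1) Int_lower1 a]] s
   ores_ores[OF U res(1) res(2,3) Int_lower1 a] ores_ores[OF U W(1) res(2) Int_lower1 W(2) a] by simp
next
 show "is_sheaf (tp X) (\<lambda>U. Ms (open_image X U0 F) U) (mres (open_image X U0 F))"
  using is_sheaf_Int[OF sheaf U0] by (simp add: open_image_def)
qed

lemma mod_sheaf_subsheaf:
 assumes zero: "\<And>U. opn X U \<Longrightarrow> P U 0[msec F U]"
  and add: "\<And>U s t. \<lbrakk>opn X U; s \<in> Ms F U; t \<in> Ms F U; P U s; P U t\<rbrakk> \<Longrightarrow> P U (s +[msec F U] t)"
  and smult: "\<And>U a s. \<lbrakk>opn X U; a \<in> Os X U; s \<in> Ms F U; P U s\<rbrakk> \<Longrightarrow> P U (a *.[msec F U] s)"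
  and res: "\<And>U W s. \<lbrakk>opn X U; opn X W; W \<subseteq> U; s \<in> Ms F U; P U s\<rbrakk> \<Longrightarrow> P W (mres F U W s)"
  and loc: "\<And>U s. \<lbrakk>opn X U; s \<in> Ms F U; \<And>p. p \<in> U \<Longrightarrow> \<exists>W. opn X W \<and> p \<in> W \<and> W \<subseteq> U \<and>
    P W (mres F U W s)\<rbrakk> \<Longrightarrow> P U s"
 shows "mod_sheaf X (subsheaf F P)"
 unfolding mod_sheaf_def
proof (intro conjI allI impI ballI)
 fix U assume U: "opn X U"
 interpret M: module "osec X U" "msec F U" by (rule module_sec[OF U])
 have "submodule {s. s \<in> Ms F U \<and> P U s} (osec X U) (msec F U)"
 proof (rule M.submoduleI)
  fix s assume s: "s \<in> {s. s \<in> Ms F U \<and> P U s}"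
  have "\<ominus>\<^bsub>msec F U\<^esub> s = (\<ominus>\<^bsub>osec X U\<^esub> 1[osec X U]) *.[msec F U] s"
   using s M.smult_l_minus[of "1[osec X U]" s] by simp
  thus "\<ominus>\<^bsub>msec F U\<^esub> s \<in> {s. s \<in> Ms F U \<and> P U s}" using smult[OF U] s by simp
 qed (use zero add smult U in auto)
 from submodule.submodule_is_module[OF this module_sec[OF U]]
 show "module (osec X U) (msec (subsheaf F P) U)" by (simp add: subsheaf_def)
next
 show "is_sheaf (tp X) (\<lambda>U. Ms (subsheaf F P) U) (mres (subsheaf F P))"
  unfolding subsheaf_sel by (rule is_sheaf_local_subset[where P = P, OF sheaf res loc])
qed (auto simp: res_add res_smult)

end

lemma (in integral_space) line_bundle_section_eqI:
 assumes G: "line_bundle X G" and W: "opn X W" and U: "opn X U" "U \<noteq> {}"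
  and r: "r \<in> Ms G W" "r' \<in> Ms G W" and eq: "mres G W (W \<inter> U) r = mres G W (W \<inter> U) r'"
 shows "r = r'"
proof -
 interpret G: module_sheaf X G by (rule line_bundle_module_sheaf[OF G])
 show ?thesis
 proof (rule sheaf_eqI[OF G.sheaf W r])
  fix p assume p: "p \<in> W"
  have "p \<in> pts X" using p openin_subset[OF W] by auto
  then obtain Z \<eta> where Z: "p \<in> Z" "free_gen X G Z \<eta>" using line_bundleD(2)[OF G] by blast
  note \<eta> = free_genD(1,2)[OF Z(2)]
  let ?Y = "W \<inter> Z" and ?D = "W \<inter> Z \<inter> U"
  have Y: "opn X ?Y" "?Y \<subseteq> W" "?Y \<subseteq> Z" "?Y \<noteq> {}" using W \<eta> p Z(1) by auto
  have D: "opn X ?D" "?D \<subseteq> ?Y" "?D \<noteq> {}" "opn X (W \<inter> U)" "W \<inter> U \<subseteq> W" "?D \<subseteq> W \<inter> U"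
   using Y U W opn_meet[OF Y(1) U(1) Y(4) U(2)] by auto
  obtain y where y: "transition X G ?Y W r Z \<eta> y"
   by (rule G.free_gen_transitionE[OF Z(2) W r(1) Y(1-3)])
  obtain y' where y': "transition X G ?Y W r' Z \<eta> y'"
   by (rule G.free_gen_transitionE[OF Z(2) W r(2) Y(1-3)])
  have "mres G W ?D r = mres G W ?D r'"
   using G.res_res[OF W D(4,1,6,5) r(1)] G.res_res[OF W D(4,1,6,5) r(2)] eq by simp
  hence "transition X G ?D W r Z \<eta> (ores X ?Y ?D y')"
   using G.transition_res[OF y' W r(2) \<eta> D(1,2)] by (simp add: transition_def)
  hence "ores X ?Y ?D y = ores X ?Y ?D y'"
   by (rule G.transition_unique[OF Z(2) G.transition_res[OF y W r(1) \<eta> D(1,2)]])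
  hence "y = y'" by (rule ores_inj[OF Y(1) D(1,2,3) transitionD(4)[OF y] transitionD(4)[OF y']])
  hence "mres G W ?Y r = mres G W ?Y r'" using transitionD(5)[OF y] transitionD(5)[OF y'] by simp
  thus "\<exists>Y. opn X Y \<and> p \<in> Y \<and> Y \<subseteq> W \<and> mres G W Y r = mres G W Y r'" using Y p Z(1)
   by (intro exI[of _ ?Y]) simp
 qed
qed

subsection \<open>Extending sections and homomorphisms\<close>

locale dense_frame = integral_space X for X :: "('p, 'a) rspace" +
 fixes F :: "('p, 'a, 'm) msheaf" and G :: "('p, 'a, 'n) msheaf" and U0 e0
 assumes line_bundle_F: "line_bundle X F" and line_bundle_G: "line_bundle X G"
  and e0: "free_gen X F U0 e0" and U0_nonempty: "U0 \<noteq> {}"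

sublocale dense_frame \<subseteq> F: module_sheaf X F by (rule line_bundle_module_sheaf[OF line_bundle_F])
sublocale dense_frame \<subseteq> G: module_sheaf X G by (rule line_bundle_module_sheaf[OF line_bundle_G])

context dense_frame
begin

lemma opn_U0: "opn X U0" and e0_closed: "e0 \<in> Ms F U0" using free_genD[OF e0] by simp_all

lemma opn_Int_U0: "opn X U \<Longrightarrow> opn X (U \<inter> U0)" using opn_U0 by blast

lemma Int_U0_subset: "U \<inter> U0 \<subseteq> U" "U \<inter> U0 \<subseteq> U0" "W \<subseteq> U \<Longrightarrow> W \<inter> U0 \<subseteq> U \<inter> U0" by auto

lemmas G_section_eqI = line_bundle_section_eqI[OF line_bundle_G _ opn_U0 U0_nonempty]

definition extendable :: "'p set \<Rightarrow> 'n \<Rightarrow> bool"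
 where "extendable U u \<longleftrightarrow> (\<exists>r\<in>Ms G U. mres G U (U \<inter> U0) r = u)"

lemma extendableI: "\<lbrakk>r \<in> Ms G U; mres G U (U \<inter> U0) r = u\<rbrakk> \<Longrightarrow> extendable U u"
 by (auto simp: extendable_def)

lemma extendableE:
 assumes "extendable U u" obtains r where "r \<in> Ms G U" "mres G U (U \<inter> U0) r = u"
 using assms by (auto simp: extendable_def)

lemma extendable_zero: "opn X U \<Longrightarrow> extendable U 0[msec G (U \<inter> U0)]"
 by (rule extendableI[OF G.zero_closed G.res_zero[OF _ opn_Int_U0 Int_U0_subset(1)]])

lemma extendable_add:
 assumes U: "opn X U" and "extendable U u" "extendable U v"
 shows "extendable U (u +[msec G (U \<inter> U0)] v)"
 using assms(2,3) extendableI[OF G.add_closed[OF U] G.res_add[OF U opn_Int_U0[OF U] Int_U0_subset(1)]]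
 by (metis extendableE)

lemma extendable_smult:
 assumes U: "opn X U" and a: "a \<in> Os X U" and "extendable U u"
 shows "extendable U (ores X U (U \<inter> U0) a *.[msec G (U \<inter> U0)] u)"
 using assms(3) extendableI[OF G.smult_closed[OF U a]
   G.res_smult[OF U opn_Int_U0[OF U] Int_U0_subset(1) a]]
 by (metis extendableE)

text \<open>Density of \<open>U\<^sub>0\<close> makes extensions unique, so that local extensions glue.\<close>

lemma extendable_local:
 assumes W: "opn X W" and u: "u \<in> Ms G (W \<inter> U0)"
  and loc: "\<And>p. p \<in> W \<Longrightarrow> \<exists>Z. opn X Z \<and> p \<in> Z \<and> Z \<subseteq> W \<and> extendable Z (mres G (W \<inter> U0) (Z \<inter> U0) u)"
 shows "extendable W u"
proof -
 note oW = opn_Int_U0[OF W]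
 let ?I = "{Z. opn X Z \<and> Z \<subseteq> W \<and> extendable Z (mres G (W \<inter> U0) (Z \<inter> U0) u)}"
 have cover: "\<Union>?I = W" using loc by blast
 have "\<forall>Z\<in>?I. \<exists>r. r \<in> Ms G Z \<and> mres G Z (Z \<inter> U0) r = mres G (W \<inter> U0) (Z \<inter> U0) u"
  by (auto elim: extendableE)
 from bchoice[OF this] obtain r where
  extension: "\<forall>Z\<in>?I. r Z \<in> Ms G Z \<and> mres G Z (Z \<inter> U0) (r Z) = mres G (W \<inter> U0) (Z \<inter> U0) u" ..
 have r: "r Z \<in> Ms G Z" "mres G Z (Z \<inter> U0) (r Z) = mres G (W \<inter> U0) (Z \<inter> U0) u" if "Z \<in> ?I" for Z
  using bspec[OF extension that] by (rule conjunct1, rule conjunct2)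
 have opn: "opn X Z" "Z \<subseteq> W" if "Z \<in> ?I" for Z using that by auto
 have r_res: "mres G Y (Y \<inter> U0) (mres G Z Y (r Z)) = mres G (W \<inter> U0) (Y \<inter> U0) u"
   if Z: "Z \<in> ?I" and Y: "opn X Y" "Y \<subseteq> Z" for Z Y
  using G.res_res[OF opn(1)[OF Z] Y(1) opn_Int_U0[OF Y(1)] Int_U0_subset(1) Y(2) r(1)[OF Z]]
   G.res_res[OF opn(1)[OF Z] opn_Int_U0[OF opn(1)[OF Z]] opn_Int_U0[OF Y(1)]
     Int_U0_subset(3)[OF Y(2)] Int_U0_subset(1) r(1)[OF Z]]
   G.res_res[OF oW opn_Int_U0[OF opn(1)[OF Z]] opn_Int_U0[OF Y(1)] Int_U0_subset(3)[OF Y(2)]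
     Int_U0_subset(3)[OF opn(2)[OF Z]] u] r(2)[OF Z]
  by simp
 have "mres G Z (Z \<inter> Z') (r Z) = mres G Z' (Z \<inter> Z') (r Z')" if Z: "Z \<in> ?I" "Z' \<in> ?I" for Z Z'
 proof -
  have Y: "opn X (Z \<inter> Z')" "Z \<inter> Z' \<subseteq> Z" "Z \<inter> Z' \<subseteq> Z'" using opn[OF Z(1)] opn[OF Z(2)] by auto
  show ?thesis
   by (rule G_section_eqI[OF Y(1) G.res_closed[OF opn(1)[OF Z(1)] Y(1,2) r(1)[OF Z(1)]]
     G.res_closed[OF opn(1)[OF Z(2)] Y(1,3) r(1)[OF Z(2)]]])
    (use r_res[OF Z(1) Y(1,2)] r_res[OF Z(2) Y(1,3)] in simp)
 qed
 hence "\<exists>!t. t \<in> Ms G (\<Union>?I) \<and> (\<forall>Z\<in>?I. mres G (\<Union>?I) Z t = r Z)"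
  by (intro is_sheafD[OF G.sheaf] opn(1) r(1))
 then obtain t where t: "t \<in> Ms G W" "\<forall>Z\<in>?I. mres G W Z t = r Z" unfolding cover by blast
 have "mres G W (W \<inter> U0) t = u"
 proof (rule sheaf_eqI[OF G.sheaf oW G.res_closed[OF W oW Int_U0_subset(1) t(1)] u])
  fix p assume p: "p \<in> W \<inter> U0"
  then obtain Z where Z: "Z \<in> ?I" "p \<in> Z" using cover by blast
  note o = opn_Int_U0[OF opn(1)[OF Z(1)]] and sub = Int_U0_subset(3)[OF opn(2)[OF Z(1)]]
  have "mres G (W \<inter> U0) (Z \<inter> U0) (mres G W (W \<inter> U0) t) = mres G Z (Z \<inter> U0) (mres G W Z t)"
   using G.res_res[OF W oW o sub Int_U0_subset(1) t(1)] G.res_res[OF W opn(1)[OF Z(1)]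
     o Int_U0_subset(1) opn(2)[OF Z(1)] t(1)] by simp
  hence "mres G (W \<inter> U0) (Z \<inter> U0) (mres G W (W \<inter> U0) t) = mres G (W \<inter> U0) (Z \<inter> U0) u"
   using bspec[OF t(2) Z(1)] r(2)[OF Z(1)] by simp
  thus "\<exists>Y. opn X Y \<and> p \<in> Y \<and> Y \<subseteq> W \<inter> U0 \<and> mres G (W \<inter> U0) Y (mres G W (W \<inter> U0) t) =
    mres G (W \<inter> U0) Y u"
   using o p Z(2) sub by blast
 qed
 with t(1) show ?thesis by (rule extendableI)
qed

definition coord :: "'p set \<Rightarrow> 'm \<Rightarrow> 'a"
 where "coord W x = (THE c. transition X F (W \<inter> U0) W x U0 e0 c)"

lemma coord_eqI:
 assumes "transition X F (W \<inter> U0) W x U0 e0 c" shows "coord W x = c"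
 unfolding coord_def using assms F.transition_unique[OF e0] by blast

lemma coord_transition:
 assumes "opn X W" "x \<in> Ms F W" shows "transition X F (W \<inter> U0) W x U0 e0 (coord W x)"
proof -
 obtain c where c: "transition X F (W \<inter> U0) W x U0 e0 c"
  by (rule F.free_gen_transitionE[OF e0 assms opn_Int_U0[OF assms(1)] Int_U0_subset(1,2)])
 thus ?thesis by (simp add: coord_eqI[OF c])
qed

lemma coord_closed: "\<lbrakk>opn X W; x \<in> Ms F W\<rbrakk> \<Longrightarrow> coord W x \<in> Os X (W \<inter> U0)"
 by (rule transitionD(4)[OF coord_transition])

lemma coord_res:
 assumes W: "opn X W" "opn X Z" "Z \<subseteq> W" and x: "x \<in> Ms F W"
 shows "coord Z (mres F W Z x) = ores X (W \<inter> U0) (Z \<inter> U0) (coord W x)"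
proof (rule coord_eqI)
 show "transition X F (Z \<inter> U0) Z (mres F W Z x) U0 e0 (ores X (W \<inter> U0) (Z \<inter> U0) (coord W x))"
  unfolding F.transition_res_left[OF W(1) x W(2,3) Int_U0_subset(1)]
  by (rule F.transition_res[OF coord_transition[OF W(1) x] W(1) x opn_U0 e0_closed
    opn_Int_U0[OF W(2)] Int_U0_subset(3)[OF W(3)]])
qed

lemma coord_add: "\<lbrakk>opn X W; x \<in> Ms F W; y \<in> Ms F W\<rbrakk> \<Longrightarrow> coord W (x +[msec F W] y) =
  coord W x +[osec X (W \<inter> U0)] coord W y"
 by (intro coord_eqI F.transition_add coord_transition opn_U0 e0_closed)

lemma coord_smult:
 "\<lbrakk>opn X W; a \<in> Os X W; x \<in> Ms F W\<rbrakk> \<Longrightarrow> coord W (a *.[msec F W] x) =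
   ores X W (W \<inter> U0) a *[osec X (W \<inter> U0)] coord W x"
 by (intro coord_eqI F.transition_smult coord_transition opn_U0 e0_closed)

lemma coord_e0: "coord U0 e0 = 1[osec X U0]"
 using coord_eqI[of U0 e0] F.transition_refl[OF opn_U0 e0_closed opn_U0 order_refl] by simp

text \<open>The value at \<open>x\<close> of the homomorphism \<open>e\<^sub>0 \<mapsto> s\<close> over \<open>W \<inter> U\<^sub>0\<close>.\<close>

abbreviation hom_value :: "'p set \<Rightarrow> 'n \<Rightarrow> 'p set \<Rightarrow> 'm \<Rightarrow> 'n"
 where "hom_value U s W x \<equiv> coord W x *.[msec G (W \<inter> U0)] mres G (U \<inter> U0) (W \<inter> U0) s"

definition hom_extends :: "'p set \<Rightarrow> 'n \<Rightarrow> bool"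
 where "hom_extends U s \<longleftrightarrow> (\<forall>W x. opn X W \<and> W \<subseteq> U \<and> x \<in> Ms F W \<longrightarrow> extendable W (hom_value U s W x))"

lemma hom_extendsD: "\<lbrakk>hom_extends U s; opn X W; W \<subseteq> U; x \<in> Ms F W\<rbrakk> \<Longrightarrow> extendable W (hom_value U s W x)"
 by (simp add: hom_extends_def)

lemma section_res_closed: "\<lbrakk>opn X U; opn X W; W \<subseteq> U; s \<in> Ms G (U \<inter> U0)\<rbrakk> \<Longrightarrow>
  mres G (U \<inter> U0) (W \<inter> U0) s \<in> Ms G (W \<inter> U0)"
 by (rule G.res_closed[OF opn_Int_U0 opn_Int_U0 Int_U0_subset(3)])

lemma section_res_res:
 "\<lbrakk>opn X U; opn X W; opn X Z; Z \<subseteq> W; W \<subseteq> U; s \<in> Ms G (U \<inter> U0)\<rbrakk> \<Longrightarrow>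
  mres G (W \<inter> U0) (Z \<inter> U0) (mres G (U \<inter> U0) (W \<inter> U0) s) = mres G (U \<inter> U0) (Z \<inter> U0) s"
 by (rule G.res_res[OF opn_Int_U0 opn_Int_U0 opn_Int_U0 Int_U0_subset(3) Int_U0_subset(3)])

lemma hom_value_res:
 assumes U: "opn X U" and s: "s \<in> Ms G (U \<inter> U0)" and W: "opn X W" "W \<subseteq> U" and Z: "opn X Z"
   "Z \<subseteq> W" and x: "x \<in> Ms F W"
 shows "mres G (W \<inter> U0) (Z \<inter> U0) (hom_value U s W x) = hom_value U s Z (mres F W Z x)"
 unfolding coord_res[OF W(1) Z x] section_res_res[OF U W(1) Z W(2) s, symmetric]
 by (rule G.res_smult[OF opn_Int_U0[OF W(1)] opn_Int_U0[OF Z(1)] Int_U0_subset(3)[OF Z(2)]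
   coord_closed[OF W(1) x] section_res_closed[OF U W s]])

lemma hom_extends_res:
 assumes "opn X U" "opn X W" "W \<subseteq> U" "s \<in> Ms G (U \<inter> U0)" "hom_extends U s"
 shows "hom_extends W (mres G (U \<inter> U0) (W \<inter> U0) s)"
 unfolding hom_extends_def
proof (intro allI impI, elim conjE)
 fix Z x assume Z: "opn X Z" "Z \<subseteq> W" "x \<in> Ms F Z"
 show "extendable Z (hom_value W (mres G (U \<inter> U0) (W \<inter> U0) s) Z x)"
  unfolding section_res_res[OF assms(1,2) Z(1,2) assms(3,4)]
  using hom_extendsD[OF assms(5) Z(1) _ Z(3)] Z(2) assms(3) by blast
qed

lemma hom_extends_local:
 assumes U: "opn X U" and s: "s \<in> Ms G (U \<inter> U0)"
  and loc: "\<And>p. p \<in> U \<Longrightarrow> \<exists>Z. opn X Z \<and> p \<in> Z \<and> Z \<subseteq> U \<and> hom_extends Z (mres G (U \<inter> U0) (Z \<inter> U0) s)"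
 shows "hom_extends U s"
 unfolding hom_extends_def
proof (intro allI impI, elim conjE)
 fix W x assume W: "opn X W" "W \<subseteq> U" and x: "x \<in> Ms F W"
 show "extendable W (hom_value U s W x)"
 proof (rule extendable_local[OF W(1)])
  show "hom_value U s W x \<in> Ms G (W \<inter> U0)"
   by (rule G.smult_closed[OF opn_Int_U0[OF W(1)] coord_closed[OF W(1) x] section_res_closed[OF U W s]])
  fix p assume p: "p \<in> W"
  then obtain Z where Z: "opn X Z" "p \<in> Z" "Z \<subseteq> U" "hom_extends Z (mres G (U \<inter> U0) (Z \<inter> U0) s)"
   using loc W(2) by blast
  have WZ: "opn X (W \<inter> Z)" "W \<inter> Z \<subseteq> W" "W \<inter> Z \<subseteq> Z" using W Z by auto
  have "extendable (W \<inter> Z) (hom_value U s (W \<inter> Z) (mres F W (W \<inter> Z) x))"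
   using hom_extendsD[OF Z(4) WZ(1,3) F.res_closed[OF W(1) WZ(1,2) x]]
   unfolding section_res_res[OF U Z(1) WZ(1,3) Z(3) s] .
  hence "extendable (W \<inter> Z) (mres G (W \<inter> U0) (W \<inter> Z \<inter> U0) (hom_value U s W x))"
   unfolding hom_value_res[OF U s W WZ(1,2) x] .
  thus "\<exists>Z. opn X Z \<and> p \<in> Z \<and> Z \<subseteq> W \<and> extendable Z (mres G (W \<inter> U0) (Z \<inter> U0) (hom_value U s W x))"
   using WZ p Z(2) by blast
 qed
qed

lemma hom_extends_free_gen:
 assumes \<epsilon>: "free_gen X F U \<epsilon>" and s: "s \<in> Ms G (U \<inter> U0)"
   and ext: "extendable U (coord U \<epsilon> *.[msec G (U \<inter> U0)] s)"
 shows "hom_extends U s"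
 unfolding hom_extends_def
proof (intro allI impI, elim conjE)
 note U = free_genD(1,2)[OF \<epsilon>]
 obtain r where r: "r \<in> Ms G U" "mres G U (U \<inter> U0) r = hom_value U s U \<epsilon>"
  using extendableE[OF ext] G.res_id[OF opn_Int_U0[OF U(1)] s] by metis
 fix W x assume W: "opn X W" "W \<subseteq> U" and x: "x \<in> Ms F W"
 obtain y where y: "y \<in> Os X W" "x = y *.[msec F W] mres F U W \<epsilon>" by (rule free_genE[OF \<epsilon> W x])
 note o = opn_Int_U0[OF W(1)] and \<epsilon>W = F.res_closed[OF U(1) W U(2)]
 interpret M: module "osec X (W \<inter> U0)" "msec G (W \<inter> U0)" by (rule G.module_sec[OF o])
 have "mres G W (W \<inter> U0) (mres G U W r) = hom_value U s W (mres F U W \<epsilon>)"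
  unfolding hom_value_res[OF U(1) s U(1) order_refl W U(2), symmetric] r(2)[symmetric]
  using G.res_res[OF U(1) W(1) o Int_U0_subset(1) W(2) r(1)]
   G.res_res[OF U(1) opn_Int_U0[OF U(1)] o Int_U0_subset(3)[OF W(2)] Int_U0_subset(1) r(1)] by simp
 hence "extendable W (hom_value U s W (mres F U W \<epsilon>))"
  by (rule extendableI[OF G.res_closed[OF U(1) W r(1)]])
 from extendable_smult[OF W(1) y(1) this] show "extendable W (hom_value U s W x)"
  unfolding y(2) coord_smult[OF W(1) y(1) \<epsilon>W]
   M.smult_assoc1[OF ores_closed[OF W(1) o Int_U0_subset(1) y(1)] coord_closed[OF W(1) \<epsilon>W]
     section_res_closed[OF U(1) W s]] .
qed

definition hom_extension :: "'n \<Rightarrow> 'p set \<Rightarrow> 'm \<Rightarrow> 'n"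
 where "hom_extension s U x = (SOME r. r \<in> Ms G U \<and> mres G U (U \<inter> U0) r = hom_value (pts X) s U x)"

context
 fixes s assumes s: "s \<in> Ms G U0" and ext: "hom_extends (pts X) s"
begin

private lemma P0: "pts X \<inter> U0 = U0" and s': "s \<in> Ms G (pts X \<inter> U0)"
 using openin_subset[OF opn_U0] s by (auto simp: Int_absorb1)

lemma hom_extension:
 assumes U: "opn X U" "x \<in> Ms F U"
 shows hom_extension_closed: "hom_extension s U x \<in> Ms G U"
  and hom_extension_res_U0: "mres G U (U \<inter> U0) (hom_extension s U x) = hom_value (pts X) s U x"
proof -
 have "\<exists>r. r \<in> Ms G U \<and> mres G U (U \<inter> U0) r = hom_value (pts X) s U x"
  using hom_extendsD[OF ext U(1) openin_subset[OF U(1)] U(2)] by (auto elim: extendableE)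
 from someI_ex[OF this] show "hom_extension s U x \<in> Ms G U"
   "mres G U (U \<inter> U0) (hom_extension s U x) = hom_value (pts X) s U x"
  unfolding hom_extension_def by blast+
qed

lemma hom_extension_eqI:
 assumes U: "opn X U" "x \<in> Ms F U" and r: "r \<in> Ms G U" "mres G U (U \<inter> U0) r = hom_value (pts X) s U x"
 shows "hom_extension s U x = r"
 by (rule G_section_eqI[OF U(1) hom_extension_closed[OF U] r(1)]) (simp only:
   hom_extension_res_U0[OF U] r(2))

lemma hom_extension_e0: "hom_extension s U0 e0 = s"
proof (rule hom_extension_eqI[OF opn_U0 e0_closed s])
 interpret M: module "osec X U0" "msec G U0" by (rule G.module_sec[OF opn_U0])
 show "mres G U0 (U0 \<inter> U0) s = hom_value (pts X) s U0 e0" using s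
  by (simp add: P0 G.res_id[OF opn_U0 s] coord_e0)
qed

lemma hom_extension_mod_hom: "(\<lambda>U\<in>{U. opn X U}. \<lambda>x\<in>Ms F U. hom_extension s U x) \<in> mod_hom X F G"
proof (rule mod_homI[OF _ _ _ _ ring_sheaf F.mod_sheaf])
 fix U x assume U: "opn X U" and x: "x \<in> Ms F U"
 note o = opn_Int_U0[OF U] and sU = section_res_closed[OF opn_pts U openin_subset[OF U] s']
   and ext_x = hom_extension[OF U x]
 interpret M: module "osec X (U \<inter> U0)" "msec G (U \<inter> U0)" by (rule G.module_sec[OF o])
 show "hom_extension s U x \<in> Ms G U" by (rule ext_x(1))
 show "hom_extension s U (x +[msec F U] y) = hom_extension s U x +[msec G U] hom_extension s U y"
   if y: "y \<in> Ms F U" for y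
  by (rule hom_extension_eqI[OF U F.add_closed[OF U x y]
    G.add_closed[OF U ext_x(1) hom_extension(1)[OF U y]]])
   (simp add: G.res_add[OF U o Int_U0_subset(1) ext_x(1) hom_extension(1)[OF U y]] ext_x(2)
     hom_extension(2)[OF U y] coord_add[OF U x y]
    M.smult_l_distr[OF coord_closed[OF U x] coord_closed[OF U y] sU])
 show "hom_extension s U (a *.[msec F U] x) = a *.[msec G U] hom_extension s U x"
   if a: "a \<in> Os X U" for a
  by (rule hom_extension_eqI[OF U F.smult_closed[OF U a x] G.smult_closed[OF U a ext_x(1)]])
   (simp add: G.res_smult[OF U o Int_U0_subset(1) a ext_x(1)] ext_x(2) coord_smult[OF U a x]
    M.smult_assoc1[OF ores_closed[OF U o Int_U0_subset(1) a] coord_closed[OF U x] sU])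
 show "hom_extension s W (mres F U W x) = mres G U W (hom_extension s U x)"
   if W: "opn X W" "W \<subseteq> U" for W
 proof (rule hom_extension_eqI[OF W(1) F.res_closed[OF U W x] G.res_closed[OF U W ext_x(1)]])
  show "mres G W (W \<inter> U0) (mres G U W (hom_extension s U x)) = hom_value (pts X) s W (mres F U W x)"
   unfolding hom_value_res[OF opn_pts s' U openin_subset[OF U] W x, symmetric] ext_x(2)[symmetric]
   using G.res_res[OF U W(1) opn_Int_U0[OF W(1)] Int_U0_subset(1) W(2) ext_x(1)]
    G.res_res[OF U o opn_Int_U0[OF W(1)] Int_U0_subset(3)[OF W(2)] Int_U0_subset(1) ext_x(1)] by simp
 qed
qed

lemma ex_hom_extension: "\<exists>\<phi>\<in>mod_hom X F G. \<phi> U0 e0 = s"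
 using hom_extension_mod_hom hom_extension_e0 opn_U0 e0_closed by (intro bexI) simp_all

end

subsection \<open>The sheaf of homomorphisms\<close>

text \<open>\<open>\<H>om(F, G)\<close>, realized inside the sections of \<open>G\<close> over \<open>U\<^sub>0\<close> as the values at \<open>e\<^sub>0\<close>. In this
  form its sections have the same type as those of \<open>G\<close>.\<close>

definition hom_sheaf :: "('p, 'a, 'n) msheaf"
  where "hom_sheaf = subsheaf (open_image X U0 G) hom_extends"

lemma hom_sheaf_sel:
 "Ms hom_sheaf U = {s. s \<in> Ms G (U \<inter> U0) \<and> hom_extends U s}"
 "a *.[msec hom_sheaf U] s = ores X U (U \<inter> U0) a *.[msec G (U \<inter> U0)] s"
 "mres hom_sheaf U W = mres G (U \<inter> U0) (W \<inter> U0)"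
 by (simp_all add: hom_sheaf_def)

lemma hom_extends_zero: assumes U: "opn X U" shows "hom_extends U 0[msec G (U \<inter> U0)]"
 unfolding hom_extends_def
proof (intro allI impI, elim conjE)
 fix W x assume W: "opn X W" "W \<subseteq> U" and x: "x \<in> Ms F W"
 note o = opn_Int_U0[OF W(1)]
 show "extendable W (hom_value U 0[msec G (U \<inter> U0)] W x)"
  unfolding G.res_zero[OF opn_Int_U0[OF U] o Int_U0_subset(3)[OF W(2)]]
   module.smult_r_null[OF G.module_sec[OF o] coord_closed[OF W(1) x]] by (rule extendable_zero[OF W(1)])
qed

lemma hom_extends_add:
 assumes U: "opn X U" and s: "s \<in> Ms G (U \<inter> U0)" "t \<in> Ms G (U \<inter> U0)" and ext: "hom_extends U s"
   "hom_extends U t"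
 shows "hom_extends U (s +[msec G (U \<inter> U0)] t)"
 unfolding hom_extends_def
proof (intro allI impI, elim conjE)
 fix W x assume W: "opn X W" "W \<subseteq> U" "x \<in> Ms F W"
 note o = opn_Int_U0[OF W(1)] and closed = section_res_closed[OF U W(1,2)]
 show "extendable W (hom_value U (s +[msec G (U \<inter> U0)] t) W x)"
  unfolding G.res_add[OF opn_Int_U0[OF U] o Int_U0_subset(3)[OF W(2)] s]
   module.smult_r_distr[OF G.module_sec[OF o] coord_closed[OF W(1,3)] closed[OF s(1)] closed[OF s(2)]]
  by (rule extendable_add[OF W(1) hom_extendsD[OF ext(1) W] hom_extendsD[OF ext(2) W]])
qed

lemma hom_extends_smult:
 assumes U: "opn X U" and a: "a \<in> Os X U" and s: "s \<in> Ms G (U \<inter> U0)" "hom_extends U s"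
 shows "hom_extends U (ores X U (U \<inter> U0) a *.[msec G (U \<inter> U0)] s)"
 unfolding hom_extends_def
proof (intro allI impI, elim conjE)
 fix W x assume W: "opn X W" "W \<subseteq> U" "x \<in> Ms F W"
 note o = opn_Int_U0[OF W(1)] and oU = opn_Int_U0[OF U] and sub = Int_U0_subset(3)[OF W(2)]
 interpret M: module "osec X (W \<inter> U0)" "msec G (W \<inter> U0)" by (rule G.module_sec[OF o])
 let ?a = "ores X (U \<inter> U0) (W \<inter> U0) (ores X U (U \<inter> U0) a)" and ?s = "mres G (U \<inter> U0) (W \<inter> U0) s"
 have a_res: "ores X W (W \<inter> U0) (ores X U W a) = ?a"
  using ores_ores[OF U W(1) o Int_U0_subset(1) W(2) a] ores_ores[OF U oU o sub Int_U0_subset(1) a]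
  by simp
 have aU: "ores X U (U \<inter> U0) a \<in> Os X (U \<inter> U0)" and aW: "?a \<in> Os X (W \<inter> U0)"
  using ores_closed[OF U oU Int_U0_subset(1) a] ores_closed[OF oU o sub] by blast+
 have "coord W x *.[msec G (W \<inter> U0)] (?a *.[msec G (W \<inter> U0)] ?s) =
   ?a *.[msec G (W \<inter> U0)] hom_value U s W x"
  using coord_closed[OF W(1,3)] aW section_res_closed[OF U W(1,2) s(1)]
  by (metis M.smult_assoc1 M.R.m_comm)
 thus "extendable W (hom_value U (ores X U (U \<inter> U0) a *.[msec G (U \<inter> U0)] s) W x)"
  unfolding G.res_smult[OF oU o sub aU s(1)]
  using extendable_smult[OF W(1) ores_closed[OF U W(1,2) a] hom_extendsD[OF s(2) W]]
  by (simp add: a_res)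
qed

lemma mod_sheaf_hom_sheaf: "mod_sheaf X hom_sheaf"
proof -
 interpret J: module_sheaf X "open_image X U0 G"
   by unfold_locales (rule G.mod_sheaf_open_image[OF opn_U0])
 show ?thesis unfolding hom_sheaf_def
  by (rule J.mod_sheaf_subsheaf)
   (simp_all add: hom_extends_zero hom_extends_add hom_extends_smult hom_extends_res hom_extends_local)
qed

abbreviation hom_gen :: "'p set \<Rightarrow> 'n \<Rightarrow> 'a \<Rightarrow> 'n"
 where "hom_gen U \<eta> a \<equiv> a *.[msec G (U \<inter> U0)] mres G U (U \<inter> U0) \<eta>"

context
 fixes U \<epsilon> \<eta> a
 assumes \<epsilon>: "free_gen X F U \<epsilon>" and \<eta>: "free_gen X G U \<eta>" and a: "transition X F (U \<inter> U0) U0 e0 U \<epsilon> a"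
begin

private lemma U: "opn X U" "\<epsilon> \<in> Ms F U" "\<eta> \<in> Ms G U" and opn_D: "opn X (U \<inter> U0)"
 using free_genD(1,2)[OF \<epsilon>] free_genD(2)[OF \<eta>] opn_U0 by auto

private lemma a_closed: "a \<in> Os X (U \<inter> U0)" and \<eta>_res: "mres G U (U \<inter> U0) \<eta> \<in> Ms G (U \<inter> U0)"
 by (rule transitionD(4)[OF a], rule G.res_closed[OF U(1) opn_D Int_U0_subset(1) U(3)])

private lemma coord_mult_a: "coord U \<epsilon> *[osec X (U \<inter> U0)] a = 1[osec X (U \<inter> U0)]"
 by (rule F.transition_inverse[OF \<epsilon> coord_transition[OF U(1,2)] a])

lemma hom_gen_closed: "hom_gen U \<eta> a \<in> Ms hom_sheaf U"
proof -
 interpret D: module "osec X (U \<inter> U0)" "msec G (U \<inter> U0)" by (rule G.module_sec[OF opn_D])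
 have "coord U \<epsilon> *.[msec G (U \<inter> U0)] hom_gen U \<eta> a = mres G U (U \<inter> U0) \<eta>"
  using D.smult_assoc1[OF coord_closed[OF U(1,2)] a_closed \<eta>_res] coord_mult_a \<eta>_res by simp
 hence "hom_extends U (hom_gen U \<eta> a)"
  by (intro hom_extends_free_gen[OF \<epsilon> D.smult_closed[OF a_closed \<eta>_res] extendableI[OF U(3)]]) simp
 thus ?thesis using D.smult_closed[OF a_closed \<eta>_res] by (simp add: hom_sheaf_sel)
qed

context
 fixes W assumes W: "opn X W" "W \<subseteq> U"
begin

private abbreviation (input) a' where "a' \<equiv> ores X (U \<inter> U0) (W \<inter> U0) a"
private abbreviation (input) c' where "c' \<equiv> ores X (U \<inter> U0) (W \<inter> U0) (coord U \<epsilon>)"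
private abbreviation (input) \<eta>' where "\<eta>' \<equiv> mres G U (W \<inter> U0) \<eta>"

private lemma opn_W: "opn X (W \<inter> U0)" and W_subset: "W \<inter> U0 \<subseteq> U \<inter> U0" "W \<inter> U0 \<subseteq> U"
 using opn_Int_U0[OF W(1)] W(2) by auto

interpretation M: module "osec X (W \<inter> U0)" "msec G (W \<inter> U0)" by (rule G.module_sec[OF opn_W])

private lemma closed: "a' \<in> Os X (W \<inter> U0)" "c' \<in> Os X (W \<inter> U0)" "\<eta>' \<in> Ms G (W \<inter> U0)"
 using ores_closed[OF opn_D opn_W W_subset(1)] a_closed coord_closed[OF U(1,2)] G.res_closed[OF U(1)
   opn_W W_subset(2) U(3)] by blast+

private lemma inverse: "a' *[osec X (W \<inter> U0)] c' = 1[osec X (W \<inter> U0)]"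
 using ores_mult[OF opn_D opn_W W_subset(1) coord_closed[OF U(1,2)]
   a_closed] coord_mult_a ores_one[OF opn_D opn_W W_subset(1)]
  M.R.m_comm[OF closed(1,2)] by simp

private lemma y_res: "y \<in> Os X W \<Longrightarrow> ores X W (W \<inter> U0) y \<in> Os X (W \<inter> U0)"
 by (rule ores_closed[OF W(1) opn_W Int_U0_subset(1)])

lemma smult_hom_gen:
 assumes y: "y \<in> Os X W"
 shows "y *.[msec hom_sheaf W] mres hom_sheaf U W (hom_gen U \<eta> a) =
   (ores X W (W \<inter> U0) y *[osec X (W \<inter> U0)] a') *.[msec G (W \<inter> U0)] \<eta>'"
 unfolding hom_sheaf_sel G.res_smult[OF opn_D opn_W W_subset(1) a_closed \<eta>_res] G.res_res[OF U(1)
   opn_D opn_W W_subset(1) Int_U0_subset(1) U(3)]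
 by (rule M.smult_assoc1[OF y_res[OF y] closed(1,3), symmetric])

lemma hom_gen_generates:
 assumes "t \<in> Ms hom_sheaf W"
 shows "\<exists>y\<in>Os X W. t = y *.[msec hom_sheaf W] mres hom_sheaf U W (hom_gen U \<eta> a)"
proof -
 have t: "t \<in> Ms G (W \<inter> U0)" "hom_extends W t" using assms by (auto simp: hom_sheaf_sel)
 obtain r where r: "r \<in> Ms G W" "mres G W (W \<inter> U0) r = c' *.[msec G (W \<inter> U0)] t"
  using hom_extendsD[OF t(2) W(1) order_refl F.res_closed[OF U(1) W U(2)]]
  unfolding coord_res[OF U(1) W U(2)] G.res_id[OF opn_W t(1)] by (rule extendableE)
 obtain y where y: "y \<in> Os X W" "r = y *.[msec G W] mres G U W \<eta>" by (rule free_genE[OF \<eta> W r(1)])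
 have "mres G W (W \<inter> U0) r = ores X W (W \<inter> U0) y *.[msec G (W \<inter> U0)] \<eta>'"
  unfolding y(2) G.res_smult[OF W(1) opn_W Int_U0_subset(1) y(1) G.res_closed[OF U(1) W U(3)]]
   G.res_res[OF U(1) W(1) opn_W Int_U0_subset(1) W(2) U(3)] ..
 hence "(a' *[osec X (W \<inter> U0)] c') *.[msec G (W \<inter> U0)] t =
   (a' *[osec X (W \<inter> U0)] ores X W (W \<inter> U0) y) *.[msec G (W \<inter> U0)] \<eta>'"
  using r(2) by (simp add: M.smult_assoc1[OF closed(1,2) t(1)]
    M.smult_assoc1[OF closed(1) y_res[OF y(1)] closed(3)])
 hence "t = y *.[msec hom_sheaf W] mres hom_sheaf U W (hom_gen U \<eta> a)"
  unfolding smult_hom_gen[OF y(1)] inverse using t(1)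
  by (simp add: M.R.m_comm[OF closed(1) y_res[OF y(1)]])
 with y(1) show ?thesis by (intro bexI)
qed

lemma hom_gen_cancel:
 assumes y: "y \<in> Os X W" and z: "z \<in> Os X W"
  and eq: "y *.[msec hom_sheaf W] mres hom_sheaf U W (hom_gen U \<eta> a) =
    z *.[msec hom_sheaf W] mres hom_sheaf U W (hom_gen U \<eta> a)"
 shows "y = z"
proof (cases "W = {}")
 case True
 thus ?thesis using osec_empty y z by simp
next
 case False
 let ?y = "ores X W (W \<inter> U0) y" and ?z = "ores X W (W \<inter> U0) z"
 have "?y *[osec X (W \<inter> U0)] a' = ?z *[osec X (W \<inter> U0)] a'"
  by (rule G.free_gen_cancel[OF \<eta> opn_W W_subset(2) M.R.m_closed[OF y_res[OF y] closed(1)]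
    M.R.m_closed[OF y_res[OF z] closed(1)]])
   (use eq[unfolded smult_hom_gen[OF y] smult_hom_gen[OF z]] in simp)
 hence "?y *[osec X (W \<inter> U0)] (a' *[osec X (W \<inter> U0)] c') =
   ?z *[osec X (W \<inter> U0)] (a' *[osec X (W \<inter> U0)] c')"
  by (simp add: M.R.m_assoc[OF y_res[OF y] closed(1,2), symmetric]
    M.R.m_assoc[OF y_res[OF z] closed(1,2), symmetric])
 hence "?y = ?z" unfolding inverse using y_res[OF y] y_res[OF z] by simp
 thus ?thesis by (rule ores_inj[OF W(1) opn_W Int_U0_subset(1)
   opn_meet[OF W(1) opn_U0 False U0_nonempty] y z])
qed

end

lemma free_gen_hom_sheaf: "free_gen X hom_sheaf U (hom_gen U \<eta> a)"
 unfolding free_gen_def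
proof (intro conjI allI impI ballI U(1) hom_gen_closed; elim conjE)
 fix W t assume W: "opn X W" "W \<subseteq> U" and t: "t \<in> Ms hom_sheaf W"
 from hom_gen_generates[OF W t] hom_gen_cancel[OF W]
 show "\<exists>!y. y \<in> Os X W \<and> t = y *.[msec hom_sheaf W] mres hom_sheaf U W (hom_gen U \<eta> a)" by metis
qed

end

lemma free_gen_hom_sheaf_U0:
 assumes f0: "free_gen X G U0 f0" shows "free_gen X hom_sheaf U0 f0"
proof -
 interpret M: module "osec X U0" "msec G U0" by (rule G.module_sec[OF opn_U0])
 have "transition X F (U0 \<inter> U0) U0 e0 U0 e0 1[osec X U0]"
  using F.transition_refl[OF opn_U0 e0_closed opn_U0 order_refl] by simp
 from free_gen_hom_sheaf[OF e0 f0 this] show ?thesis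
  using G.res_id[OF opn_U0 free_genD(2)[OF f0]] free_genD(2)[OF f0] by simp
qed

lemma transition_hom_sheaf:
 assumes \<epsilon>: "free_gen X F U \<epsilon>" and \<eta>: "free_gen X G U \<eta>"
  and a: "transition X F (U \<inter> U0) U \<epsilon> U0 e0 a" and a': "transition X F (U \<inter> U0) U0 e0 U \<epsilon> a'"
  and b: "transition X G (U \<inter> U0) U0 f0 U \<eta> b"
 shows "transition X hom_sheaf (U \<inter> U0) U0 f0 U (hom_gen U \<eta> a') (a *[osec X (U \<inter> U0)] b)"
proof -
 let ?D = "U \<inter> U0"
 note D = transitionD(1-3)[OF a] and closed = transitionD(4)[OF a] transitionD(4)[OF a']
   transitionD(4)[OF b]
 interpret M: module "osec X ?D" "msec G ?D" by (rule G.module_sec[OF D(1)])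
 have \<eta>D: "mres G U ?D \<eta> \<in> Ms G ?D" by (rule
   G.res_closed[OF free_genD(1)[OF \<eta>] D(1,2) free_genD(2)[OF \<eta>]])
 note ab = M.R.m_closed[OF closed(1,3)] and gen = M.smult_closed[OF closed(2) \<eta>D]
 have "a *[osec X ?D] b *[osec X ?D] a' = b"
  using F.transition_inverse[OF \<epsilon> a a'] closed by (metis M.R.m_assoc M.R.m_comm M.R.l_one)
 hence "mres G U0 ?D f0 = (a *[osec X ?D] b) *.[msec G ?D] hom_gen U \<eta> a'"
  using transitionD(5)[OF b] M.smult_assoc1[OF ab closed(2) \<eta>D] by simp
 thus ?thesis
  using D ab G.res_id[OF D(1) gen] ores_id[OF D(1) ab]
  by (intro transitionI) (simp_all add: hom_sheaf_sel Int_assoc)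
qed

lemma common_free_gens:
 assumes "p \<in> pts X"
 obtains U \<epsilon> \<eta> where "p \<in> U" "free_gen X F U \<epsilon>" "free_gen X G U \<eta>"
proof -
 obtain U \<epsilon> where U: "p \<in> U" "free_gen X F U \<epsilon>" using line_bundleD(2)[OF line_bundle_F assms] by blast
 obtain W \<eta> where W: "p \<in> W" "free_gen X G W \<eta>" using line_bundleD(2)[OF line_bundle_G assms] by blast
 have o: "opn X (U \<inter> W)" using free_genD(1)[OF U(2)] free_genD(1)[OF W(2)] by blast
 show thesis
  by (rule that[of "U \<inter> W", OF _ F.free_gen_res[OF U(2) o] G.free_gen_res[OF W(2) o]]) (use U(1)
    W(1) in auto)
qed

lemma line_bundle_hom_sheaf: "line_bundle X hom_sheaf"
 unfolding line_bundle_def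
proof (intro conjI ballI mod_sheaf_hom_sheaf)
 fix p assume "p \<in> pts X"
 then obtain U \<epsilon> \<eta> where U: "p \<in> U" "free_gen X F U \<epsilon>" "free_gen X G U \<eta>" by (rule common_free_gens)
 obtain a where "transition X F (U \<inter> U0) U0 e0 U \<epsilon> a"
  by (rule F.free_gen_transitionE[OF U(2) opn_U0 e0_closed opn_Int_U0[OF free_genD(1)[OF U(2)]]
    Int_U0_subset(2,1)])
 from free_gen_hom_sheaf[OF U(2,3) this] U(1) show "\<exists>U e. p \<in> U \<and> free_gen X hom_sheaf U e" by blast
qed

end

section \<open>Coherence of line bundles\<close>

lemma (in module) finsum_smult_rdistr:
 assumes "finite B" "d \<in> B \<rightarrow> carrier R" "x \<in> carrier M"
 shows "finsum M (\<lambda>i. d i *.[M] x) B = finsum R d B *.[M] x"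
 using assms
proof (induction B)
 case (insert i B)
 have d: "d \<in> B \<rightarrow> carrier R" "d i \<in> carrier R" "(\<lambda>i. d i *.[M] x) \<in> B \<rightarrow> carrier M"
  using insert.prems by auto
 show ?case unfolding R.finsum_insert[OF insert.hyps d(1,2)] M.finsum_insert[OF insert.hyps d(3)
   smult_closed[OF d(2) insert.prems(2)]]
  using insert.IH[OF d(1) insert.prems(2)] smult_l_distr[OF d(2) R.finsum_closed[OF d(1)]
    insert.prems(2)] by simp
qed (simp add: smult_l_null)

context module_sheaf
begin

lemma free_gen_smult_eq_zero_iff:
 assumes g: "free_gen X F W g" and Z: "opn X Z" "Z \<subseteq> W" and d: "d \<in> Os X Z"
 shows "d *.[msec F Z] mres F W Z g = 0[msec F Z] \<longleftrightarrow> d = 0[osec X Z]"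
proof -
 interpret M: module "osec X Z" "msec F Z" by (rule module_sec[OF Z(1)])
 have "0[osec X Z] *.[msec F Z] mres F W Z g = 0[msec F Z]"
  by (rule M.smult_l_null[OF res_closed[OF free_genD(1)[OF g] Z free_genD(2)[OF g]]])
 thus ?thesis using free_gen_cancel[OF g Z d M.R.zero_closed] by auto
qed

lemma lin_comb_eq_zero_iff:
 assumes g: "free_gen X F W g" and U: "opn X U" and s: "s \<in> {..<n} \<rightarrow> Ms F U"
  and c: "\<And>i. i < n \<Longrightarrow> transition X F W U (s i) W g (c i)" and Z: "opn X Z"
    "Z \<subseteq> W" and b: "b \<in> {..<n} \<rightarrow> Os X Z"
 shows "lin_comb F U Z n b s = 0[msec F Z] \<longleftrightarrow>
   finsum (osec X Z) (\<lambda>i. b i *[osec X Z] ores X W Z (c i)) {..<n} = 0[osec X Z]"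
proof -
 interpret M: module "osec X Z" "msec F Z" by (rule module_sec[OF Z(1)])
 note W = free_genD(1,2)[OF g]
 note gZ = res_closed[OF W(1) Z W(2)]
 let ?d = "\<lambda>i. b i *[osec X Z] ores X W Z (c i)"
 have cZ: "transition X F Z U (s i) W g (ores X W Z (c i))" if "i < n" for i
  by (rule transition_res[OF c[OF that] U _ W Z]) (use s that in auto)
 have b': "b i \<in> Os X Z" if "i < n" for i using b that by auto
 have d: "?d \<in> {..<n} \<rightarrow> Os X Z" using b' transitionD(4)[OF cZ] by auto
 have "lin_comb F U Z n b s = finsum (msec F Z) (\<lambda>i. ?d i *.[msec F Z] mres F W Z g) {..<n}"
  unfolding lin_comb_def
 proof (rule M.M.finsum_cong')
  show "b i *.[msec F Z] mres F U Z (s i) = ?d i *.[msec F Z] mres F W Z g" if "i \<in> {..<n}" for i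
   using that M.smult_assoc1[OF b' transitionD(4)[OF cZ] gZ] transitionD(5)[OF cZ] by simp
 qed (use d gZ in auto)
 also have "... = finsum (osec X Z) ?d {..<n} *.[msec F Z] mres F W Z g"
  by (rule M.finsum_smult_rdistr[OF finite_lessThan d gZ])
 finally show ?thesis using free_gen_smult_eq_zero_iff[OF g Z M.R.finsum_closed[OF d]] by simp
qed

lemma line_bundle_finite_type:
 assumes "line_bundle X F" shows "finite_type X F"
 unfolding finite_type_def
proof
 fix p assume "p \<in> pts X"
 then obtain U e where p: "p \<in> U" and e: "free_gen X F U e" using line_bundleD(2)[OF assms] by blast
 have "\<exists>Z a. opn X Z \<and> q \<in> Z \<and> Z \<subseteq> W \<and> a \<in> {..<1} \<rightarrow> Os X Z \<and> mres F W Z t = lin_comb F U Z 1 a (\<lambda>_. e)"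
  if W: "opn X W" "W \<subseteq> U" and t: "t \<in> Ms F W" "q \<in> W" for W t q
 proof -
  interpret M: module "osec X W" "msec F W" by (rule module_sec[OF W(1)])
  obtain a where a: "a \<in> Os X W" "t = a *.[msec F W] mres F U W e" by (rule free_genE[OF e W t(1)])
  have "lin_comb F U W 1 (\<lambda>_. a) (\<lambda>_. e) = t"
   unfolding lin_comb_def using a(2) t(1) by (simp add: lessThan_Suc M.M.finsum_singleton)
  thus ?thesis using W t a(1) res_id[OF W(1) t(1)] by (intro exI[of _ W] exI[of _ "\<lambda>_. a"]) simp
 qed
 thus "\<exists>U n s. opn X U \<and> p \<in> U \<and> s \<in> {..<n} \<rightarrow> Ms F U \<and>
  (\<forall>W. opn X W \<and> W \<subseteq> U \<longrightarrow> (\<forall>t\<in>Ms F W. \<forall>q\<in>W. \<exists>Z a.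
   opn X Z \<and> q \<in> Z \<and> Z \<subseteq> W \<and> a \<in> {..<n} \<rightarrow> Os X Z \<and> mres F W Z t = lin_comb F U Z n a s))"
  using p free_genD(1,2)[OF e] by (intro exI[of _ U] exI[of _ 1] exI[of _ "\<lambda>_. e"]) simp
qed

end

definition relations_finite_type_at :: "('p, 'a) rspace \<Rightarrow> ('p, 'a, 'm) msheaf \<Rightarrow> 'p set \<Rightarrow> nat \<Rightarrow>
  (nat \<Rightarrow> 'm) \<Rightarrow> 'p \<Rightarrow> bool"
 where "relations_finite_type_at X F U n s p \<longleftrightarrow> (\<exists>W (m::nat) r. opn X W \<and> p \<in> W \<and> W \<subseteq> U \<and>
  (\<forall>j<m. r j \<in> {..<n} \<rightarrow> Os X W \<and> lin_comb F U W n (r j) s = 0[msec F W]) \<and>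
  (\<forall>Z b. opn X Z \<and> Z \<subseteq> W \<and> b \<in> {..<n} \<rightarrow> Os X Z \<and> lin_comb F U Z n b s = 0[msec F Z] \<longrightarrow>
   (\<forall>q\<in>Z. \<exists>Y c. opn X Y \<and> q \<in> Y \<and> Y \<subseteq> Z \<and> c \<in> {..<m} \<rightarrow> Os X Y \<and>
    (\<forall>i<n. ores X Z Y (b i) = finsum (osec X Y) (\<lambda>j. c j *[osec X Y] ores X W Y (r j i)) {..<m}))))"

lemma coherent_iff_relations:
 "coherent X F \<longleftrightarrow> mod_sheaf X F \<and> finite_type X F \<and>
  (\<forall>U n s p. opn X U \<and> s \<in> {..<n} \<rightarrow> Ms F U \<and> p \<in> U \<longrightarrow> relations_finite_type_at X F U n s p)"
 unfolding coherent_def relations_finite_type_at_def by blast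

lemma relations_finite_type_at_transfer:
 assumes rel: "relations_finite_type_at X F W n s' p" and W: "W \<subseteq> U"
  and iff: "\<And>Z b. \<lbrakk>opn X Z; Z \<subseteq> W; b \<in> {..<n} \<rightarrow> Os X Z\<rbrakk> \<Longrightarrow>
   lin_comb G U Z n b s = 0[msec G Z] \<longleftrightarrow> lin_comb F W Z n b s' = 0[msec F Z]"
 shows "relations_finite_type_at X G U n s p"
proof -
 obtain Y and m :: nat and r where Y: "opn X Y" "p \<in> Y" "Y \<subseteq> W"
  and r: "\<forall>j<m. r j \<in> {..<n} \<rightarrow> Os X Y \<and> lin_comb F W Y n (r j) s' = 0[msec F Y]"
  and generate: "\<forall>Z b. opn X Z \<and> Z \<subseteq> Y \<and> b \<in> {..<n} \<rightarrow> Os X Z \<and> lin_comb F W Z n b s' = 0[msec F Z] \<longrightarrow>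
   (\<forall>q\<in>Z. \<exists>Y' c. opn X Y' \<and> q \<in> Y' \<and> Y' \<subseteq> Z \<and> c \<in> {..<m} \<rightarrow> Os X Y' \<and>
    (\<forall>i<n. ores X Z Y' (b i) = finsum (osec X Y') (\<lambda>j. c j *[osec X Y'] ores X Y Y' (r j i)) {..<m}))"
  using rel unfolding relations_finite_type_at_def by (elim exE conjE) (rule that)
 have "opn X Z \<and> Z \<subseteq> Y \<and> b \<in> {..<n} \<rightarrow> Os X Z \<and> lin_comb F W Z n b s' = 0[msec F Z]"
  if "opn X Z \<and> Z \<subseteq> Y \<and> b \<in> {..<n} \<rightarrow> Os X Z \<and> lin_comb G U Z n b s = 0[msec G Z]" for Z b
  using that iff[of Z b] Y(3) by auto
 note generate' = generate[rule_format, OF this]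
 show ?thesis unfolding relations_finite_type_at_def
 proof (intro exI[of _ Y] exI[of _ m] exI[of _ r] conjI Y(1,2))
  show "Y \<subseteq> U" using Y(3) W by simp
  show "\<forall>j<m. r j \<in> {..<n} \<rightarrow> Os X Y \<and> lin_comb G U Y n (r j) s = 0[msec G Y]"
   using r iff[OF Y(1,3)] by simp
 qed (intro allI impI ballI, rule generate')
qed

lemma (in ringed_space) coherent_line_bundle:
 assumes F: "line_bundle X F" "coherent X F" and G: "line_bundle X G"
 shows "coherent X G"
proof -
 interpret F: module_sheaf X F by (rule line_bundle_module_sheaf[OF F(1)])
 interpret G: module_sheaf X G by (rule line_bundle_module_sheaf[OF G])
 have "relations_finite_type_at X G U n s p"
   if U: "opn X U" and s: "s \<in> {..<n} \<rightarrow> Ms G U" and p: "p \<in> U" for U n s p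
 proof -
  have "p \<in> pts X" using p openin_subset[OF U] by auto
  then obtain Wf f Wg g where f: "p \<in> Wf" "free_gen X F Wf f" and g: "p \<in> Wg" "free_gen X G Wg g"
   using line_bundleD(2)[OF F(1)] line_bundleD(2)[OF G] by meson
  let ?W = "U \<inter> (Wf \<inter> Wg)"
  have W: "opn X ?W" "?W \<subseteq> U" "?W \<subseteq> Wf" "?W \<subseteq> Wg" "p \<in> ?W"
   using U f g free_genD(1)[OF f(2)] free_genD(1)[OF g(2)] p by auto
  note f' = F.free_gen_res[OF f(2) W(1,3)] and g' = G.free_gen_res[OF g(2) W(1,4)]
  have "\<exists>c. transition X G ?W U (s i) ?W (mres G Wg ?W g) c" if "i < n" for i
   using G.free_gen_transitionE[OF g' U _ W(1,2) order_refl, of "s i"] s that by blast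
  then obtain c where c: "\<And>i. i < n \<Longrightarrow> transition X G ?W U (s i) ?W (mres G Wg ?W g) (c i)" by metis
  let ?s = "\<lambda>i. c i *.[msec F ?W] mres F Wf ?W f"
  have s': "?s i \<in> Ms F ?W" if "i < n" for i
   by (rule F.smult_closed[OF W(1) transitionD(4)[OF c[OF that]] free_genD(2)[OF f']])
  have c': "transition X F ?W ?W (?s i) ?W (mres F Wf ?W f) (c i)" if "i < n" for i
   using F.res_id[OF W(1) s'[OF that]] F.res_id[OF W(1) free_genD(2)[OF f']]
   by (intro transitionI W(1) transitionD(4)[OF c[OF that]]) simp_all
  have s'': "?s \<in> {..<n} \<rightarrow> Ms F ?W" using s' by simp
  have "relations_finite_type_at X F ?W n ?s p" using F(2) W(1,5) s''
   unfolding coherent_iff_relations by blast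
  thus ?thesis
   by (rule relations_finite_type_at_transfer[OF _ W(2)])
    (simp only: G.lin_comb_eq_zero_iff[OF g' U s c] F.lin_comb_eq_zero_iff[OF f' W(1) s'' c'])
 qed
 thus ?thesis unfolding coherent_iff_relations
  using G.mod_sheaf G.line_bundle_finite_type[OF G] by blast
qed

section \<open>Twisting by an ample line bundle\<close>

locale module_sheaf_iso = module_sheaf X F for X :: "('p, 'a) rspace" and F :: "('p, 'a, 'm) msheaf" +
 fixes G :: "('p, 'a, 'n) msheaf" and \<phi> :: "'p set \<Rightarrow> 'm \<Rightarrow> 'n"
 assumes mod_hom: "\<phi> \<in> mod_hom X F G" and bij: "opn X U \<Longrightarrow> bij_betw (\<phi> U) (Ms F U) (Ms G U)"
begin

lemma eq_iff: "\<lbrakk>opn X U; s \<in> Ms F U; t \<in> Ms F U\<rbrakk> \<Longrightarrow> \<phi> U s = \<phi> U t \<longleftrightarrow> s = t"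
 by (rule inj_on_eq_iff[OF bij_betw_imp_inj_on[OF bij]])

lemma smult_res_iff:
 assumes "opn X W" "t \<in> Ms F W" "opn X D" "D \<subseteq> W" "a \<in> Os X D" "s \<in> Ms F D"
 shows "\<phi> D s = a *.[msec G D] mres G W D (\<phi> W t) \<longleftrightarrow> s = a *.[msec F D] mres F W D t"
 using eq_iff[OF assms(3,6) smult_closed[OF assms(3,5) res_closed[OF assms(1,3,4,2)]]]
  mod_homD(3)[OF mod_hom assms(3,5) res_closed[OF assms(1,3,4,2)]] mod_homD(4)[OF mod_hom
    assms(1,3,4,2)] by simp

lemma transition_iff:
 assumes "opn X U" "s \<in> Ms F U" "opn X W" "t \<in> Ms F W"
 shows "transition X G D U (\<phi> U s) W (\<phi> W t) a \<longleftrightarrow> transition X F D U s W t a"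
 unfolding transition_def
 using smult_res_iff[OF assms(3,4) _ _ _
   res_closed[OF assms(1) _ _ assms(2)]] mod_homD(4)[OF mod_hom assms(1) _ _ assms(2)] by metis

lemma free_gen_iff:
 assumes "e \<in> Ms F U" shows "free_gen X G U (\<phi> U e) \<longleftrightarrow> free_gen X F U e"
proof -
 have generates_iff: "(\<forall>s\<in>Ms G W. \<exists>!a. a \<in> Os X W \<and> s = a *.[msec G W] mres G U W (\<phi> U e)) \<longleftrightarrow>
   (\<forall>s\<in>Ms F W. \<exists>!a. a \<in> Os X W \<and> s = a *.[msec F W] mres F U W
     e)" if U: "opn X U" and W: "opn X W" "W \<subseteq> U" for W
 proof -
  have "(\<exists>!a. a \<in> Os X W \<and> \<phi> W s = a *.[msec G W] mres G U W (\<phi> U e)) \<longleftrightarrow>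
    (\<exists>!a. a \<in> Os X W \<and> s = a *.[msec F W] mres F U W e)"
   if "s \<in> Ms F W" for s
   using smult_res_iff[OF U assms W _ that] by metis
  moreover have "(\<forall>s\<in>Ms G W. Q s) \<longleftrightarrow> (\<forall>s\<in>Ms F W. Q (\<phi> W s))" for Q
   by (subst bij_betw_imp_surj_on[OF bij[OF W(1)], symmetric]) simp
  ultimately show ?thesis by simp
 qed
 show ?thesis unfolding free_gen_def
 proof (intro conj_cong iff_allI imp_cong refl; (elim conjE)?)
  show "\<phi> U e \<in> Ms G U \<longleftrightarrow> e \<in> Ms F U" if "opn X U"
   using assms mod_homD(1)[OF mod_hom that assms] by blast
 qed (rule generates_iff)
qed

lemma ex_free_gen:
 assumes "free_gen X G U g"
 shows "\<exists>e. free_gen X F U e \<and> \<phi> U e = g"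
proof -
 have "g \<in> \<phi> U ` Ms F U"
  unfolding bij_betw_imp_surj_on[OF bij[OF free_genD(1)[OF assms]]] by (rule free_genD(2)[OF assms])
 thus ?thesis using assms free_gen_iff by blast
qed

end

lemma mod_isoE:
 assumes "mod_iso X F G" "ring_sheaf X" "mod_sheaf X F"
 obtains \<phi> where "module_sheaf_iso X F G \<phi>"
proof -
 obtain \<phi> where "\<phi> \<in> mod_hom X F G" "\<forall>U. opn X U \<longrightarrow> bij_betw (\<phi> U) (Ms F U) (Ms G U)"
  using assms(1) unfolding mod_iso_def by (elim bexE)
 thus thesis using assms(2,3)
  by (intro that[of \<phi>] module_sheaf_iso.intro module_sheaf.intro ringed_space.intro
    module_sheaf_axioms.intro module_sheaf_iso_axioms.intro) simp_all
qed

text \<open>\<open>g U w t\<close> plays the role of the generator \<open>w \<otimes> t\<^sup>m\<close> of \<open>P \<cong> F \<otimes> A\<^sup>m\<close>.\<close>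

definition twisted_frames ::
 "('p, 'a) rspace \<Rightarrow> ('p, 'a, 'm) msheaf \<Rightarrow> ('p, 'a, 'l) msheaf \<Rightarrow> nat \<Rightarrow> ('p, 'a, 'n) msheaf \<Rightarrow>
   ('p set \<Rightarrow> 'm \<Rightarrow> 'l \<Rightarrow> 'n) \<Rightarrow> bool"
 where "twisted_frames X F A m P g \<longleftrightarrow>
  (\<forall>U w t. free_gen X F U w \<and> free_gen X A U t \<longrightarrow> free_gen X P U (g U w t)) \<and>
  (\<forall>D U w t W w' t' a b. free_gen X F U w \<and> free_gen X A U t \<and> free_gen X F W w' \<and> free_gen X A W t' \<and>
    transition X F D U w W w' a \<and> transition X A D U t W t' b \<longrightarrow>
   transition X P D U (g U w t) W (g W w' t') (a *[osec X D] b ^[osec X D] m))"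

lemma twisted_framesD:
 assumes "twisted_frames X F A m P g" "free_gen X F U w" "free_gen X A U t"
 shows "free_gen X P U (g U w t)"
  "\<lbrakk>free_gen X F W w'; free_gen X A W t'; transition X F D U w W w' a; transition X A D U t W t' b\<rbrakk> \<Longrightarrow>
   transition X P D U (g U w t) W (g W w' t') (a *[osec X D] b ^[osec X D] m)"
 using assms unfolding twisted_frames_def by blast+

lemma twisted_framesI:
 assumes "\<And>U w t. \<lbrakk>free_gen X F U w; free_gen X A U t\<rbrakk> \<Longrightarrow> free_gen X P U (g U w t)"
  and "\<And>D U w t W w' t' a b. \<lbrakk>free_gen X F U w; free_gen X A U t; free_gen X F W w'; free_gen X A W t';
    transition X F D U w W w' a; transition X A D U t W t' b\<rbrakk> \<Longrightarrow>
   transition X P D U (g U w t) W (g W w' t') (a *[osec X D] b ^[osec X D] m)"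
 shows "twisted_frames X F A m P g"
 using assms unfolding twisted_frames_def by blast

context ringed_space
begin

lemma twisted_frames_0: "twisted_frames X F A 0 F (\<lambda>U w t. w)"
proof (rule twisted_framesI)
 fix D U w W w' a assume a: "transition X F D U w W w' a"
 interpret cring "osec X D" by (rule cring_O[OF transitionD(1)[OF a]])
 show "transition X F D U w W w' (a *[osec X D] b ^[osec X D] (0::nat))" for b
  using a transitionD(4)[OF a] by simp
qed

lemma twisted_frames_Suc:
 assumes g: "twisted_frames X F A m P g" and h: "twisted_frames X P A 1 P' h"
 shows "twisted_frames X F A (Suc m) P' (\<lambda>U w t. h U (g U w t) t)"
proof (rule twisted_framesI)
 fix U w t assume U: "free_gen X F U w" "free_gen X A U t"
 note gU = twisted_framesD(1)[OF g U]
 show "free_gen X P' U (h U (g U w t) t)" by (rule twisted_framesD(1)[OF h gU U(2)])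
 fix D W w' t' a b assume W: "free_gen X F W w'" "free_gen X A W t'"
  and ab: "transition X F D U w W w' a" "transition X A D U t W t' b"
 interpret cring "osec X D" by (rule cring_O[OF transitionD(1)[OF ab(1)]])
 have "a *[osec X D] b ^[osec X D] m *[osec X D] b ^[osec X D] (1::nat) =
   a *[osec X D] b ^[osec X D] Suc m"
  using transitionD(4)[OF ab(1)] transitionD(4)[OF ab(2)] by (simp add: m_assoc)
 thus "transition X P' D U (h U (g U w t) t) W (h W (g W w' t') t') (a *[osec X D] b ^[osec X D] Suc m)"
  using twisted_framesD(2)[OF h gU U(2) twisted_framesD(1)[OF g W] W(2)
    twisted_framesD(2)[OF g U W ab] ab(2)] by simp
qed

lemma line_bundle_twisted_frames:
 assumes F: "line_bundle X F" and A: "line_bundle X A" and P: "mod_sheaf X P"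
   and g: "twisted_frames X F A m P g"
 shows "line_bundle X P"
 unfolding line_bundle_def
proof (intro conjI ballI P)
 interpret F: module_sheaf X F by (rule line_bundle_module_sheaf[OF F])
 interpret A: module_sheaf X A by (rule line_bundle_module_sheaf[OF A])
 fix p assume p: "p \<in> pts X"
 obtain U w where U: "p \<in> U" "free_gen X F U w" using line_bundleD(2)[OF F p] by blast
 obtain W t where W: "p \<in> W" "free_gen X A W t" using line_bundleD(2)[OF A p] by blast
 have I: "opn X (U \<inter> W)" "U \<inter> W \<subseteq> U" "U \<inter> W \<subseteq> W"
  using free_genD(1)[OF U(2)] free_genD(1)[OF W(2)] by auto
 from twisted_framesD(1)[OF g F.free_gen_res[OF U(2) I(1,2)] A.free_gen_res[OF W(2) I(1,3)]] U(1) W(1)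
 show "\<exists>U e. p \<in> U \<and> free_gen X P U e" by blast
qed

end

lemma ex_twisted_frames_tensor:
 assumes X: "lrs X" and P: "line_bundle X P" and A: "line_bundle X A" and P': "mod_sheaf X P'"
   and iso: "mod_iso X P' (tensor X P A)"
 shows "\<exists>h. twisted_frames X P A 1 P' h"
proof -
 interpret ringed_space X by unfold_locales (use X in \<open>simp add: lrs_def\<close>)
 interpret T: line_bundle_tensor X P A by (rule line_bundle_tensorI[OF X P line_bundleD(1)[OF A]])
 obtain \<phi> where \<phi>: "module_sheaf_iso X P' T.FG \<phi>"
  using mod_isoE[OF iso ring_sheaf P'] unfolding T.tensor_eq by blast
 interpret \<phi>: module_sheaf_iso X P' T.FG \<phi> by (rule \<phi>)
 have pure: "free_gen X T.FG U (T.pure_section U w U t)"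
   if "free_gen X P U w" "free_gen X A U t" for U w t
  using T.free_gen_pure_section[OF _ that] preim_mor_id[OF free_genD(1)[OF that(1)]] by simp
 define h where "h U w t = (SOME e. free_gen X P' U e \<and> \<phi> U e = T.pure_section U w U t)" for U w t
 have h: "free_gen X P' U (h U w t)" "\<phi> U (h U w t) = T.pure_section U w U t"
   if U: "free_gen X P U w" "free_gen X A U t" for U w t
  unfolding h_def using someI_ex[OF \<phi>.ex_free_gen[OF pure[OF U]]] by blast+
 have "twisted_frames X P A 1 P' h"
 proof (rule twisted_framesI)
  fix U w t assume U: "free_gen X P U w" "free_gen X A U t"
  show "free_gen X P' U (h U w t)" by (rule h(1)[OF U])
  fix D W w' t' a b assume W: "free_gen X P W w'" "free_gen X A W t'"
   and ab: "transition X P D U w W w' a" "transition X A D U t W t' b"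
  note D = transitionD[OF ab(1)]
  interpret O: cring "osec X D" by (rule cring_O[OF D(1)])
  have pre: "preim X mor_id U = U" "preim X mor_id W = W" "preim X mor_id D = D"
   using preim_mor_id free_genD(1)[OF U(1)] free_genD(1)[OF W(1)] D(1) by blast+
  have "T.pull D D a = a" unfolding pre using ores_id[OF D(1,4)] by (simp add: mor_id_def)
  hence "transition X T.FG D U (T.pure_section U w U t) W (T.pure_section W w' W t') (a *[osec X D] b)"
   using T.transition_pure_section[OF ab free_genD(1,2)[OF U(1)] W(1) free_genD(1,2)[OF U(2)]
     free_genD(1,2)[OF W(2)]] pre by simp
  hence "transition X P' D U (h U w t) W (h W w' t') (a *[osec X D] b)"
   unfolding h(2)[OF U, symmetric] h(2)[OF W, symmetric]
   by (simp only: \<phi>.transition_iff[OF free_genD(1,2)[OF h(1)[OF U]] free_genD(1,2)[OF h(1)[OF W]]])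
  thus "transition X P' D U (h U w t) W (h W w' t') (a *[osec X D] b ^[osec X D] (1::nat))"
   using transitionD(4)[OF ab(2)] by simp
 qed
 thus ?thesis by blast
qed

lemma ex_twisted_frames:
 assumes X: "lrs X" and A: "line_bundle X A" and P0: "line_bundle X (P 0)"
  and P: "\<And>m. mod_sheaf X (P m)" "\<And>m. mod_iso X (P (Suc m)) (tensor X (P m) A)"
 shows "\<exists>g. twisted_frames X (P 0) A m (P m) g"
proof (induction m)
 interpret ringed_space X by unfold_locales (use X in \<open>simp add: lrs_def\<close>)
 case 0
 show ?case using twisted_frames_0 by blast
next
 interpret ringed_space X by unfold_locales (use X in \<open>simp add: lrs_def\<close>)
 case (Suc m)
 then obtain g where g: "twisted_frames X (P 0) A m (P m) g" by blast
 obtain h where "twisted_frames X (P m) A 1 (P (Suc m)) h"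
  using ex_twisted_frames_tensor[OF X line_bundle_twisted_frames[OF P0 A P(1) g] A P] by blast
 from twisted_frames_Suc[OF g this] show ?case by blast
qed

lemma (in module_sheaf) nonzero_global_section:
 assumes gg: "globally_generated X F" and w: "free_gen X F U0 w" and p: "p \<in> U0"
  and one: "\<And>W. opn X W \<Longrightarrow> W \<noteq> {} \<Longrightarrow> 1[osec X W] \<noteq> 0[osec X W]"
 obtains \<tau> \<xi> where "\<tau> \<in> Ms F (pts X)" "transition X F U0 (pts X) \<tau> U0 w \<xi>" "\<xi> \<noteq> 0[osec X U0]"
proof -
 note U0 = free_genD(1,2)[OF w]
 note sub = openin_subset[OF U0(1)]
 obtain W and n :: nat and t a where W: "opn X W" "p \<in> W" "W \<subseteq> U0" and t: "t \<in> {..<n} \<rightarrow> Ms F (pts X)"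
  and a: "a \<in> {..<n} \<rightarrow> Os X W" and eq: "mres F U0 W w = lin_comb F (pts X) W n a t"
  using gg U0 p unfolding globally_generated_def by meson
 interpret M0: module "osec X U0" "msec F U0" by (rule module_sec[OF U0(1)])
 interpret M: module "osec X W" "msec F W" by (rule module_sec[OF W(1)])
 have "\<exists>i<n. mres F (pts X) U0 (t i) \<noteq> 0[msec F U0]"
 proof (rule ccontr)
  assume "\<not> (\<exists>i<n. mres F (pts X) U0 (t i) \<noteq> 0[msec F U0])"
  hence zero: "mres F (pts X) U0 (t i) = 0[msec F U0]" if "i < n" for i using that by blast
  have "a i *.[msec F W] mres F (pts X) W (t i) = 0[msec F W]" if i: "i \<in> {..<n}" for i
  proof -
   have ti: "t i \<in> Ms F (pts X)" "a i \<in> Os X W" using t a i by auto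
   have "mres F (pts X) W (t i) = 0[msec F W]"
    using res_res[OF opn_pts U0(1) W(1,3) sub ti(1)] zero[of i] i res_zero[OF U0(1) W(1,3)] by simp
   thus ?thesis using M.smult_r_null[OF ti(2)] by simp
  qed
  hence "lin_comb F (pts X) W n a t = 0[msec F W]" unfolding lin_comb_def
   by (rule M.M.add.finprod_one_eqI)
  hence "1[osec X W] *.[msec F W] mres F U0 W w = 0[msec F W]" using eq by (simp add: M.smult_r_null)
  hence "1[osec X W] = 0[osec X W]" using free_gen_smult_eq_zero_iff[OF w W(1,3) M.R.one_closed] by simp
  thus False using one[OF W(1)] W(2) by auto
 qed
 then obtain i where i: "i < n" "mres F (pts X) U0 (t i) \<noteq> 0[msec F U0]" by blast
 have ti: "t i \<in> Ms F (pts X)" using t i(1) by auto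
 obtain \<xi> where \<xi>: "transition X F U0 (pts X) (t i) U0 w \<xi>"
  by (rule free_gen_transitionE[OF w opn_pts ti U0(1) sub order_refl])
 have "\<xi> \<noteq> 0[osec X U0]" using i(2) transitionD(5)[OF \<xi>] M0.smult_l_null res_id[OF U0] U0(2) by auto
 with ti \<xi> show thesis by (rule that)
qed

section \<open>The total space\<close>

lemma (in ringed_space) free_gen_osheaf:
 assumes W: "opn X W" shows "free_gen X (osheaf X) W 1[osec X W]"
proof -
 have "\<exists>!a. a \<in> Os X Z \<and> s = a *[osec X Z] ores X W Z 1[osec X W]"
   if Z: "opn X Z" "Z \<subseteq> W" "s \<in> Os X Z" for Z s
 proof -
  interpret cring "osec X Z" by (rule cring_O[OF Z(1)])
  show ?thesis unfolding ores_one[OF W Z(1,2)] using Z(3) by (intro ex1I[of _ s]) auto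
 qed
 thus ?thesis unfolding free_gen_def using W O_one_closed[OF W] by simp
qed

lemma (in ringed_space) line_bundle_osheaf: "line_bundle X (osheaf X)"
 unfolding line_bundle_def using mod_sheaf_osheaf free_gen_osheaf[OF opn_pts] by blast

lemma carrier_UP_iff:
 "p \<in> carrier (UP R) \<longleftrightarrow> p \<in> UNIV \<rightarrow> carrier R \<and> finite {m. p m \<noteq> 0[R]}"
proof -
 have "(\<exists>n. bound 0[R] n p) \<longleftrightarrow> finite {m. p m \<noteq> 0[R]}"
 proof
  assume "\<exists>n. bound 0[R] n p"
  then obtain n where n: "bound 0[R] n p" ..
  have "{m. p m \<noteq> 0[R]} \<subseteq> {..n}" using bound_below[OF n] by blast
  thus "finite {m. p m \<noteq> 0[R]}" by (rule finite_subset) simp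
 next
  assume "finite {m. p m \<noteq> 0[R]}"
  then obtain n where "\<forall>m\<in>{m. p m \<noteq> 0[R]}. m \<le> n" using finite_nat_set_iff_bounded_le by blast
  hence "bound 0[R] n p" by (intro bound.intro) (use not_le in blast)
  thus "\<exists>n. bound 0[R] n p" ..
 qed
 thus ?thesis by (auto simp: UP_def up_def)
qed

lemma (in UP_pre_univ_prop) eval_eq_finsum_support:
 assumes s: "s \<in> carrier S" and p: "p \<in> carrier P"
 shows "eval R S h s p = finsum S (\<lambda>m. h (p m) *[S] s ^[S] m) {m. p m \<noteq> 0[R]}"
proof -
 have coeff: "coeff P p = p" using p by (simp add: P_def UP_def)
 have p': "p m \<in> carrier R" for m using p by (auto simp: P_def carrier_UP_iff)
 have "{m. p m \<noteq> 0[R]} \<subseteq> {..deg R p}" using deg_aboveD[OF _ p] unfolding coeff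
  by (auto simp: not_le[symmetric])
 hence "finsum S (\<lambda>m. h (p m) *[S] s ^[S] m) {m. p m \<noteq> 0[R]} =
   finsum S (\<lambda>m. h (p m) *[S] s ^[S] m) {..deg R p}"
  by (intro S.add.finprod_mono_neutral_cong_left) (use s p' in auto)
 thus ?thesis unfolding eval_on_carrier[OF p] coeff by simp
qed

locale line_bundle_total_space =
 fixes X :: "('p, 'a) rspace" and L :: "('p, 'a, 'l) msheaf" and V :: "('v, 'b) rspace"
  and \<pi> :: "('v, 'b, 'p, 'a) rmor" and \<sigma> :: "'p set \<Rightarrow> ('p set \<Rightarrow> 'l \<Rightarrow> 'a) \<Rightarrow> 'b"
 assumes integral_X: "integral_scheme X" and line_bundle_dual: "line_bundle X (dual X L)"
   and total_space: "total_space X L V \<pi> \<sigma>"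
begin

abbreviation A where "A \<equiv> dual X L"
abbreviation pr where "pr \<equiv> preim V \<pi>"

lemma lrs_V: "lrs V" and pre_hom_\<pi>: "pre_hom V X \<pi>"
 and affine_open_preim: "affine_open X U \<Longrightarrow> affine_open V (pr U)"
 and \<sigma>_hom: "\<sigma> \<in> mod_hom X A (pushforward_osheaf V \<pi>)"
 using total_space by (simp_all add: total_space_def scheme_def lrs_hom_iff)

sublocale X: integral_space X by (rule integral_scheme_integral_space[OF integral_X])
sublocale A: module_sheaf X A by (rule X.line_bundle_module_sheaf[OF line_bundle_dual])
sublocale V: ringed_space V by unfold_locales (use lrs_V in \<open>simp add: lrs_def\<close>)

lemmas opn_preim = pre_hom_opn[OF pre_hom_\<pi>]
 and \<pi>_ring_hom = pre_hom_ring_hom[OF pre_hom_\<pi>]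
 and \<pi>_closed = pre_hom_mco_closed[OF pre_hom_\<pi>]
 and \<pi>_res = pre_hom_res[OF pre_hom_\<pi>]

lemma \<sigma>_closed: "\<lbrakk>opn X U; t \<in> Ms A U\<rbrakk> \<Longrightarrow> \<sigma> U t \<in> Os V (pr U)"
 using mod_homD(1)[OF \<sigma>_hom] by (simp add: pushforward_osheaf_def)

lemma \<sigma>_smult: "\<lbrakk>opn X U; a \<in> Os X U; t \<in> Ms A U\<rbrakk> \<Longrightarrow> \<sigma> U (a *.[msec A U] t) =
  mco \<pi> U a *[osec V (pr U)] \<sigma> U t"
 using mod_homD(3)[OF \<sigma>_hom] by (simp add: pushforward_osheaf_def)

lemma \<sigma>_res: "\<lbrakk>opn X U; opn X W; W \<subseteq> U; t \<in> Ms A U\<rbrakk> \<Longrightarrow> \<sigma> W (mres A U W t) = ores V (pr U) (pr W) (\<sigma> U t)"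
 using mod_homD(4)[OF \<sigma>_hom] by (simp add: pushforward_osheaf_def)

lemma \<sigma>_transition:
 assumes d: "transition X A D U t W t' d" and U: "opn X U" "t \<in> Ms A U" and W: "opn X W" "t' \<in> Ms A W"
 shows "ores V (pr U) (pr D) (\<sigma> U t) = mco \<pi> D d *[osec V (pr D)] ores V (pr W) (pr D) (\<sigma> W t')"
proof -
 note d = transitionD[OF d]
 show ?thesis
  unfolding \<sigma>_res[OF U(1) d(1,2) U(2), symmetric] \<sigma>_res[OF W(1) d(1,3) W(2), symmetric] d(5)
  by (rule \<sigma>_smult[OF d(1,4) A.res_closed[OF W(1) d(1,3) W(2)]])
qed

subsection \<open>Integrality\<close>

context
 fixes U t assumes U: "affine_open X U" "U \<noteq> {}" and t: "free_gen X A U t"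
begin

private lemma opn_U: "opn X U" by (rule free_genD(1)[OF t])

interpretation R: domain "osec X U" by (rule integral_schemeD(4)[OF integral_X opn_U U(2)])
interpretation S: cring "osec V (pr U)" by (rule V.cring_O[OF opn_preim[OF opn_U]])
interpretation h: ring_hom_cring "osec X U" "osec V (pr U)" "mco \<pi> U"
 by (intro ring_hom_cring.intro R.is_cring S.is_cring ring_hom_cring_axioms.intro \<pi>_ring_hom[OF opn_U])
interpretation UP: UP_domain "osec X U" "UP (osec X U)" by unfold_locales simp
interpretation UP_pre_univ_prop "osec X U" "osec V (pr U)" "mco \<pi> U" "UP (osec X U)" by unfold_locales

private lemma \<sigma>_t: "\<sigma> U t \<in> Os V (pr U)" by (rule \<sigma>_closed[OF opn_U free_genD(2)[OF t]])

private abbreviation ev where "ev \<equiv> eval (osec X U) (osec V (pr U)) (mco \<pi> U) (\<sigma> U t)"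

lemma ring_iso_eval: "ev \<in> ring_iso (UP (osec X U)) (osec V (pr U))"
proof (rule ring_iso_memI)
 have ex1: "\<exists>!p. p \<in> carrier (UP (osec X U)) \<and> s = ev p" if "s \<in> Os V (pr U)" for s
 proof -
  have "\<exists>!c :: nat \<Rightarrow> 'a. c \<in> UNIV \<rightarrow> Os X U \<and> finite {m. c m \<noteq> 0[osec X U]} \<and> s = finsum (osec V (pr U))
   (\<lambda>m. mco \<pi> U (c m) *[osec V (pr U)] \<sigma> U t ^[osec V (pr U)] m) {m. c m \<noteq> 0[osec X U]}"
   using total_space U(1) t that unfolding total_space_def by blast
  moreover have "(p \<in> carrier (UP (osec X U)) \<and> s = ev p) \<longleftrightarrow>
    (p \<in> UNIV \<rightarrow> Os X U \<and> finite {m. p m \<noteq> 0[osec X U]} \<and> s = finsum (osec V (pr U))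
    (\<lambda>m. mco \<pi> U (p m) *[osec V (pr U)] \<sigma> U t ^[osec V (pr U)] m) {m. p m \<noteq> 0[osec X U]})" for p
   using eval_eq_finsum_support[OF \<sigma>_t, of p] unfolding carrier_UP_iff by argo
  ultimately show ?thesis by presburger
 qed
 note hom = eval_ring_hom[OF \<sigma>_t]
 show "ev p \<in> Os V (pr U)" if "p \<in> carrier (UP (osec X U))" for p by (rule ring_hom_closed[OF hom that])
 thus "bij_betw ev (carrier (UP (osec X U))) (Os V (pr U))"
  unfolding bij_betw_def inj_on_def using ex1 by blast
qed (use ring_hom_mult[OF eval_ring_hom[OF \<sigma>_t]] ring_hom_add[OF eval_ring_hom[OF \<sigma>_t]]
  ring_hom_one[OF eval_ring_hom[OF \<sigma>_t]] in auto)

lemma eval_zero: "ev 0[UP (osec X U)] = 0[osec V (pr U)]"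
 by (rule ring_hom_zero[OF eval_ring_hom[OF \<sigma>_t] UP.UP_ring S.ring_axioms])

lemma domain_preim: "domain (osec V (pr U))"
 using domain.ring_iso_imp_img_domain[OF UP.UP_domain ring_iso_eval] unfolding eval_zero by simp

lemma preim_nonempty: "pr U \<noteq> {}"
proof
 interpret D: domain "osec V (pr U)" by (rule domain_preim)
 assume empty: "pr U = {}"
 have "1[osec V (pr U)] = 0[osec V (pr U)]"
  unfolding empty by (rule V.osec_empty) (use S.one_closed S.zero_closed in \<open>simp_all only: empty\<close>)
 thus False using D.one_not_zero by simp
qed

lemma monomial_nonzero:
 assumes \<xi>: "\<xi> \<in> Os X U" "\<xi> \<noteq> 0[osec X U]"
 shows "mco \<pi> U \<xi> *[osec V (pr U)] \<sigma> U t ^[osec V (pr U)] (m::nat) \<noteq> 0[osec V (pr U)]"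
proof
 assume "mco \<pi> U \<xi> *[osec V (pr U)] \<sigma> U t ^[osec V (pr U)] m = 0[osec V (pr U)]"
 hence "ev (monom (UP (osec X U)) \<xi> m) = ev 0[UP (osec X U)]" unfolding eval_zero
  using eval_monom[OF \<xi>(1) \<sigma>_t] by simp
 moreover have "inj_on ev (carrier (UP (osec X U)))" using ring_iso_memE(5)[OF ring_iso_eval]
  by (rule bij_betw_imp_inj_on)
 ultimately have "monom (UP (osec X U)) \<xi> m = 0[UP (osec X U)]" using \<xi>(1) by (auto dest: inj_onD)
 hence "coeff (UP (osec X U)) (monom (UP (osec X U)) \<xi> m) m = 0[osec X U]" by simp
 thus False using \<xi> by simp
qed

end

lemma affine_free_genE:
 assumes "opn X N" "p \<in> N"
 obtains U t where "affine_open X U" "p \<in> U" "U \<subseteq> N" "free_gen X A U t"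
proof -
 have "p \<in> pts X" using assms openin_subset by blast
 then obtain W t where W: "p \<in> W" "free_gen X A W t" using line_bundleD(2)[OF line_bundle_dual] by blast
 have "opn X (N \<inter> W)" "p \<in> N \<inter> W" using assms W free_genD(1)[OF W(2)] by auto
 then obtain U where U: "affine_open X U" "p \<in> U" "U \<subseteq> N \<inter> W" by (rule affine_open_base[OF integral_X])
 have "free_gen X A U (mres A W U t)" by (rule A.free_gen_res[OF W(2)]) (use U
   in \<open>auto simp: affine_open_def\<close>)
 thus thesis using U by (intro that[of U]) auto
qed

lemma integral_space_V: "integral_space V"
proof (rule integral_spaceI[OF V.ring_sheaf])
 let ?U = "{pr U |U t. affine_open X U \<and> U \<noteq> {} \<and> free_gen X A U t}"
 show "affine_open V W" "domain (osec V W)" if "W \<in> ?U" for W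
  using that affine_open_preim domain_preim by blast+
 show "\<exists>W\<in>?U. p \<in> W" if p: "p \<in> pts V" for p
 proof -
  have "mpt \<pi> p \<in> pts X" by (rule pre_hom_pts[OF pre_hom_\<pi> p])
  then obtain U t where U: "affine_open X U" "mpt \<pi> p \<in> U" "U \<subseteq> pts X" "free_gen X A U t"
   by (rule affine_free_genE[OF X.opn_pts])
  have "p \<in> pr U" "U \<noteq> {}" using p U(2) by (auto simp: preim_def)
  thus ?thesis using U(1,4) by blast
 qed
 fix W W' assume "W \<in> ?U" "W' \<in> ?U"
 then obtain U U' where U: "W = pr U" "affine_open X U" "U \<noteq> {}" and U': "W' = pr U'"
   "affine_open X U'" "U' \<noteq> {}" by blast
 have opn: "opn X U" "opn X U'" using U(2) U'(2) by (auto simp: affine_open_def)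
 obtain p where p: "p \<in> U \<inter> U'" using X.opn_meet[OF opn U(3) U'(3)] by blast
 have "opn X (U \<inter> U')" using opn by blast
 then obtain Z s where Z: "affine_open X Z" "p \<in> Z" "Z \<subseteq> U \<inter> U'" "free_gen X A Z s"
  by (rule affine_free_genE[OF _ p])
 have "Z \<noteq> {}" using Z(2) by blast
 from preim_nonempty[OF Z(1) this Z(4)] show "W \<inter> W' \<noteq> {}"
  using preim_mono[OF Z(3), of V \<pi>] unfolding U(1) U'(1) preim_Int by blast
qed

sublocale V: integral_space V by (rule integral_space_V)

lemma domain_global: "domain (osec V (pts V))"
proof -
 obtain p where p: "p \<in> pts X" using integral_schemeD(3)[OF integral_X] by blast
 obtain U t where U: "affine_open X U" "p \<in> U" "free_gen X A U t"
  by (rule affine_free_genE[OF X.opn_pts p])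
 have ne: "U \<noteq> {}" using U(2) by blast
 note opn = opn_preim[OF free_genD(1)[OF U(3)]]
 show ?thesis
  by (rule V.domain_osec[OF V.opn_pts opn openin_subset[OF opn] preim_nonempty[OF U(1) ne U(3)]
    domain_preim[OF U(1) ne U(3)]])
qed

subsection \<open>Pullbacks of line bundles\<close>

definition pullback_section :: "('p, 'a, 'm) msheaf \<Rightarrow> 'p set \<Rightarrow> 'm \<Rightarrow> 'v \<Rightarrow>
  (('p set \<times> 'm) set \<times> ('v set \<times> 'b) set \<Rightarrow>\<^sub>0 int) set"
 where "pullback_section E U e = line_bundle_pullback_tensor.pure_section V X \<pi> E (osheaf V) U e
   (pr U) 1[osec V (pr U)]"

lemma pullback_tensor_osheaf: "line_bundle X E \<Longrightarrow> line_bundle_pullback_tensor V X \<pi> E (osheaf V)"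
 by (rule line_bundle_pullback_tensor.intro[OF lrs_V integral_schemeD(1)[OF integral_X] pre_hom_\<pi> _
   V.mod_sheaf_osheaf])

lemma line_bundle_pullback: "line_bundle X E \<Longrightarrow> line_bundle V (pullback V X \<pi> E)"
 unfolding pullback_eq_pullback_tensor
 by (rule line_bundle_pullback_tensor.line_bundle_FG[OF pullback_tensor_osheaf V.line_bundle_osheaf])

lemma free_gen_pullback_section:
 assumes "line_bundle X E" "free_gen X E U e"
 shows "free_gen V (pullback V X \<pi> E) (pr U) (pullback_section E U e)"
 unfolding pullback_eq_pullback_tensor pullback_section_def
 by (rule line_bundle_pullback_tensor.free_gen_pure_section[OF pullback_tensor_osheaf[OF assms(1)]
   order_refl assms(2)
   V.free_gen_osheaf[OF opn_preim[OF free_genD(1)[OF assms(2)]]]])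

lemma transition_pullback_section:
 assumes E: "line_bundle X E" and e: "free_gen X E U e" and e': "free_gen X E U' e'"
   and a: "transition X E D U e U' e' a"
 shows "transition V (pullback V X \<pi> E) (pr D) (pr U) (pullback_section E U e) (pr U')
   (pullback_section E U' e') (mco \<pi> D a)"
proof -
 interpret T: line_bundle_pullback_tensor V X \<pi> E "osheaf V" by (rule pullback_tensor_osheaf[OF E])
 note U = free_genD(1,2)[OF e] and U' = free_genD(1,2)[OF e'] and D = transitionD[OF a]
 note opn = opn_preim[OF D(1)] opn_preim[OF U(1)] opn_preim[OF U'(1)]
 interpret O: cring "osec V (pr D)" by (rule V.cring_O[OF opn(1)])
 have one: "1[osec V (pr W)] \<in> Ms (osheaf V) (pr W)" if "opn X W" for W
  using V.O_one_closed[OF opn_preim[OF that]] by simp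
 have "transition V (osheaf V) (pr D) (pr U) 1[osec V (pr U)] (pr U') 1[osec V (pr U')]
   1[osec V (pr D)]"
  using V.ores_one[OF opn(2,1) preim_mono[OF D(2)]] V.ores_one[OF opn(3,1) preim_mono[OF D(3)]]
  by (intro transitionI opn preim_mono D) simp_all
 from T.transition_pure_section[OF a this U e' opn(2) one[OF U(1)] opn(3) one[OF U'(1)] order_refl
   order_refl order_refl]
 show ?thesis
  unfolding pullback_eq_pullback_tensor pullback_section_def
  using V.ores_id[OF opn(1) \<pi>_closed[OF D(1,4)]] \<pi>_closed[OF D(1,4)] by simp
qed

end

subsection \<open>Homomorphisms between pullbacks\<close>

text \<open>\<open>\<xi>\<close> is the coefficient, in the frame \<open>e\<^sub>0\<^sup>-\<^sup>1 \<otimes> f\<^sub>0 \<otimes> t\<^sub>0\<^sup>m\<close> over \<open>U\<^sub>0\<close>, of a global section of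
  \<open>\<H>om(E, E') \<otimes> A\<^sup>m\<close>, and \<open>\<psi>\<close> is its coefficient in another local frame.\<close>

definition twisted_hom_coefficient ::
 "('p, 'a) rspace \<Rightarrow> ('p, 'a, 'l) msheaf \<Rightarrow> nat \<Rightarrow> ('p, 'a, 'm) msheaf \<Rightarrow> ('p, 'a, 'n) msheaf \<Rightarrow> 'p set \<Rightarrow>
   'm \<Rightarrow> 'n \<Rightarrow> 'l \<Rightarrow> 'a \<Rightarrow> bool"
 where "twisted_hom_coefficient X A m E E' U0 e0 f0 t0 \<xi> \<longleftrightarrow>
  (\<forall>U \<epsilon> \<eta> t a b d. free_gen X E U \<epsilon> \<and> free_gen X E' U \<eta> \<and> free_gen X A U t \<and> transition X E (U \<inter> U0)
    U \<epsilon> U0 e0 a \<and>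
    transition X E' (U \<inter> U0) U0 f0 U \<eta> b \<and> transition X A (U \<inter> U0) U0 t0 U t d \<longrightarrow>
   (\<exists>\<psi>\<in>Os X U. ores X U (U \<inter> U0) \<psi> = ores X U0 (U \<inter> U0) \<xi> *[osec X (U \<inter> U0)]
     (a *[osec X (U \<inter> U0)] b *[osec X (U \<inter> U0)] d ^[osec X (U \<inter> U0)] m)))"

lemma (in dense_frame) twisted_hom_coefficient_global_section:
 assumes P: "mod_sheaf X P" and g: "twisted_frames X hom_sheaf A m P g" and f0: "free_gen X G U0 f0"
   and t0: "free_gen X A U0 t0"
  and \<tau>: "\<tau> \<in> Ms P (pts X)" and \<xi>: "transition X P U0 (pts X) \<tau> U0 (g U0 f0 t0) \<xi>"
 shows "twisted_hom_coefficient X A m F G U0 e0 f0 t0 \<xi>"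
 unfolding twisted_hom_coefficient_def
proof (intro allI impI, elim conjE)
 interpret P: module_sheaf X P by unfold_locales (rule P)
 note f0_H = free_gen_hom_sheaf_U0[OF f0]
 note w = twisted_framesD(1)[OF g f0_H t0]
 fix U \<epsilon> \<eta> t a b d
 let ?D = "U \<inter> U0"
 assume \<epsilon>: "free_gen X F U \<epsilon>" and \<eta>: "free_gen X G U \<eta>" and t: "free_gen X A U t"
   and a: "transition X F ?D U \<epsilon> U0 e0 a"
  and b: "transition X G ?D U0 f0 U \<eta> b" and d: "transition X A ?D U0 t0 U t d"
 note D = transitionD(1-3)[OF a] and U = free_genD(1)[OF \<epsilon>]
 obtain a' where a': "transition X F ?D U0 e0 U \<epsilon> a'"
  by (rule F.free_gen_transitionE[OF \<epsilon> opn_U0 e0_closed D(1,3,2)])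
 note \<omega> = free_gen_hom_sheaf[OF \<epsilon> \<eta> a']
 let ?y = "g U (hom_gen U \<eta> a') t"
 note y = twisted_framesD(1)[OF g \<omega> t]
 have wy: "transition X P ?D U0 (g U0 f0 t0) U ?y (a *[osec X ?D] b *[osec X ?D] d ^[osec X ?D] m)"
  by (rule twisted_framesD(2)[OF g f0_H t0 \<omega> t transition_hom_sheaf[OF \<epsilon> \<eta> a a' b] d])
 obtain \<psi> where \<psi>: "transition X P U (pts X) \<tau> U ?y \<psi>"
  by (rule P.free_gen_transitionE[OF y opn_pts \<tau> U openin_subset[OF U] order_refl])
 have "ores X U ?D \<psi> = ores X U0 ?D \<xi> *[osec X ?D] (a *[osec X ?D] b *[osec X ?D] d ^[osec X ?D] m)"
  by (rule P.transition_unique[OF y P.transition_res[OF \<psi> opn_pts \<tau> free_genD(1,2)[OF y] D(1,2)]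
    P.transition_trans[OF P.transition_res[OF \<xi> opn_pts \<tau> free_genD(1,2)[OF w] D(1,3)] wy
      free_genD(1,2)[OF y]]])
 thus "\<exists>\<psi>\<in>Os X U. ores X U ?D \<psi> = ores X U0 ?D
   \<xi> *[osec X ?D] (a *[osec X ?D] b *[osec X ?D] d ^[osec X ?D] m)"
  using transitionD(4)[OF \<psi>] by blast
qed

lemma ex_twisted_hom_coefficient:
 fixes E E' :: "('p, 'a, 'm) msheaf"
 assumes X: "integral_scheme X" and ample: "ample TYPE('m) X A"
  and E: "line_bundle X E" and E': "line_bundle X E'" "coherent X E'"
  and e0: "free_gen X E U0 e0" and f0: "free_gen X E' U0 f0" and t0: "free_gen X A U0 t0"
    and U0: "U0 \<noteq> {}"
 obtains m \<xi> where "\<xi> \<in> Os X U0" "\<xi> \<noteq> 0[osec X U0]" "twisted_hom_coefficient X A m E E' U0 e0 f0 t0 \<xi>"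
proof -
 interpret integral_space X by (rule integral_scheme_integral_space[OF X])
 interpret H: dense_frame X E E' U0 e0 by unfold_locales (fact E E' e0 U0)+
 have A: "line_bundle X A" using ample by (simp add: ample_def)
 have "coherent X H.hom_sheaf" by (rule coherent_line_bundle[OF E' H.line_bundle_hom_sheaf])
 then obtain P m where P0: "P 0 = H.hom_sheaf" and P: "\<And>m. mod_sheaf X (P m)"
   "\<And>m. mod_iso X (P (Suc m)) (tensor X (P m) A)"
  and gg: "globally_generated X (P m)" using ample unfolding ample_def by blast
 have "line_bundle X (P 0)" using H.line_bundle_hom_sheaf P0 by simp
 from ex_twisted_frames[OF integral_schemeD(1)[OF X] A this P]
 obtain g where g: "twisted_frames X H.hom_sheaf A m (P m) g" unfolding P0 by blast
 interpret P: module_sheaf X "P m" by unfold_locales (rule P(1))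
 obtain p0 where p0: "p0 \<in> U0" using U0 by blast
 have "1[osec X W] \<noteq> 0[osec X W]" if "opn X W" "W \<noteq> {}" for W
  using domain.one_not_zero[OF integral_schemeD(4)[OF X that]] .
 then obtain \<tau> \<xi> where \<tau>: "\<tau> \<in> Ms (P m) (pts X)"
   and \<xi>: "transition X (P m) U0 (pts X) \<tau> U0 (g U0 f0 t0) \<xi>" "\<xi> \<noteq> 0[osec X U0]"
  by (rule P.nonzero_global_section[OF gg
    twisted_framesD(1)[OF g H.free_gen_hom_sheaf_U0[OF f0] t0] p0])
 show thesis
  by (rule that[OF transitionD(4)[OF \<xi>(1)] \<xi>(2)
    H.twisted_hom_coefficient_global_section[OF P(1) g f0 t0 \<tau> \<xi>(1)]])
qed

context line_bundle_total_space
begin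

abbreviation monomial_function :: "'p set \<Rightarrow> ('p set \<Rightarrow> 'l \<Rightarrow> 'a) \<Rightarrow> nat \<Rightarrow> 'a \<Rightarrow> 'b"
 where "monomial_function U t m \<psi> \<equiv> mco \<pi> U \<psi> *[osec V (pr U)] \<sigma> U t ^[osec V (pr U)] m"

lemma monomial_function_closed:
 assumes "opn X U" "t \<in> Ms A U" "\<psi> \<in> Os X U" shows "monomial_function U t m \<psi> \<in> Os V (pr U)"
proof -
 interpret cring "osec V (pr U)" by (rule V.cring_O[OF opn_preim[OF assms(1)]])
 show ?thesis using \<pi>_closed[OF assms(1,3)] \<sigma>_closed[OF assms(1,2)] by simp
qed

lemma monomial_function_res:
 assumes U: "opn X U" "t \<in> Ms A U" "\<psi> \<in> Os X U" and D: "opn X D" "D \<subseteq> U"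
 shows "ores V (pr U) (pr D) (monomial_function U t m \<psi>) =
  mco \<pi> D (ores X U D \<psi>) *[osec V (pr D)] ores V (pr U) (pr D) (\<sigma> U t) ^[osec V (pr D)] m"
proof -
 interpret cring "osec V (pr U)" by (rule V.cring_O[OF opn_preim[OF U(1)]])
 note opn = opn_preim[OF U(1)] opn_preim[OF D(1)] preim_mono[OF D(2)] and \<sigma>t = \<sigma>_closed[OF U(1,2)]
 show ?thesis
  unfolding V.ores_mult[OF opn \<pi>_closed[OF U(1,3)] nat_pow_closed[OF \<sigma>t]] V.ores_pow[OF opn
    \<sigma>t] \<pi>_res[OF U(1) D U(3)] ..
qed

lemma monomial_function_transition:
 assumes d: "transition X A D U0 t0 U t d" and U0: "opn X U0" "t0 \<in> Ms A U0" and U: "opn X U"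
   "t \<in> Ms A U"
  and a: "a \<in> Os X D" and b: "b \<in> Os X D" and \<xi>: "\<xi> \<in> Os X U0" and \<psi>: "\<psi> \<in> Os X U"
  and eq: "ores X U D \<psi> = ores X U0 D \<xi> *[osec X D] (a *[osec X D] b *[osec X D] d ^[osec X D] m)"
 shows "ores V (pr U) (pr D) (monomial_function U t m \<psi>) =
  mco \<pi> D a *[osec V (pr D)]
   (ores V (pr U0) (pr D) (monomial_function U0 t0 m \<xi>) *[osec V (pr D)] mco \<pi> D b)"
proof -
 note D = transitionD(1-4)[OF d]
 note opn = opn_preim[OF U(1)] opn_preim[OF D(1)] preim_mono[OF D(3)]
 interpret O: cring "osec X D" by (rule X.cring_O[OF D(1)])
 interpret W: cring "osec V (pr D)" by (rule V.cring_O[OF opn(2)])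
 interpret h: ring_hom_cring "osec X D" "osec V (pr D)" "mco \<pi> D"
  by (intro ring_hom_cring.intro O.is_cring W.is_cring ring_hom_cring_axioms.intro \<pi>_ring_hom[OF D(1)])
 let ?x = "mco \<pi> D (ores X U0 D \<xi>)" and ?a = "mco \<pi> D a" and ?b = "mco \<pi> D b" and ?d = "mco \<pi> D d"
   and ?T = "ores V (pr U) (pr D) (\<sigma> U t)"
 have \<xi>D: "ores X U0 D \<xi> \<in> Os X D" by (rule X.ores_closed[OF U0(1) D(1,2) \<xi>])
 have T: "?T \<in> Os V (pr D)" by (rule V.ores_closed[OF opn \<sigma>_closed[OF U]])
 have closed: "?x \<in> Os V (pr D)" "?a \<in> Os V (pr D)" "?b \<in> Os V (pr D)" "?d \<in> Os V (pr D)"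
  using \<xi>D a b D(4) by simp_all
 have "ores V (pr U) (pr D) (monomial_function U t m \<psi>) =
   ?x *[osec V (pr D)] (?a *[osec V (pr D)] ?b *[osec V (pr D)] ?d ^[osec V (pr D)] m) *[osec V
     (pr D)] ?T ^[osec V (pr D)] m"
  unfolding monomial_function_res[OF U \<psi> D(1,3)] eq using \<xi>D a b D(4) by (simp add: h.hom_pow)
 also have "... = ?a *[osec V (pr D)] (?x *[osec V (pr D)] (?d *[osec V (pr D)] ?T) ^[osec V
   (pr D)] m *[osec V (pr D)] ?b)"
  unfolding W.nat_pow_distrib[OF closed(4) T]
  using closed W.nat_pow_closed[OF closed(4), of m] W.nat_pow_closed[OF T, of m] by (simp add: W.m_ac)
 also have "... = ?a *[osec V (pr D)] (ores V (pr U0) (pr D) (monomial_function U0 t0 m \<xi>) *[osec V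
   (pr D)] ?b)"
  unfolding monomial_function_res[OF U0 \<xi> D(1,2)] \<sigma>_transition[OF d U0 U] ..
 finally show ?thesis .
qed

context
 fixes E :: "('p, 'a, 'm) msheaf" and E' :: "('p, 'a, 'n) msheaf" and U0 e0 f0 t0 and m :: nat and \<xi>
 assumes E: "line_bundle X E" and E': "line_bundle X E'" and U0: "affine_open X U0" "U0 \<noteq> {}"
  and e0: "free_gen X E U0 e0" and f0: "free_gen X E' U0 f0" and t0: "free_gen X A U0 t0"
  and \<xi>: "\<xi> \<in> Os X U0" "twisted_hom_coefficient X A m E E' U0 e0 f0 t0 \<xi>"
begin

private abbreviation (input) F where "F \<equiv> pullback V X \<pi> E"
private abbreviation (input) F' where "F' \<equiv> pullback V X \<pi> E'"
private abbreviation (input) \<theta> where "\<theta> \<equiv> monomial_function U0 t0 m \<xi>"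
private abbreviation (input) s where "s \<equiv> \<theta> *.[msec F' (pr U0)] pullback_section E' U0 f0"

interpretation E: module_sheaf X E by (rule X.line_bundle_module_sheaf[OF E])
interpretation E': module_sheaf X E' by (rule X.line_bundle_module_sheaf[OF E'])
interpretation H: dense_frame V F F' "pr U0" "pullback_section E U0 e0"
 by unfold_locales (fact line_bundle_pullback[OF E] line_bundle_pullback[OF E']
   free_gen_pullback_section[OF E e0] preim_nonempty[OF U0 t0])+

private lemma U0': "opn X U0" "t0 \<in> Ms A U0" by (fact free_genD(1)[OF t0] free_genD(2)[OF t0])+

private lemma \<theta>_closed: "\<theta> \<in> Os V (pr U0)" by (rule monomial_function_closed[OF U0' \<xi>(1)])

private lemma s_closed: "s \<in> Ms F' (pr U0)"
 by (rule H.G.smult_closed[OF H.opn_U0 \<theta>_closed free_genD(2)[OF free_gen_pullback_section[OF E' f0]]])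

private lemma hom_extends_frame:
 assumes \<epsilon>: "free_gen X E U \<epsilon>" and \<eta>: "free_gen X E' U \<eta>" and t: "free_gen X A U t"
 shows "H.hom_extends (pr U) (mres F' (pr U0) (pr U \<inter> pr U0) s)"
proof -
 let ?D = "U \<inter> U0"
 note U = free_genD(1,2)[OF t]
 have D: "opn X ?D" "?D \<subseteq> U" "?D \<subseteq> U0" using U(1) U0'(1) by auto
 obtain a where a: "transition X E ?D U \<epsilon> U0 e0 a"
  by (rule E.free_gen_transitionE[OF e0 U(1) free_genD(2)[OF \<epsilon>] D])
 obtain b where b: "transition X E' ?D U0 f0 U \<eta> b"
  by (rule E'.free_gen_transitionE[OF \<eta> U0'(1) free_genD(2)[OF f0] D(1,3,2)])
 obtain d where d: "transition X A ?D U0 t0 U t d" by (rule A.free_gen_transitionE[OF t U0' D(1,3,2)])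
 obtain \<psi> where \<psi>: "\<psi> \<in> Os X U" "ores X U ?D \<psi> =
   ores X U0 ?D \<xi> *[osec X ?D] (a *[osec X ?D] b *[osec X ?D] d ^[osec X ?D] m)"
  using \<xi>(2) \<epsilon> \<eta> t a b d unfolding twisted_hom_coefficient_def by blast
 note c = monomial_function_closed[OF U \<psi>(1), of m]
 note a' = transition_pullback_section[OF E \<epsilon> e0 a] and b' = transition_pullback_section[OF E' f0 \<eta> b]
  and f0' = free_genD(2)[OF free_gen_pullback_section[OF E' f0]]
    and \<eta>' = free_genD(1,2)[OF free_gen_pullback_section[OF E' \<eta>]]
 note pD = transitionD(1-3)[OF b']
 interpret M: module "osec V (pr ?D)" "msec F' (pr ?D)" by (rule H.G.module_sec[OF pD(1)])
 have \<theta>D: "ores V (pr U0) (pr ?D) \<theta> *[osec V (pr ?D)] mco \<pi> ?D b \<in> Os V (pr ?D)"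
  using V.ores_closed[OF H.opn_U0 pD(1,2) \<theta>_closed] transitionD(4)[OF b'] by simp
 have coord: "H.coord (pr U) (pullback_section E U \<epsilon>) = mco \<pi> ?D a"
  by (rule H.coord_eqI) (use a' in \<open>simp add: preim_Int\<close>)
 have "mres F' (pr U) (pr ?D) (monomial_function U t m \<psi> *.[msec F' (pr U)] pullback_section E' U \<eta>)
   = mco \<pi> ?D a *.[msec F' (pr ?D)] mres F' (pr U0) (pr ?D) s"
  unfolding H.G.res_smult[OF \<eta>'(1) pD(1,3) c \<eta>'(2)]
   monomial_function_transition[OF d U0' U transitionD(4)[OF a] transitionD(4)[OF b] \<xi>(1) \<psi>]
   transitionD(5)[OF H.G.transition_smult[OF b' H.opn_U0 f0' \<eta>' \<theta>_closed]]
  by (rule M.smult_assoc1[OF transitionD(4)[OF a'] \<theta>D H.G.res_closed[OF \<eta>'(1) pD(1,3) \<eta>'(2)]])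
 hence "H.extendable (pr U) (mco \<pi> ?D a *.[msec F' (pr ?D)] mres F' (pr U0) (pr ?D) s)"
  by (intro H.extendableI[OF H.G.smult_closed[OF \<eta>'(1) c \<eta>'(2)]]) (simp add: preim_Int)
 thus ?thesis using H.G.res_closed[OF H.opn_U0 pD(1,2) s_closed]
  by (intro H.hom_extends_free_gen[OF free_gen_pullback_section[OF E \<epsilon>]]) (simp_all add:
    coord preim_Int)
qed

lemma ex_hom_monomial_function: "\<exists>\<phi>\<in>mod_hom V F F'. \<phi> (pr U0) (pullback_section E U0 e0) = s"
proof (rule H.ex_hom_extension[OF s_closed])
 have P0: "pts V \<inter> pr U0 = pr U0" using openin_subset[OF H.opn_U0] by auto
 show "H.hom_extends (pts V) s"
 proof (rule H.hom_extends_local[OF V.opn_pts, unfolded P0, OF s_closed])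
  fix p assume p: "p \<in> pts V"
  interpret XE: dense_frame X E E' U0 e0 by unfold_locales (fact E E' e0 U0)+
  obtain U \<epsilon> \<eta> where U: "mpt \<pi> p \<in> U" "free_gen X E U \<epsilon>" "free_gen X E' U \<eta>"
   by (rule XE.common_free_gens[OF pre_hom_pts[OF pre_hom_\<pi> p]])
  obtain W t where W: "mpt \<pi> p \<in> W" "W \<subseteq> U" "free_gen X A W t"
   using affine_free_genE[OF free_genD(1)[OF U(2)] U(1)] by metis
  note W' = free_genD(1)[OF W(3)] W(2)
  have "p \<in> pr W" using p W(1) by (simp add: preim_def)
  thus "\<exists>Z. opn V Z \<and> p \<in> Z \<and> Z \<subseteq> pts V \<and> H.hom_extends Z (mres F' (pr U0) (Z \<inter> pr U0) s)"
   using hom_extends_frame[OF E.free_gen_res[OF U(2) W'] E'.free_gen_res[OF U(3) W']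
     W(3)] opn_preim[OF W'(1)] openin_subset by blast
 qed
qed

end

lemma ex_pullback_hom:
 fixes E E' :: "('p, 'a, 'm) msheaf"
 assumes ample: "ample TYPE('m) X A" and E: "line_bundle X E" and E': "line_bundle X E'" "coherent X E'"
  and U0: "affine_open X U0" "U0 \<noteq> {}" and e0: "free_gen X E U0 e0" and f0: "free_gen X E' U0 f0"
    and t0: "free_gen X A U0 t0"
 obtains \<phi> \<theta> where "\<phi> \<in> mod_hom V (pullback V X \<pi> E) (pullback V X \<pi> E')" "\<theta> \<in> Os V (pr U0)"
   "\<theta> \<noteq> 0[osec V (pr U0)]"
  "\<phi> (pr U0) (pullback_section E U0 e0) =
    \<theta> *.[msec (pullback V X \<pi> E') (pr U0)] pullback_section E' U0 f0"
proof -
 obtain m \<xi> where \<xi>: "\<xi> \<in> Os X U0" "\<xi> \<noteq> 0[osec X U0]" "twisted_hom_coefficient X A m E E' U0 e0 f0 t0 \<xi>"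
  by (rule ex_twisted_hom_coefficient[OF integral_X ample E E' e0 f0 t0 U0(2)])
 from ex_hom_monomial_function[OF E E'(1) U0 e0 f0 t0 \<xi>(1,3)] that
  monomial_function_closed[OF free_genD(1,2)[OF t0] \<xi>(1)] monomial_nonzero[OF U0 t0 \<xi>(1,2)]
 show thesis by blast
qed

lemma nonzero_round_trip_pullback:
 fixes E E' :: "('p, 'a, 'm) msheaf"
 assumes ample: "ample TYPE('m) X A" and E: "line_bundle X E"
   "coherent X E" and E': "line_bundle X E'" "coherent X E'"
 shows "nonzero_round_trip V (pullback V X \<pi> E) (pullback V X \<pi> E')"
proof -
 let ?F = "pullback V X \<pi> E" and ?F' = "pullback V X \<pi> E'"
 interpret E: module_sheaf X E by (rule X.line_bundle_module_sheaf[OF E(1)])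
 interpret E': module_sheaf X E' by (rule X.line_bundle_module_sheaf[OF E'(1)])
 obtain p where p: "p \<in> pts X" using integral_schemeD(3)[OF integral_X] by blast
 obtain W e where W: "p \<in> W" "free_gen X E W e" using line_bundleD(2)[OF E(1) p] by blast
 obtain W' f where W': "p \<in> W'" "free_gen X E' W' f" using line_bundleD(2)[OF E'(1) p] by blast
 have "opn X (W \<inter> W')" "p \<in> W \<inter> W'" using W W' free_genD(1)[OF W(2)] free_genD(1)[OF W'(2)] by auto
 then obtain U t where U: "affine_open X U" "p \<in> U" "U \<subseteq> W \<inter> W'" and t: "free_gen X A U t"
  by (rule affine_free_genE)
 have sub: "U \<subseteq> W" "U \<subseteq> W'" "U \<noteq> {}" using U by auto
 note opn = opn_preim[OF free_genD(1)[OF t]]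
 note e = E.free_gen_res[OF W(2) free_genD(1)[OF t] sub(1)]
   and f = E'.free_gen_res[OF W'(2) free_genD(1)[OF t] sub(2)]
 let ?e = "pullback_section E U (mres E W U e)" and ?f = "pullback_section E' U (mres E' W' U f)"
 obtain \<phi> \<theta> where \<phi>: "\<phi> \<in> mod_hom V ?F ?F'" and \<theta>: "\<theta> \<in> Os V (pr U)"
   "\<theta> \<noteq> 0[osec V (pr U)]" and \<phi>_e: "\<phi> (pr U) ?e = \<theta> *.[msec ?F' (pr U)] ?f"
  by (rule ex_pullback_hom[OF ample E(1) E' U(1) sub(3) e f t])
 obtain \<chi> \<eta> where \<chi>: "\<chi> \<in> mod_hom V ?F' ?F" and \<eta>: "\<eta> \<in> Os V (pr U)"
   "\<eta> \<noteq> 0[osec V (pr U)]" and \<chi>_f: "\<chi> (pr U) ?f = \<eta> *.[msec ?F (pr U)] ?e"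
  by (rule ex_pullback_hom[OF ample E'(1) E U(1) sub(3) f e t])
 interpret F: module_sheaf V ?F by (rule V.line_bundle_module_sheaf[OF line_bundle_pullback[OF E(1)]])
 obtain h where h: "h \<in> Os V (pts V)" "hom_comp V ?F \<chi> \<phi> = hom_smult V ?F ?F h (hom_id V ?F)"
  by (rule V.line_bundle_endomorphism[OF line_bundle_pullback[OF E(1)]
    V.hom_comp_closed[OF F.mod_sheaf \<phi> \<chi>]])
 note e_gen = free_gen_pullback_section[OF E(1) e]
   and f_closed = free_genD(2)[OF free_gen_pullback_section[OF E'(1) f]]
 note e_closed = free_genD(2)[OF e_gen] and hU = V.ores_closed[OF V.opn_pts opn
   openin_subset[OF opn] h(1)]
 interpret D: domain "osec V (pr U)" by (rule domain_preim[OF U(1) sub(3) t])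
 interpret M: module "osec V (pr U)" "msec ?F (pr U)" by (rule F.module_sec[OF opn])
 have "ores V (pts V) (pr U) h *.[msec ?F (pr U)] ?e = hom_comp V ?F \<chi> \<phi> (pr U) ?e"
  unfolding h(2) by (simp add: hom_apply[OF opn e_closed])
 also have "... = (\<theta> *[osec V (pr U)] \<eta>) *.[msec ?F (pr U)] ?e"
  unfolding hom_apply(2)[OF opn e_closed] \<phi>_e mod_homD(3)[OF \<chi> opn \<theta>(1) f_closed] \<chi>_f
  by (rule M.smult_assoc1[OF \<theta>(1) \<eta>(1) e_closed, symmetric])
 finally have "ores V (pts V) (pr U) h = \<theta> *[osec V (pr U)] \<eta>"
  using F.free_gen_cancel[OF e_gen opn order_refl hU D.m_closed[OF \<theta>(1) \<eta>(1)]] F.res_id[OF opn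
    e_closed] by simp
 hence "ores V (pts V) (pr U) h \<noteq> 0[osec V (pr U)]" using D.integral[OF _ \<theta>(1) \<eta>(1)] \<theta>(2) \<eta>(2) by auto
 hence "h \<noteq> 0[osec V (pts V)]" using V.ores_zero[OF V.opn_pts opn openin_subset[OF opn]] by auto
 thus ?thesis unfolding nonzero_round_trip_def using \<phi> \<chi> h by blast
qed

end

theorem corollary3p2:
  fixes \<kappa> :: "'k::alg_closed_field \<Rightarrow> 'a"
    and X :: "('p, 'a) rspace"
    and L :: "('p, 'a, 'l) msheaf"
    and E :: "int \<Rightarrow> ('p, 'a, 'm) msheaf"
    and n :: nat
    and V :: "('v, 'b) rspace"
    and \<pi> :: "('v, 'b, 'p, 'a) rmor"
    and \<sigma> :: "'p set \<Rightarrow> ('p set \<Rightarrow> 'l \<Rightarrow> 'a) \<Rightarrow> 'b"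
  assumes "smooth_projective_variety \<kappa> X"
    and "line_bundle X L"
    and "ample TYPE('m) X (dual X L)"
    and "n \<ge> 1"
    and "\<forall>i\<in>{1..int n}. line_bundle X (E i)"
    and "exceptional_collection \<kappa> X n E"
    and "full_collection X n E"
    and "strong_collection X n E"
    and "simple_spiral X L n E"
    and "total_space X L V \<pi> \<sigma>"
  defines "\<kappa>\<^sub>V \<equiv> (\<lambda>c. mco \<pi> (pts X) (\<kappa> c))"
    and "F \<equiv> (\<lambda>i. pullback V X \<pi> (E i))"
  shows "(\<exists>Z. irreducible_component (tp (M\<^sub>0 \<kappa>\<^sub>V V n F)) Z \<and>
           iso_onto_closed (V\<^sub>0 V) (inv_ring \<kappa>\<^sub>V V n F) (\<phi>\<^sub>0 \<kappa>\<^sub>V V n F) (reduced_ideal Z)) \<and>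
         (reduced_scheme (M\<^sub>0 \<kappa>\<^sub>V V n F) \<longrightarrow>
           (\<exists>Z. irreducible_component (tp (M\<^sub>0 \<kappa>\<^sub>V V n F)) Z \<and>
             iso_onto_closed (V\<^sub>0 V) (inv_ring \<kappa>\<^sub>V V n F) (\<phi>\<^sub>0 \<kappa>\<^sub>V V n F)
               (component_ideal (inv_ring \<kappa>\<^sub>V V n F) Z)))"
proof -
 have X: "integral_scheme X" and \<kappa>: "\<kappa> \<in> ring_hom k_ring (osec X (pts X))"
  using assms(1) by (simp_all add: smooth_projective_variety_def k_scheme_def)
 interpret line_bundle_total_space X L V \<pi> \<sigma>
  using X assms(3,10) by (intro line_bundle_total_space.intro) (simp_all add: ample_def)
 have E: "line_bundle X (E i)" "coherent X (E i)" if "i \<in> {1..int n}" for i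
  using assms(5,6) that by (simp_all add: exceptional_collection_def exceptional_object_def)
 have "bondal V \<kappa>\<^sub>V n F"
 proof (intro bondal.intro bondal_axioms.intro V.ringed_space_axioms)
  show "\<kappa>\<^sub>V \<in> ring_hom k_ring (osec V (pts V))"
   using ring_hom_trans[OF \<kappa> \<pi>_ring_hom[OF X.opn_pts]]
   unfolding \<kappa>\<^sub>V_def preim_pts[OF pre_hom_\<pi>] comp_def .
  show "line_bundle V (F i)" if "i \<in> {1..int n}" for i unfolding F_def
   by (rule line_bundle_pullback[OF E(1)[OF that]])
  show "nonzero_round_trip V (F 1) (F i)" if "i \<in> {1..int n}" for i
   unfolding F_def by (rule nonzero_round_trip_pullback[OF assms(3)]) (use E that assms(4) in auto)
 qed (fact assms(4) domain_global)+
 from bondal.iso_onto_component[OF this] show ?thesis by blast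
qed

end
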